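(* Let $E$ be an elliptic curve over $\mathbb C$ with $j(E)=12^3$, let $P_0\in E$, and let $C_4\subset\mathbb P^3$ be the image of $E$ under the embedding $f_4:E\hookrightarrow\mathbb P^3$ associated with the complete linear system $|4P_0|$. Then there are four non-coplanar points $Q_0,Q_1,Q_2,Q_3\in\mathbb P^3$ (the vertices of a tetrahedron) such that, writing $\ell_{ij}$ for the line through $Q_i$ and $Q_j$ $(0\le i<j\le 3)$, the following hold. (a) The $V_4$-lines for $C_4$ are exactly the six lines $\ell_{01},\ell_{02},\ell_{03},\ell_{12},\ell_{13},\ell_{23}$. Every other Galois line for $C_4$ is a $Z_4$-line. (b) Every $Z_4$-line passes through exactly one of the vertices, and through each vertex $Q_i$ there pass exactly two $Z_4$-lines (so there are exactly eight $Z_4$-lines). Two $Z_4$-lines which do not pass through the same vertex are disjoint. (c) Each $Z_4$-line meets the union of the $V_4$-lines in exactly two points. One of them is a vertex $Q_i$; denote the other one, for the two $Z_4$-lines through $Q_i$, by $R_{i1}$ and $R_{i2}$ $(0\le i\le 3)$. The points $R_{01},R_{02},R_{31},R_{32}$ are four distinct points of $\ell_{12}$ different from $Q_1,Q_2$, and $R_{11},R_{12},R_{21},R_{22}$ are four distinct points of $\ell_{03}$ different from $Q_0,Q_3$. (d) In suitable homogeneous coordinates of $\mathbb P^3$ (with $i=\sqrt{-1}$ inside coordinates), these points are $$Q_0=(0:0:0:1),\quad Q_1=(4:-1:2:0),\quad Q_2=(4:-1:-2:0),\quad Q_3=(4:1:0:0),$$ $$R_{01}=(0:0:1:0),\quad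 R_{02}=(4:-1:0:0),\quad R_{31}=(4:-1:2i:0),\quad R_{32}=(4:-1:-2i:0),$$ $$R_{21}=(4:1:0:-2\sqrt2\,i),\quad R_{22}=(4:1:0:2\sqrt2\,i),\quad R_{11}=(4:1:0:2\sqrt2),\quad R_{12}=(4:1:0:-2\sqrt2).$$
   Context: The ground field is $\mathbb C$. The $j$-invariant is normalized so that $j(E)=12^3=1728$ means that $E$ has an automorphism of order four with a fixed point, i.e. $E\cong\{y^2=4x^3-x\}$. Let $C\subset\mathbb P^3$ be an embedded curve. For a line $\ell\subset\mathbb P^3$ with $\ell\cap C=\emptyset$, the linear projection with center $\ell$ restricts to a morphism $\pi_\ell:C\to\mathbb P^1$ of degree $\deg C$. The line $\ell$ is called a Galois line for $C$ if the field extension $\mathbb C(C)/\pi_\ell^*\mathbb C(\mathbb P^1)$ is Galois; the Galois group is then the group belonging to (associated with) $\ell$. A $V_4$-line (resp. $Z_4$-line) is a Galois line whose Galois group is isomorphic to Klein's four group $V_4$ (resp. to the cyclic group $Z_4$ of order $4$). *)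

theory Defs
  imports
    "HOL-Analysis.Analysis"
    "HOL-Algebra.QuotRing"
    "HOL-Algebra.Bij"
    "HOL-Algebra.Elementary_Groups"
    "HOL-Algebra.Finite_Extensions"
begin

section \<open>Projective space\<close>

text \<open>
  Points and lines of the projective space with homogeneous coordinates indexed by \<open>'n\<close> are
  the linear subspaces of \<open>complex ^ 'n\<close> of dimension 1 and 2; incidence is inclusion.
  Recall that in the numeral index types the coordinates are \<open>1, ..., n\<close>.
\<close>

type_synonym 'n ppoint = "(complex ^ 'n) set"

definition proj_points :: "'n::finite ppoint set" where
  "proj_points = {p. vec.subspace p \<and> vec.dim p = 1}"

definition proj_lines :: "(complex ^ 'n::finite) set set" where
  "proj_lines = {l. vec.subspace l \<and> vec.dim l = 2}"

definition hcoord :: "complex ^ 'n::finite \<Rightarrow> 'n ppoint" where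
  "hcoord v = vec.span {v}"

definition points_of :: "(complex ^ 'n::finite) set \<Rightarrow> 'n ppoint set" where
  "points_of l = {p \<in> proj_points. p \<subseteq> l}"

definition line_through :: "'n::finite ppoint \<Rightarrow> 'n ppoint \<Rightarrow> (complex ^ 'n) set" where
  "line_through p q = vec.span (p \<union> q)"

definition proj_map :: "complex ^ 'n::finite ^ 'm::finite \<Rightarrow> 'n ppoint \<Rightarrow> 'm ppoint" where
  "proj_map A p = (\<lambda>v. A *v v) ` p"

section \<open>Rational functions on projective curves\<close>

definition homogeneous_poly :: "nat \<Rightarrow> (complex ^ 'n::finite \<Rightarrow> complex) \<Rightarrow> bool" where
  "homogeneous_poly d P \<longleftrightarrow>
     (\<exists>(M :: ('n \<Rightarrow> nat) set) c. finite M \<and> (\<forall>m\<in>M. (\<Sum>i\<in>UNIV. m i) = d) \<and>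
        P = (\<lambda>v. \<Sum>m\<in>M. c m * (\<Prod>i\<in>UNIV. (v $ i) ^ m i)))"

definition rep :: "'n::finite ppoint \<Rightarrow> complex ^ 'n" where
  "rep p = (SOME v. v \<in> p \<and> v \<noteq> 0)"

definition hquot ::
    "(complex ^ 'n::finite \<Rightarrow> complex) \<Rightarrow> (complex ^ 'n \<Rightarrow> complex) \<Rightarrow> 'n ppoint \<Rightarrow> complex" where
  "hquot P Q p = P (rep p) / Q (rep p)"

text \<open>
  On an irreducible projective curve the nonempty open sets are the complements of the finite
  sets, and a nonzero homogeneous form has only finitely many zeros.  The function field
  therefore consists of the quotients of forms of equal degree, two functions being identified
  when they agree outside a finite set; the value \<open>0\<close> which \<open>hquot\<close> takes at the zeros of the
  denominator is irrelevant.  The definitions below are only meant for irreducible curves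
  (and, from \<open>ord_at\<close> on, for smooth ones).
\<close>

definition fun_ring :: "'n::finite ppoint set \<Rightarrow> ('n ppoint \<Rightarrow> complex) ring" where
  "fun_ring S =
     \<lparr>carrier = extensional S,
      monoid.mult = (\<lambda>f g. \<lambda>p\<in>S. f p * g p), one = (\<lambda>p\<in>S. 1),
      zero = (\<lambda>p\<in>S. 0), add = (\<lambda>f g. \<lambda>p\<in>S. f p + g p)\<rparr>"

definition negligible_funs :: "'n::finite ppoint set \<Rightarrow> ('n ppoint \<Rightarrow> complex) set" where
  "negligible_funs S = {f \<in> carrier (fun_ring S). finite {p \<in> S. f p \<noteq> 0}}"

definition fun_class ::
    "'n::finite ppoint set \<Rightarrow> ('n ppoint \<Rightarrow> complex) \<Rightarrow> ('n ppoint \<Rightarrow> complex) set" where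
  "fun_class S f = negligible_funs S +>\<^bsub>fun_ring S\<^esub> restrict f S"

definition function_field :: "'n::finite ppoint set \<Rightarrow> ('n ppoint \<Rightarrow> complex) set ring" where
  "function_field S = (fun_ring S Quot negligible_funs S)
     \<lparr>carrier := {fun_class S (hquot P Q) | d P Q.
        homogeneous_poly d P \<and> homogeneous_poly d Q \<and> (\<exists>p\<in>S. Q (rep p) \<noteq> 0)}\<rparr>"

definition const_class :: "'n::finite ppoint set \<Rightarrow> complex \<Rightarrow> ('n ppoint \<Rightarrow> complex) set" where
  "const_class S c = fun_class S (\<lambda>_. c)"

text \<open>\<open>\<phi>\<close> is regular at \<open>p\<close>, with value \<open>c\<close> there.\<close>

definition has_value ::
    "'n::finite ppoint set \<Rightarrow> ('n ppoint \<Rightarrow> complex) set \<Rightarrow> 'n ppoint \<Rightarrow> complex \<Rightarrow> bool" where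
  "has_value S \<phi> p c \<longleftrightarrow>
     (\<exists>d P Q. homogeneous_poly d P \<and> homogeneous_poly d Q \<and> Q (rep p) \<noteq> 0 \<and>
        \<phi> = fun_class S (hquot P Q) \<and> c = hquot P Q p)"

definition local_ring :: "'n::finite ppoint set \<Rightarrow> 'n ppoint \<Rightarrow> ('n ppoint \<Rightarrow> complex) set set" where
  "local_ring S p = {\<phi>. \<exists>c. has_value S \<phi> p c}"

definition max_ideal :: "'n::finite ppoint set \<Rightarrow> 'n ppoint \<Rightarrow> ('n ppoint \<Rightarrow> complex) set set" where
  "max_ideal S p = {\<phi>. has_value S \<phi> p 0}"

definition uniformizer ::
    "'n::finite ppoint set \<Rightarrow> 'n ppoint \<Rightarrow> ('n ppoint \<Rightarrow> complex) set \<Rightarrow> bool" where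
  "uniformizer S p t \<longleftrightarrow> t \<in> max_ideal S p \<and>
     max_ideal S p = {t \<otimes>\<^bsub>function_field S\<^esub> u | u. u \<in> local_ring S p}"

text \<open>The order of vanishing of a nonzero rational function at \<open>p\<close> (negative at a pole).\<close>

definition ord_at :: "'n::finite ppoint set \<Rightarrow> 'n ppoint \<Rightarrow> ('n ppoint \<Rightarrow> complex) set \<Rightarrow> int" where
  "ord_at S p \<phi> = (THE n. \<exists>t u. uniformizer S p t \<and> u \<in> local_ring S p - max_ideal S p \<and>
     \<phi> = u \<otimes>\<^bsub>function_field S\<^esub> (t [^]\<^bsub>function_field S\<^esub> n))"

text \<open>The space \<open>L(D)\<close> whose projectivization is the complete linear system \<open>|D|\<close>.\<close>

definition riemann_roch_space ::
    "'n::finite ppoint set \<Rightarrow> ('n ppoint \<Rightarrow> int) \<Rightarrow> ('n ppoint \<Rightarrow> complex) set set" where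
  "riemann_roch_space S D = {\<phi> \<in> carrier (function_field S).
     \<phi> = \<zero>\<^bsub>function_field S\<^esub> \<or> (\<forall>p\<in>S. ord_at S p \<phi> \<ge> - D p)}"

definition point_divisor :: "int \<Rightarrow> 'n::finite ppoint \<Rightarrow> 'n ppoint \<Rightarrow> int" where
  "point_divisor n p = (\<lambda>q. if q = p then n else 0)"

definition is_basis ::
    "'n::finite ppoint set \<Rightarrow> ('n ppoint \<Rightarrow> complex) set set \<Rightarrow>
     ('k::finite \<Rightarrow> ('n ppoint \<Rightarrow> complex) set) \<Rightarrow> bool" where
  "is_basis S V F \<longleftrightarrow> (\<forall>i. F i \<in> V) \<and>
     (\<forall>\<phi>\<in>V. \<exists>!c :: complex ^ 'k.
       \<phi> = (\<Oplus>\<^bsub>function_field S\<^esub>i\<in>UNIV. const_class S (c $ i) \<otimes>\<^bsub>function_field S\<^esub> F i))"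

text \<open>
  The morphism \<open>p \<mapsto> (F\<^sub>1(p) : ... : F\<^sub>k(p))\<close> given by rational functions on a smooth curve; at
  a point \<open>p\<close> where some \<open>F\<^sub>i\<close> has a pole or all of them vanish, they are first multiplied by a
  common nonzero rational function \<open>g\<close>.
\<close>

definition curve_morphism ::
    "'n::finite ppoint set \<Rightarrow> ('k::finite \<Rightarrow> ('n ppoint \<Rightarrow> complex) set) \<Rightarrow>
     'n ppoint \<Rightarrow> 'k ppoint" where
  "curve_morphism S F p = (THE q. \<exists>g \<in> carrier (function_field S). \<exists>w :: complex ^ 'k.
     w \<noteq> 0 \<and> (\<forall>i. has_value S (g \<otimes>\<^bsub>function_field S\<^esub> F i) p (w $ i)) \<and> q = hcoord w)"

text \<open>The subfield \<open>\<pi>\<^sup>* \<complex>(T)\<close> of \<open>\<complex>(S)\<close> for a nonconstant morphism of curves \<open>\<pi> : S \<rightarrow> T\<close>.\<close>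

definition pullback_field ::
    "'n::finite ppoint set \<Rightarrow> 'm::finite ppoint set \<Rightarrow> ('n ppoint \<Rightarrow> 'm ppoint) \<Rightarrow>
     ('n ppoint \<Rightarrow> complex) set set" where
  "pullback_field S T \<pi> =
     {fun_class S (f \<circ> \<pi>) | f. fun_class T f \<in> carrier (function_field T)}"

section \<open>Elliptic curves\<close>

definition weierstrass_disc ::
    "complex \<Rightarrow> complex \<Rightarrow> complex \<Rightarrow> complex \<Rightarrow> complex \<Rightarrow> complex" where
  "weierstrass_disc a1 a2 a3 a4 a6 =
     (let b2 = a1^2 + 4*a2; b4 = 2*a4 + a1*a3; b6 = a3^2 + 4*a6;
          b8 = a1^2*a6 + 4*a2*a6 - a1*a3*a4 + a2*a3^2 - a4^2
      in - (b2^2*b8) - 8*b4^3 - 27*b6^2 + 9*b2*b4*b6)"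

definition weierstrass_j ::
    "complex \<Rightarrow> complex \<Rightarrow> complex \<Rightarrow> complex \<Rightarrow> complex \<Rightarrow> complex" where
  "weierstrass_j a1 a2 a3 a4 a6 =
     (let b2 = a1^2 + 4*a2; b4 = 2*a4 + a1*a3; c4 = b2^2 - 24*b4
      in c4^3 / weierstrass_disc a1 a2 a3 a4 a6)"

text \<open>The plane cubic \<open>y\<^sup>2 + a1 x y + a3 y = x\<^sup>3 + a2 x\<^sup>2 + a4 x + a6\<close>, homogenized.\<close>

definition weierstrass_curve ::
    "complex \<Rightarrow> complex \<Rightarrow> complex \<Rightarrow> complex \<Rightarrow> complex \<Rightarrow> 3 ppoint set" where
  "weierstrass_curve a1 a2 a3 a4 a6 = {p \<in> proj_points. \<forall>v\<in>p.
     (let x = v $ 1; y = v $ 2; z = v $ 3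
      in y^2*z + a1*x*y*z + a3*y*z^2 = x^3 + a2*x^2*z + a4*x*z^2 + a6*z^3)}"

section \<open>Galois lines\<close>

definition galois_auts :: "('a, 'b) ring_scheme \<Rightarrow> 'a set \<Rightarrow> ('a \<Rightarrow> 'a) set" where
  "galois_auts L K = {\<sigma> \<in> ring_iso L L \<inter> extensional (carrier L). \<forall>x\<in>K. \<sigma> x = x}"

definition galois_group :: "('a, 'b) ring_scheme \<Rightarrow> 'a set \<Rightarrow> ('a \<Rightarrow> 'a) monoid" where
  "galois_group L K = BijGroup (carrier L) \<lparr>carrier := galois_auts L K\<rparr>"

definition galois_extension :: "('a, 'b) ring_scheme \<Rightarrow> 'a set \<Rightarrow> bool" where
  "galois_extension L K \<longleftrightarrow>
     subfield K L \<and> (\<forall>x \<in> carrier L. ring.algebraic L K x) \<and>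
     {x \<in> carrier L. \<forall>\<sigma> \<in> galois_auts L K. \<sigma> x = x} = K"

text \<open>
  The projection with center \<open>l\<close> is given by any two independent linear forms vanishing on \<open>l\<close>
  (the rows of the matrix below).  Another choice changes it by an automorphism of the
  projective line only, so that the subfield is independent of the choice.
\<close>

definition line_subfield :: "4 ppoint set \<Rightarrow> (complex ^ 4) set \<Rightarrow> (4 ppoint \<Rightarrow> complex) set set" where
  "line_subfield C l =
     pullback_field C proj_points (proj_map (SOME A :: complex ^ 4 ^ 2. {v. A *v v = 0} = l))"

definition galois_line :: "4 ppoint set \<Rightarrow> (complex ^ 4) set \<Rightarrow> bool" where
  "galois_line C l \<longleftrightarrow> l \<in> proj_lines \<and> points_of l \<inter> C = {} \<and>
     galois_extension (function_field C) (line_subfield C l)"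

definition V4_line :: "4 ppoint set \<Rightarrow> (complex ^ 4) set \<Rightarrow> bool" where
  "V4_line C l \<longleftrightarrow> galois_line C l \<and>
     galois_group (function_field C) (line_subfield C l) \<cong>
       (integer_mod_group 2 \<times>\<times> integer_mod_group 2)"

definition Z4_line :: "4 ppoint set \<Rightarrow> (complex ^ 4) set \<Rightarrow> bool" where
  "Z4_line C l \<longleftrightarrow> galois_line C l \<and>
     galois_group (function_field C) (line_subfield C l) \<cong> integer_mod_group 4"

end

theory Submission
  imports Defs "HOL-Computational_Algebra.Fundamental_Theorem_Algebra" "HOL-Real_Asymp.Real_Asymp"
begin

text \<open>The condition j = 1728 brings the Weierstrass equation, by a linear change of
  coordinates, to y^2 = x^3 - x (\<open>weierstrass_1728\<close>). For every base point P0 there are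
  functions \<open>px\<close>, \<open>py\<close> satisfying the same equation, with
  \<open>px\<close> regular away from P0 and having a double pole at P0: the affine coordinates
  themselves if P0 is the point at infinity, otherwise their composites with the involution P -> P0
  - P. A growth argument takes the place of Riemann-Roch: an element of L(4 P0) is bounded by a
  multiple of (1 + |px|)^2, hence is a combination of 1, px, py, px^2
  (\<open>riemann_roch_space_eq\<close>). Up to a projectivity, the quartic is therefore the image
  of (1 : x : y : x^2), and in the basis \<open>sec\<close> it is the intersection of the two
  diagonal quadrics s1^2 + s2^2 = s3^2 and s4^2 = s2^2 + s3^2 (\<open>quartic_model\<close>). The
  pencil they span has four singular members, whose vertices are the coordinate points; these are
  the vertices of the tetrahedron.

  Let the line l, disjoint from the curve, be the zero set of two linear forms h1, h2, and let K be
  the field pulled back by the projection. An automorphism over K sends a coordinate divided by h2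
  to a function whose poles are still bounded by h2; since the curve is linearly normal, this is
  again a linear form over h2. So the automorphism comes from a matrix W which preserves the cone
  and fixes both forms (\<open>hom_matrix\<close>, \<open>galois_aut_matrix\<close>). Such a W
  permutes the vertices of the singular quadrics, hence is monomial
  (\<open>cone_aut_monomial\<close>), and only the eight permutations respecting the partition
  {1,4}, {2,3} occur (\<open>permutation_cases\<close>). Comparing the columns of the two forms
  shows that W is the identity or a single sign change, unless l is an edge of the tetrahedron or
  one of eight further lines (\<open>stabilizer_cases\<close>). Outside these cases the group fixes
  all but one of the coordinates divided by h2; if the extension were Galois, those three would lie
  in K, so the three coordinates would vanish on l, which is impossible
  (\<open>galois_extension_cases\<close>).

  Conversely, for an edge or one of the eight lines, four explicit matrices act through characters
  on two forms complementary to h1, h2. Every rational function is a K-combination of four monomials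
  in these forms, and averaging over the group shows that the invariants lie in K (locale
  \<open>diagonal_line\<close>, in particular \<open>fixed_eq\<close> and
  \<open>galois_group_iso\<close>). The edges get the group V4 and the eight other lines Z4. The
  incidences of parts (b), (c) and (d) are then read off from coordinates
  (\<open>tetrahedron\<close>).\<close>

abbreviation "hpoly == homogeneous_poly"
abbreviation "ffld == function_field"
abbreviation "pdeg == Polynomial.degree"

section \<open>Homogeneous forms\<close>

text \<open>A form is defined by a set of exponent vectors, each with one coefficient. A family with
  repeated exponents is brought to that shape by adding the coefficients over each fibre of
  \<open>m\<close>.\<close>

lemma hom_poly_sum_monomials:
 fixes m :: "'k => 'n::finite => nat"
 assumes "finite I" "!!k. k : I ==> (\<Sum>i\<in>UNIV. m k i) = d"
 shows "hpoly d (%v. \<Sum>k\<in>I. c k * (\<Prod>i\<in>UNIV. (v $ i) ^ m k i))"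
proof -
 have "(\<Sum>e\<in>m ` I. (\<Sum>k\<in>{k\<in>I. m k = e}. c k) * (\<Prod>i\<in>UNIV. (v $ i) ^ e i)) =
 (\<Sum>k\<in>I. c k * (\<Prod>i\<in>UNIV. (v $ i) ^ m k i))" for v :: "complex ^ 'n"
 proof -
 have "(\<Sum>e\<in>m ` I. (\<Sum>k\<in>{k\<in>I. m k = e}. c k) * (\<Prod>i\<in>UNIV. (v $ i) ^ e i)) =
 (\<Sum>e\<in>m ` I. \<Sum>k\<in>{k\<in>I. m k = e}. c k * (\<Prod>i\<in>UNIV. (v $ i) ^ m k i))"
 by (intro sum.cong refl) (simp add: sum_distrib_right)
 also have "\<dots> = (\<Sum>k\<in>I. c k * (\<Prod>i\<in>UNIV. (v $ i) ^ m k i))"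
 using assms(1) by (rule sum.image_gen[symmetric])
 finally show ?thesis .
 qed
 then show ?thesis
 unfolding homogeneous_poly_def using assms
 by (intro exI[of _ "m ` I"] exI[of _ "%e. \<Sum>k\<in>{k\<in>I. m k = e}. c k"]) auto
qed

lemma hom_poly_add:
 assumes "hpoly d P" "hpoly d Q"
 shows "hpoly d (%v. P v + Q v)"
proof -
 obtain M1 c1 where 1: "finite M1" "\<forall>m\<in>M1. (\<Sum>i\<in>UNIV. m i) = d"
 "P = (%v. \<Sum>m\<in>M1. c1 m * (\<Prod>i\<in>UNIV. (v $ i) ^ m i))"
 using assms(1) unfolding homogeneous_poly_def by blast
 obtain M2 c2 where 2: "finite M2" "\<forall>m\<in>M2. (\<Sum>i\<in>UNIV. m i) = d"
 "Q = (%v. \<Sum>m\<in>M2. c2 m * (\<Prod>i\<in>UNIV. (v $ i) ^ m i))"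
 using assms(2) unfolding homogeneous_poly_def by blast
 \<comment> \<open>The two exponent sets may overlap. The disjoint sum keeps both copies and leaves
   the merging to \<open>hom_poly_sum_monomials\<close>.\<close>
 have "hpoly d (%v. \<Sum>k\<in>M1 <+> M2. case_sum c1 c2 k * (\<Prod>i\<in>UNIV. (v $ i) ^ case_sum id id k i))"
 using 1 2 by (intro hom_poly_sum_monomials) auto
 then show ?thesis
 using 1 2 by (simp add: sum.Plus)
qed

lemma hom_poly_mult:
 assumes "hpoly d P" "hpoly e Q"
 shows "hpoly (d + e) (%v. P v * Q v)"
proof -
 obtain M1 c1 where 1: "finite M1" "\<forall>m\<in>M1. (\<Sum>i\<in>UNIV. m i) = d"
 "P = (%v. \<Sum>m\<in>M1. c1 m * (\<Prod>i\<in>UNIV. (v $ i) ^ m i))"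
 using assms(1) unfolding homogeneous_poly_def by blast
 obtain M2 c2 where 2: "finite M2" "\<forall>m\<in>M2. (\<Sum>i\<in>UNIV. m i) = e"
 "Q = (%v. \<Sum>m\<in>M2. c2 m * (\<Prod>i\<in>UNIV. (v $ i) ^ m i))"
 using assms(2) unfolding homogeneous_poly_def by blast
 have "hpoly (d + e) (%v. \<Sum>k\<in>M1 \<times> M2. (c1 (fst k) * c2 (snd k)) *
 (\<Prod>i\<in>UNIV. (v $ i) ^ (fst k i + snd k i)))"
 using 1 2 by (intro hom_poly_sum_monomials) (auto simp: sum.distrib)
 moreover have "(\<Sum>k\<in>M1 \<times> M2. (c1 (fst k) * c2 (snd k)) * (\<Prod>i\<in>UNIV. (v $ i) ^ (fst k i + snd k i))) = P v * Q v" for v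
 unfolding 1 2 by (simp add: sum_product sum.cartesian_product power_add prod.distrib case_prod_unfold algebra_simps)
 ultimately show ?thesis by simp
qed

lemma hom_poly_const: "hpoly 0 (%v. c)"
 using hom_poly_sum_monomials[of "{()}" "%_ _. 0" 0 "%_. c"] by simp

lemma hom_poly_coord: "hpoly 1 (%v. v $ i)"
proof -
 have "(\<Prod>j\<in>UNIV. (v $ j) ^ (if j = i then 1 else 0)) = v $ i" for v :: "complex ^ 'a"
 proof -
 have "(\<Prod>j\<in>UNIV. (v $ j) ^ (if j = i then 1 else 0)) = (\<Prod>j\<in>UNIV. if j = i then v $ j else 1)"
 by (intro prod.cong) auto
 then show ?thesis by simp
 qed
 then show ?thesis
 using hom_poly_sum_monomials[of "{()}" "%_ j. if j = i then 1 else 0" 1 "%_. 1"] by simp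
qed

lemma hom_poly_cmult:
 "hpoly d P ==> hpoly d (%v. c * P v)"
 using hom_poly_mult[OF hom_poly_const, of d P c] by simp

lemma hom_poly_0: "hpoly d (%v. 0)"
 using hom_poly_sum_monomials[of "{}" undefined d undefined] by simp

lemma hom_poly_power: "hpoly d P ==> hpoly (n * d) (%v. P v ^ n)"
 by (induction n) (auto simp: hom_poly_const intro: hom_poly_mult)

lemma hom_poly_sum:
 "finite I ==> (!!i. i : I ==> hpoly d (%v. f i v)) ==>
 hpoly d (%v. \<Sum>i\<in>I. f i v)"
 by (induction I rule: finite_induct) (auto simp: hom_poly_0 intro: hom_poly_add)

text \<open>The tool for everything that is shown for all forms: scaling, continuity, normal forms
  on a curve, the action of field homomorphisms. Monomials are products of coordinates, so sums and
  products suffice; \<open>?H\<close> carries homogeneity along because the rules \<open>add\<close>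
  and \<open>mult\<close> offer it as a premise.\<close>

lemma hom_poly_induct [consumes 1, case_names const coord add mult]:
 assumes P: "hpoly d P"
 and const: "!!c. \<Phi> 0 (%v. c)"
 and coord: "!!i. \<Phi> 1 (%v. v $ i)"
 and add: "!!d P Q. hpoly d P ==> hpoly d Q ==> \<Phi> d P ==> \<Phi> d Q ==> \<Phi> d (%v. P v + Q v)"
 and mult: "!!d e P Q. hpoly d P ==> hpoly e Q ==> \<Phi> d P ==> \<Phi> e Q ==> \<Phi> (d + e) (%v. P v * Q v)"
 shows "\<Phi> d P"
proof -
 obtain M c where M: "finite M" "\<forall>m\<in>M. (\<Sum>i\<in>UNIV. m i) = d"
 and PM: "P = (%v. \<Sum>m\<in>M. c m * (\<Prod>i\<in>UNIV. (v $ i) ^ m i))"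
 using P unfolding homogeneous_poly_def by blast
 let ?H = "%d P. hpoly d P & \<Phi> d P"
 have H_const: "?H 0 (%v. c)" for c by (simp add: const hom_poly_const)
 have H_coord: "?H 1 (%v. v $ i)" for i using coord hom_poly_coord by blast
 have H_mult: "?H d P ==> ?H e Q ==> ?H (d + e) (%v. P v * Q v)" for d e P Q
 using mult hom_poly_mult by blast
 have H_add: "?H d P ==> ?H d Q ==> ?H d (%v. P v + Q v)" for d P Q
 using add hom_poly_add by blast
 have H_pow: "?H n (%v. (v $ i) ^ n)" for i n
 proof (induction n)
 case (Suc n)
 then show ?case using H_mult[OF H_coord Suc] by simp
 qed (use H_const[of 1] in simp)
 have H_prod: "finite I ==> ?H (\<Sum>i\<in>I. m i) (%v. \<Prod>i\<in>I. (v $ i) ^ m i)" for I m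
 proof (induction I rule: finite_induct)
 case empty
 then show ?case using H_const[of 1] by simp
 next
 case (insert x F)
 then show ?case using H_mult[OF H_pow insert.IH] by simp
 qed
 have H_mono: "?H d (%v. c * (\<Prod>i\<in>UNIV. (v $ i) ^ m i))" if "(\<Sum>i\<in>UNIV. m i) = d" for m c
 using H_mult[OF H_const H_prod[of UNIV m]] that by simp
 \<comment> \<open>The empty sum must count as a form of degree \<open>d\<close>, so it is written
   as 0 times a power of a coordinate.\<close>
 have H_zero: "?H d (%v. 0)"
 proof -
 have "?H d (%v. 0 * (v $ undefined) ^ d)"
 using H_mult[OF H_const[of 0] H_pow[of d undefined]] by simp
 then show ?thesis by simp
 qed
 have "?H d (%v. \<Sum>m\<in>N. c m * (\<Prod>i\<in>UNIV. (v $ i) ^ m i))" if "N \<subseteq> M" for N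
 using finite_subset[OF that M(1)] that
 proof (induction N rule: finite_induct)
 case empty
 then show ?case using H_zero by simp
 next
 case (insert x F)
 then have "?H d (%v. c x * (\<Prod>i\<in>UNIV. (v $ i) ^ x i))"
 using M(2) by (intro H_mono) auto
 from H_add[OF this] insert show ?case
 by simp
 qed
 from this[of M] show ?thesis by (simp add: PM)
qed

lemma hom_poly_scale:
 assumes "hpoly d P"
 shows "P (c *s v) = c ^ d * P v"
 using assms by (induction rule: hom_poly_induct) (auto simp: algebra_simps power_add)

lemma continuous_on_homogeneous_poly:
 assumes "hpoly d P"
 shows "continuous_on S P"
 using assms by (induction rule: hom_poly_induct) (auto intro!: continuous_intros)

lemma hom_poly_linear: "hpoly 1 (%v. (A *v v) $ i)"
 unfolding matrix_vector_mult_def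
 by (simp, intro hom_poly_sum finite hom_poly_cmult[OF hom_poly_coord[unfolded One_nat_def]])

lemma hom_poly_compose:
 fixes A :: "complex ^ 'n::finite ^ 'm::finite"
 assumes "hpoly d P"
 shows "hpoly d (%v. P (A *v v))"
 using assms
proof (induction rule: hom_poly_induct)
 case (coord i)
 then show ?case by (rule hom_poly_linear)
qed (auto intro: hom_poly_const hom_poly_add hom_poly_mult)

section \<open>Projective points and their representative vectors\<close>

lemma hcoord_eq_range: "hcoord v = range (%c. c *s v)"
 unfolding hcoord_def by (rule vec.span_singleton)

lemma mem_hcoord: "w : hcoord v \<longleftrightarrow> (EX c. w = c *s v)"
 by (auto simp: hcoord_eq_range)

lemma hcoord_in_proj_points: "v ~= 0 ==> hcoord v : proj_points"
 unfolding proj_points_def hcoord_def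
 using vec.dim_eq_card_independent[of "{v}"] by (simp add: vec.dim_span)

lemma proj_point_eq_hcoord:
 assumes "p : proj_points" "v : p" "v ~= 0"
 shows "p = hcoord v"
proof -
 have p: "vec.subspace p" "vec.dim p = 1" using assms(1) by (auto simp: proj_points_def)
 have "vec.dim (hcoord v) = 1" using hcoord_in_proj_points[OF assms(3)] by (simp add: proj_points_def)
 moreover have "hcoord v \<subseteq> p" unfolding hcoord_def using p(1) assms(2)
 by (simp add: vec.span_minimal)
 moreover have "vec.subspace (hcoord v)" unfolding hcoord_def by simp
 ultimately show ?thesis using vec.subspace_dim_equal[of "hcoord v" p] p by simp
qed

lemma rep_in: assumes "p : proj_points" shows "rep p : p" and "rep p ~= 0"
proof -
 have "\<not> p \<subseteq> {0}"
 using assms vec.dim_eq_0[of p] by (auto simp: proj_points_def)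
 then have "EX v. v : p & v ~= 0" by blast
 from someI_ex[OF this] show "rep p : p" "rep p ~= 0" by (auto simp: rep_def)
qed

lemma hcoord_rep: "p : proj_points ==> hcoord (rep p) = p"
 using proj_point_eq_hcoord rep_in by metis

lemma hcoord_eq_iff:
 assumes "v ~= 0" "w ~= 0"
 shows "hcoord v = hcoord w \<longleftrightarrow> (EX c. c ~= 0 & w = c *s v)"
proof
 assume "hcoord v = hcoord w"
 then have "w : hcoord v" by (metis mem_hcoord vec.scale_one)
 then show "EX c. c ~= 0 & w = c *s v" using assms by (auto simp: mem_hcoord)
next
 assume "EX c. c ~= 0 & w = c *s v"
 then have "w : hcoord v" by (auto simp: mem_hcoord)
 then show "hcoord v = hcoord w"
 using proj_point_eq_hcoord[OF hcoord_in_proj_points] assms by blast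
qed

lemma hcoord_scale: "c ~= 0 ==> hcoord (c *s v) = hcoord v"
 by (cases "v = 0") (use hcoord_eq_iff[of "c *s v" v] hcoord_eq_iff[of v "c *s v"] in auto)

lemma rep_scale:
 assumes "p : proj_points" "v : p" "v ~= 0"
 obtains c where "c ~= 0" "rep p = c *s v"
 using hcoord_eq_iff[of v "rep p"] proj_point_eq_hcoord[OF assms] hcoord_rep[OF assms(1)] rep_in(2)[OF assms(1)] assms
 by metis

lemma rep_hcoord:
 assumes "v ~= 0" obtains c where "c ~= 0" "rep (hcoord v) = c *s v"
 using rep_scale[OF hcoord_in_proj_points[OF assms] _ assms] mem_hcoord vec.scale_one by metis

lemma hquot_eq:
 assumes "hpoly d P" "hpoly d Q" "p : proj_points" "v : p" "v ~= 0"
 shows "hquot P Q p = P v / Q v"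
proof -
 obtain c where "c ~= 0" "rep p = c *s v" using rep_scale[OF assms(3-)] .
 then show ?thesis
 unfolding hquot_def using hom_poly_scale[OF assms(1)] hom_poly_scale[OF assms(2)] by simp
qed

lemma hom_poly_rep_eq_0_iff:
 assumes "hpoly d P" "p : proj_points" "v : p" "v ~= 0"
 shows "P (rep p) = 0 \<longleftrightarrow> P v = 0"
proof -
 obtain c where "c ~= 0" "rep p = c *s v" using rep_scale[OF assms(2-)] .
 then show ?thesis
 using hom_poly_scale[OF assms(1)] by simp
qed

lemma proj_map_hcoord: "proj_map A (hcoord v) = hcoord (A *v v)"
 unfolding proj_map_def hcoord_eq_range image_image
 by (simp add: matrix_vector_mult_scaleR vector_scalar_commute)

section \<open>Agreement outside finite sets\<close>

text \<open>Equality in the function field is equality off a finite set of points. Expressed by a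
  filter, finitely many exceptional sets can be discarded at once by
  \<open>eventually_elim\<close>.\<close>

definition almost :: "'a set => 'a filter" where
 "almost S = inf cofinite (principal S)"

abbreviation ev where "ev S P == eventually P (almost S)"

lemma eventually_almost: "eventually P (almost S) \<longleftrightarrow> finite {p\<in>S. \<not> P p}"
 unfolding almost_def eventually_inf_principal eventually_cofinite
 by (rule arg_cong[where f = finite]) auto

lemma eventually_almostI: "(!!p. p : S ==> P p) ==> eventually P (almost S)"
 unfolding eventually_almost by (rule finite_subset[of _ "{}"]) auto

lemma eventually_almost_in: "ev S (%p. p : S)"
 by (simp add: eventually_almost)

section \<open>The function field of an irreducible curve\<close>

text \<open>Replaces cosets of negligible functions by a filter condition; from here on,
  computations in the quotient ring are pointwise computations that hold almost everywhere.\<close>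

lemma fun_class_altdef:
 "fun_class S f = {g : extensional S. ev S (%p. g p = f p)}"
proof (intro equalityI subsetI)
 fix g assume "g : fun_class S f"
 then obtain h where h: "h : extensional S" "finite {p\<in>S. h p ~= 0}" "g = (\<lambda>p\<in>S. h p + restrict f S p)"
 by (auto simp: fun_class_def a_r_coset_def r_coset_def negligible_funs_def fun_ring_def)
 then have "{p\<in>S. g p ~= f p} = {p\<in>S. h p ~= 0}" by auto
 with h show "g : {g : extensional S. ev S (%p. g p = f p)}"
 by (simp add: eventually_almost)
next
 fix g assume "g : {g : extensional S. ev S (%p. g p = f p)}"
 then have g: "g : extensional S" "finite {p\<in>S. g p ~= f p}" by (auto simp: eventually_almost)
 define h where "h = (\<lambda>p\<in>S. g p - f p)"
 have "{p\<in>S. h p ~= 0} = {p\<in>S. g p ~= f p}" by (auto simp: h_def)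
 moreover have "g = (\<lambda>p\<in>S. h p + restrict f S p)"
 using g(1) by (auto simp: h_def extensional_def fun_eq_iff)
 moreover have "h : extensional S" by (simp add: h_def)
 ultimately show "g : fun_class S f" using g(2)
 by (auto simp: fun_class_def a_r_coset_def r_coset_def negligible_funs_def fun_ring_def intro!: bexI[of _ h])
qed

lemma fun_class_eq_iff:
 "fun_class S f = fun_class S g \<longleftrightarrow> ev S (%p. f p = g p)"
proof
 assume eq: "fun_class S f = fun_class S g"
 have "restrict f S : fun_class S f"
 by (auto simp: fun_class_altdef eventually_almost)
 then have "ev S (%p. restrict f S p = g p)" unfolding eq by (auto simp: fun_class_altdef)
 then show "ev S (%p. f p = g p)"
 using eventually_almost_in[of S] by eventually_elim auto
next
 assume eq: "ev S (%p. f p = g p)"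
 have "ev S (%p. h p = f p) \<longleftrightarrow> ev S (%p. h p = g p)" for h
 by (rule eventually_cong[OF eq]) simp
 then show "fun_class S f = fun_class S g" by (simp add: fun_class_altdef)
qed

lemma restrict_in_fun_class: "restrict f S : fun_class S f"
 by (auto simp: fun_class_altdef eventually_almost)

lemma function_field_mult:
 "fun_class S f \<otimes>\<^bsub>ffld S\<^esub> fun_class S g = fun_class S (%p. f p * g p)"
proof -
 \<comment> \<open>Multiplication in the quotient is a union over all pairs of representatives;
   every pair contributes the same class.\<close>
 have 1: "negligible_funs S +>\<^bsub>fun_ring S\<^esub> (a \<otimes>\<^bsub>fun_ring S\<^esub> b) = fun_class S (%p. f p * g p)"
 if "a : fun_class S f" "b : fun_class S g" for a b
 proof -
 have "negligible_funs S +>\<^bsub>fun_ring S\<^esub> (a \<otimes>\<^bsub>fun_ring S\<^esub> b) = fun_class S (%p. a p * b p)"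
 by (simp add: fun_class_def fun_ring_def)
 also have "\<dots> = fun_class S (%p. f p * g p)"
 proof -
 have "ev S (%p. a p = f p)" "ev S (%p. b p = g p)"
 using that by (auto simp: fun_class_altdef)
 then have "ev S (%p. a p * b p = f p * g p)" by eventually_elim simp
 then show ?thesis by (simp add: fun_class_eq_iff)
 qed
 finally show ?thesis .
 qed
 have "fun_class S f \<otimes>\<^bsub>ffld S\<^esub> fun_class S g =
 (\<Union>a\<in>fun_class S f. \<Union>b\<in>fun_class S g. negligible_funs S +>\<^bsub>fun_ring S\<^esub> (a \<otimes>\<^bsub>fun_ring S\<^esub> b))"
 by (simp add: function_field_def FactRing_def rcoset_mult_def)
 also have "\<dots> = fun_class S (%p. f p * g p)"
 proof -
 have "fun_class S f ~= {}" "fun_class S g ~= {}" using restrict_in_fun_class by blast+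
 then show ?thesis using 1 by auto
 qed
 finally show ?thesis .
qed

lemma function_field_add:
 "fun_class S f \<oplus>\<^bsub>ffld S\<^esub> fun_class S g = fun_class S (%p. f p + g p)"
proof -
 have "fun_class S f \<oplus>\<^bsub>ffld S\<^esub> fun_class S g =
 (\<Union>a\<in>fun_class S f. \<Union>b\<in>fun_class S g. {\<lambda>p\<in>S. a p + b p})"
 by (simp add: function_field_def FactRing_def set_add_def set_mult_def fun_ring_def)
 also have "\<dots> = fun_class S (%p. f p + g p)"
 proof (intro equalityI subsetI)
 fix h assume "h : (\<Union>a\<in>fun_class S f. \<Union>b\<in>fun_class S g. {\<lambda>p\<in>S. a p + b p})"
 then obtain a b where ab: "a : fun_class S f" "b : fun_class S g" "h = (\<lambda>p\<in>S. a p + b p)" by blast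
 then have "ev S (%p. a p = f p)" "ev S (%p. b p = g p)"
 by (auto simp: fun_class_altdef)
 then have "ev S (%p. h p = f p + g p)"
 using eventually_almost_in[of S] unfolding ab(3) by eventually_elim auto
 then show "h : fun_class S (%p. f p + g p)" by (simp add: fun_class_altdef ab(3))
 next
 fix h assume h: "h : fun_class S (%p. f p + g p)"
 define b where "b = (\<lambda>p\<in>S. h p - f p)"
 have "ev S (%p. h p = f p + g p)" using h by (simp add: fun_class_altdef)
 then have "ev S (%p. b p = g p)"
 using eventually_almost_in[of S] unfolding b_def by eventually_elim auto
 then have "b : fun_class S g" by (simp add: fun_class_altdef b_def)
 moreover have "h = (\<lambda>p\<in>S. restrict f S p + b p)"
 using h by (auto simp: b_def fun_class_altdef extensional_def fun_eq_iff)
 ultimately show "h : (\<Union>a\<in>fun_class S f. \<Union>b\<in>fun_class S g. {\<lambda>p\<in>S. a p + b p})"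
 using restrict_in_fun_class[of f S] by blast
 qed
 finally show ?thesis .
qed

lemma function_field_one: "\<one>\<^bsub>ffld S\<^esub> = fun_class S (%_. 1)"
 by (simp add: function_field_def FactRing_def fun_class_def fun_ring_def)

lemma function_field_zero: "\<zero>\<^bsub>ffld S\<^esub> = fun_class S (%_. 0)"
 by (auto simp: function_field_def FactRing_def fun_class_altdef negligible_funs_def eventually_almost fun_ring_def)

text \<open>The functions whose classes form the function field. The denominator is required to be
  nonzero almost everywhere, so the convention for division by zero only matters at finitely many
  points.\<close>

definition rational :: "'n::finite ppoint set => ('n ppoint => complex) => bool" where
 "rational S f \<longleftrightarrow> (EX d P Q. hpoly d P & hpoly d Q &
 ev S (%p. Q (rep p) ~= 0 & f p = P (rep p) / Q (rep p)))"

lemma rationalI: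
 "hpoly d P ==> hpoly d Q ==>
 ev S (%p. Q (rep p) ~= 0 & f p = P (rep p) / Q (rep p)) ==> rational S f"
 unfolding rational_def by blast

lemma rationalE:
 assumes "rational S f"
 obtains d P Q where "hpoly d P" "hpoly d Q"
 "ev S (%p. Q (rep p) ~= 0 & f p = P (rep p) / Q (rep p))"
 using assms unfolding rational_def by blast

lemma rational_cong:
 assumes "rational S f" "ev S (%p. f p = g p)"
 shows "rational S g"
proof -
 obtain d P Q where 1: "hpoly d P" "hpoly d Q"
 "ev S (%p. Q (rep p) ~= 0 & f p = P (rep p) / Q (rep p))" using rationalE[OF assms(1)] .
 show ?thesis
 by (rule rationalI[OF 1(1,2)]) (use 1(3) assms(2) in eventually_elim, auto)
qed

lemma rational_const: "rational S (%_. c)"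
 by (rule rationalI[OF hom_poly_const[of c] hom_poly_const[of 1]]) simp

lemma rational_add: assumes "rational S f" "rational S g" shows "rational S (%p. f p + g p)"
proof -
 obtain d P Q where 1: "hpoly d P" "hpoly d Q"
 "ev S (%p. Q (rep p) ~= 0 & f p = P (rep p) / Q (rep p))" using rationalE[OF assms(1)] .
 obtain e P' Q' where 2: "hpoly e P'" "hpoly e Q'"
 "ev S (%p. Q' (rep p) ~= 0 & g p = P' (rep p) / Q' (rep p))" using rationalE[OF assms(2)] .
 have "hpoly (d + e) (%v. P v * Q' v + Q v * P' v)"
 by (intro hom_poly_add hom_poly_mult 1 2)
 then show ?thesis
 by (rule rationalI[OF _ hom_poly_mult[OF 1(2) 2(2)]])
 (use 1(3) 2(3) in eventually_elim, simp add: field_simps)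
qed

lemma rational_mult: assumes "rational S f" "rational S g" shows "rational S (%p. f p * g p)"
proof -
 obtain d P Q where 1: "hpoly d P" "hpoly d Q"
 "ev S (%p. Q (rep p) ~= 0 & f p = P (rep p) / Q (rep p))" using rationalE[OF assms(1)] .
 obtain e P' Q' where 2: "hpoly e P'" "hpoly e Q'"
 "ev S (%p. Q' (rep p) ~= 0 & g p = P' (rep p) / Q' (rep p))" using rationalE[OF assms(2)] .
 show ?thesis
 by (rule rationalI[OF hom_poly_mult[OF 1(1) 2(1)] hom_poly_mult[OF 1(2) 2(2)]])
 (use 1(3) 2(3) in eventually_elim, simp add: field_simps)
qed

lemma rational_uminus: "rational S f ==> rational S (%p. - f p)"
 using rational_mult[OF rational_const[of S "-1"]] by simp

lemma rational_diff: "rational S f ==> rational S g ==> rational S (%p. f p - g p)"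
 using rational_add[OF _ rational_uminus, of S f g] by simp

lemma rational_power: "rational S f ==> rational S (%p. f p ^ n)"
 by (induction n) (auto intro: rational_const rational_mult)

lemma rational_sum: "finite I ==> (!!i. i : I ==> rational S (f i)) ==> rational S (%p. \<Sum>i\<in>I. f i p)"
 by (induction I rule: finite_induct) (auto intro: rational_const rational_add)

text \<open>Irreducibility is captured by \<open>form_dichotomy\<close>: a form vanishes at almost
  no point or at almost all points.\<close>

locale irreducible_curve =
 fixes S :: "'n::finite ppoint set"
 assumes points: "S \<subseteq> proj_points"
 and infinite: "infinite S"
 and form_dichotomy: "hpoly d P ==>
 ev S (%p. P (rep p) ~= 0) | ev S (%p. P (rep p) = 0)"
begin

lemma almost_neq_bot: "almost S ~= bot"
 using infinite by (auto simp: trivial_limit_def eventually_almost)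

lemma rational_dichotomy:
 assumes "rational S f"
 shows "ev S (%p. f p ~= 0) | ev S (%p. f p = 0)"
proof -
 obtain d P Q where 1: "hpoly d P" "hpoly d Q"
 "ev S (%p. Q (rep p) ~= 0 & f p = P (rep p) / Q (rep p))" using rationalE[OF assms(1)] .
 from form_dichotomy[OF 1(1)] show ?thesis
 proof
 assume "ev S (%p. P (rep p) ~= 0)"
 then have "ev S (%p. f p ~= 0)" using 1(3) by eventually_elim auto
 then show ?thesis ..
 next
 assume "ev S (%p. P (rep p) = 0)"
 then have "ev S (%p. f p = 0)" using 1(3) by eventually_elim auto
 then show ?thesis ..
 qed
qed

lemma rational_inverse: assumes "rational S f" shows "rational S (%p. inverse (f p))"
proof -
 obtain d P Q where 1: "hpoly d P" "hpoly d Q"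
 "ev S (%p. Q (rep p) ~= 0 & f p = P (rep p) / Q (rep p))" using rationalE[OF assms(1)] .
 from form_dichotomy[OF 1(1)] show ?thesis
 proof
 assume "ev S (%p. P (rep p) ~= 0)"
 then have "ev S (%p. P (rep p) ~= 0 & inverse (f p) = Q (rep p) / P (rep p))"
 using 1(3) by eventually_elim auto
 then show ?thesis by (rule rationalI[OF 1(2,1)])
 next
 assume "ev S (%p. P (rep p) = 0)"
 then have "ev S (%p. 0 = inverse (f p))" using 1(3) by eventually_elim auto
 then show ?thesis by (rule rational_cong[OF rational_const])
 qed
qed

lemma rational_divide: "rational S f ==> rational S g ==> rational S (%p. f p / g p)"
 unfolding divide_inverse by (intro rational_mult rational_inverse)

lemma rational_hquot:
 assumes "hpoly d P" "hpoly d Q"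
 shows "rational S (%p. P (rep p) / Q (rep p))"
 using form_dichotomy[OF assms(2)]
proof
 assume "ev S (%p. Q (rep p) ~= 0)"
 then have "ev S (%p. Q (rep p) ~= 0 & P (rep p) / Q (rep p) = P (rep p) / Q (rep p))" by simp
 then show ?thesis by (rule rationalI[OF assms])
next
 assume "ev S (%p. Q (rep p) = 0)"
 then have "ev S (%p. 0 = P (rep p) / Q (rep p))" by eventually_elim auto
 then show ?thesis by (rule rational_cong[OF rational_const])
qed

lemma carrier_function_field: "carrier (ffld S) = fun_class S ` {f. rational S f}"
proof (intro equalityI subsetI)
 fix x assume "x : carrier (ffld S)"
 then obtain d P Q where "x = fun_class S (hquot P Q)" "hpoly d P" "hpoly d Q"
 by (auto simp: function_field_def)
 then show "x : fun_class S ` {f. rational S f}" using rational_hquot by (auto simp: hquot_def[abs_def])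
next
 fix x assume "x : fun_class S ` {f. rational S f}"
 then obtain f where f: "rational S f" "x = fun_class S f" by blast
 then obtain d P Q where 1: "hpoly d P" "hpoly d Q"
 "ev S (%p. Q (rep p) ~= 0 & f p = P (rep p) / Q (rep p))" using rationalE by blast
 have "ev S (%p. Q (rep p) ~= 0)" "ev S (%p. f p = hquot P Q p)"
 using 1(3) unfolding hquot_def by (auto elim: eventually_mono)
 moreover have "\<exists>p\<in>S. Q (rep p) ~= 0"
 using eventually_happens'[OF almost_neq_bot eventually_conj[OF calculation(1) eventually_almost_in]] by blast
 ultimately show "x : carrier (ffld S)"
 unfolding function_field_def f(2) using 1 by (auto simp: fun_class_eq_iff)
qed

lemma fun_class_in_carrier: "fun_class S f : carrier (ffld S) \<longleftrightarrow> rational S f"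
proof
 assume "fun_class S f : carrier (ffld S)"
 then obtain g where g: "rational S g" "fun_class S f = fun_class S g"
 unfolding carrier_function_field by blast
 then have "ev S (%p. g p = f p)" by (metis fun_class_eq_iff)
 with g(1) show "rational S f" by (rule rational_cong)
qed (auto simp: carrier_function_field)

lemma carrierE:
 assumes "x : carrier (ffld S)" obtains f where "rational S f" "x = fun_class S f"
 using assms unfolding carrier_function_field by blast

text \<open>By the dichotomy a nonzero class vanishes at only finitely many points, so its pointwise
  inverse is an inverse in the ring.\<close>

lemma field_function_field: "field (ffld S)"
proof -
 let ?L = "ffld S"
 note simps = function_field_mult function_field_add function_field_one function_field_zero
 have "abelian_group ?L"
 proof (rule abelian_groupI)
 fix x y assume "x : carrier ?L" "y : carrier ?L"
 then obtain f g where fg: "rational S f" "x = fun_class S f" "rational S g" "y = fun_class S g"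
 by (metis carrierE)
 then show "x \<oplus>\<^bsub>?L\<^esub> y : carrier ?L" by (simp add: simps fun_class_in_carrier rational_add)
 show "x \<oplus>\<^bsub>?L\<^esub> y = y \<oplus>\<^bsub>?L\<^esub> x" by (simp add: fg simps add.commute)
 next
 show "\<zero>\<^bsub>?L\<^esub> : carrier ?L" by (simp add: simps fun_class_in_carrier rational_const)
 next
 fix x y z assume "x : carrier ?L" "y : carrier ?L" "z : carrier ?L"
 then obtain f g h where fg: "x = fun_class S f" "y = fun_class S g" "z = fun_class S h"
 by (metis carrierE)
 show "x \<oplus>\<^bsub>?L\<^esub> y \<oplus>\<^bsub>?L\<^esub> z = x \<oplus>\<^bsub>?L\<^esub> (y \<oplus>\<^bsub>?L\<^esub> z)" by (simp add: fg simps add.assoc)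
 next
 fix x assume "x : carrier ?L"
 then obtain f where f: "rational S f" "x = fun_class S f" by (metis carrierE)
 show "\<zero>\<^bsub>?L\<^esub> \<oplus>\<^bsub>?L\<^esub> x = x" by (simp add: f simps)
 from f have "fun_class S (%p. - f p) : carrier ?L" by (simp add: fun_class_in_carrier rational_uminus)
 then show "\<exists>y\<in>carrier ?L. y \<oplus>\<^bsub>?L\<^esub> x = \<zero>\<^bsub>?L\<^esub>" by (rule bexI[rotated]) (simp add: f simps)
 qed
 moreover have "Group.comm_monoid ?L"
 proof (rule comm_monoidI)
 fix x y assume "x : carrier ?L" "y : carrier ?L"
 then obtain f g where fg: "rational S f" "x = fun_class S f" "rational S g" "y = fun_class S g"
 by (metis carrierE)
 then show "x \<otimes>\<^bsub>?L\<^esub> y : carrier ?L" by (simp add: simps fun_class_in_carrier rational_mult)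
 show "x \<otimes>\<^bsub>?L\<^esub> y = y \<otimes>\<^bsub>?L\<^esub> x" by (simp add: fg simps mult.commute)
 next
 show "\<one>\<^bsub>?L\<^esub> : carrier ?L" by (simp add: simps fun_class_in_carrier rational_const)
 next
 fix x y z assume "x : carrier ?L" "y : carrier ?L" "z : carrier ?L"
 then obtain f g h where fg: "x = fun_class S f" "y = fun_class S g" "z = fun_class S h"
 by (metis carrierE)
 show "x \<otimes>\<^bsub>?L\<^esub> y \<otimes>\<^bsub>?L\<^esub> z = x \<otimes>\<^bsub>?L\<^esub> (y \<otimes>\<^bsub>?L\<^esub> z)" by (simp add: fg simps mult.assoc)
 next
 fix x assume "x : carrier ?L"
 then obtain f where f: "x = fun_class S f" by (metis carrierE)
 show "\<one>\<^bsub>?L\<^esub> \<otimes>\<^bsub>?L\<^esub> x = x" by (simp add: f simps)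
 qed
 ultimately have cring: "cring ?L"
 proof (rule cringI)
 fix x y z assume "x : carrier ?L" "y : carrier ?L" "z : carrier ?L"
 then obtain f g h where fg: "x = fun_class S f" "y = fun_class S g" "z = fun_class S h"
 by (metis carrierE)
 show "(x \<oplus>\<^bsub>?L\<^esub> y) \<otimes>\<^bsub>?L\<^esub> z = x \<otimes>\<^bsub>?L\<^esub> z \<oplus>\<^bsub>?L\<^esub> y \<otimes>\<^bsub>?L\<^esub> z" by (simp add: fg simps distrib_right)
 qed
 then interpret L: cring ?L .
 have "Units ?L = carrier ?L - {\<zero>\<^bsub>?L\<^esub>}"
 proof (intro equalityI subsetI)
 fix x assume "x : Units ?L"
 then obtain y where y: "x : carrier ?L" "y : carrier ?L" "x \<otimes>\<^bsub>?L\<^esub> y = \<one>\<^bsub>?L\<^esub>" by (auto simp: Units_def)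
 have "x ~= \<zero>\<^bsub>?L\<^esub>"
 proof
 assume "x = \<zero>\<^bsub>?L\<^esub>"
 then have "ev S (%p. (0::complex) = 1)"
 proof -
 obtain g where "y = fun_class S g" using carrierE[OF y(2)] .
 then show ?thesis using y(3) \<open>x = _\<close> by (simp add: simps fun_class_eq_iff)
 qed
 then show False using almost_neq_bot by simp
 qed
 then show "x : carrier ?L - {\<zero>\<^bsub>?L\<^esub>}" using y by simp
 next
 fix x assume x: "x : carrier ?L - {\<zero>\<^bsub>?L\<^esub>}"
 then obtain f where f: "rational S f" "x = fun_class S f" by (auto elim: carrierE)
 then have "ev S (%p. f p ~= 0)"
 using rational_dichotomy[OF f(1)] x by (auto simp: simps fun_class_eq_iff)
 then have "ev S (%p. f p * inverse (f p) = 1)" by eventually_elim auto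
 then have "x \<otimes>\<^bsub>?L\<^esub> fun_class S (%p. inverse (f p)) = \<one>\<^bsub>?L\<^esub>"
 by (simp add: f simps fun_class_eq_iff)
 moreover have "fun_class S (%p. inverse (f p)) : carrier ?L"
 using f rational_inverse by (simp add: fun_class_in_carrier)
 moreover have "fun_class S (%p. inverse (f p)) \<otimes>\<^bsub>?L\<^esub> x = \<one>\<^bsub>?L\<^esub>"
 using calculation x L.m_comm[of x] by simp
 ultimately show "x : Units ?L" using x unfolding Units_def by blast
 qed
 then show ?thesis using L.cring_fieldI by blast
qed

end

section \<open>Values, uniformizers and orders at a point\<close>

text \<open>The analogue of \<open>has_value\<close> for representatives instead of classes:
  \<open>f\<close> only has to agree almost everywhere with a quotient of forms that is defined at
  \<open>p\<close>.\<close>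

definition has_val :: "'n::finite ppoint set => ('n ppoint => complex) => 'n ppoint => complex => bool" where
 "has_val S f p c \<longleftrightarrow> (EX d P Q. hpoly d P & hpoly d Q & Q (rep p) ~= 0 &
 ev S (%q. f q = P (rep q) / Q (rep q)) & c = P (rep p) / Q (rep p))"

lemma has_value_iff: "has_value S (fun_class S f) p c \<longleftrightarrow> has_val S f p c"
 unfolding has_value_def has_val_def fun_class_eq_iff hquot_def by blast

lemma has_valI:
 "hpoly d P ==> hpoly d Q ==> Q (rep p) ~= 0 ==>
 ev S (%q. f q = P (rep q) / Q (rep q)) ==> c = P (rep p) / Q (rep p) ==> has_val S f p c"
 unfolding has_val_def by blast

lemma has_valE:
 assumes "has_val S f p c"
 obtains d P Q where "hpoly d P" "hpoly d Q" "Q (rep p) ~= 0"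
 "ev S (%q. f q = P (rep q) / Q (rep q))" "c = P (rep p) / Q (rep p)"
 using assms unfolding has_val_def by blast

lemma has_val_cong:
 assumes "has_val S f p c" "ev S (%q. f q = g q)"
 shows "has_val S g p c"
proof -
 obtain d P Q where 1: "hpoly d P" "hpoly d Q" "Q (rep p) ~= 0"
 "ev S (%q. f q = P (rep q) / Q (rep q))" "c = P (rep p) / Q (rep p)"
 using has_valE[OF assms(1)] .
 show ?thesis by (rule has_valI[OF 1(1,2,3) _ 1(5)]) (use 1(4) assms(2) in eventually_elim, simp)
qed

lemma has_val_const: "has_val S (%_. c) p c"
 by (rule has_valI[OF hom_poly_const[of c] hom_poly_const[of 1]]) auto

lemma has_val_quot:
 "hpoly d P ==> hpoly d Q ==> Q (rep p) ~= 0 ==>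
 has_val S (%q. P (rep q) / Q (rep q)) p (P (rep p) / Q (rep p))"
 by (rule has_valI) auto

text \<open>With \<open>form_eq_0\<close>, a denominator that is nonzero at one point is nonzero
  almost everywhere. This makes values unique and compatible with the field operations.\<close>

locale closed_irreducible_curve = irreducible_curve S for S :: "'n::finite ppoint set" +
 assumes form_eq_0: "hpoly d P ==> ev S (%p. P (rep p) = 0) ==> p : S ==> P (rep p) = 0"
begin

lemma form_nonzero:
 "hpoly d Q ==> p : S ==> Q (rep p) ~= 0 ==> ev S (%q. Q (rep q) ~= 0)"
 using form_dichotomy[of d Q] form_eq_0[of d Q p] by blast

lemma has_val_rational:
 assumes "p : S" "has_val S f p c" shows "rational S f"
proof -
 obtain d P Q where 1: "hpoly d P" "hpoly d Q" "Q (rep p) ~= 0"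
 "ev S (%q. f q = P (rep q) / Q (rep q))" "c = P (rep p) / Q (rep p)"
 using has_valE[OF assms(2)] .
 from form_nonzero[OF 1(2) assms(1) 1(3)] 1(4)
 have "ev S (%q. Q (rep q) ~= 0 & f q = P (rep q) / Q (rep q))" by eventually_elim auto
 then show ?thesis by (rule rationalI[OF 1(1,2)])
qed

context
 fixes p assumes p: "p : S"
begin

lemma has_val_add: assumes "has_val S f p a" "has_val S g p b" shows "has_val S (%q. f q + g q) p (a + b)"
proof -
 obtain d P Q where 1: "hpoly d P" "hpoly d Q" "Q (rep p) ~= 0"
 "ev S (%q. f q = P (rep q) / Q (rep q))" "a = P (rep p) / Q (rep p)"
 using has_valE[OF assms(1)] .
 obtain e P' Q' where 2: "hpoly e P'" "hpoly e Q'" "Q' (rep p) ~= 0"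
 "ev S (%q. g q = P' (rep q) / Q' (rep q))" "b = P' (rep p) / Q' (rep p)"
 using has_valE[OF assms(2)] .
 have "hpoly (d + e) (%v. P v * Q' v + Q v * P' v)"
 by (intro hom_poly_add hom_poly_mult 1 2)
 then show ?thesis
 proof (rule has_valI[OF _ hom_poly_mult[OF 1(2) 2(2)]])
 show "ev S (%q. f q + g q = (P (rep q) * Q' (rep q) + Q (rep q) * P' (rep q)) / (Q (rep q) * Q' (rep q)))"
 using 1(4) 2(4) form_nonzero[OF 1(2) p 1(3)] form_nonzero[OF 2(2) p 2(3)]
 by eventually_elim (simp add: field_simps)
 show "a + b = (P (rep p) * Q' (rep p) + Q (rep p) * P' (rep p)) / (Q (rep p) * Q' (rep p))"
 unfolding 1(5) 2(5) using 1(3) 2(3) by (simp add: field_simps)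
 qed (use 1 2 in auto)
qed

lemma has_val_mult: assumes "has_val S f p a" "has_val S g p b" shows "has_val S (%q. f q * g q) p (a * b)"
proof -
 obtain d P Q where 1: "hpoly d P" "hpoly d Q" "Q (rep p) ~= 0"
 "ev S (%q. f q = P (rep q) / Q (rep q))" "a = P (rep p) / Q (rep p)"
 using has_valE[OF assms(1)] .
 obtain e P' Q' where 2: "hpoly e P'" "hpoly e Q'" "Q' (rep p) ~= 0"
 "ev S (%q. g q = P' (rep q) / Q' (rep q))" "b = P' (rep p) / Q' (rep p)"
 using has_valE[OF assms(2)] .
 show ?thesis
 proof (rule has_valI[OF hom_poly_mult[OF 1(1) 2(1)] hom_poly_mult[OF 1(2) 2(2)]])
 show "ev S (%q. f q * g q = P (rep q) * P' (rep q) / (Q (rep q) * Q' (rep q)))"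
 using 1(4) 2(4) by eventually_elim simp
 qed (use 1 2 in auto)
qed

lemma has_val_inverse: assumes "has_val S f p a" "a ~= 0" shows "has_val S (%q. inverse (f q)) p (inverse a)"
proof -
 obtain d P Q where 1: "hpoly d P" "hpoly d Q" "Q (rep p) ~= 0"
 "ev S (%q. f q = P (rep q) / Q (rep q))" "a = P (rep p) / Q (rep p)"
 using has_valE[OF assms(1)] .
 show ?thesis
 proof (rule has_valI[OF 1(2,1)])
 show "ev S (%q. inverse (f q) = Q (rep q) / P (rep q))"
 using 1(4) by eventually_elim simp
 qed (use 1 assms in auto)
qed

lemma has_val_uminus: "has_val S f p a ==> has_val S (%q. - f q) p (- a)"
 using has_val_mult[OF has_val_const[of S "-1"]] by simp

lemma has_val_diff: "has_val S f p a ==> has_val S g p b ==> has_val S (%q. f q - g q) p (a - b)"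
 using has_val_add[OF _ has_val_uminus, of f a g b] by simp

lemma has_val_divide: "has_val S f p a ==> has_val S g p b ==> b ~= 0 ==> has_val S (%q. f q / g q) p (a / b)"
 unfolding divide_inverse by (intro has_val_mult has_val_inverse)

lemma has_val_power: "has_val S f p a ==> has_val S (%q. f q ^ n) p (a ^ n)"
 by (induction n) (auto intro: has_val_const has_val_mult)

lemma has_val_power_int: "has_val S f p a ==> a ~= 0 ==> has_val S (%q. f q powi n) p (a powi n)"
 unfolding power_int_def by (auto intro: has_val_power has_val_inverse)

lemma has_val_sum:
 "finite I ==> (!!i. i : I ==> has_val S (f i) p (a i)) ==> has_val S (%q. \<Sum>i\<in>I. f i q) p (\<Sum>i\<in>I. a i)"
 by (induction I rule: finite_induct) (auto intro: has_val_const has_val_add)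

lemma has_val_eventually_nonzero:
 assumes "has_val S f p a" "a ~= 0" shows "ev S (%q. f q ~= 0)"
proof -
 obtain d P Q where 1: "hpoly d P" "hpoly d Q" "Q (rep p) ~= 0"
 "ev S (%q. f q = P (rep q) / Q (rep q))" "a = P (rep p) / Q (rep p)"
 using has_valE[OF assms(1)] .
 with assms have "P (rep p) ~= 0" by auto
 from 1(4) form_nonzero[OF 1(1) p this] form_nonzero[OF 1(2) p 1(3)] show ?thesis by eventually_elim simp
qed

text \<open>Two different values would give the zero function a nonzero value, but a function with a
  nonzero value is nonzero almost everywhere.\<close>

lemma has_val_unique:
 assumes "has_val S f p a" "has_val S f p b" shows "a = b"
proof (rule ccontr)
 assume "a ~= b"
 then have "ev S (%q. f q - f q ~= 0)"
 using has_val_eventually_nonzero[OF has_val_diff[OF assms]] by simp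
 then show False using almost_neq_bot by simp
qed

text \<open>Every function vanishing at \<open>p\<close> is divisible by \<open>t\<close> in the
  local ring. Nonvanishing almost everywhere allows powers of \<open>t\<close> to be
  cancelled.\<close>

definition unif :: "('n ppoint => complex) => bool" where
 "unif t \<longleftrightarrow> has_val S t p 0 & ev S (%q. t q ~= 0) &
 (ALL f. has_val S f p 0 --> (EX g c. has_val S g p c & ev S (%q. f q = t q * g q)))"

lemma unifE:
 assumes "unif t" "has_val S f p 0"
 obtains g c where "has_val S g p c" "ev S (%q. f q = t q * g q)"
 using assms unfolding unif_def by blast

text \<open>\<open>f\<close> is a unit at \<open>p\<close> times an integral power of
  \<open>t\<close>, so it has a well-defined order.\<close>

definition ordered :: "('n ppoint => complex) => ('n ppoint => complex) => bool" where
 "ordered t f \<longleftrightarrow> (EX n u c. c ~= 0 & has_val S u p c & ev S (%q. f q = u q * t q powi n))"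

lemma orderedI:
 "c ~= 0 ==> has_val S u p c ==> ev S (%q. f q = u q * t q powi n) ==> ordered t f"
 unfolding ordered_def by blast

lemma orderedE:
 assumes "ordered t f"
 obtains n u c where "c ~= 0" "has_val S u p c" "ev S (%q. f q = u q * t q powi n)"
 using assms unfolding ordered_def by blast

lemma ordered_unit: "has_val S u p c ==> c ~= 0 ==> ordered t u"
 by (rule orderedI[of c u _ _ 0]) auto

lemma ordered_self: "ordered t t"
 by (rule orderedI[of 1 "%_. 1" _ _ 1]) (auto intro: has_val_const)

lemma ordered_cong: "ordered t f ==> ev S (%q. f q = g q) ==> ordered t g"
proof (erule orderedE)
 fix n u c assume a: "ev S (%q. f q = g q)" "c ~= 0" "has_val S u p c" "ev S (%q. f q = u q * t q powi n)"
 from a(1,4) have "ev S (%q. g q = u q * t q powi n)" by eventually_elim simp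
 with a(2,3) show ?thesis by (rule orderedI)
qed

lemma ordered_mult:
 assumes t: "unif t" and "ordered t f" "ordered t g" shows "ordered t (%q. f q * g q)"
proof -
 have t0: "ev S (%q. t q ~= 0)" using t by (simp add: unif_def)
 obtain n u c where 1: "c ~= 0" "has_val S u p c" "ev S (%q. f q = u q * t q powi n)" using orderedE[OF assms(2)] .
 obtain m w b where 2: "b ~= 0" "has_val S w p b" "ev S (%q. g q = w q * t q powi m)" using orderedE[OF assms(3)] .
 show ?thesis
 by (rule orderedI[OF _ has_val_mult[OF 1(2) 2(2)], of _ _ "n + m"])
 (use 1 2 in simp, use 1(3) 2(3) t0 in eventually_elim, simp add: power_int_add)
qed

lemma ordered_inverse:
 assumes "ordered t f" shows "ordered t (%q. inverse (f q))"
proof -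
 obtain n u c where 1: "c ~= 0" "has_val S u p c" "ev S (%q. f q = u q * t q powi n)" using orderedE[OF assms] .
 show ?thesis
 by (rule orderedI[OF _ has_val_inverse[OF 1(2,1)], of _ _ "- n"])
 (use 1 in simp, use 1(3) in eventually_elim, simp add: power_int_minus)
qed

lemma ordered_power: assumes "unif t" "ordered t f" shows "ordered t (%q. f q ^ n)"
 by (induction n) (auto intro: ordered_unit[OF has_val_const] ordered_mult[OF assms(1)] assms)

lemma ordered_nonzero:
 assumes t: "unif t" and f: "ordered t f" shows "ev S (%q. f q ~= 0)"
proof -
 have t0: "ev S (%q. t q ~= 0)" using t by (simp add: unif_def)
 obtain n u c where 1: "c ~= 0" "has_val S u p c" "ev S (%q. f q = u q * t q powi n)" using orderedE[OF f] .
 from t0 1(3) has_val_eventually_nonzero[OF 1(2,1)] show ?thesis by eventually_elim simp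
qed

lemma has_val_of_order:
 assumes "has_val S t p 0" "has_val S u p c" "ev S (%q. f q = u q * t q powi n)" "n \<ge> 0"
 shows "has_val S f p (if n = 0 then c else 0)"
proof -
 have "has_val S (%q. u q * t q ^ nat n) p (c * 0 ^ nat n)" by (intro has_val_mult has_val_power assms)
 moreover have "ev S (%q. u q * t q ^ nat n = f q)"
 using assms(3) by eventually_elim (use \<open>n \<ge> 0\<close> in \<open>simp add: power_int_def\<close>)
 ultimately have "has_val S f p (c * 0 ^ nat n)" by (rule has_val_cong)
 moreover have "c * 0 ^ nat n = (if n = 0 then c else 0)" using \<open>n \<ge> 0\<close> by (auto simp: power_0_left)
 ultimately show ?thesis by metis
qed

text \<open>If \<open>n > m\<close>, the unit \<open>w\<close> equals \<open>u\<close> times a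
  positive power of \<open>t\<close> and would vanish at \<open>p\<close>.\<close>

lemma order_unique:
 assumes t: "unif t"
 and 1: "c ~= 0" "has_val S u p c" "ev S (%q. f q = u q * t q powi n)"
 and 2: "b ~= 0" "has_val S w p b" "ev S (%q. f q = w q * t q powi m)"
 shows "n <= m"
proof (rule ccontr)
 assume "\<not> n <= m"
 have t0: "ev S (%q. t q ~= 0)" "has_val S t p 0" using t by (auto simp: unif_def)
 have "ev S (%q. w q = u q * t q powi (n - m))"
 using t0(1) 1(3) 2(3) by eventually_elim (auto simp: power_int_diff field_simps)
 then have "has_val S w p 0" using has_val_of_order[OF t0(2) 1(2), of w "n - m"] \<open>\<not> n <= m\<close> by simp
 then show False using has_val_unique[OF 2(2)] 2(1) by simp
qed

text \<open>A regular function without an order is divisible by every power of \<open>t\<close>.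
  Then so is its product with any regular function, and the product could not have a finite order.
  This lets orders be tested on norms.\<close>

lemma ordered_factor:
 assumes t: "unif t" and f: "has_val S f p a" and g: "has_val S g p b" and fg: "ordered t (%q. f q * g q)"
 shows "ordered t f"
proof (rule ccontr)
 assume nf: "\<not> ordered t f"
 have t0: "ev S (%q. t q ~= 0)" "has_val S t p 0" using t by (auto simp: unif_def)
 have *: "EX h c. has_val S h p c & ev S (%q. f q = h q * t q powi int k)" for k
 proof (induction k)
 case 0
 then show ?case using f by auto
 next
 case (Suc k)
 then obtain h c where h: "has_val S h p c" "ev S (%q. f q = h q * t q powi int k)" by blast
 have "c = 0" using nf orderedI[OF _ h] by blast
 then obtain h' c' where h': "has_val S h' p c'" "ev S (%q. h q = t q * h' q)"
 using unifE[OF t] h by blast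
 have "ev S (%q. f q = h' q * t q powi int (Suc k))"
 using h(2) h'(2) t0(1) by eventually_elim (simp add: power_int_def nat_add_distrib algebra_simps)
 then show ?case using h'(1) by blast
 qed
 obtain n u c where 1: "c ~= 0" "has_val S u p c" "ev S (%q. f q * g q = u q * t q powi n)" using orderedE[OF fg] .
 \<comment> \<open>The exponent \<open>nat (n + 1)\<close> is a natural number larger than
   \<open>n\<close>, also when \<open>n\<close> is negative.\<close>
 obtain h d where h: "has_val S h p d" "ev S (%q. f q = h q * t q powi int (nat (n + 1)))" using * by blast
 define k where "k = int (nat (n + 1)) - n"
 have k: "k > 0" by (simp add: k_def)
 have "ev S (%q. u q = h q * g q * t q powi k)"
 using t0(1) 1(3) h(2) unfolding k_def by eventually_elim (auto simp: power_int_diff field_simps)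
 from has_val_of_order[OF t0(2) has_val_mult[OF h(1) g] this] k
 have "has_val S u p 0" by simp
 then show False using has_val_unique[OF 1(2)] 1(1) by simp
qed

text \<open>The local ring at \<open>p\<close> is a discrete valuation ring with parameter
  \<open>t\<close>.\<close>

definition dvr_with :: "('n ppoint => complex) => bool" where
 "dvr_with t \<longleftrightarrow> unif t & (ALL f. rational S f --> ev S (%q. f q = 0) | ordered t f)"

lemma dvr_dichotomy:
 assumes "dvr_with t" "rational S f"
 shows "(EX c. has_val S f p c) | (ev S (%q. f q ~= 0) & has_val S (%q. inverse (f q)) p 0)"
proof (cases "ev S (%q. f q = 0)")
 case True
 then have "ev S (%q. 0 = f q)" by eventually_elim simp
 then show ?thesis using has_val_cong[OF has_val_const[of S 0 p]] by blast
next
 case False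
 have t0: "has_val S t p 0" "unif t" using assms(1) by (auto simp: dvr_with_def unif_def)
 have o: "ordered t f" using False assms by (auto simp: dvr_with_def)
 obtain n u c where 1: "c ~= 0" "has_val S u p c" "ev S (%q. f q = u q * t q powi n)"
 using orderedE[OF o] .
 show ?thesis
 proof (cases "n \<ge> 0")
 case True
 then show ?thesis using has_val_of_order[OF t0(1) 1(2,3)] by blast
 next
 case False
 have "ev S (%q. inverse (f q) = inverse (u q) * t q powi (- n))"
 using 1(3) by eventually_elim (simp add: power_int_minus)
 from has_val_of_order[OF t0(1) has_val_inverse[OF 1(2,1)] this] False
 have "has_val S (%q. inverse (f q)) p 0" by simp
 then show ?thesis using ordered_nonzero[OF t0(2) o] by blast
 qed
qed

text \<open>The local ring is integrally closed: if \<open>f\<close> were not regular, 1/f would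
  vanish at \<open>p\<close>, and so would the constant 1, being the product of f^2 and
  (1/f)^2.\<close>

lemma has_val_of_square:
 assumes "dvr_with t" "rational S f" "has_val S (%q. f q ^ 2) p a"
 shows "EX c. has_val S f p c & c ^ 2 = a"
proof -
 have "EX c. has_val S f p c"
 proof (rule ccontr)
 assume "\<nexists>c. has_val S f p c"
 with dvr_dichotomy[OF assms(1,2)] have 1: "ev S (%q. f q ~= 0)" "has_val S (%q. inverse (f q)) p 0" by auto
 have "has_val S (%q. f q ^ 2 * inverse (f q) ^ 2) p (a * 0 ^ 2)"
 by (intro has_val_mult has_val_power assms 1)
 moreover have "ev S (%q. f q ^ 2 * inverse (f q) ^ 2 = 1)"
 using 1(1) by eventually_elim (simp add: field_simps)
 ultimately have "has_val S (%q. 1) p 0" using has_val_cong by fastforce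
 then show False using has_val_unique[OF has_val_const[of S 1]] by force
 qed
 then show ?thesis using has_val_unique[OF has_val_power assms(3)] by blast
qed

end

end

section \<open>The order of vanishing computed from a parameter\<close>

context irreducible_curve
begin

lemma nat_pow_fun_class:
 "fun_class S t [^]\<^bsub>ffld S\<^esub> (n::nat) = fun_class S (%q. t q ^ n)"
proof -
 interpret L: field "ffld S" by (rule field_function_field)
 show ?thesis
 by (induction n) (simp_all add: function_field_one function_field_mult mult.commute)
qed

lemma inv_fun_class:
 assumes "rational S t" "ev S (%q. t q ~= 0)"
 shows "inv\<^bsub>ffld S\<^esub> (fun_class S t) = fun_class S (%q. inverse (t q))"
proof -
 interpret L: field "ffld S" by (rule field_function_field)
 have "ev S (%q. t q * inverse (t q) = 1)" using assms(2) by eventually_elim simp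
 then show ?thesis
 by (intro L.comm_inv_char)
 (auto simp: function_field_one function_field_mult fun_class_eq_iff fun_class_in_carrier assms(1) rational_inverse)
qed

lemma int_pow_fun_class:
 assumes "rational S t" "ev S (%q. t q ~= 0)"
 shows "fun_class S t [^]\<^bsub>ffld S\<^esub> (n::int) = fun_class S (%q. t q powi n)"
proof (cases "n \<ge> 0")
 case True
 then show ?thesis
 using int_pow_int[of "ffld S" "fun_class S t" "nat n"] nat_pow_fun_class[of t "nat n"]
 by (simp add: power_int_def)
next
 case False
 have "ev S (%q. t q ^ nat (- n) ~= 0)" using assms(2) by eventually_elim simp
 then have "inv\<^bsub>ffld S\<^esub> (fun_class S t [^]\<^bsub>ffld S\<^esub> nat (- n)) = fun_class S (%q. inverse (t q ^ nat (- n)))"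
 unfolding nat_pow_fun_class by (intro inv_fun_class rational_power assms)
 then show ?thesis using False by (simp add: int_pow_def nat_pow_def power_int_def power_inverse)
qed

end

context closed_irreducible_curve
begin

context
 fixes p assumes p: "p : S"
begin

lemma local_ring_eq: "local_ring S p = fun_class S ` {f. EX c. has_val S f p c}"
proof (intro equalityI subsetI)
 fix \<phi> assume "\<phi> : local_ring S p"
 then obtain c where c: "has_value S \<phi> p c" by (auto simp: local_ring_def)
 then obtain P Q where "\<phi> = fun_class S (hquot P Q)" by (auto simp: has_value_def)
 with c show "\<phi> : fun_class S ` {f. EX c. has_val S f p c}" by (auto simp: has_value_iff)
qed (auto simp: local_ring_def has_value_iff)

lemma max_ideal_eq: "max_ideal S p = fun_class S ` {f. has_val S f p 0}"
proof (intro equalityI subsetI)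
 fix \<phi> assume "\<phi> : max_ideal S p"
 then have c: "has_value S \<phi> p 0" by (auto simp: max_ideal_def)
 then obtain P Q where "\<phi> = fun_class S (hquot P Q)" by (auto simp: has_value_def)
 with c show "\<phi> : fun_class S ` {f. has_val S f p 0}" by (auto simp: has_value_iff)
qed (auto simp: max_ideal_def has_value_iff)

lemma fun_class_in_local_ring: "fun_class S f : local_ring S p \<longleftrightarrow> (EX c. has_val S f p c)"
 by (auto simp: local_ring_def has_value_iff)

lemma fun_class_in_max_ideal: "fun_class S f : max_ideal S p \<longleftrightarrow> has_val S f p 0"
 by (auto simp: max_ideal_def has_value_iff)

lemma uniformizer_fun_class:
 assumes "unif p t" shows "uniformizer S p (fun_class S t)"
 unfolding uniformizer_def
proof (intro conjI equalityI subsetI)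
 show "fun_class S t : max_ideal S p" using assms by (simp add: fun_class_in_max_ideal unif_def[OF p])
next
 fix \<phi> assume "\<phi> : max_ideal S p"
 then obtain f where f: "\<phi> = fun_class S f" "has_val S f p 0" by (auto simp: max_ideal_eq)
 then obtain g c where g: "has_val S g p c" "ev S (%q. f q = t q * g q)"
 using unifE[OF p assms] by blast
 then have "\<phi> = fun_class S t \<otimes>\<^bsub>ffld S\<^esub> fun_class S g"
 by (simp add: f function_field_mult fun_class_eq_iff)
 then show "\<phi> : {fun_class S t \<otimes>\<^bsub>ffld S\<^esub> u |u. u : local_ring S p}"
 using g fun_class_in_local_ring by blast
next
 fix \<phi> assume "\<phi> : {fun_class S t \<otimes>\<^bsub>ffld S\<^esub> u |u. u : local_ring S p}"
 then obtain g c where g: "\<phi> = fun_class S t \<otimes>\<^bsub>ffld S\<^esub> fun_class S g" "has_val S g p c"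
 by (auto simp: local_ring_eq)
 have "has_val S (%q. t q * g q) p (0 * c)"
 by (intro has_val_mult[OF p] g) (use assms in \<open>simp add: unif_def[OF p]\<close>)
 then show "\<phi> : max_ideal S p" by (simp add: g(1) function_field_mult fun_class_in_max_ideal)
qed

text \<open>Justifies the definite description in \<open>ord_at\<close>. Two uniformizers divide
  each other, so they differ by a unit (\<open>g\<close> and \<open>h\<close> are inverse to each
  other), and replacing one by the other leaves the exponent unchanged.\<close>

lemma ord_at_eq:
 assumes t: "unif p t" and u: "c ~= 0" "has_val S u p c" and f: "ev S (%q. f q = u q * t q powi n)"
 shows "ord_at S p (fun_class S f) = n"
 unfolding ord_at_def
proof (rule the_equality)
 have t0: "has_val S t p 0" "ev S (%q. t q ~= 0)" using t by (auto simp: unif_def[OF p])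
 have "fun_class S u : local_ring S p - max_ideal S p"
 using u has_val_unique[OF p, of u c 0] by (auto simp: fun_class_in_local_ring fun_class_in_max_ideal)
 moreover have "fun_class S f = fun_class S u \<otimes>\<^bsub>ffld S\<^esub> (fun_class S t [^]\<^bsub>ffld S\<^esub> n)"
 using f int_pow_fun_class[OF has_val_rational[OF p t0(1)] t0(2)] by (simp add: function_field_mult fun_class_eq_iff)
 ultimately show "EX t u. uniformizer S p t & u : local_ring S p - max_ideal S p &
 fun_class S f = u \<otimes>\<^bsub>ffld S\<^esub> t [^]\<^bsub>ffld S\<^esub> n"
 using uniformizer_fun_class[OF t] by blast
next
 fix m :: int assume "EX t u. uniformizer S p t & u : local_ring S p - max_ideal S p &
 fun_class S f = u \<otimes>\<^bsub>ffld S\<^esub> t [^]\<^bsub>ffld S\<^esub> m"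
 then obtain T U where TU: "uniformizer S p T" "U : local_ring S p" "U \<notin> max_ideal S p"
 "fun_class S f = U \<otimes>\<^bsub>ffld S\<^esub> T [^]\<^bsub>ffld S\<^esub> m" by blast
 have t0: "has_val S t p 0" "ev S (%q. t q ~= 0)" using t by (auto simp: unif_def[OF p])
 obtain t' where t': "T = fun_class S t'" "has_val S t' p 0"
 using TU(1) by (auto simp: uniformizer_def max_ideal_eq)
 obtain w b where w: "U = fun_class S w" "has_val S w p b" using TU(2) by (auto simp: local_ring_eq)
 with TU(3) have "b ~= 0" by (auto simp: fun_class_in_max_ideal)
 have "fun_class S t : max_ideal S p" using t0 by (simp add: fun_class_in_max_ideal)
 then obtain g a where g: "has_val S g p a" "fun_class S t = T \<otimes>\<^bsub>ffld S\<^esub> fun_class S g"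
 using TU(1) unfolding uniformizer_def by (auto simp: local_ring_eq)
 then have gt: "ev S (%q. t q = t' q * g q)" by (simp add: t' function_field_mult fun_class_eq_iff)
 obtain h a' where h: "has_val S h p a'" "ev S (%q. t' q = t q * h q)"
 using unifE[OF p t t'(2)] by blast
 have gh: "ev S (%q. g q * h q = 1)" using gt h(2) t0(2) by eventually_elim (auto simp: mult.commute)
 have "a * a' = 1"
 using has_val_unique[OF p has_val_cong[OF has_val_mult[OF p g(1) h(1)] gh] has_val_const] .
 then have a': "a' ~= 0" by auto
 have t'0: "ev S (%q. t' q ~= 0)" using gt t0(2) by eventually_elim auto
 have "ev S (%q. f q = w q * t' q powi m)"
 using TU(4) int_pow_fun_class[OF has_val_rational[OF p t'(2)] t'0]
 by (simp add: t' w function_field_mult fun_class_eq_iff)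
 then have f': "ev S (%q. f q = (w q * h q powi m) * t q powi m)"
 using h(2) by eventually_elim (simp add: power_int_mult_distrib)
 have wh: "has_val S (%q. w q * h q powi m) p (b * a' powi m)"
 by (intro has_val_mult[OF p] has_val_power_int[OF p] w h a')
 have "b * a' powi m ~= 0" using \<open>b ~= 0\<close> a' by simp
 then show "m = n"
 using order_unique[OF p t u f _ wh f'] order_unique[OF p t _ wh f' u f] by force
qed

lemma ord_at_nonneg_iff:
 assumes "dvr_with p t" "rational S f" "\<not> ev S (%q. f q = 0)"
 shows "ord_at S p (fun_class S f) \<ge> 0 \<longleftrightarrow> (EX c. has_val S f p c)"
proof -
 have t: "unif p t" "has_val S t p 0" using assms(1) by (auto simp: dvr_with_def[OF p] unif_def[OF p])
 have ot: "ordered p t f" using assms by (auto simp: dvr_with_def[OF p])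
 obtain n u c where 1: "c ~= 0" "has_val S u p c" "ev S (%q. f q = u q * t q powi n)"
 by (rule orderedE[OF p ot]) (rule that)
 have nonneg: "n \<ge> 0" if "has_val S f p a" for a
 proof (rule ccontr)
 assume n: "\<not> n \<ge> 0"
 have "ev S (%q. u q = f q * t q powi (- n))"
 using 1(3) t(1)[unfolded unif_def[OF p], THEN conjunct2, THEN conjunct1]
 by eventually_elim (simp add: power_int_minus field_simps)
 from has_val_of_order[OF p t(2) that this] n have "has_val S u p 0" by simp
 then show False using has_val_unique[OF p 1(2)] 1(1) by simp
 qed
 show ?thesis
 proof
 assume "ord_at S p (fun_class S f) \<ge> 0"
 then have "n \<ge> 0" using ord_at_eq[OF t(1) 1] by simp
 from has_val_of_order[OF p t(2) 1(2,3) this] show "EX c. has_val S f p c" ..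
 next
 assume "EX c. has_val S f p c"
 then have "n \<ge> 0" using nonneg by (elim exE)
 then show "ord_at S p (fun_class S f) \<ge> 0" using ord_at_eq[OF t(1) 1] by simp
 qed
qed

text \<open>The hypothesis on \<open>g\<close> says that \<open>g\<close> has order exactly
  \<open>- k\<close>; orders add.\<close>

lemma ord_at_mult_power:
 assumes "dvr_with p t" "rational S f" "\<not> ev S (%q. f q = 0)"
 and "has_val S (%q. g q * t q powi k) p b" "b ~= 0"
 shows "ord_at S p (fun_class S (%q. f q * g q)) = ord_at S p (fun_class S f) - k"
proof -
 have t: "unif p t" "has_val S t p 0" "ev S (%q. t q ~= 0)"
 using assms(1) by (auto simp: dvr_with_def[OF p] unif_def[OF p])
 have ot: "ordered p t f" using assms by (auto simp: dvr_with_def[OF p])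
 obtain n u c where 1: "c ~= 0" "has_val S u p c" "ev S (%q. f q = u q * t q powi n)"
 by (rule orderedE[OF p ot]) (rule that)
 have "ev S (%q. f q * g q = (u q * (g q * t q powi k)) * t q powi (n - k))"
 using 1(3) t(3) by eventually_elim (simp add: power_int_diff)
 from ord_at_eq[OF t(1) _ has_val_mult[OF p 1(2) assms(4)] this] 1(1) assms(5) ord_at_eq[OF t(1) 1]
 show ?thesis by simp
qed

end
end

section \<open>Rational functions of bounded growth\<close>

text \<open>The complement of a finite set is dense in the plane, and the inequality is a closed
  condition.\<close>

lemma continuous_ineq_cofinite:
 fixes f g :: "complex => real"
 assumes "finite A" "!!z. z \<notin> A ==> f z <= g z" "continuous_on UNIV f" "continuous_on UNIV g"
 shows "f z <= g z"
proof -
 have "closure (- A) = UNIV"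
 using empty_interior_finite[OF assms(1)] by (simp add: closure_complement)
 then have "z : closure (- A)" by simp
 moreover have "closed {z. f z <= g z}" using assms(3,4) by (simp add: closed_Collect_le)
 then have "closure (- A) \<subseteq> {z. f z <= g z}" using assms(2) by (intro closure_minimal) auto
 ultimately show ?thesis by auto
qed

text \<open>Along the positive integers p(n) / n^deg tends to the leading coefficient; a growth
  exponent below the degree would force this limit to be 0.\<close>

lemma degree_le_of_growth:
 fixes p :: "complex poly"
 assumes "!!z. norm (poly p z) <= K * (1 + norm z) ^ m" "p ~= 0"
 shows "pdeg p <= m"
proof (rule ccontr)
 let ?d = "pdeg p"
 assume "\<not> ?d <= m"
 then have d: "Suc m <= ?d" by simp
 have lim: "((%n::nat. poly p (of_nat n) / (of_nat n) ^ ?d) \<longlongrightarrow> Polynomial.lead_coeff p) sequentially"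
 by (rule filterlim_compose[OF poly_divide_tendsto_aux]) (rule tendsto_of_nat)
 have "\<forall>\<^sub>F n in sequentially. norm (poly p (of_nat n) / (of_nat n) ^ ?d) <= (\<bar>K\<bar> * 2 ^ m) * (1 / real n)"
 proof (rule eventually_sequentiallyI[of 1])
 fix n :: nat assume n: "1 <= n"
 have "norm (poly p (of_nat n)) <= K * (1 + real n) ^ m" using assms(1)[of "of_nat n"] by simp
 also have "\<dots> <= \<bar>K\<bar> * (2 * real n) ^ m"
 using n by (intro mult_mono power_mono) auto
 finally have 1: "norm (poly p (of_nat n)) <= \<bar>K\<bar> * 2 ^ m * real n ^ m" by (simp add: power_mult_distrib)
 have 2: "real n ^ Suc m <= real n ^ ?d" using n d by (intro power_increasing) auto
 have "norm (poly p (of_nat n) / (of_nat n) ^ ?d) = norm (poly p (of_nat n)) / real n ^ ?d"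
 by (simp add: norm_divide norm_power)
 also have "\<dots> <= \<bar>K\<bar> * 2 ^ m * real n ^ m / real n ^ Suc m"
 using 1 2 n by (intro frac_le) auto
 also have "\<dots> = (\<bar>K\<bar> * 2 ^ m) * (1 / real n)" using n by simp
 finally show "norm (poly p (of_nat n) / (of_nat n) ^ ?d) <= (\<bar>K\<bar> * 2 ^ m) * (1 / real n)" .
 qed
 moreover have "((%n. (\<bar>K\<bar> * 2 ^ m) * (1 / real n)) \<longlongrightarrow> 0) sequentially"
 using tendsto_mult_right_zero[OF lim_1_over_n] by simp
 ultimately have "((%n::nat. poly p (of_nat n) / (of_nat n) ^ ?d) \<longlongrightarrow> 0) sequentially"
 by (rule Lim_null_comparison)
 then have "Polynomial.lead_coeff p = 0" using LIMSEQ_unique lim by blast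
 then show False using assms(2) by simp
qed

text \<open>The inequality bounds w p/q, where w^2 = f. At a root of q its right side vanishes
  doubly while f vanishes at most simply, so p vanishes there too and a linear factor cancels;
  induction on deg q then shows that p/q is a polynomial, whose degree is limited by the growth.
  This is the source of all finiteness statements about spaces of functions below.\<close>

lemma rational_growth:
 fixes p q f :: "complex poly"
 assumes "finite A" "!!z. z \<notin> A ==> norm (poly p z) ^ 2 * norm (poly f z) <= K * (1 + norm z) ^ m * norm (poly q z) ^ 2"
 and "q ~= 0" and f: "!!z. poly f z = 0 ==> poly (pderiv f) z ~= 0"
 shows "EX r. p = q * r & (r = 0 | 2 * pdeg r + pdeg f <= m)"
 using assms(1-3)
proof (induction "pdeg q" arbitrary: p q A)
 case 0
 then obtain c where c: "q = [:c:]" "c ~= 0" by (metis degree_eq_zeroE pCons_0_0)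
 have f0: "f ~= 0" using f by fastforce
 show ?case
 proof (cases "p = 0")
 case False
 have "norm (poly (p * p * f) z) <= (K * norm c ^ 2) * (1 + norm z) ^ m" for z
 proof (rule continuous_ineq_cofinite[OF 0(2)])
 show "norm (poly (p * p * f) z) <= (K * norm c ^ 2) * (1 + norm z) ^ m" if "z \<notin> A" for z
 using 0(3)[OF that] by (simp add: c norm_mult power2_eq_square algebra_simps)
 qed (intro continuous_intros)+
 then have "pdeg (p * p * f) <= m" using False f0 by (intro degree_le_of_growth) auto
 then have "2 * pdeg p + pdeg f <= m"
 using False f0 by (simp add: degree_mult_eq)
 then show ?thesis using c by (intro exI[of _ "Polynomial.smult (1 / c) p"]) simp
 qed auto
next
 case (Suc n)
 then have "EX z. poly q z = 0"
 by (intro fundamental_theorem_of_algebra) (simp add: constant_degree)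
 then obtain z0 where "poly q z0 = 0" ..
 then obtain q1 where q1: "q = [:- z0, 1:] * q1" using poly_eq_0_iff_dvd dvdE by metis
 have q10: "q1 ~= 0" using Suc q1 by auto
 have deg: "n = pdeg q1"
 using Suc(2) q10 unfolding q1 by (subst (asm) degree_mult_eq) auto
 have lin: "poly ([:- z0, 1:] * r) z = (z - z0) * poly r z" for r z by (simp add: algebra_simps)
 have all: "norm (poly p z) ^ 2 * norm (poly f z) <= K * (1 + norm z) ^ m * norm (poly q z) ^ 2" for z
 by (rule continuous_ineq_cofinite[OF Suc(3,4)]) (assumption | intro continuous_intros)+
 have "norm (poly p z0) ^ 2 * norm (poly f z0) <= 0" using all[of z0] \<open>poly q z0 = 0\<close> by simp
 then have "norm (poly p z0) ^ 2 * norm (poly f z0) = 0" by (metis mult_nonneg_nonneg norm_ge_zero order_antisym zero_le_power)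
 then have "poly p z0 = 0 | poly f z0 = 0" by simp
 have "poly p z0 = 0"
 proof (rule ccontr)
 \<comment> \<open>Here f has a simple zero. Dividing the inequality once by |z - z0| leaves a
   further factor |z - z0| on the right, but a nonzero value on the left.\<close>
 assume p0: "poly p z0 ~= 0"
 with \<open>poly p z0 = 0 | _\<close> have f0: "poly f z0 = 0" by simp
 then obtain f1 where f1: "f = [:- z0, 1:] * f1" using poly_eq_0_iff_dvd dvdE by metis
 have "poly f1 z0 ~= 0" using f[OF f0] unfolding f1 pderiv_mult by (auto simp: pderiv_pCons simp del: mult_pCons_left)
 have "norm (poly p z0) ^ 2 * norm (poly f1 z0) <= K * (1 + norm z0) ^ m * norm (z0 - z0) * norm (poly q1 z0) ^ 2"
 proof (rule continuous_ineq_cofinite[of "{z0}" "%z. norm (poly p z) ^ 2 * norm (poly f1 z)"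
 "%z. K * (1 + norm z) ^ m * norm (z - z0) * norm (poly q1 z) ^ 2"])
 fix z assume "z \<notin> {z0}"
 then have "norm (z - z0) > 0" by simp
 moreover have "(norm (poly p z) ^ 2 * norm (poly f1 z)) * norm (z - z0)
 <= (K * (1 + norm z) ^ m * norm (z - z0) * norm (poly q1 z) ^ 2) * norm (z - z0)"
 using all[of z] unfolding f1 q1 lin norm_mult by (simp add: power2_eq_square mult_ac)
 ultimately show "norm (poly p z) ^ 2 * norm (poly f1 z) <= K * (1 + norm z) ^ m * norm (z - z0) * norm (poly q1 z) ^ 2"
 using mult_right_le_imp_le by blast
 qed (auto intro!: continuous_intros)
 then show False using p0 \<open>poly f1 z0 ~= 0\<close> by (simp add: mult_le_0_iff)
 qed
 then obtain p1 where p1: "p = [:- z0, 1:] * p1" using poly_eq_0_iff_dvd dvdE by metis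
 have bound: "norm (poly p1 z) ^ 2 * norm (poly f z) <= K * (1 + norm z) ^ m * norm (poly q1 z) ^ 2" if "z \<notin> {z0}" for z
 proof -
 have "norm (z - z0) ^ 2 > 0" using that by simp
 moreover have "(norm (poly p1 z) ^ 2 * norm (poly f z)) * norm (z - z0) ^ 2
 <= (K * (1 + norm z) ^ m * norm (poly q1 z) ^ 2) * norm (z - z0) ^ 2"
 using all[of z] unfolding p1 q1 lin norm_mult by (simp add: power2_eq_square mult_ac)
 ultimately show ?thesis using mult_right_le_imp_le by blast
 qed
 have "EX r. p1 = q1 * r & (r = 0 | 2 * pdeg r + pdeg f <= m)"
 by (rule Suc(1)[OF deg finite.insertI[OF finite.emptyI] bound q10])
 then obtain r where "p1 = q1 * r" "r = 0 | 2 * pdeg r + pdeg f <= m" by blast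
 then show ?case using p1 q1 by (metis mult.assoc)
qed

section \<open>Criteria for local parameters\<close>

context closed_irreducible_curve
begin

context
 fixes p assumes p: "p : S"
begin

text \<open>\<open>f\<close> is a constant modulo \<open>t\<close>. Such functions form a ring, so
  the property passes from the coordinates to all forms.\<close>

definition decomp :: "('n ppoint => complex) => ('n ppoint => complex) => bool" where
 "decomp t f \<longleftrightarrow> (EX g c a. has_val S g p c & ev S (%q. f q = a + t q * g q))"

lemma decompI: "has_val S g p c ==> ev S (%q. f q = a + t q * g q) ==> decomp t f"
 unfolding decomp_def by blast

lemma decompE:
 assumes "decomp t f"
 obtains g c a where "has_val S g p c" "ev S (%q. f q = a + t q * g q)"
 using assms unfolding decomp_def by blast

lemma decomp_const: "decomp t (%_. a)"
 by (rule decompI[of "%_. 0" 0 _ a]) (auto intro: has_val_const)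

lemma decomp_add: assumes "decomp t f" "decomp t g" shows "decomp t (%q. f q + g q)"
proof -
 obtain h c a where 1: "has_val S h p c" "ev S (%q. f q = a + t q * h q)" using decompE[OF assms(1)] .
 obtain k d b where 2: "has_val S k p d" "ev S (%q. g q = b + t q * k q)" using decompE[OF assms(2)] .
 show ?thesis
 by (rule decompI[OF has_val_add[OF p 1(1) 2(1)], of _ "a + b"])
 (use 1(2) 2(2) in eventually_elim, simp add: algebra_simps)
qed

lemma decomp_mult:
 assumes t: "has_val S t p 0" and "decomp t f" "decomp t g" shows "decomp t (%q. f q * g q)"
proof -
 obtain h c a where 1: "has_val S h p c" "ev S (%q. f q = a + t q * h q)" using decompE[OF assms(2)] .
 obtain k d b where 2: "has_val S k p d" "ev S (%q. g q = b + t q * k q)" using decompE[OF assms(3)] .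
 have "has_val S (%q. a * k q + b * h q + t q * (h q * k q)) p (a * d + b * c + 0 * (c * d))"
 by (intro has_val_add[OF p] has_val_mult[OF p] has_val_const 1 2 t)
 then show ?thesis
 by (rule decompI[of _ _ _ "a * b"])
 (use 1(2) 2(2) in eventually_elim, simp add: algebra_simps)
qed

text \<open>All quotients P / m^d are constant modulo \<open>t\<close>, because the coordinates over
  \<open>m\<close> are. If such a quotient vanishes at \<open>p\<close>, the constant is 0 and
  \<open>t\<close> divides it; a denominator that is nonzero at \<open>p\<close> is a unit.\<close>

lemma unif_of_generators:
 assumes m: "hpoly 1 m" "m (rep p) ~= 0"
 and t: "has_val S t p 0" "ev S (%q. t q ~= 0)"
 and gen: "!!i. decomp t (%q. rep q $ i / m (rep q))"
 shows "unif p t"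
proof -
 have dec: "decomp t (%q. P (rep q) / m (rep q) ^ d)" if "hpoly d P" for d P
 using that
 proof (induction rule: hom_poly_induct)
 case (const c)
 then show ?case using decomp_const by simp
 next
 case (coord i)
 then show ?case using gen by simp
 next
 case (add d P Q)
 then show ?case using decomp_add[OF add(3,4)] by (simp add: add_divide_distrib)
 next
 case (mult d e P Q)
 then show ?case using decomp_mult[OF t(1) mult(3,4)] by (simp add: power_add)
 qed
 have "EX g c. has_val S g p c & ev S (%q. f q = t q * g q)" if f: "has_val S f p 0" for f
 proof -
 obtain d P Q where 1: "hpoly d P" "hpoly d Q" "Q (rep p) ~= 0"
 "ev S (%q. f q = P (rep q) / Q (rep q))" "0 = P (rep p) / Q (rep p)"
 using has_valE[OF f] .
 have md: "hpoly d (%v. m v ^ d)" using hom_poly_power[OF m(1), of d] by simp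
 have valP: "has_val S (%q. P (rep q) / m (rep q) ^ d) p (P (rep p) / m (rep p) ^ d)"
 by (rule has_val_quot[OF 1(1) md]) (use m in simp)
 have valQ: "has_val S (%q. Q (rep q) / m (rep q) ^ d) p (Q (rep p) / m (rep p) ^ d)"
 by (rule has_val_quot[OF 1(2) md]) (use m in simp)
 obtain g c a where g: "has_val S g p c" "ev S (%q. P (rep q) / m (rep q) ^ d = a + t q * g q)"
 using decompE[OF dec[OF 1(1)]] .
 have "has_val S (%q. a + t q * g q) p (a + 0 * c)"
 by (intro has_val_add[OF p] has_val_mult[OF p] has_val_const t g)
 then have "a + 0 * c = P (rep p) / m (rep p) ^ d"
 using has_val_unique[OF p _ has_val_cong[OF valP g(2)]] by blast
 then have a: "a = 0" using 1(3,5) by simp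
 have "has_val S (%q. g q / (Q (rep q) / m (rep q) ^ d)) p (c / (Q (rep p) / m (rep p) ^ d))"
 by (rule has_val_divide[OF p g(1) valQ]) (use 1(3) m in simp)
 moreover have "ev S (%q. f q = t q * (g q / (Q (rep q) / m (rep q) ^ d)))"
 using 1(4) g(2) form_nonzero[OF 1(2) p 1(3)] form_nonzero[OF m(1) p m(2)]
 by eventually_elim (simp add: a field_simps)
 ultimately show ?thesis by blast
 qed
 then show ?thesis using t by (simp add: unif_def[OF p])
qed

text \<open>It suffices to find for each form a cofactor such that the product has an order:
  \<open>ordered_factor\<close> transfers this to the form itself, and orders pass to
  quotients.\<close>

lemma dvr_of_norms:
 assumes t: "unif p t" and m: "hpoly 1 m" "m (rep p) ~= 0"
 and norm: "!!d P. hpoly d P ==> \<not> ev S (%q. P (rep q) = 0) ==>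
 EX P'. hpoly d P' & ordered p t (%q. P (rep q) * P' (rep q) / m (rep q) ^ (2 * d))"
 shows "dvr_with p t"
proof -
 have val: "has_val S (%q. P (rep q) / m (rep q) ^ d) p (P (rep p) / m (rep p) ^ d)"
 if "hpoly d P" for d P
 by (rule has_val_quot[OF that]) (use m hom_poly_power[OF m(1), of d] in simp_all)
 have ord: "ordered p t (%q. P (rep q) / m (rep q) ^ d)"
 if P: "hpoly d P" "\<not> ev S (%q. P (rep q) = 0)" for d P
 proof -
 obtain P' where P': "hpoly d P'" "ordered p t (%q. P (rep q) * P' (rep q) / m (rep q) ^ (2 * d))"
 using norm[OF P] by blast
 then have "ordered p t (%q. (P (rep q) / m (rep q) ^ d) * (P' (rep q) / m (rep q) ^ d))"
 by (simp add: power_add mult_2)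
 then show ?thesis using ordered_factor[OF p t val[OF P(1)] val[OF P'(1)]] by blast
 qed
 have "ordered p t f" if f: "rational S f" "\<not> ev S (%q. f q = 0)" for f
 proof -
 obtain d P Q where 1: "hpoly d P" "hpoly d Q"
 "ev S (%q. Q (rep q) ~= 0 & f q = P (rep q) / Q (rep q))" using rationalE[OF f(1)] .
 have P0: "\<not> ev S (%q. P (rep q) = 0)"
 proof
 assume "ev S (%q. P (rep q) = 0)"
 then have "ev S (%q. f q = 0)" using 1(3) by eventually_elim simp
 then show False using f(2) by simp
 qed
 have Q0: "\<not> ev S (%q. Q (rep q) = 0)"
 proof
 assume "ev S (%q. Q (rep q) = 0)"
 then have "ev S (%q. False)" using 1(3) by eventually_elim simp
 then show False using almost_neq_bot by simp
 qed
 have "ordered p t (%q. (P (rep q) / m (rep q) ^ d) * inverse (Q (rep q) / m (rep q) ^ d))"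
 by (intro ordered_mult[OF p t] ordered_inverse[OF p] ord 1 P0 Q0)
 moreover have "ev S (%q. (P (rep q) / m (rep q) ^ d) * inverse (Q (rep q) / m (rep q) ^ d) = f q)"
 using 1(3) form_nonzero[OF m(1) p m(2)] by eventually_elim simp
 ultimately show ?thesis by (rule ordered_cong[OF p])
 qed
 then show ?thesis using t by (auto simp: dvr_with_def[OF p])
qed

end
end

section \<open>The elliptic curve with j-invariant 1728\<close>

definition cub :: "complex poly" where "cub = [:0, -1, 0, 1:]"

lemma poly_cub: "poly cub x = x ^ 3 - x"
 by (simp add: cub_def power3_eq_cube algebra_simps)

lemma cub_nonzero: "cub ~= 0" and degree_cub: "pdeg cub = 3"
 by (simp_all add: cub_def)

lemma cub_simple_roots: "poly cub z = 0 ==> poly (pderiv cub) z ~= 0"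
proof
 assume "poly cub z = 0" "poly (pderiv cub) z = 0"
 then have 1: "z ^ 3 - z = 0" and 2: "3 * z ^ 2 - 1 = 0"
 by (simp_all add: poly_cub, simp add: cub_def pderiv_pCons power2_eq_square algebra_simps)
 \<comment> \<open>A Bezout identity for the cubic and its derivative.\<close>
 have "- 2 = (9 * z) * (z ^ 3 - z) - (3 * z ^ 2 - 1) * (3 * z ^ 2 - 2)" by (simp add: algebra_simps power2_eq_square power3_eq_cube)
 then show False using 1 2 by simp
qed

text \<open>The norm of A + y C down to the field of x cannot vanish: A^2 has even degree, C^2 times
  the cubic has odd degree.\<close>

lemma cubic_norm_nonzero:
 assumes "A ~= 0 | C ~= 0" shows "A * A - C * C * cub ~= 0"
proof
 assume "A * A - C * C * cub = 0"
 then have eq: "A * A = C * C * cub" by simp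
 then have "A ~= 0" "C ~= 0" using assms cub_nonzero by auto
 then have "pdeg A + pdeg A = pdeg C + pdeg C + 3"
 using arg_cong[OF eq, of pdeg] cub_nonzero by (simp add: degree_mult_eq degree_cub)
 then show False by presburger
qed

text \<open>The curve stays in its original coordinates; \<open>B\<close> takes them to coordinates
  in which the equation is y^2 z = x^3 - x z^2, and \<open>Bi\<close> takes them back.\<close>

locale elliptic_curve =
 fixes B Bi :: "complex ^ 3 ^ 3" and E :: "3 ppoint set"
 assumes B_Bi: "B ** Bi = mat 1" and Bi_B: "Bi ** B = mat 1"
 and E_def: "E = {p : proj_points. \<forall>v\<in>p. ((B *v v) $ 2) ^ 2 * (B *v v) $ 3 = ((B *v v) $ 1) ^ 3 - (B *v v) $ 1 * ((B *v v) $ 3) ^ 2}"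
begin

lemma B_Bi_vec [simp]: "B *v (Bi *v w) = w" and Bi_B_vec [simp]: "Bi *v (B *v w) = w"
 by (simp_all add: matrix_vector_mul_assoc B_Bi Bi_B)

lemma Bi_eq_0_iff [simp]: "Bi *v w = 0 \<longleftrightarrow> w = 0"
 by (metis B_Bi_vec matrix_vector_mult_0_right)

definition pt :: "complex ^ 3 => 3 ppoint" where "pt w = hcoord (Bi *v w)"
definition aff :: "complex => complex => 3 ppoint" where "aff x y = pt (vector [x, y, 1])"
definition origin :: "3 ppoint" where "origin = pt (vector [0, 1, 0])"
definition co :: "3 ppoint => complex ^ 3" where "co p = B *v rep p"
definition xi :: "3 ppoint => complex" where "xi p = co p $ 1 / co p $ 3"
definition eta :: "3 ppoint => complex" where "eta p = co p $ 2 / co p $ 3"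

lemma pt_in_E:
 assumes "w ~= 0" shows "pt w : E \<longleftrightarrow> (w $ 2) ^ 2 * w $ 3 = (w $ 1) ^ 3 - w $ 1 * (w $ 3) ^ 2"
proof -
 have "pt w : proj_points" using assms by (simp add: pt_def hcoord_in_proj_points)
 moreover have "B *v (c *s (Bi *v w)) = c *s w" for c by (simp add: vector_scalar_commute)
 moreover have "(c * y) ^ 2 * (c * z) = (c * x) ^ 3 - c * x * (c * z) ^ 2"
 if "y ^ 2 * z = x ^ 3 - x * z ^ 2" for c x y z :: complex
 proof -
 have "(c * y) ^ 2 * (c * z) = c ^ 3 * (y ^ 2 * z)" by (simp add: power2_eq_square power3_eq_cube)
 also have "\<dots> = (c * x) ^ 3 - c * x * (c * z) ^ 2" unfolding that
 by (simp add: power2_eq_square power3_eq_cube algebra_simps)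
 finally show ?thesis .
 qed
 ultimately show ?thesis
 unfolding E_def pt_def hcoord_eq_range by (auto dest: spec[of _ 1])
qed

lemma E_points: "E \<subseteq> proj_points"
 by (auto simp: E_def)

lemma co_nonzero: "p : E ==> co p ~= 0"
 using rep_in(2) E_points Bi_B_vec unfolding co_def by (metis in_mono matrix_vector_mult_0_right)

lemma pt_co: "p : E ==> pt (co p) = p"
 using E_points hcoord_rep by (auto simp: pt_def co_def)

lemma co_eq: "p : E ==> (co p $ 2) ^ 2 * co p $ 3 = (co p $ 1) ^ 3 - co p $ 1 * (co p $ 3) ^ 2"
 using pt_in_E[OF co_nonzero] pt_co by metis

lemma pt_scale: "c ~= 0 ==> pt (c *s w) = pt w"
 by (simp add: pt_def vector_scalar_commute hcoord_scale)

lemma co_pt: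
 assumes "w ~= 0" obtains c where "c ~= 0" "co (pt w) = c *s w" "rep (pt w) = c *s (Bi *v w)"
 using rep_hcoord[of "Bi *v w"] assms unfolding co_def pt_def
 by (metis B_Bi_vec Bi_eq_0_iff vector_scalar_commute)

lemma vector3_eq_0: "vector [x, y, z] = (0 :: complex ^ 3) \<longleftrightarrow> x = 0 & y = 0 & z = 0"
 by (auto simp: vec_eq_iff forall_3)

lemma aff_in_E: "aff x y : E \<longleftrightarrow> y ^ 2 = x ^ 3 - x"
 unfolding aff_def by (subst pt_in_E) (auto simp: vector3_eq_0)

lemma origin_in_E: "origin : E"
 unfolding origin_def by (subst pt_in_E) (auto simp: vector3_eq_0)

lemma co_aff:
 obtains c where "c ~= 0" "co (aff x y) $ 1 = c * x" "co (aff x y) $ 2 = c * y" "co (aff x y) $ 3 = c"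
 "rep (aff x y) = c *s (Bi *v vector [x, y, 1])"
proof -
 have "vector [x, y, 1] ~= (0 :: complex ^ 3)" by (simp add: vector3_eq_0)
 then obtain c where "c ~= 0" "co (aff x y) = c *s vector [x, y, 1]" "rep (aff x y) = c *s (Bi *v vector [x, y, 1])"
 unfolding aff_def using co_pt by blast
 then show thesis using that[of c] by simp
qed

lemma xi_aff [simp]: "xi (aff x y) = x" and eta_aff [simp]: "eta (aff x y) = y"
 using co_aff[of x y] by (metis xi_def nonzero_mult_div_cancel_left, metis eta_def nonzero_mult_div_cancel_left)

lemma E_cases:
 assumes "p : E"
 obtains "p = origin" | "p = aff (xi p) (eta p)" "eta p ^ 2 = xi p ^ 3 - xi p"
proof (cases "co p $ 3 = 0")
 case True
 then have "co p $ 1 = 0" using co_eq[OF assms] by simp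
 with True have "co p = (co p $ 2) *s vector [0, 1, 0]" by (simp add: vec_eq_iff forall_3)
 moreover have "co p $ 2 ~= 0" using calculation co_nonzero[OF assms] by auto
 ultimately have "pt (co p) = origin" unfolding origin_def by (metis pt_scale)
 then show thesis using that(1) pt_co[OF assms] by simp
next
 case False
 then have "co p = (co p $ 3) *s vector [xi p, eta p, 1]" by (simp add: vec_eq_iff forall_3 xi_def eta_def)
 then have "pt (co p) = aff (xi p) (eta p)" unfolding aff_def using False pt_scale by metis
 then have p: "p = aff (xi p) (eta p)" using pt_co[OF assms] by simp
 then have "eta p ^ 2 = xi p ^ 3 - xi p" using aff_in_E assms by metis
 with p show thesis using that(2) by blast
qed

lemma co_origin: "co origin $ 1 = 0" "co origin $ 2 ~= 0" "co origin $ 3 = 0"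
proof -
 have "vector [0, 1, 0] ~= (0 :: complex ^ 3)" by (simp add: vector3_eq_0)
 then obtain c where "c ~= 0" "co origin = c *s vector [0, 1, 0]"
 unfolding origin_def using co_pt by blast
 then show "co origin $ 1 = 0" "co origin $ 2 ~= 0" "co origin $ 3 = 0" by auto
qed

text \<open>Only the point at infinity and the at most two points above each root of
  \<open>N\<close> are left out.\<close>

lemma eventually_affine:
 assumes "N ~= 0" "!!x y. y ^ 2 = x ^ 3 - x ==> poly N x ~= 0 ==> P (aff x y)"
 shows "eventually P (almost E)"
proof -
 let ?T = "\<Union>x\<in>{x. poly N x = 0}. aff x ` {y. y ^ 2 = x ^ 3 - x}"
 have fin: "finite {y :: complex. y ^ 2 = c}" for c
 proof -
 have "{y. y ^ 2 = c} = {y. poly [:- c, 0, 1:] y = 0}" by (auto simp: power2_eq_square)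
 then show ?thesis using poly_roots_finite[of "[:- c, 0, 1:]"] by simp
 qed
 have "finite (insert origin ?T)" using fin poly_roots_finite[OF assms(1)] by auto
 moreover have "{p\<in>E. \<not> P p} \<subseteq> insert origin ?T"
 proof
 fix p assume "p : {p\<in>E. \<not> P p}"
 then have p: "p : E" "\<not> P p" by auto
 from p(1) show "p : insert origin ?T"
 proof (rule E_cases)
 assume a: "p = aff (xi p) (eta p)" "eta p ^ 2 = xi p ^ 3 - xi p"
 then have "poly N (xi p) = 0" using assms(2) p(2) by metis
 then have "aff (xi p) (eta p) : ?T" using a(2) by blast
 then show ?thesis using a(1) by simp
 qed simp
 qed
 ultimately show ?thesis unfolding eventually_almost by (rule finite_subset[rotated])
qed

lemma almost_affine:
 assumes "eventually P (almost E)"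
 obtains A where "finite A" "!!x y. y ^ 2 = x ^ 3 - x ==> x \<notin> A ==> P (aff x y)"
proof (rule that[of "xi ` {p\<in>E. \<not> P p}"])
 show "P (aff x y)" if "y ^ 2 = x ^ 3 - x" "x \<notin> xi ` {p\<in>E. \<not> P p}" for x y
 using that aff_in_E xi_aff by (metis (mono_tags, lifting) image_iff mem_Collect_eq)
qed (use assms in \<open>simp add: eventually_almost\<close>)

lemma form_affine:
 assumes "hpoly d P"
 shows "EX A C. ALL x y. y ^ 2 = x ^ 3 - x --> P (Bi *v vector [x, y, 1]) = poly A x + y * poly C x"
 using assms
proof (induction rule: hom_poly_induct)
 case (const c)
 then show ?case by (intro exI[of _ "[:c:]"] exI[of _ 0]) simp
next
 case (coord i)
 then show ?case
 by (intro exI[of _ "[:Bi $ i $ 3, Bi $ i $ 1:]"] exI[of _ "[:Bi $ i $ 2:]"])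
 (simp add: matrix_vector_mult_def sum_3 algebra_simps)
next
 case (add d P Q)
 then obtain A C A' C' where 1: "!!x y. y ^ 2 = x ^ 3 - x ==> P (Bi *v vector [x, y, 1]) = poly A x + y * poly C x"
 "!!x y. y ^ 2 = x ^ 3 - x ==> Q (Bi *v vector [x, y, 1]) = poly A' x + y * poly C' x" by blast
 show ?case by (intro exI[of _ "A + A'"] exI[of _ "C + C'"]) (simp add: 1 algebra_simps)
next
 case (mult d e P Q)
 then obtain A C A' C' where 1: "!!x y. y ^ 2 = x ^ 3 - x ==> P (Bi *v vector [x, y, 1]) = poly A x + y * poly C x"
 "!!x y. y ^ 2 = x ^ 3 - x ==> Q (Bi *v vector [x, y, 1]) = poly A' x + y * poly C' x" by blast
 have "(a + y * c) * (a' + y * c') = (a * a' + (c * c') * (x ^ 3 - x)) + y * (a * c' + a' * c)"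
 if "y ^ 2 = x ^ 3 - x" for x y a c a' c' :: complex
 unfolding that[symmetric] by (simp add: algebra_simps power2_eq_square)
 then show ?case by (intro exI[of _ "A * A' + C * C' * cub"] exI[of _ "A * C' + A' * C"]) (simp add: 1 poly_cub)
qed

lemma affine_form_nonzero:
 assumes "A ~= 0 | C ~= 0"
 shows "ev E (%p. poly A (xi p) + eta p * poly C (xi p) ~= 0)"
proof (rule eventually_affine[OF cubic_norm_nonzero[OF assms]])
 fix x y assume y: "y ^ 2 = x ^ 3 - x" "poly (A * A - C * C * cub) x ~= 0"
 have "poly (A * A - C * C * cub) x = (poly A x + y * poly C x) * (poly A x - y * poly C x)"
 by (simp add: poly_cub y(1)[symmetric] algebra_simps power2_eq_square)
 with y(2) show "poly A (xi (aff x y)) + eta (aff x y) * poly C (xi (aff x y)) ~= 0" by auto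
qed

lemma rep_aff_form:
 assumes "hpoly d P"
 shows "EX c. c ~= 0 & P (rep (aff x y)) = c ^ d * P (Bi *v vector [x, y, 1]) & co (aff x y) $ 1 = c * x &
 co (aff x y) $ 2 = c * y & co (aff x y) $ 3 = c"
proof -
 obtain c where "c ~= 0" "co (aff x y) $ 1 = c * x" "co (aff x y) $ 2 = c * y" "co (aff x y) $ 3 = c"
 "rep (aff x y) = c *s (Bi *v vector [x, y, 1])" using co_aff .
 then show ?thesis using hom_poly_scale[OF assms] by auto
qed

lemma infinite_E: "infinite E"
proof
 assume "finite E"
 moreover have "xi ` E = UNIV"
 proof (intro equalityI subsetI)
 fix x :: complex
 have "aff x (csqrt (x ^ 3 - x)) : E" by (simp add: aff_in_E)
 then show "x : xi ` E" using xi_aff by force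
 qed simp
 ultimately show False using infinite_UNIV_char_0[where 'a = complex] finite_imageI[of E xi] by simp
qed

text \<open>The point at infinity is a limit of affine points: (n : y_n : 1), rescaled to (n/y_n : 1
  : 1/y_n), tends to (0 : 1 : 0). By continuity a form vanishing on the affine part vanishes at
  infinity.\<close>

lemma form_at_origin:
 assumes P: "hpoly d P" and 0: "!!x y. y ^ 2 = x ^ 3 - x ==> P (Bi *v vector [x, y, 1]) = 0"
 shows "P (Bi *v vector [0, 1, 0]) = 0"
proof -
 define y where "y n = csqrt (of_nat n ^ 3 - of_nat n)" for n
 have ny: "norm (y n) = sqrt (real n ^ 3 - real n)" if "n \<ge> 2" for n
 proof -
 have "real n <= real n ^ 3" using that by (simp add: self_le_power)
 have "(of_nat n ^ 3 - of_nat n :: complex) = of_real (real n ^ 3 - real n)" by simp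
 then have "norm (of_nat n ^ 3 - of_nat n :: complex) = \<bar>real n ^ 3 - real n\<bar>" by (metis norm_of_real)
 then show ?thesis unfolding y_def using \<open>real n <= _\<close> by (simp add: norm_csqrt)
 qed
 have l1: "(%n. of_nat n / y n) \<longlonglongrightarrow> 0"
 proof (rule Lim_null_comparison)
 show "\<forall>\<^sub>F n in sequentially. norm (of_nat n / y n) <= real n / sqrt (real n ^ 3 - real n)"
 by (rule eventually_sequentiallyI[of 2]) (simp add: norm_divide ny)
 show "(%n. real n / sqrt (real n ^ 3 - real n)) \<longlonglongrightarrow> 0" by real_asymp
 qed
 have l2: "(%n. 1 / y n) \<longlonglongrightarrow> 0"
 proof (rule Lim_null_comparison)
 show "\<forall>\<^sub>F n in sequentially. norm (1 / y n) <= 1 / sqrt (real n ^ 3 - real n)"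
 by (rule eventually_sequentiallyI[of 2]) (simp add: norm_divide ny)
 show "(%n. 1 / sqrt (real n ^ 3 - real n)) \<longlonglongrightarrow> 0" by real_asymp
 qed
 have "(%n. vector [of_nat n / y n, 1, 1 / y n] :: complex ^ 3) \<longlonglongrightarrow> vector [0, 1, 0]"
 proof (rule vec_tendstoI)
 show "(%n. vector [of_nat n / y n, 1, 1 / y n] $ i) \<longlonglongrightarrow> (vector [0, 1, 0] :: complex ^ 3) $ i" for i
 using exhaust_3[of i] l1 l2 by auto
 qed
 moreover have "isCont (%w. P (Bi *v w)) (vector [0, 1, 0])"
 using continuous_on_homogeneous_poly[OF hom_poly_compose[OF P], of UNIV Bi] continuous_on_eq_continuous_at by blast
 ultimately have lim: "(%n. P (Bi *v vector [of_nat n / y n, 1, 1 / y n])) \<longlonglongrightarrow> P (Bi *v vector [0, 1, 0])"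
 by (rule isCont_tendsto_compose[rotated])
 have "P (Bi *v vector [of_nat n / y n, 1, 1 / y n]) = 0" if "n \<ge> 2" for n
 proof -
 have "real n ^ 3 > real n" using that power_strict_increasing[of 1 3 "real n"] by simp
 then have "y n ~= 0" using ny[OF that] by auto
 then have "(vector [of_nat n / y n, 1, 1 / y n] :: complex ^ 3) = (1 / y n) *s vector [of_nat n, y n, 1]"
 by (simp add: vec_eq_iff forall_3)
 then have "P (Bi *v vector [of_nat n / y n, 1, 1 / y n]) = (1 / y n) ^ d * P (Bi *v vector [of_nat n, y n, 1])"
 using hom_poly_scale[OF P] vector_scalar_commute by metis
 also have "\<dots> = 0" using 0[of "y n" "of_nat n"] by (simp add: y_def)
 finally show ?thesis .
 qed
 then have "\<forall>\<^sub>F n in sequentially. P (Bi *v vector [of_nat n / y n, 1, 1 / y n]) = 0"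
 by (rule eventually_sequentiallyI)
 then have "(%n. P (Bi *v vector [of_nat n / y n, 1, 1 / y n])) \<longlonglongrightarrow> 0"
 by (rule tendsto_eventually)
 then show ?thesis using lim LIMSEQ_unique by blast
qed

sublocale closed_irreducible_curve E
proof (unfold_locales)
 fix d and P :: "complex ^ 3 => complex" assume P: "hpoly d P"
 obtain A C where AC: "!!x y. y ^ 2 = x ^ 3 - x ==> P (Bi *v vector [x, y, 1]) = poly A x + y * poly C x"
 using form_affine[OF P] by blast
 have rep: "P (rep (aff x y)) = 0 \<longleftrightarrow> poly A x + y * poly C x = 0" if "y ^ 2 = x ^ 3 - x" for x y
 using rep_aff_form[OF P, of x y] AC[OF that] by auto
 have nz: "ev E (%p. P (rep p) ~= 0)" if nonzero: "A ~= 0 | C ~= 0"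
 proof -
 obtain T where T: "finite T" "!!x y. y ^ 2 = x ^ 3 - x ==> x \<notin> T ==> poly A x + y * poly C x ~= 0"
 using almost_affine[OF affine_form_nonzero[OF nonzero]] by (metis xi_aff eta_aff)
 have "(\<Prod>a\<in>T. [:- a, 1:]) ~= 0" using T(1) by auto
 then show ?thesis
 by (rule eventually_affine) (use T in \<open>auto simp: rep poly_prod\<close>)
 qed
 show "ev E (%p. P (rep p) ~= 0) | ev E (%p. P (rep p) = 0)"
 proof (cases "A ~= 0 | C ~= 0")
 case False
 then have "ev E (%p. P (rep p) = 0)"
 by (intro eventually_affine[of 1]) (auto simp: rep)
 then show ?thesis ..
 qed (use nz in blast)
 fix p assume 0: "ev E (%p. P (rep p) = 0)" and p: "p : E"
 have "\<not> (A ~= 0 | C ~= 0)"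
 proof
 assume "A ~= 0 | C ~= 0"
 from nz[OF this] 0 have "ev E (%_. False)" by eventually_elim simp
 then show False using infinite_E by (simp add: eventually_almost)
 qed
 then have AC0: "P (Bi *v vector [x, y, 1]) = 0" if "y ^ 2 = x ^ 3 - x" for x y using AC[OF that] by simp
 from p show "P (rep p) = 0"
 proof (rule E_cases)
 assume "p = origin"
 moreover have "vector [0, 1, 0] ~= (0 :: complex ^ 3)" by (simp add: vector3_eq_0)
 then obtain c where "rep origin = c *s (Bi *v vector [0, 1, 0])"
 unfolding origin_def using co_pt by blast
 ultimately show ?thesis using form_at_origin[OF P AC0] hom_poly_scale[OF P] by simp
 next
 assume "p = aff (xi p) (eta p)" "eta p ^ 2 = xi p ^ 3 - xi p"
 then show ?thesis using rep_aff_form[OF P, of "xi p" "eta p"] AC0 by (metis mult_zero_right)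
 qed
qed (use E_points infinite_E in auto)

end

text \<open>Over the complex numbers \<open>N\<close> splits into linear factors, and orders
  add.\<close>

lemma ordered_poly:
 fixes S :: "'n::finite ppoint set"
 assumes "closed_irreducible_curve S" "p : S" "closed_irreducible_curve.unif S p t"
 and lin: "!!c. closed_irreducible_curve.ordered S p t (%q. f q - c)" and "N ~= 0"
 shows "closed_irreducible_curve.ordered S p t (%q. poly N (f q))"
proof -
 interpret closed_irreducible_curve S by fact
 note p = \<open>p : S\<close>
 show ?thesis
 using \<open>N ~= 0\<close>
 proof (induction "pdeg N" arbitrary: N)
 case 0
 then obtain c where c: "N = [:c:]" "c ~= 0" by (metis degree_eq_zeroE pCons_0_0)
 then show ?case using ordered_unit[OF p has_val_const[of S c p]] by simp
 next
 case (Suc n)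
 then have "EX z. poly N z = 0"
 by (intro fundamental_theorem_of_algebra) (simp add: constant_degree)
 then obtain z0 N1 where N1: "N = [:- z0, 1:] * N1" using poly_eq_0_iff_dvd dvdE by metis
 have N10: "N1 ~= 0" using Suc N1 by auto
 have "n = pdeg N1"
 using Suc(2) N10 unfolding N1 by (subst (asm) degree_mult_eq) auto
 from ordered_mult[OF p assms(3) lin[of z0] Suc(1)[OF this N10]]
 show ?case unfolding N1 by (simp add: algebra_simps)
 qed
qed

context elliptic_curve
begin

lemma co3_aff: "co (aff x y) $ 3 ~= 0"
proof -
 obtain c where "c ~= 0" "co (aff x y) $ 3 = c" using co_aff .
 then show ?thesis by simp
qed

lemma homogeneous_coordinate: "hpoly 1 (%v. (B *v v) $ i)"
 by (rule hom_poly_linear)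

lemma rational_xi: "rational E xi" and rational_eta: "rational E eta"
 unfolding xi_def eta_def co_def
 by (intro rational_hquot[OF homogeneous_coordinate homogeneous_coordinate])+

lemma eventually_weierstrass: "ev E (%p. eta p ^ 2 = xi p ^ 3 - xi p)"
 by (rule eventually_affine[of 1]) auto

lemma eventually_poly_xi: "N ~= 0 ==> ev E (%p. poly N (xi p) ~= 0)"
 by (rule eventually_affine[of N]) auto

lemma eventually_co3: "ev E (%p. co p $ 3 ~= 0)"
 by (rule eventually_affine[of 1]) (simp_all add: co3_aff)

lemma eventually_eta: "ev E (%p. eta p ~= 0)"
 using eventually_weierstrass eventually_poly_xi[OF cub_nonzero]
 by eventually_elim (auto simp: poly_cub)

lemma has_val_co:
 assumes "p : E" "co p $ j ~= 0" shows "has_val E (%q. co q $ i / co q $ j) p (co p $ i / co p $ j)"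
 using assms unfolding co_def by (intro has_val_quot[OF homogeneous_coordinate homogeneous_coordinate]) auto

lemma has_val_xi: "y ^ 2 = x ^ 3 - x ==> has_val E xi (aff x y) x"
 and has_val_eta: "y ^ 2 = x ^ 3 - x ==> has_val E eta (aff x y) y"
proof -
 assume y: "y ^ 2 = x ^ 3 - x"
 note co3_aff[of x y]
 then show "has_val E xi (aff x y) x" "has_val E eta (aff x y) y"
 using has_val_co[of "aff x y" 3 1] has_val_co[of "aff x y" 3 2] y xi_aff[of x y] eta_aff[of x y]
 by (auto simp: aff_in_E xi_def[abs_def] eta_def[abs_def])
qed

text \<open>\<open>P'\<close> is \<open>P\<close> composed with the reflection y -> - y (the matrix
  \<open>D\<close>, transported to the given coordinates). The product is the norm A^2 - C^2 (x^3 -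
  x), a polynomial in x alone.\<close>

lemma norm_form:
 assumes P: "hpoly d P" "\<not> ev E (%q. P (rep q) = 0)"
 shows "EX P' N. hpoly d P' & N ~= 0 &
 ev E (%q. P (rep q) * P' (rep q) = poly N (xi q) * co q $ 3 ^ (2 * d))"
proof -
 obtain A C where AC: "!!x y. y ^ 2 = x ^ 3 - x ==> P (Bi *v vector [x, y, 1]) = poly A x + y * poly C x"
 using form_affine[OF P(1)] by blast
 define D :: "complex ^ 3 ^ 3" where "D = vector [vector [1, 0, 0], vector [0, -1, 0], vector [0, 0, 1]]"
 define P' where "P' = (%v. P ((Bi ** D ** B) *v v))"
 have P': "hpoly d P'" unfolding P'_def by (rule hom_poly_compose[OF P(1)])
 have D: "D *v vector [x, y, 1] = vector [x, - y, 1]" for x y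
 by (simp add: D_def vec_eq_iff forall_3 matrix_vector_mult_def sum_3)
 have "ev E (%q. P (rep q) * P' (rep q) = poly (A * A - C * C * cub) (xi q) * co q $ 3 ^ (2 * d))"
 proof (rule eventually_affine[of 1])
 fix x y :: complex assume y: "y ^ 2 = x ^ 3 - x"
 obtain c where c: "c ~= 0" "co (aff x y) $ 3 = c" "rep (aff x y) = c *s (Bi *v vector [x, y, 1])"
 using co_aff .
 have 1: "P (rep (aff x y)) = c ^ d * (poly A x + y * poly C x)"
 unfolding c(3) hom_poly_scale[OF P(1)] AC[OF y] ..
 have "P' (rep (aff x y)) = c ^ d * P' (Bi *v vector [x, y, 1])"
 unfolding c(3) by (rule hom_poly_scale[OF P'])
 also have "\<dots> = c ^ d * P (Bi *v vector [x, - y, 1])"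
 by (simp add: P'_def matrix_vector_mul_assoc[symmetric] D)
 also have "\<dots> = c ^ d * (poly A x - y * poly C x)" using AC[of "- y" x] y by simp
 finally have 2: "P' (rep (aff x y)) = c ^ d * (poly A x - y * poly C x)" .
 show "P (rep (aff x y)) * P' (rep (aff x y)) = poly (A * A - C * C * cub) (xi (aff x y)) * co (aff x y) $ 3 ^ (2 * d)"
 unfolding 1 2 c(2) mult_2 power_add by (simp add: poly_cub y[symmetric] algebra_simps power2_eq_square)
 qed simp
 moreover have "A ~= 0 | C ~= 0"
 proof (rule ccontr)
 assume "\<not> ?thesis"
 then have "ev E (%q. P (rep q) = 0)"
 proof (intro eventually_affine[of 1])
 fix x y :: complex assume y: "y ^ 2 = x ^ 3 - x" and AC0: "\<not> (A ~= 0 | C ~= 0)"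
 then show "P (rep (aff x y)) = 0" using rep_aff_form[OF P(1), of x y] AC[OF y] by auto
 qed auto
 then show False using P(2) by simp
 qed
 ultimately show ?thesis using P' cubic_norm_nonzero by blast
qed

context
 fixes p assumes p: "p : E"
begin

lemma decomp_cong: "decomp p t f ==> ev E (%q. f q = g q) ==> decomp p t g"
proof (erule decompE[OF p])
 fix h c a assume 1: "ev E (%q. f q = g q)" "has_val E h p c" "ev E (%q. f q = a + t q * h q)"
 from 1(1,3) have "ev E (%q. g q = a + t q * h q)" by eventually_elim simp
 with 1(2) show ?thesis by (rule decompI[OF p])
qed

lemma decomp_coordinates:
 assumes t: "has_val E t p 0" and co: "!!j. decomp p t (%q. co q $ j / co q $ k)"
 shows "decomp p t (%q. rep q $ i / (B *v rep q) $ k)"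
proof -
 have "decomp p t (%q. Bi $ i $ 1 * (co q $ 1 / co q $ k) + Bi $ i $ 2 * (co q $ 2 / co q $ k) + Bi $ i $ 3 * (co q $ 3 / co q $ k))"
 by (intro decomp_add[OF p] decomp_mult[OF p] decomp_const[OF p] t co)
 moreover have "rep q $ i = (Bi *v co q) $ i" for q by (simp add: co_def)
 then have "rep q $ i = Bi $ i $ 1 * co q $ 1 + Bi $ i $ 2 * co q $ 2 + Bi $ i $ 3 * co q $ 3" for q
 by (simp add: matrix_vector_mult_def sum_3)
 ultimately show ?thesis by (simp add: co_def add_divide_distrib)
qed

lemma decomp_self: "decomp p t t"
 by (rule decompI[OF p has_val_const[of E 1], where a = 0]) auto

text \<open>At a finite point the norm of a form is a polynomial in \<open>xi\<close>, so only the
  functions \<open>xi - c\<close> need an order with respect to \<open>t\<close>.\<close>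

lemma dvr_affine:
 assumes co3: "co p $ 3 ~= 0" and t: "has_val E t p 0" "ev E (%q. t q ~= 0)"
 and dec: "decomp p t xi" "decomp p t eta" and ord: "!!c. ordered p t (%q. xi q - c)"
 shows "dvr_with p t"
proof -
 have "decomp p t (%q. co q $ j / co q $ 3)" for j
 proof -
 have "ev E (%q. 1 = co q $ 3 / co q $ 3)" using eventually_co3 by eventually_elim simp
 from decomp_cong[OF decomp_const[OF p, of t 1] this] show ?thesis
 using exhaust_3[of j] dec by (auto simp: xi_def[abs_def] eta_def[abs_def])
 qed
 then have unif: "unif p t"
 by (intro unif_of_generators[OF p homogeneous_coordinate _ t decomp_coordinates[OF t(1)]])
 (use co3 in \<open>simp_all add: co_def\<close>)
 show ?thesis
 proof (rule dvr_of_norms[OF p unif homogeneous_coordinate[of 3]])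
 fix d and P :: "complex ^ 3 => complex"
 assume P: "hpoly d P" "\<not> ev E (%q. P (rep q) = 0)"
 obtain P' N where P': "hpoly d P'" "N ~= 0"
 "ev E (%q. P (rep q) * P' (rep q) = poly N (xi q) * co q $ 3 ^ (2 * d))"
 using norm_form[OF P] by blast
 have "ev E (%q. poly N (xi q) = P (rep q) * P' (rep q) / (B *v rep q) $ 3 ^ (2 * d))"
 using P'(3) eventually_co3 by eventually_elim (simp add: co_def)
 from ordered_cong[OF p ordered_poly[OF closed_irreducible_curve_axioms p unif ord P'(2)] this]
 have "ordered p t (%q. P (rep q) * P' (rep q) / (B *v rep q) $ 3 ^ (2 * d))" .
 then show "EX P'. hpoly d P' & ordered p t (%q. P (rep q) * P' (rep q) / (B *v rep q) $ 3 ^ (2 * d))"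
 using P'(1) by blast
 qed (use co3 in \<open>simp add: co_def\<close>)
qed

end

lemma eventually_neq_xi: "ev E (%q. xi q - c ~= 0)"
 using eventually_poly_xi[of "[:- c, 1:]"] by (auto elim: eventually_mono)

text \<open>Away from the points with y = 0 the curve is a graph over the x-line: eta - y is xi - x
  times a regular function, from the factorization of eta^2 - y^2.\<close>

lemma dvr_generic:
 assumes y: "y ^ 2 = x ^ 3 - x" "y ~= 0"
 shows "dvr_with (aff x y) (%q. xi q - x)"
proof -
 let ?p = "aff x y" and ?t = "%q. xi q - x"
 have p: "?p : E" using y by (simp add: aff_in_E)
 note vx = has_val_xi[OF y(1)] and vy = has_val_eta[OF y(1)]
 have t: "has_val E ?t ?p 0" using has_val_diff[OF p vx has_val_const[of E x]] by simp
 show ?thesis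
 proof (rule dvr_affine[OF p _ t eventually_neq_xi])
 show "co ?p $ 3 ~= 0" by (rule co3_aff)
 show "decomp ?p ?t xi"
 by (rule decompI[OF p has_val_const[of E 1], where a = x]) simp
 have y2: "y + y ~= 0" using y(2) by simp
 have vy2: "has_val E (%q. eta q + y) ?p (y + y)" by (intro has_val_add[OF p] vy has_val_const)
 have "has_val E (%q. (xi q ^ 2 + xi q * x + x ^ 2 - 1) / (eta q + y)) ?p ((x ^ 2 + x * x + x ^ 2 - 1) / (y + y))"
 by (intro has_val_divide[OF p] has_val_diff[OF p] has_val_add[OF p] has_val_power[OF p] has_val_mult[OF p] has_val_const vx vy2)
 (use y(2) in simp)
 then show "decomp ?p ?t eta"
 proof (rule decompI[OF p, of _ _ _ y])
 show "ev E (%q. eta q = y + (xi q - x) * ((xi q ^ 2 + xi q * x + x ^ 2 - 1) / (eta q + y)))"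
 using eventually_weierstrass has_val_eventually_nonzero[OF p vy2 y2]
 proof eventually_elim
 case (elim q)
 have "(eta q - y) * (eta q + y) = eta q ^ 2 - y ^ 2"
 by (simp add: algebra_simps power2_eq_square)
 also have "\<dots> = (xi q - x) * (xi q ^ 2 + xi q * x + x ^ 2 - 1)"
 unfolding elim(1) y(1) by (simp add: algebra_simps power2_eq_square power3_eq_cube)
 finally have "(eta q - y) * (eta q + y) = (xi q - x) * (xi q ^ 2 + xi q * x + x ^ 2 - 1)" .
 then show ?case using elim y(2) by (simp add: divide_simps) (simp add: algebra_simps)
 qed
 qed
 show "ordered ?p ?t (%q. xi q - c)" for c
 proof (cases "c = x")
 case False
 have "has_val E (%q. xi q - c) ?p (x - c)" by (intro has_val_diff[OF p] vx has_val_const)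
 then show ?thesis using False ordered_unit[OF p] by auto
 qed (simp add: ordered_self[OF p])
 qed
qed

text \<open>Where y = 0 the tangent is vertical: xi - x equals eta^2 over a function with value 3
  x^2 - 1, which is nonzero since the cubic has simple roots.\<close>

lemma dvr_two_torsion:
 assumes y: "0 = x ^ 3 - x"
 shows "dvr_with (aff x 0) eta"
proof -
 have y': "0 ^ 2 = x ^ 3 - x" using y by simp
 let ?p = "aff x 0"
 have p: "?p : E" using y by (simp add: aff_in_E)
 note vx = has_val_xi[OF y'] and vy = has_val_eta[OF y']
 define g where "g = (%q. xi q ^ 2 + xi q * x + x ^ 2 - 1)"
 have "3 * x ^ 2 - 1 ~= 0"
 using cub_simple_roots[of x] y by (simp add: poly_cub) (simp add: cub_def pderiv_pCons power2_eq_square algebra_simps)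
 moreover have "has_val E g ?p (x ^ 2 + x * x + x ^ 2 - 1)" unfolding g_def
 by (intro has_val_diff[OF p] has_val_add[OF p] has_val_power[OF p] has_val_mult[OF p] has_val_const vx)
 ultimately have g: "has_val E g ?p (3 * x ^ 2 - 1)" "3 * x ^ 2 - 1 ~= 0" by (simp_all add: power2_eq_square)
 have eq: "ev E (%q. xi q - x = eta q ^ 2 * inverse (g q))"
 using eventually_weierstrass has_val_eventually_nonzero[OF p g]
 proof eventually_elim
 case (elim q)
 have "(xi q - x) * g q = xi q ^ 3 - xi q - (x ^ 3 - x)"
 unfolding g_def by (simp add: algebra_simps power2_eq_square power3_eq_cube)
 then have "eta q ^ 2 = (xi q - x) * g q" using elim(1) y by simp
 then show ?case using elim by simp
 qed
 show ?thesis
 proof (rule dvr_affine[OF p _ vy eventually_eta])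
 show "co ?p $ 3 ~= 0" by (rule co3_aff)
 show "decomp ?p eta eta" by (rule decomp_self[OF p])
 have "has_val E (%q. eta q * inverse (g q)) ?p (0 * inverse (3 * x ^ 2 - 1))"
 by (intro has_val_mult[OF p] has_val_inverse[OF p] vy g)
 then show "decomp ?p eta xi"
 by (rule decompI[OF p, of _ _ _ x]) (use eq in eventually_elim, simp add: algebra_simps power2_eq_square)
 show "ordered ?p eta (%q. xi q - c)" for c
 proof (cases "c = x")
 case False
 have "has_val E (%q. xi q - c) ?p (x - c)" by (intro has_val_diff[OF p] vx has_val_const)
 then show ?thesis using False ordered_unit[OF p] by auto
 next
 case True
 show ?thesis
 by (rule orderedI[OF p _ has_val_inverse[OF p g], of _ _ 2])
 (use g(2) in simp, use eq in eventually_elim, simp add: True power_int_def)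
 qed
 qed
qed

text \<open>In the chart at infinity, with t = x/y and w = 1/y, the equation divided by y^3 reads w
  (1 + x/y^2) = t^3, and x/y^2 = t w.\<close>

lemma origin_vals:
 "has_val E (%q. xi q / eta q) origin 0" "has_val E (%q. 1 / eta q) origin 0"
 "has_val E (%q. 1 + xi q / eta q ^ 2) origin 1"
 "ev E (%q. (1 / eta q) * (1 + xi q / eta q ^ 2) = (xi q / eta q) ^ 3)"
proof -
 note p = origin_in_E
 have "ev E (%q. co q $ 1 / co q $ 2 = xi q / eta q)"
 using eventually_co3 by eventually_elim (simp add: xi_def eta_def)
 from has_val_cong[OF has_val_co[OF p co_origin(2), of 1] this]
 show a: "has_val E (%q. xi q / eta q) origin 0" by (simp add: co_origin)
 have "ev E (%q. co q $ 3 / co q $ 2 = 1 / eta q)"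
 by (simp add: eta_def)
 from has_val_cong[OF has_val_co[OF p co_origin(2), of 3] this]
 show b: "has_val E (%q. 1 / eta q) origin 0" by (simp add: co_origin)
 have "has_val E (%q. 1 + (xi q / eta q) * (1 / eta q)) origin (1 + 0 * 0)"
 by (intro has_val_add[OF p] has_val_mult[OF p] has_val_const a b)
 then show "has_val E (%q. 1 + xi q / eta q ^ 2) origin 1" by (simp add: power2_eq_square)
 show "ev E (%q. (1 / eta q) * (1 + xi q / eta q ^ 2) = (xi q / eta q) ^ 3)"
 using eventually_weierstrass eventually_eta
 proof eventually_elim
 case (elim q)
 then show ?case
 by (simp add: field_simps power2_eq_square power3_eq_cube)
 qed
qed

text \<open>The chart equation shows that 1/y is t^3 times a unit; hence y has order -3 and x = t y
  has order -2, and the coordinates over y are constants modulo t.\<close>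

lemma dvr_origin: "dvr_with origin (%q. xi q / eta q)"
proof -
 note p = origin_in_E
 let ?t = "%q. xi q / eta q"
 note v = origin_vals
 have t0: "ev E (%q. ?t q ~= 0)"
 using eventually_eta eventually_neq_xi[of 0] by eventually_elim simp
 have e3: "ev E (%q. 1 + xi q / eta q ^ 2 ~= 0)" by (rule has_val_eventually_nonzero[OF p v(3)]) simp
 have dec: "decomp origin ?t (%q. co q $ j / co q $ 2)" for j
 proof -
 have 1: "decomp origin ?t (%q. co q $ 1 / co q $ 2)"
 by (rule decomp_cong[OF p decomp_self[OF p]])
 (use eventually_co3 in eventually_elim, simp add: xi_def eta_def)
 have 2: "decomp origin ?t (%q. co q $ 2 / co q $ 2)"
 by (rule decomp_cong[OF p decomp_const[OF p, of _ 1]])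
 (use eventually_eta in eventually_elim, auto simp: eta_def)
 have "has_val E (%q. (xi q / eta q) ^ 2 / (1 + xi q / eta q ^ 2)) origin (0 ^ 2 / 1)"
 by (intro has_val_divide[OF p] has_val_power[OF p] v) simp
 then have 3: "decomp origin ?t (%q. co q $ 3 / co q $ 2)"
 proof (rule decompI[OF p, of _ _ _ 0])
 show "ev E (%q. co q $ 3 / co q $ 2 = 0 + ?t q * ((xi q / eta q) ^ 2 / (1 + xi q / eta q ^ 2)))"
 using v(4) e3
 proof eventually_elim
 case (elim q)
 have "co q $ 3 / co q $ 2 = 1 / eta q" by (simp add: eta_def)
 also have "\<dots> = (xi q / eta q) ^ 3 / (1 + xi q / eta q ^ 2)" using elim by (metis nonzero_eq_divide_eq)
 finally show ?case by (simp add: power2_eq_square power3_eq_cube mult.assoc)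
 qed
 qed
 show ?thesis using exhaust_3[of j] 1 2 3 by auto
 qed
 have unif: "unif origin ?t"
 by (intro unif_of_generators[OF p homogeneous_coordinate _ v(1) t0 decomp_coordinates[OF p v(1) dec]])
 (use co_origin in \<open>simp add: co_def\<close>)
 have ord_eta: "ordered origin ?t eta"
 proof (rule orderedI[OF p _ v(3), of _ _ "-3"])
 show "ev E (%q. eta q = (1 + xi q / eta q ^ 2) * ?t q powi -3)"
 using v(4) t0 eventually_eta
 proof eventually_elim
 case (elim q)
 have "1 + xi q / eta q ^ 2 = eta q * ((1 / eta q) * (1 + xi q / eta q ^ 2))" using elim(3) by simp
 then have 1: "1 + xi q / eta q ^ 2 = eta q * ?t q ^ 3" unfolding elim(1) .
 have 2: "?t q ^ 3 * ?t q powi -3 = 1" using elim(2) by (simp add: power_int_minus)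
 show ?case by (simp only: 1 mult.assoc 2 mult_1_right)
 qed
 qed simp
 have ord_xi: "ordered origin ?t xi"
 by (rule ordered_cong[OF p ordered_mult[OF p unif ordered_self[OF p] ord_eta]])
 (use eventually_eta in eventually_elim, simp)
 have ord: "ordered origin ?t (%q. xi q - c)" for c
 proof -
 have "has_val E (%q. (xi q / eta q) ^ 2 / (1 + xi q / eta q ^ 2)) origin (0 ^ 2 / 1)"
 by (intro has_val_divide[OF p] has_val_power[OF p] v) simp
 then have "has_val E (%q. 1 - c * ((xi q / eta q) ^ 2 / (1 + xi q / eta q ^ 2))) origin (1 - c * (0 ^ 2 / 1))"
 by (intro has_val_diff[OF p] has_val_mult[OF p] has_val_const)
 then have "ordered origin ?t (%q. 1 - c * ((xi q / eta q) ^ 2 / (1 + xi q / eta q ^ 2)))"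
 by (rule ordered_unit[OF p]) simp
 from ordered_mult[OF p unif ord_xi this] show ?thesis
 proof (rule ordered_cong[OF p])
 show "ev E (%q. xi q * (1 - c * ((xi q / eta q) ^ 2 / (1 + xi q / eta q ^ 2))) = xi q - c)"
 using v(4) e3 t0 eventually_eta
 proof eventually_elim
 case (elim q)
 have "xi q * (xi q / eta q) ^ 2 = eta q * (xi q / eta q) ^ 3"
 using elim(4) by (simp add: power2_eq_square power3_eq_cube)
 also have "\<dots> = 1 + xi q / eta q ^ 2" unfolding elim(1)[symmetric] using elim(4) by simp
 finally have "xi q * ((xi q / eta q) ^ 2 / (1 + xi q / eta q ^ 2)) = 1" using elim(2) by simp
 then show ?case by (simp add: right_diff_distrib mult.left_commute)
 qed
 qed
 qed
 show ?thesis
 proof (rule dvr_of_norms[OF p unif homogeneous_coordinate[of 2]])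
 fix d and P :: "complex ^ 3 => complex"
 assume P: "hpoly d P" "\<not> ev E (%q. P (rep q) = 0)"
 obtain P' N where P': "hpoly d P'" "N ~= 0"
 "ev E (%q. P (rep q) * P' (rep q) = poly N (xi q) * co q $ 3 ^ (2 * d))"
 using norm_form[OF P] by blast
 have "ordered origin ?t (%q. poly N (xi q) * inverse (eta q) ^ (2 * d))"
 by (intro ordered_mult[OF p unif] ordered_power[OF p unif] ordered_inverse[OF p] ord_eta
 ordered_poly[OF closed_irreducible_curve_axioms p unif ord P'(2)])
 moreover have "ev E (%q. poly N (xi q) * inverse (eta q) ^ (2 * d) = P (rep q) * P' (rep q) / (B *v rep q) $ 2 ^ (2 * d))"
 using P'(3) eventually_co3 by eventually_elim (simp add: eta_def co_def[symmetric] divide_simps power_divide)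
 ultimately have "ordered origin ?t (%q. P (rep q) * P' (rep q) / (B *v rep q) $ 2 ^ (2 * d))"
 by (rule ordered_cong[OF p])
 then show "EX P'. hpoly d P' & ordered origin ?t (%q. P (rep q) * P' (rep q) / (B *v rep q) $ 2 ^ (2 * d))"
 using P'(1) by blast
 qed (use co_origin in \<open>simp add: co_def\<close>)
qed

lemma dvr_exists:
 assumes "p : E" shows "EX t. dvr_with p t"
 using assms
proof (rule E_cases)
 assume "p = origin" then show ?thesis using dvr_origin by auto
next
 assume "p = aff (xi p) (eta p)" "eta p ^ 2 = xi p ^ 3 - xi p"
 then show ?thesis using dvr_generic[of "eta p" "xi p"] dvr_two_torsion[of "xi p"]
 by (cases "eta p = 0") auto
qed

text \<open>Multiplying numerator and denominator by the conjugate of the denominator leaves a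
  denominator depending on x only.\<close>

lemma rational_normal_form:
 assumes "rational E f"
 shows "EX A C D. D ~= 0 & ev E (%q. f q * poly D (xi q) = poly A (xi q) + eta q * poly C (xi q))"
proof -
 obtain d P Q where 1: "hpoly d P" "hpoly d Q"
 "ev E (%q. Q (rep q) ~= 0 & f q = P (rep q) / Q (rep q))" using rationalE[OF assms] .
 obtain A C where AC: "!!x y. y ^ 2 = x ^ 3 - x ==> P (Bi *v vector [x, y, 1]) = poly A x + y * poly C x"
 using form_affine[OF 1(1)] by blast
 obtain A' C' where AC': "!!x y. y ^ 2 = x ^ 3 - x ==> Q (Bi *v vector [x, y, 1]) = poly A' x + y * poly C' x"
 using form_affine[OF 1(2)] by blast
 have aff: "ev E (%q. f q = (poly A (xi q) + eta q * poly C (xi q)) / (poly A' (xi q) + eta q * poly C' (xi q))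
 & (poly A' (xi q) + eta q * poly C' (xi q)) ~= 0)"
 proof -
 have "ev E (%q. P (rep q) / Q (rep q) = (poly A (xi q) + eta q * poly C (xi q)) / (poly A' (xi q) + eta q * poly C' (xi q))
 & (Q (rep q) ~= 0 --> poly A' (xi q) + eta q * poly C' (xi q) ~= 0))"
 proof (rule eventually_affine[of 1])
 fix x y :: complex assume y: "y ^ 2 = x ^ 3 - x"
 obtain c where c: "c ~= 0" "rep (aff x y) = c *s (Bi *v vector [x, y, 1])" using co_aff .
 show "P (rep (aff x y)) / Q (rep (aff x y)) = (poly A (xi (aff x y)) + eta (aff x y) * poly C (xi (aff x y))) / (poly A' (xi (aff x y)) + eta (aff x y) * poly C' (xi (aff x y)))
 & (Q (rep (aff x y)) ~= 0 --> poly A' (xi (aff x y)) + eta (aff x y) * poly C' (xi (aff x y)) ~= 0)"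
 unfolding c(2) hom_poly_scale[OF 1(1)] hom_poly_scale[OF 1(2)] AC[OF y] AC'[OF y]
 using c(1) by simp
 qed simp
 then show ?thesis using 1(3) by eventually_elim auto
 qed
 have nz: "A' ~= 0 | C' ~= 0"
 proof (rule ccontr)
 assume "\<not> ?thesis"
 then have "ev E (%q. False)" using aff by auto
 then show False using almost_neq_bot by simp
 qed
 have "ev E (%q. f q * poly (A' * A' - C' * C' * cub) (xi q) = poly (A * A' - C * C' * cub) (xi q) + eta q * poly (C * A' - A * C') (xi q))"
 using aff eventually_weierstrass
 proof eventually_elim
 case (elim q)
 have *: "poly (A' * A' - C' * C' * cub) (xi q) = (poly A' (xi q) + eta q * poly C' (xi q)) * (poly A' (xi q) - eta q * poly C' (xi q))"
 by (simp add: poly_cub elim(2)[symmetric] algebra_simps power2_eq_square)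
 have "f q * poly (A' * A' - C' * C' * cub) (xi q) = (poly A (xi q) + eta q * poly C (xi q)) * (poly A' (xi q) - eta q * poly C' (xi q))"
 unfolding * using elim(1) by (metis mult.assoc nonzero_eq_divide_eq)
 also have "\<dots> = poly (A * A' - C * C' * cub) (xi q) + eta q * poly (C * A' - A * C') (xi q)"
 by (simp add: poly_cub elim(2)[symmetric] algebra_simps power2_eq_square)
 finally show ?case .
 qed
 then show ?thesis using cubic_norm_nonzero[OF nz] by blast
qed

lemma affine_form_unique:
 assumes "ev E (%q. poly A (xi q) + eta q * poly C (xi q) = 0)"
 shows "A = 0" "C = 0"
proof -
 have "\<not> (A ~= 0 | C ~= 0)"
 proof
 assume "A ~= 0 | C ~= 0"
 from affine_form_nonzero[OF this] assms have "ev E (%q. False)" by eventually_elim simp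
 then show False using almost_neq_bot by simp
 qed
 then show "A = 0" "C = 0" by auto
qed

text \<open>Write f = (A + y C) / D. The bound at (x, y) and at (x, -y) bounds A/D and y C/D
  separately, and \<open>rational_growth\<close> makes A/D a polynomial of degree at most 2 and C/D
  a constant, since y^2 has degree 3.\<close>

lemma bounded_rational:
 assumes f: "rational E f" and bound: "ev E (%q. norm (f q) <= K * (1 + norm (xi q)) ^ 2)"
 shows "EX c0 c1 c2 c3. ev E (%q. f q = c0 + c1 * xi q + c2 * eta q + c3 * xi q ^ 2)"
proof -
 obtain A C D where D: "D ~= 0"
 and eq: "ev E (%q. f q * poly D (xi q) = poly A (xi q) + eta q * poly C (xi q))"
 using rational_normal_form[OF f] by blast
 have "ev E (%q. norm (poly A (xi q) + eta q * poly C (xi q)) <= K * (1 + norm (xi q)) ^ 2 * norm (poly D (xi q)))"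
 using eq bound
 proof eventually_elim
 case (elim q)
 have "norm (f q * poly D (xi q)) <= K * (1 + norm (xi q)) ^ 2 * norm (poly D (xi q))"
 unfolding norm_mult using elim(2) by (rule mult_right_mono) simp
 then show ?case using elim(1) by simp
 qed
 then obtain T where T: "finite T" "!!x y. y ^ 2 = x ^ 3 - x ==> x \<notin> T ==>
 norm (poly A (xi (aff x y)) + eta (aff x y) * poly C (xi (aff x y))) <= K * (1 + norm (xi (aff x y))) ^ 2 * norm (poly D (xi (aff x y)))"
 using almost_affine by blast
 note T = T(1) T(2)[unfolded xi_aff eta_aff]
 have parts: "norm (poly A x) <= K * (1 + norm x) ^ 2 * norm (poly D x) &
 norm (y * poly C x) <= K * (1 + norm x) ^ 2 * norm (poly D x)"
 if "x \<notin> T" "y ^ 2 = x ^ 3 - x" for x y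
 proof -
 have 1: "norm (poly A x + y * poly C x) <= K * (1 + norm x) ^ 2 * norm (poly D x)" using T(2)[OF that(2,1)] .
 have "(- y) ^ 2 = x ^ 3 - x" using that(2) by simp
 from T(2)[OF this that(1)] have 2: "norm (poly A x - y * poly C x) <= K * (1 + norm x) ^ 2 * norm (poly D x)" by simp
 have "norm (2 * poly A x) <= norm (poly A x + y * poly C x) + norm (poly A x - y * poly C x)"
 using norm_triangle_ineq[of "poly A x + y * poly C x" "poly A x - y * poly C x"] by (simp add: algebra_simps)
 moreover have "norm (2 * (y * poly C x)) <= norm (poly A x + y * poly C x) + norm (poly A x - y * poly C x)"
 using norm_triangle_ineq4[of "poly A x + y * poly C x" "poly A x - y * poly C x"] by (simp add: algebra_simps)
 ultimately show ?thesis using 1 2 by (simp add: norm_mult)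
 qed
 have sq: "(K * (1 + norm x) ^ 2 * norm (poly D x)) ^ 2 = K ^ 2 * (1 + norm x) ^ 4 * norm (poly D x) ^ 2" for x
 by (simp add: power_mult_distrib power_mult[symmetric])
 have 1: "norm (poly A x) ^ 2 * norm (poly 1 x) <= K ^ 2 * (1 + norm x) ^ 4 * norm (poly D x) ^ 2" if "x \<notin> T" for x
 using power_mono[OF conjunct1[OF parts[OF that, of "csqrt (x ^ 3 - x)"]], of 2] by (simp add: sq)
 obtain r where r: "A = D * r" "r = 0 | 2 * pdeg r + pdeg (1 :: complex poly) <= 4"
 using rational_growth[OF T(1) 1 D] by auto
 have 2: "norm (poly C x) ^ 2 * norm (poly cub x) <= K ^ 2 * (1 + norm x) ^ 4 * norm (poly D x) ^ 2" if "x \<notin> T" for x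
 proof -
 define y where "y = csqrt (x ^ 3 - x)"
 have y: "y ^ 2 = x ^ 3 - x" by (simp add: y_def)
 have "norm (y * poly C x) ^ 2 = norm (poly C x) ^ 2 * norm (poly cub x)"
 by (simp add: poly_cub y[symmetric] norm_mult norm_power power_mult_distrib)
 then show ?thesis using power_mono[OF conjunct2[OF parts[OF that y]], of 2] by (simp add: sq)
 qed
 obtain s where s: "C = D * s" "s = 0 | 2 * pdeg s + pdeg cub <= 4"
 using rational_growth[OF T(1) 2 D cub_simple_roots] by auto
 have "pdeg s = 0" using s(2) by (auto simp: degree_cub)
 then obtain c2 where c2: "s = [:c2:]" by (metis degree_eq_zeroE)
 have "pdeg r <= 2" using r(2) by auto
 then have r': "r = [:Polynomial.coeff r 0, Polynomial.coeff r 1, Polynomial.coeff r 2:]"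
 by (intro poly_eqI) (auto simp: coeff_pCons coeff_eq_0 numeral_2_eq_2 split: nat.split)
 have "ev E (%q. f q = Polynomial.coeff r 0 + Polynomial.coeff r 1 * xi q + c2 * eta q + Polynomial.coeff r 2 * xi q ^ 2)"
 using eq eventually_poly_xi[OF D]
 proof eventually_elim
 case (elim q)
 have "f q * poly D (xi q) = (poly r (xi q) + eta q * c2) * poly D (xi q)"
 unfolding elim(1) r(1) s(1) by (simp add: c2 algebra_simps)
 then have "f q = poly r (xi q) + eta q * c2" using elim(2) by simp
 then show ?case by (subst (asm) r') (simp add: algebra_simps power2_eq_square)
 qed
 then show ?thesis by blast
qed

end

section \<open>From local bounds to global bounds\<close>

context elliptic_curve
begin

lemma compact_cone:
 "compact {v. norm v = 1 & ((B *v v) $ 2) ^ 2 * (B *v v) $ 3 = ((B *v v) $ 1) ^ 3 - (B *v v) $ 1 * ((B *v v) $ 3) ^ 2}"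
proof -
 have "continuous_on UNIV (%v. (B *v v) $ i)" for i
 by (rule continuous_on_homogeneous_poly[OF homogeneous_coordinate])
 then have "closed {v. ((B *v v) $ 2) ^ 2 * (B *v v) $ 3 = ((B *v v) $ 1) ^ 3 - (B *v v) $ 1 * ((B *v v) $ 3) ^ 2}"
 by (intro closed_Collect_eq continuous_intros)
 moreover have "compact (sphere (0 :: complex ^ 3) 1)" by simp
 moreover have "sphere (0 :: complex ^ 3) 1 = {v. norm v = 1}" by (auto simp: sphere_def)
 ultimately show ?thesis using compact_Int_closed by (fastforce simp: Collect_conj_eq)
qed

lemma hcoord_in_E:
 assumes "v ~= 0"
 shows "hcoord v : E \<longleftrightarrow> ((B *v v) $ 2) ^ 2 * (B *v v) $ 3 = ((B *v v) $ 1) ^ 3 - (B *v v) $ 1 * ((B *v v) $ 3) ^ 2"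
proof -
 have "B *v v ~= 0" using assms by (metis Bi_B_vec matrix_vector_mult_0_right)
 from pt_in_E[OF this] show ?thesis by (simp add: pt_def)
qed

text \<open>The unit vectors in the cone over the curve form a compact set. Near each of them |f| is
  at most a constant times the weight \<open>h\<close>, because a regular function is locally
  bounded; finitely many neighbourhoods suffice.\<close>

lemma compact_bound:
 assumes h: "!!q. h q \<ge> (0 :: real)"
 and loc: "!!p. p : E ==> EX g c. has_val E g p c & ev E (%q. norm (f q :: complex) <= norm (g q) * h q)"
 shows "EX K. ev E (%q. norm (f q) <= K * h q)"
proof -
 let ?K = "{v. norm v = 1 & ((B *v v) $ 2) ^ 2 * (B *v v) $ 3 = ((B *v v) $ 1) ^ 3 - (B *v v) $ 1 * ((B *v v) $ 3) ^ 2}"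
 define G where "G v U M \<longleftrightarrow> open U & v : U &
 ev E (%q. \<forall>w\<in>q. norm w = 1 & w : U --> norm (f q) <= M * h q)" for v U M
 have "EX U M. G v U M" if v: "v : ?K" for v
 proof -
 have v0: "v ~= 0" using v by auto
 then have p: "hcoord v : E" using v hcoord_in_E by blast
 obtain g c where g: "has_val E g (hcoord v) c" "ev E (%q. norm (f q) <= norm (g q) * h q)"
 using loc[OF p] by blast
 obtain d P Q where 1: "hpoly d P" "hpoly d Q" "Q (rep (hcoord v)) ~= 0"
 "ev E (%q. g q = P (rep q) / Q (rep q))" using has_valE[OF g(1)] .
 have "v : hcoord v" by (metis mem_hcoord vec.scale_one)
 then have Qv: "Q v ~= 0"
 using hom_poly_rep_eq_0_iff[OF 1(2) hcoord_in_proj_points[OF v0] _ v0] 1(3) by simp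
 have "isCont P v" "isCont Q v"
 using continuous_on_homogeneous_poly[OF 1(1), of UNIV] continuous_on_homogeneous_poly[OF 1(2), of UNIV]
 by (simp_all add: continuous_on_eq_continuous_at)
 then have cont: "isCont (%w. norm (P w / Q w)) v" using Qv by (intro continuous_intros)
 define M where "M = norm (P v / Q v) + 1"
 have "eventually (%w. norm (P w / Q w) < M) (at v)"
 using cont unfolding isCont_def by (rule order_tendstoD) (simp add: M_def)
 then have "eventually (%w. norm (P w / Q w) < M) (nhds v)"
 by (simp add: eventually_nhds_conv_at M_def)
 then obtain U where U: "open U" "v : U" "!!w. w : U ==> norm (P w / Q w) < M"
 unfolding eventually_nhds by blast
 have "ev E (%q. \<forall>w\<in>q. norm w = 1 & w : U --> norm (f q) <= M * h q)"
 using g(2) 1(4) eventually_almost_in[of E]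
 proof eventually_elim
 case (elim q)
 show ?case
 proof (intro ballI impI)
 fix w assume w: "w : q" "norm w = 1 & w : U"
 then have "w ~= 0" by auto
 then have "g q = P w / Q w"
 using hquot_eq[OF 1(1,2) _ w(1)] elim E_points by (auto simp: hquot_def)
 then have "norm (g q) <= M" using U(3) w by (auto intro: less_imp_le)
 then have "norm (g q) * h q <= M * h q" using h by (rule mult_right_mono)
 then show "norm (f q) <= M * h q" using elim(1) by simp
 qed
 qed
 then have "G v U M" using U unfolding G_def by blast
 then show ?thesis by blast
 qed
 then have "EX UM. \<forall>v\<in>?K. G v (fst (UM v)) (snd (UM v))" by (intro bchoice) auto
 then obtain UM where UM: "\<forall>v\<in>?K. G v (fst (UM v)) (snd (UM v))" ..
 define U M where "U v = fst (UM v)" and "M v = snd (UM v)" for v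
 have UM: "open (U v) & v : U v &
 ev E (%q. \<forall>w\<in>q. norm w = 1 & w : U v --> norm (f q) <= M v * h q)" if "v : ?K" for v
 using UM[THEN bspec, OF that] unfolding G_def U_def M_def .
 obtain T where T: "T \<subseteq> ?K" "finite T" "?K \<subseteq> (\<Union>v\<in>T. U v)"
 proof (rule compactE_image[OF compact_cone, of ?K U])
 show "open (U v)" if "v : ?K" for v using UM[OF that] by simp
 show "?K \<subseteq> (\<Union>v\<in>?K. U v)"
 proof
 fix v assume "v : ?K"
 then show "v : (\<Union>v\<in>?K. U v)" using UM by blast
 qed
 qed
 have ev: "ev E (%q. \<forall>v\<in>T. \<forall>w\<in>q. norm w = 1 & w : U v --> norm (f q) <= M v * h q)"
 using T(1,2) UM by (intro eventually_ball_finite) auto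
 have "ev E (%q. norm (f q) <= (\<Sum>v\<in>T. \<bar>M v\<bar>) * h q)"
 using ev eventually_almost_in[of E]
 proof eventually_elim
 case (elim q)
 have q: "q : proj_points" using elim E_points by blast
 define w where "w = complex_of_real (1 / norm (rep q)) *s rep q"
 have r0: "rep q ~= 0" "rep q : q" using rep_in[OF q] by auto
 have wq: "w : q" using r0 q unfolding w_def proj_points_def by (simp add: vec.subspace_scale)
 have "w = (1 / norm (rep q)) *\<^sub>R rep q" unfolding w_def
 by (simp only: vec_eq_iff vector_scaleR_component vector_smult_component) (simp add: scaleR_conv_of_real)
 then have nw: "norm w = 1" using r0 by simp
 have "w : ?K" using nw wq elim(2) unfolding E_def by blast
 then obtain v where v: "v : T" "w : U v" using T(3) by blast
 have "norm (f q) <= M v * h q" using elim(1) v wq nw by blast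
 also have "\<dots> <= (\<Sum>v\<in>T. \<bar>M v\<bar>) * h q"
 using member_le_sum[OF v(1), of "%v. \<bar>M v\<bar>"] T(2) h by (intro mult_right_mono) auto
 finally show ?case .
 qed
 then show ?thesis by blast
qed

end

section \<open>Weierstrass functions with their pole at an arbitrary base point\<close>

text \<open>\<open>px\<close> and \<open>py\<close> satisfy the equation of the curve, with the pole
  of \<open>px\<close> at \<open>P0\<close> instead of infinity. The last assumption says that the
  self-map q -> (px q, py q) is an involution, so results about \<open>xi\<close>,
  \<open>eta\<close> can be transported both ways.\<close>

locale based_curve = elliptic_curve B Bi E for B Bi E +
 fixes P0 :: "3 ppoint" and px py :: "3 ppoint => complex"
 assumes P0: "P0 : E"
 and rational_px: "rational E px" and rational_py: "rational E py"
 and weierstrass: "ev E (%q. py q ^ 2 = px q ^ 3 - px q)"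
 and regular_px: "p : E ==> p ~= P0 ==> EX c. has_val E px p c"
 and pole_px: "EX t b. dvr_with P0 t & has_val E (%q. px q * t q ^ 2) P0 b & b ~= 0"
 and involution: "ev E (%q. px (aff (px q) (py q)) = xi q & py (aff (px q) (py q)) = eta q)"
begin

definition iota :: "3 ppoint => 3 ppoint" where "iota q = aff (px q) (py q)"

lemma xi_iota [simp]: "xi (iota q) = px q" and eta_iota [simp]: "eta (iota q) = py q"
 by (simp_all add: iota_def)

lemma eventually_iota_good:
 "ev E (%q. q : E & iota q : E & px (iota q) = xi q & py (iota q) = eta q & iota (iota q) = q)"
proof -
 have "ev E (%q. q = aff (xi q) (eta q))"
 by (rule eventually_affine[of 1]) auto
 then show ?thesis using weierstrass involution eventually_almost_in[of E]
 by eventually_elim (simp add: iota_def aff_in_E)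
qed

text \<open>Off a finite set the map is its own inverse, hence injective, so preimages of finite
  sets are finite.\<close>

lemma eventually_iota:
 assumes "eventually P (almost E)" shows "ev E (%q. P (iota q))"
proof -
 let ?G = "%q. q : E & iota q : E & px (iota q) = xi q & py (iota q) = eta q & iota (iota q) = q"
 have fin: "finite {q\<in>E. \<not> ?G q}" using eventually_iota_good by (simp add: eventually_almost)
 have "inj_on iota {q. ?G q}" by (rule inj_on_inverseI[of _ iota]) simp
 then have "finite (iota -` {q\<in>E. \<not> P q} \<inter> {q. ?G q})"
 using assms finite_vimage_IntI[of "{q\<in>E. \<not> P q}" iota "{q. ?G q}"] by (simp add: eventually_almost)
 with fin have "finite ({q\<in>E. \<not> ?G q} \<union> (iota -` {q\<in>E. \<not> P q} \<inter> {q. ?G q}))" by simp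
 then show ?thesis unfolding eventually_almost by (rule rev_finite_subset) auto
qed

lemma rational_iota:
 assumes "rational E f" shows "rational E (%q. f (iota q))"
proof -
 have rat: "rational E (%q. P (Bi *v vector [px q, py q, 1]))" if "hpoly d P" for d P
 using that
 proof (induction rule: hom_poly_induct)
 case (coord i)
 have "rational E (%q. Bi $ i $ 1 * px q + Bi $ i $ 2 * py q + Bi $ i $ 3)"
 by (intro rational_add rational_mult rational_const rational_px rational_py)
 then show ?case by (simp add: matrix_vector_mult_def sum_3)
 qed (auto intro: rational_const rational_add rational_mult)
 obtain d P Q where 1: "hpoly d P" "hpoly d Q"
 "ev E (%q. Q (rep q) ~= 0 & f q = P (rep q) / Q (rep q))" using rationalE[OF assms] .
 have "ev E (%q. P (Bi *v vector [px q, py q, 1]) / Q (Bi *v vector [px q, py q, 1]) = f (iota q))"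
 using eventually_iota[OF 1(3)]
 proof eventually_elim
 case (elim q)
 obtain c where c: "c ~= 0" "rep (iota q) = c *s (Bi *v vector [px q, py q, 1])"
 unfolding iota_def using co_aff .
 then show ?case using elim hom_poly_scale[OF 1(1)] hom_poly_scale[OF 1(2)] by simp
 qed
 then show ?thesis by (rule rational_cong[OF rational_divide[OF rat[OF 1(1)] rat[OF 1(2)]]])
qed

lemma bounded_rational_px:
 assumes f: "rational E f" and bound: "ev E (%q. norm (f q) <= K * (1 + norm (px q)) ^ 2)"
 shows "EX c0 c1 c2 c3. ev E (%q. f q = c0 + c1 * px q + c2 * py q + c3 * px q ^ 2)"
proof -
 have "ev E (%q. norm (f (iota q)) <= K * (1 + norm (xi q)) ^ 2)"
 using eventually_iota[OF bound] eventually_iota_good by eventually_elim simp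
 from bounded_rational[OF rational_iota[OF f] this] obtain c0 c1 c2 c3 where
 "ev E (%q. f (iota q) = c0 + c1 * xi q + c2 * eta q + c3 * xi q ^ 2)" by blast
 from eventually_iota[OF this] eventually_iota_good
 have "ev E (%q. f q = c0 + c1 * px q + c2 * py q + c3 * px q ^ 2)"
 by eventually_elim simp
 then show ?thesis by blast
qed

lemma px_form_unique:
 assumes "ev E (%q. poly A (px q) + py q * poly C (px q) = 0)"
 shows "A = 0" "C = 0"
proof -
 have "ev E (%q. poly A (xi q) + eta q * poly C (xi q) = 0)"
 using eventually_iota[OF assms] eventually_iota_good by eventually_elim auto
 then show "A = 0" "C = 0" using affine_form_unique by blast+
qed

lemma eventually_px: "N ~= 0 ==> ev E (%q. poly N (px q) ~= 0)"
 using eventually_iota[OF eventually_poly_xi] by simp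

lemma eventually_px_nonzero: "ev E (%q. px q ~= 0)"
 using eventually_px[of "[:0, 1:]"] by simp

text \<open>The square of \<open>py\<close> is a polynomial in \<open>px\<close>, and the local ring
  is integrally closed.\<close>

lemma regular_py:
 assumes "p : E" "has_val E px p c"
 shows "EX d. has_val E py p d & d ^ 2 = c ^ 3 - c"
proof -
 obtain t where t: "dvr_with p t" using dvr_exists[OF assms(1)] ..
 have "has_val E (%q. px q ^ 3 - px q) p (c ^ 3 - c)"
 using assms by (intro has_val_diff has_val_power) auto
 then have "has_val E (%q. py q ^ 2) p (c ^ 3 - c)"
 by (rule has_val_cong) (use weierstrass in eventually_elim, simp)
 from has_val_of_square[OF assms(1) t rational_py this] show ?thesis .
qed

lemma inverse_px: "has_val E (%q. 1 / px q) P0 0"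
proof -
 obtain t b where t: "dvr_with P0 t" "has_val E (%q. px q * t q ^ 2) P0 b" "b ~= 0" using pole_px by blast
 have u: "unif P0 t" using t(1) by (simp add: dvr_with_def[OF P0])
 then have t0: "has_val E t P0 0" "ev E (%q. t q ~= 0)" by (auto simp: unif_def[OF P0])
 have "has_val E (%q. t q ^ 2 / (px q * t q ^ 2)) P0 (0 ^ 2 / b)"
 by (intro has_val_divide[OF P0] has_val_power[OF P0] t t0)
 moreover have "ev E (%q. t q ^ 2 / (px q * t q ^ 2) = 1 / px q)"
 using t0(2) by eventually_elim simp
 ultimately show ?thesis using has_val_cong by fastforce
qed

text \<open>The square of this function is 1/px - 1/px^3, which vanishes at
  \<open>P0\<close>.\<close>

lemma py_over_square: "has_val E (%q. py q / px q ^ 2) P0 0"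
proof -
 obtain t where t: "dvr_with P0 t" using dvr_exists[OF P0] ..
 have "has_val E (%q. 1 / px q - (1 / px q) ^ 3) P0 (0 - 0 ^ 3)"
 by (intro has_val_diff[OF P0] has_val_power[OF P0] inverse_px)
 moreover have "ev E (%q. 1 / px q - (1 / px q) ^ 3 = (py q / px q ^ 2) ^ 2)"
 using weierstrass eventually_px_nonzero
 proof eventually_elim
 case (elim q)
 have "(py q / px q ^ 2) ^ 2 = (px q ^ 3 - px q) / px q ^ 4"
 by (simp add: power_divide power_mult[symmetric] elim(1))
 moreover have "1 / px q - (1 / px q) ^ 3 = (px q ^ 3 - px q) / px q ^ 4"
 using elim(2) by (simp add: field_simps eval_nat_numeral)
 ultimately show ?case by simp
 qed
 ultimately have "has_val E (%q. (py q / px q ^ 2) ^ 2) P0 0" using has_val_cong by fastforce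
 from has_val_of_square[OF P0 t _ this] show ?thesis
 using rational_divide[OF rational_py rational_power[OF rational_px]] by auto
qed

definition comb :: "complex => complex => complex => complex => 3 ppoint => complex" where
 "comb c0 c1 c2 c3 q = c0 + c1 * px q + c2 * py q + c3 * px q ^ 2"

lemma rational_comb: "rational E (comb c0 c1 c2 c3)"
 unfolding comb_def[abs_def]
 by (intro rational_add rational_mult rational_const rational_power rational_px rational_py)

lemma comb_P0: "has_val E (%q. (1 / px q) ^ 2 * comb c0 c1 c2 c3 q) P0 c3"
proof -
 have "has_val E (%q. c0 * (1 / px q) ^ 2 + c1 * (1 / px q) + c2 * (py q / px q ^ 2) + c3) P0
 (c0 * 0 ^ 2 + c1 * 0 + c2 * 0 + c3)"
 by (intro has_val_add[OF P0] has_val_mult[OF P0] has_val_power[OF P0] has_val_const inverse_px py_over_square)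
 moreover have "ev E (%q. c0 * (1 / px q) ^ 2 + c1 * (1 / px q) + c2 * (py q / px q ^ 2) + c3 =
 (1 / px q) ^ 2 * comb c0 c1 c2 c3 q)"
 using eventually_px_nonzero
 by eventually_elim (simp add: comb_def field_simps power2_eq_square)
 ultimately show ?thesis using has_val_cong by fastforce
qed

lemma comb_regular:
 assumes "p : E" "has_val E px p x" "has_val E py p y"
 shows "has_val E (comb c0 c1 c2 c3) p (c0 + c1 * x + c2 * y + c3 * x ^ 2)"
 unfolding comb_def[abs_def]
 by (intro has_val_add[OF assms(1)] has_val_mult[OF assms(1)] has_val_power[OF assms(1)] has_val_const assms)

text \<open>Since \<open>px\<close> has a double pole at \<open>P0\<close>, dividing by its square
  raises the order by exactly 4.\<close>

lemma ord_P0: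
 assumes "rational E f" "\<not> ev E (%q. f q = 0)"
 shows "ord_at E P0 (fun_class E f) \<ge> - 4 \<longleftrightarrow> (EX c. has_val E (%q. f q * (1 / px q) ^ 2) P0 c)"
proof -
 obtain t b where t: "dvr_with P0 t" "has_val E (%q. px q * t q ^ 2) P0 b" "b ~= 0" using pole_px by blast
 have u: "unif P0 t" using t(1) by (simp add: dvr_with_def[OF P0])
 then have t0: "ev E (%q. t q ~= 0)" by (auto simp: unif_def[OF P0])
 have "has_val E (%q. (1 / (px q * t q ^ 2)) ^ 2) P0 ((1 / b) ^ 2)"
 by (intro has_val_divide[OF P0] has_val_power[OF P0] has_val_const t)
 moreover have "ev E (%q. (1 / (px q * t q ^ 2)) ^ 2 = (1 / px q) ^ 2 * t q powi - 4)"
 by (intro always_eventually allI) (simp add: power_int_minus power_divide divide_inverse power_mult_distrib power_inverse power_mult[symmetric])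
 ultimately have v: "has_val E (%q. (1 / px q) ^ 2 * t q powi - 4) P0 ((1 / b) ^ 2)"
 by (rule has_val_cong)
 have r: "rational E (%q. f q * (1 / px q) ^ 2)"
 by (intro rational_mult rational_power rational_divide rational_const assms rational_px)
 have "\<not> ev E (%q. f q * (1 / px q) ^ 2 = 0)"
 proof
 assume "ev E (%q. f q * (1 / px q) ^ 2 = 0)"
 then have "ev E (%q. f q = 0)"
 using eventually_px_nonzero by eventually_elim auto
 then show False using assms(2) by simp
 qed
 from ord_at_nonneg_iff[OF P0 t(1) r this] ord_at_mult_power[OF P0 t(1) assms v] t(3)
 show ?thesis by auto
qed

text \<open>A function with at most a fourfold pole at \<open>P0\<close> is bounded locally by (1 +
  |px|)^2: at \<open>P0\<close> because f / px^2 is regular, elsewhere because f is. Compactness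
  makes the bound global and \<open>bounded_rational_px\<close> applies.\<close>

lemma riemann_roch_space_eq:
 "riemann_roch_space E (point_divisor 4 P0) = {fun_class E (comb c0 c1 c2 c3) | c0 c1 c2 c3. True}"
proof (intro equalityI subsetI)
 fix \<phi> assume "\<phi> : riemann_roch_space E (point_divisor 4 P0)"
 then have \<phi>: "\<phi> : carrier (ffld E)"
 "\<phi> = \<zero>\<^bsub>ffld E\<^esub> | (\<forall>p\<in>E. ord_at E p \<phi> \<ge> - point_divisor 4 P0 p)"
 by (auto simp: riemann_roch_space_def)
 obtain f where f: "rational E f" "\<phi> = fun_class E f" using carrierE[OF \<phi>(1)] .
 show "\<phi> : {fun_class E (comb c0 c1 c2 c3) | c0 c1 c2 c3. True}"
 proof (cases "ev E (%q. f q = 0)")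
 case True
 then have "\<phi> = fun_class E (comb 0 0 0 0)" by (simp add: f fun_class_eq_iff comb_def)
 then show ?thesis by blast
 next
 case False
 then have "\<phi> ~= \<zero>\<^bsub>ffld E\<^esub>" by (simp add: f function_field_zero fun_class_eq_iff)
 then have ord: "ord_at E p (fun_class E f) \<ge> - point_divisor 4 P0 p" if "p : E" for p using \<phi>(2) that f by auto
 have "EX K. ev E (%q. norm (f q) <= K * (1 + norm (px q)) ^ 2)"
 proof (rule compact_bound)
 fix p assume p: "p : E"
 show "EX g c. has_val E g p c & ev E (%q. norm (f q) <= norm (g q) * (1 + norm (px q)) ^ 2)"
 proof (cases "p = P0")
 case True
 then obtain c where c: "has_val E (%q. f q * (1 / px q) ^ 2) p c"
 using ord[OF p] ord_P0[OF f(1) False] by (auto simp: point_divisor_def)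
 have "ev E (%q. norm (f q) <= norm (f q * (1 / px q) ^ 2) * (1 + norm (px q)) ^ 2)"
 using eventually_px_nonzero
 proof eventually_elim
 case (elim q)
 then have "norm (f q) = norm (f q * (1 / px q) ^ 2) * norm (px q) ^ 2"
 by (simp add: norm_mult norm_power norm_divide power_divide)
 also have "\<dots> <= norm (f q * (1 / px q) ^ 2) * (1 + norm (px q)) ^ 2"
 by (intro mult_left_mono power_mono) auto
 finally show ?case .
 qed
 with c show ?thesis by blast
 next
 case neq: False
 obtain t where t: "dvr_with p t" using dvr_exists[OF p] ..
 obtain c where c: "has_val E f p c"
 using ord[OF p] ord_at_nonneg_iff[OF p t f(1) False] neq by (auto simp: point_divisor_def)
 have "norm (f q) * 1 <= norm (f q) * (1 + norm (px q)) ^ 2" for q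
 by (intro mult_left_mono one_le_power) auto
 then show ?thesis using c by auto
 qed
 qed simp
 then obtain c0 c1 c2 c3 where "ev E (%q. f q = c0 + c1 * px q + c2 * py q + c3 * px q ^ 2)"
 using bounded_rational_px[OF f(1)] by blast
 then have "\<phi> = fun_class E (comb c0 c1 c2 c3)" by (simp add: f fun_class_eq_iff comb_def)
 then show ?thesis by blast
 qed
next
 fix \<phi> assume "\<phi> : {fun_class E (comb c0 c1 c2 c3) | c0 c1 c2 c3. True}"
 then obtain c0 c1 c2 c3 where \<phi>: "\<phi> = fun_class E (comb c0 c1 c2 c3)" by blast
 let ?f = "comb c0 c1 c2 c3"
 have car: "\<phi> : carrier (ffld E)" by (simp add: \<phi> fun_class_in_carrier rational_comb)
 show "\<phi> : riemann_roch_space E (point_divisor 4 P0)"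
 proof (cases "ev E (%q. ?f q = 0)")
 case True
 then have "\<phi> = \<zero>\<^bsub>ffld E\<^esub>" by (simp add: \<phi> function_field_zero fun_class_eq_iff)
 then show ?thesis using car by (simp add: riemann_roch_space_def)
 next
 case False
 have "ord_at E p \<phi> \<ge> - point_divisor 4 P0 p" if p: "p : E" for p
 proof (cases "p = P0")
 case True
 have "has_val E (%q. ?f q * (1 / px q) ^ 2) P0 c3" using comb_P0 by (simp add: mult.commute)
 then show ?thesis using ord_P0[OF rational_comb False] True by (auto simp: \<phi> point_divisor_def)
 next
 case neq: False
 obtain t where t: "dvr_with p t" using dvr_exists[OF p] ..
 obtain x where x: "has_val E px p x" using regular_px[OF p neq] ..
 obtain y where y: "has_val E py p y" using regular_py[OF p x] by blast
 have "ord_at E p \<phi> \<ge> 0" unfolding \<phi>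
 using ord_at_nonneg_iff[OF p t rational_comb False] comb_regular[OF p x y, of c0 c1 c2 c3] by blast
 then show ?thesis using neq by (simp add: point_divisor_def)
 qed
 then show ?thesis using car by (simp add: riemann_roch_space_def)
 qed
qed

text \<open>If (x, y) were not attained away from \<open>P0\<close>, the function (py + y) / (px -
  x) would be regular there: where px = x, it equals (px^2 + x px + x^2 - 1) / (py - y) with nonzero
  denominator. It would then be a combination of 1, px, py, px^2, and comparing the coefficients of
  py gives a contradiction.\<close>

lemma value_attained:
 assumes xy: "y ^ 2 = x ^ 3 - x"
 shows "\<exists>p\<in>E. p ~= P0 & has_val E px p x & has_val E py p y"
proof (rule ccontr)
 assume none: "\<not> ?thesis"
 define g where "g = (%q. (py q + y) / (px q - x))"
 have g: "rational E g" unfolding g_def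
 by (intro rational_divide rational_add rational_diff rational_const rational_px rational_py)
 have ne: "ev E (%q. px q - x ~= 0)" using eventually_px[of "[:- x, 1:]"] by (auto elim: eventually_mono)
 have "EX K. ev E (%q. norm (g q) <= K * (1 + norm (px q)) ^ 2)"
 proof (rule compact_bound)
 fix p assume p: "p : E"
 show "EX h c. has_val E h p c & ev E (%q. norm (g q) <= norm (h q) * (1 + norm (px q)) ^ 2)"
 proof (cases "p = P0")
 case True
 have "has_val E (%q. (py q / px q ^ 2 + y * (1 / px q) ^ 2) * (1 / px q) / (1 - x * (1 / px q))) P0
 ((0 + y * 0 ^ 2) * 0 / (1 - x * 0))"
 by (intro has_val_divide[OF P0] has_val_add[OF P0] has_val_diff[OF P0] has_val_mult[OF P0] has_val_power[OF P0]
 has_val_const inverse_px py_over_square) simp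
 moreover have "ev E (%q. norm (g q) <= norm ((py q / px q ^ 2 + y * (1 / px q) ^ 2) * (1 / px q) / (1 - x * (1 / px q))) * (1 + norm (px q)) ^ 2)"
 using eventually_px_nonzero ne
 proof eventually_elim
 case (elim q)
 then have px0: "px q ~= 0" by simp
 have "g q = (py q / px q ^ 2 + y * (1 / px q) ^ 2) * (1 / px q) / (1 - x * (1 / px q)) * px q ^ 2"
 using px0 elim(2) unfolding g_def by (simp add: divide_simps power2_eq_square)
 then have "norm (g q) = norm ((py q / px q ^ 2 + y * (1 / px q) ^ 2) * (1 / px q) / (1 - x * (1 / px q))) * norm (px q) ^ 2"
 by (metis norm_mult norm_power)
 also have "\<dots> <= norm ((py q / px q ^ 2 + y * (1 / px q) ^ 2) * (1 / px q) / (1 - x * (1 / px q))) * (1 + norm (px q)) ^ 2"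
 by (intro mult_left_mono power_mono) auto
 finally show ?case .
 qed
 ultimately show ?thesis using True by blast
 next
 case neq: False
 obtain x' where x': "has_val E px p x'" using regular_px[OF p neq] ..
 obtain y' where y': "has_val E py p y'" "y' ^ 2 = x' ^ 3 - x'" using regular_py[OF p x'] by blast
 have "EX c. has_val E g p c"
 proof (cases "x' = x")
 case False
 have "has_val E g p ((y' + y) / (x' - x))" unfolding g_def
 by (intro has_val_divide[OF p] has_val_add[OF p] has_val_diff[OF p] has_val_const x' y') (use False in simp)
 then show ?thesis ..
 next
 case True
 then have "y' ~= y" using none p neq x' y' by blast
 have "has_val E (%q. (px q ^ 2 + x * px q + x ^ 2 - 1) / (py q - y)) p ((x' ^ 2 + x * x' + x ^ 2 - 1) / (y' - y))"
 by (intro has_val_divide[OF p] has_val_add[OF p] has_val_diff[OF p] has_val_mult[OF p] has_val_power[OF p] has_val_const x' y')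
 (use \<open>y' ~= y\<close> in simp)
 moreover have "has_val E (%q. py q - y) p (y' - y)" by (intro has_val_diff[OF p] has_val_const y')
 then have "ev E (%q. py q - y ~= 0)"
 by (rule has_val_eventually_nonzero[OF p]) (use \<open>y' ~= y\<close> in simp)
 then have "ev E (%q. (px q ^ 2 + x * px q + x ^ 2 - 1) / (py q - y) = g q)"
 using weierstrass ne
 proof eventually_elim
 case (elim q)
 have "(px q ^ 2 + x * px q + x ^ 2 - 1) * (px q - x) = px q ^ 3 - px q - (x ^ 3 - x)"
 by (simp add: algebra_simps power2_eq_square power3_eq_cube)
 also have "\<dots> = (py q + y) * (py q - y)" unfolding xy[symmetric] elim(2)[symmetric]
 by (simp add: algebra_simps power2_eq_square)
 finally show ?case using elim(1,3) by (simp add: g_def frac_eq_eq)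
 qed
 ultimately have "has_val E g p ((x' ^ 2 + x * x' + x ^ 2 - 1) / (y' - y))" by (rule has_val_cong)
 then show ?thesis ..
 qed
 moreover have "norm (g q) * 1 <= norm (g q) * (1 + norm (px q)) ^ 2" for q
 by (intro mult_left_mono one_le_power) auto
 ultimately show ?thesis by auto
 qed
 qed simp
 then obtain c0 c1 c2 c3 where c: "ev E (%q. g q = c0 + c1 * px q + c2 * py q + c3 * px q ^ 2)"
 using bounded_rational_px[OF g] by blast
 \<comment> \<open>The identity py + y = (px - x) times the combination, sorted as a polynomial in
   px plus py times another one; the latter, c2 (px - x) - 1, takes the value -1 at x.\<close>
 let ?A = "[:- x, 1:] * [:c0, c1, c3:] - [:y:]" and ?C = "Polynomial.smult c2 [:- x, 1:] - 1"
 have "ev E (%q. poly ?A (px q) + py q * poly ?C (px q) = 0)"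
 using c ne
 proof eventually_elim
 case (elim q)
 have "py q + y = (px q - x) * (c0 + c1 * px q + c2 * py q + c3 * px q ^ 2)"
 using elim unfolding g_def by (simp add: field_simps)
 then show ?case by (simp add: algebra_simps power2_eq_square)
 qed
 then have "?C = 0" by (rule px_form_unique)
 then have "poly ?C x = 0" by (metis poly_0)
 then show False by simp
qed

end

section \<open>Construction of such functions by chords\<close>

context elliptic_curve
begin

lemma based_curve_origin: "based_curve B Bi E origin xi eta"
proof unfold_locales
 show "EX t b. dvr_with origin t & has_val E (%q. xi q * t q ^ 2) origin b & b ~= 0"
 proof (intro exI conjI)
 show "dvr_with origin (%q. xi q / eta q)" by (rule dvr_origin)
 show "has_val E (%q. xi q * (xi q / eta q) ^ 2) origin 1"
 proof (rule has_val_cong[OF origin_vals(3)])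
 show "ev E (%q. 1 + xi q / eta q ^ 2 = xi q * (xi q / eta q) ^ 2)"
 using origin_vals(4) eventually_eta
 proof eventually_elim
 case (elim q)
 have "xi q * (xi q / eta q) ^ 2 = eta q * (xi q / eta q) ^ 3"
 using elim(2) by (simp add: power2_eq_square power3_eq_cube)
 also have "\<dots> = 1 + xi q / eta q ^ 2" unfolding elim(1)[symmetric] using elim(2) by simp
 finally show ?case by simp
 qed
 qed
 qed simp
 show "EX c. has_val E xi p c" if "p : E" "p ~= origin" for p
 using that(1)
 proof (rule E_cases)
 assume "p = aff (xi p) (eta p)" "eta p ^ 2 = xi p ^ 3 - xi p"
 then show ?thesis using has_val_xi by metis
 qed (use that in simp)
qed (auto intro: origin_in_E rational_xi rational_eta eventually_weierstrass)

text \<open>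
 Translating \<open>P0 = (x0, y0)\<close> to the point at infinity by the involution which sends \<open>P\<close> to the
 third intersection point of the curve with the line through \<open>P\<close> and \<open>- P0\<close>.
\<close>

context
 fixes x0 y0 :: complex
 assumes P0: "y0 ^ 2 = x0 ^ 3 - x0"
begin

definition slope :: "3 ppoint => complex" where "slope q = (eta q + y0) / (xi q - x0)"
definition chord_x :: "3 ppoint => complex" where "chord_x q = slope q ^ 2 - xi q - x0"
definition chord_y :: "3 ppoint => complex" where "chord_y q = slope q * (chord_x q - x0) - y0"

lemma rational_slope: "rational E slope"
 unfolding slope_def[abs_def] by (intro rational_divide rational_add rational_diff rational_const rational_xi rational_eta)

lemma rational_chord_x: "rational E chord_x"
 unfolding chord_x_def[abs_def] by (intro rational_diff rational_power rational_const rational_xi rational_slope)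

lemma rational_chord_y: "rational E chord_y"
 unfolding chord_y_def[abs_def]
 by (intro rational_diff rational_mult rational_const rational_slope rational_chord_x)

text \<open>The line y = l (x - x0) - y0 of slope l passes through the negative of the base point
  and through q; its third intersection with the cubic has first coordinate l^2 - xi - x0.\<close>

lemma chord_weierstrass: "ev E (%q. chord_y q ^ 2 = chord_x q ^ 3 - chord_x q)"
 using eventually_weierstrass eventually_neq_xi[of x0]
proof eventually_elim
 case (elim q)
 define l where "l = slope q"
 \<comment> \<open>The cubic restricted to the chord, with the known factor x - x0 removed. Its two
   roots have sum l^2 - x0.\<close>
 define h where "h x = x ^ 2 + x * x0 + x0 ^ 2 - 1 - l ^ 2 * (x - x0) + 2 * y0 * l" for x
 have l: "l * (xi q - x0) = eta q + y0" using elim(2) by (simp add: l_def slope_def)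
 have factor: "x ^ 3 - x - (l * (x - x0) - y0) ^ 2 = (x - x0) * h x + (x0 ^ 3 - x0 - y0 ^ 2)" for x
 by (simp add: h_def algebra_simps power2_eq_square power3_eq_cube)
 have "(xi q - x0) * h (xi q) = 0" using factor[of "xi q"] P0 elim(1) unfolding l by simp
 then have h0: "h (xi q) = 0" using elim(2) by simp
 have "h (chord_x q) - h (xi q) = (chord_x q - xi q) * (chord_x q + xi q + x0 - l ^ 2)"
 by (simp add: h_def algebra_simps power2_eq_square)
 also have "\<dots> = 0" by (simp add: chord_x_def l_def)
 finally have "h (chord_x q) = 0" using h0 by simp
 then have "chord_x q ^ 3 - chord_x q - chord_y q ^ 2 = 0"
 using factor[of "chord_x q"] P0 unfolding chord_y_def l_def by simp
 then show ?case by simp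
qed

text \<open>If y0 is nonzero the parameter is xi - x0 and the leading coefficient is (2 y0)^2; if y0
  = 0 the parameter is eta and the coefficient is (3 x0^2 - 1)^2.\<close>

lemma chord_pole: "EX t b. dvr_with (aff x0 y0) t & has_val E (%q. chord_x q * t q ^ 2) (aff x0 y0) b & b ~= 0"
proof -
 have p: "aff x0 y0 : E" using P0 by (simp add: aff_in_E)
 note vx = has_val_xi[OF P0] and vy = has_val_eta[OF P0]
 show ?thesis
 proof (cases "y0 = 0")
 case False
 let ?t = "%q. xi q - x0"
 have vt: "has_val E ?t (aff x0 y0) (x0 - x0)" by (intro has_val_diff[OF p] vx has_val_const)
 have "has_val E (%q. (eta q + y0) ^ 2 - (xi q + x0) * ?t q ^ 2) (aff x0 y0) ((y0 + y0) ^ 2 - (x0 + x0) * (x0 - x0) ^ 2)"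
 by (intro has_val_diff[OF p] has_val_power[OF p] has_val_mult[OF p] has_val_add[OF p] has_val_const vx vy)
 moreover have "ev E (%q. (eta q + y0) ^ 2 - (xi q + x0) * ?t q ^ 2 = chord_x q * ?t q ^ 2)"
 using eventually_neq_xi[of x0]
 proof eventually_elim
 case (elim q)
 have "(eta q + y0) ^ 2 = slope q ^ 2 * ?t q ^ 2" using elim by (simp add: slope_def power_divide)
 then show ?case by (simp add: chord_x_def algebra_simps)
 qed
 ultimately have "has_val E (%q. chord_x q * ?t q ^ 2) (aff x0 y0) ((y0 + y0) ^ 2 - (x0 + x0) * (x0 - x0) ^ 2)"
 by (rule has_val_cong)
 moreover have "(y0 + y0) ^ 2 - (x0 + x0) * (x0 - x0) ^ 2 ~= 0" using False by simp
 ultimately show ?thesis using dvr_generic[OF P0 False] by blast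
 next
 case True
 have x0: "x0 ^ 3 = x0" using P0 True by simp
 define g where "g = (%q. xi q ^ 2 + xi q * x0 + x0 ^ 2 - 1)"
 have g: "has_val E g (aff x0 y0) (x0 ^ 2 + x0 * x0 + x0 ^ 2 - 1)" unfolding g_def
 by (intro has_val_diff[OF p] has_val_power[OF p] has_val_mult[OF p] has_val_add[OF p] has_val_const vx)
 have g0: "x0 ^ 2 + x0 * x0 + x0 ^ 2 - 1 ~= 0"
 using cub_simple_roots[of x0] x0 by (simp add: poly_cub) (simp add: cub_def pderiv_pCons power2_eq_square algebra_simps)
 have "has_val E (%q. g q ^ 2 - (xi q + x0) * eta q ^ 2) (aff x0 y0) ((x0 ^ 2 + x0 * x0 + x0 ^ 2 - 1) ^ 2 - (x0 + x0) * y0 ^ 2)"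
 by (intro has_val_diff[OF p] has_val_power[OF p] has_val_mult[OF p] has_val_add[OF p] has_val_const vx vy g)
 moreover have "ev E (%q. g q ^ 2 - (xi q + x0) * eta q ^ 2 = chord_x q * eta q ^ 2)"
 using eventually_weierstrass eventually_neq_xi[of x0]
 proof eventually_elim
 case (elim q)
 have "g q * (xi q - x0) = xi q ^ 3 - xi q - (x0 ^ 3 - x0)"
 unfolding g_def by (simp add: algebra_simps power2_eq_square power3_eq_cube)
 then have "g q * (xi q - x0) = eta q ^ 2" using elim(1) x0 by simp
 moreover have "slope q = eta q / (xi q - x0)" unfolding slope_def using True by simp
 then have "slope q * (xi q - x0) = eta q" using elim(2) by simp
 ultimately have "g q * (xi q - x0) = (slope q * eta q) * (xi q - x0)" by (simp add: power2_eq_square)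
 then have "g q = slope q * eta q" using elim(2) by simp
 then show ?case by (simp add: chord_x_def algebra_simps power_mult_distrib)
 qed
 ultimately have "has_val E (%q. chord_x q * eta q ^ 2) (aff x0 y0) ((x0 ^ 2 + x0 * x0 + x0 ^ 2 - 1) ^ 2 - (x0 + x0) * y0 ^ 2)"
 by (rule has_val_cong)
 moreover have "(x0 ^ 2 + x0 * x0 + x0 ^ 2 - 1) ^ 2 - (x0 + x0) * y0 ^ 2 ~= 0" using g0 True by simp
 moreover have "dvr_with (aff x0 y0) eta" using dvr_two_torsion[of x0] x0 True by simp
 ultimately show ?thesis by blast
 qed
qed

lemma chord_neq: "ev E (%q. chord_x q - c ~= 0)"
proof -
 have p: "aff x0 y0 : E" using P0 by (simp add: aff_in_E)
 have "rational E (%q. chord_x q - c)" by (intro rational_diff rational_const rational_chord_x)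
 from rational_dichotomy[OF this] show ?thesis
 proof
 assume const: "ev E (%q. chord_x q - c = 0)"
 obtain t b where t: "dvr_with (aff x0 y0) t" "has_val E (%q. chord_x q * t q ^ 2) (aff x0 y0) b" "b ~= 0"
 using chord_pole by blast
 have "has_val E t (aff x0 y0) 0" using t(1) by (simp add: dvr_with_def[OF p] unif_def[OF p])
 then have "has_val E (%q. c * t q ^ 2) (aff x0 y0) (c * 0 ^ 2)"
 by (intro has_val_mult[OF p] has_val_power[OF p] has_val_const)
 moreover have "ev E (%q. c * t q ^ 2 = chord_x q * t q ^ 2)"
 using const by eventually_elim simp
 ultimately have "has_val E (%q. chord_x q * t q ^ 2) (aff x0 y0) (c * 0 ^ 2)" by (rule has_val_cong)
 then show ?thesis using has_val_unique[OF p t(2)] t(3) by simp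
 qed
qed

text \<open>A point and its image lie on the same chord, so both have the same slope, and the chord
  formula is symmetric in the two first coordinates.\<close>

lemma chord_involution:
 "ev E (%q. chord_x (aff (chord_x q) (chord_y q)) = xi q & chord_y (aff (chord_x q) (chord_y q)) = eta q)"
 using chord_neq[of x0] eventually_neq_xi[of x0]
proof eventually_elim
 case (elim q)
 have "slope (aff (chord_x q) (chord_y q)) = slope q"
 using elim(1) by (simp add: slope_def[of "aff _ _"] chord_y_def)
 then show ?case using elim(2) by (simp add: chord_x_def chord_y_def) (simp add: slope_def)
qed

text \<open>At a pole of \<open>chord_x\<close> the functions \<open>W\<close> = 1/chord_x and
  \<open>Z\<close> = chord_y/chord_x^2 vanish. As the construction is an involution, xi and eta are
  expressible through \<open>W\<close> and \<open>Z\<close>, and setting these to 0 gives xi = x0,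
  eta = y0. So the point is the base point.\<close>

lemma chord_regular:
 assumes p: "p : E" "p ~= aff x0 y0" shows "EX c. has_val E chord_x p c"
proof (rule ccontr)
 assume "\<nexists>c. has_val E chord_x p c"
 moreover obtain t where t: "dvr_with p t" using dvr_exists[OF p(1)] ..
 ultimately have W: "has_val E (%q. inverse (chord_x q)) p 0" and nz: "ev E (%q. chord_x q ~= 0)"
 using dvr_dichotomy[OF p(1) t rational_chord_x] by auto
 define W where "W = (%q. inverse (chord_x q))"
 define Z where "Z = (%q. chord_y q * inverse (chord_x q) ^ 2)"
 note W = W[folded W_def]
 have cong: "ev E (%q. W q - W q ^ 3 = Z q ^ 2)"
 using chord_weierstrass nz
 proof eventually_elim
 case (elim q)
 have "Z q ^ 2 = (chord_x q ^ 3 - chord_x q) * inverse (chord_x q) ^ 4"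
 by (simp add: Z_def power_mult_distrib power_mult[symmetric] elim(1))
 also have "\<dots> = W q - W q ^ 3" using elim(2) by (simp add: W_def field_simps eval_nat_numeral)
 finally show ?case by simp
 qed
 have "has_val E (%q. W q - W q ^ 3) p (0 - 0 ^ 3)" by (intro has_val_diff[OF p(1)] has_val_power[OF p(1)] W)
 then have "has_val E (%q. Z q ^ 2) p 0" using has_val_cong[OF _ cong] by simp
 moreover have "rational E Z" unfolding Z_def
 by (intro rational_mult rational_power rational_inverse rational_chord_x rational_chord_y)
 ultimately have Z: "has_val E Z p 0" using has_val_of_square[OF p(1) t, of Z 0] by auto
 \<comment> \<open>The chord formulas applied to (chord_x, chord_y), with numerator and denominator
   divided by chord_x^2 in the first and by chord_x^3 in the second.\<close>
 have key: "ev E (%q. xi q = (x0 + (x0 ^ 2 - 1) * W q + 2 * y0 * Z q + (y0 ^ 2 - x0 ^ 3) * W q ^ 2) / (1 - x0 * W q) ^ 2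
 & eta q = (2 * y0 * (1 - W q ^ 2) + (3 * x0 ^ 2 - 1) * Z q + (y0 ^ 2 - 2 * x0 ^ 3) * (Z q * W q) + 2 * y0 ^ 2 * (Z q * W q)
 + y0 * (3 * x0 ^ 2 - 1) * W q ^ 2 + y0 * (y0 ^ 2 - 2 * x0 ^ 3) * W q ^ 3) / (1 - x0 * W q) ^ 3 - y0)"
 using chord_weierstrass chord_neq[of x0] nz eventually_neq_xi[of x0]
 proof eventually_elim
 case (elim q)
 define u v l where "u = chord_x q" and "v = chord_y q" and "l = slope q"
 have uv: "v ^ 2 = u ^ 3 - u" "u - x0 ~= 0" "u ~= 0" using elim by (auto simp: u_def v_def)
 have l: "l * (u - x0) = v + y0" by (simp add: u_def v_def l_def chord_y_def)
 have xi: "xi q = l ^ 2 - u - x0" by (simp add: u_def l_def chord_x_def)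
 have eta: "eta q = l * (xi q - x0) - y0" using elim(4) by (simp add: l_def slope_def)
 have W: "W q * u = 1" using uv(3) by (simp add: W_def u_def)
 have Z: "Z q * u ^ 2 = v" using uv(3) by (simp add: Z_def u_def v_def field_simps power2_eq_square)
 have lW: "(1 - x0 * W q) * u = u - x0" using W by (simp add: algebra_simps)
 then have W0: "1 - x0 * W q ~= 0" using uv(2) by auto
 have e1: "xi q * (u - x0) ^ 2 = x0 * u ^ 2 + (x0 ^ 2 - 1) * u + 2 * y0 * v + (y0 ^ 2 - x0 ^ 3)"
 proof -
 have "xi q * (u - x0) ^ 2 = (l * (u - x0)) ^ 2 - (u + x0) * (u - x0) ^ 2"
 by (simp add: xi algebra_simps power2_eq_square)
 also have "\<dots> = v ^ 2 + 2 * y0 * v + y0 ^ 2 - (u + x0) * (u - x0) ^ 2" unfolding l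
 by (simp add: algebra_simps power2_eq_square)
 also have "\<dots> = x0 * u ^ 2 + (x0 ^ 2 - 1) * u + 2 * y0 * v + (y0 ^ 2 - x0 ^ 3)" unfolding uv(1)
 by (simp add: algebra_simps power2_eq_square power3_eq_cube)
 finally show ?thesis .
 qed
 have WW: "W q * (u * z) = z" for z using W by (simp add: mult.assoc[symmetric])
 have W2: "W q ^ 2 * u ^ 2 = 1" using W by (simp add: power_mult_distrib[symmetric])
 have W3: "W q ^ 3 * u ^ 3 = 1" using W by (simp add: power_mult_distrib[symmetric])
 have a1: "(x0 + (x0 ^ 2 - 1) * W q + 2 * y0 * Z q + (y0 ^ 2 - x0 ^ 3) * W q ^ 2) * u ^ 2 = xi q * (u - x0) ^ 2"
 proof -
 have "(x0 + (x0 ^ 2 - 1) * W q + 2 * y0 * Z q + (y0 ^ 2 - x0 ^ 3) * W q ^ 2) * u ^ 2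
 = x0 * u ^ 2 + (x0 ^ 2 - 1) * (W q * u) * u + 2 * y0 * (Z q * u ^ 2) + (y0 ^ 2 - x0 ^ 3) * (W q ^ 2 * u ^ 2)"
 by (simp add: algebra_simps power2_eq_square)
 then show ?thesis unfolding e1 W Z W2 by simp
 qed
 have "(xi q * (1 - x0 * W q) ^ 2) * u ^ 2 = xi q * (u - x0) ^ 2" unfolding lW[symmetric] by (simp add: power_mult_distrib)
 then have "xi q * (1 - x0 * W q) ^ 2 = x0 + (x0 ^ 2 - 1) * W q + 2 * y0 * Z q + (y0 ^ 2 - x0 ^ 3) * W q ^ 2"
 using a1 uv(3) by (metis mult_cancel_right power_not_zero)
 then have r1: "xi q = (x0 + (x0 ^ 2 - 1) * W q + 2 * y0 * Z q + (y0 ^ 2 - x0 ^ 3) * W q ^ 2) / (1 - x0 * W q) ^ 2"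
 using W0 by (simp add: nonzero_eq_divide_eq)
 have e2: "(eta q + y0) * (u - x0) ^ 3 = 2 * y0 * (u ^ 3 - u) + (3 * x0 ^ 2 - 1) * (u * v) + (y0 ^ 2 - 2 * x0 ^ 3) * v
 + 2 * y0 ^ 2 * v + y0 * (3 * x0 ^ 2 - 1) * u + y0 * (y0 ^ 2 - 2 * x0 ^ 3)"
 proof -
 have "(eta q + y0) * (u - x0) ^ 3 = (l * (u - x0)) * (xi q * (u - x0) ^ 2 - x0 * (u - x0) ^ 2)"
 by (simp add: eta algebra_simps power2_eq_square power3_eq_cube)
 also have "\<dots> = (v + y0) * ((3 * x0 ^ 2 - 1) * u + 2 * y0 * v + (y0 ^ 2 - 2 * x0 ^ 3))"
 unfolding l e1 by (simp add: algebra_simps power2_eq_square power3_eq_cube)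
 also have "\<dots> = 2 * y0 * v ^ 2 + (3 * x0 ^ 2 - 1) * (u * v) + (y0 ^ 2 - 2 * x0 ^ 3) * v
 + 2 * y0 ^ 2 * v + y0 * (3 * x0 ^ 2 - 1) * u + y0 * (y0 ^ 2 - 2 * x0 ^ 3)"
 by (simp add: algebra_simps power2_eq_square power3_eq_cube)
 finally show ?thesis unfolding uv(1) .
 qed
 have a2: "(2 * y0 * (1 - W q ^ 2) + (3 * x0 ^ 2 - 1) * Z q + (y0 ^ 2 - 2 * x0 ^ 3) * (Z q * W q) + 2 * y0 ^ 2 * (Z q * W q)
 + y0 * (3 * x0 ^ 2 - 1) * W q ^ 2 + y0 * (y0 ^ 2 - 2 * x0 ^ 3) * W q ^ 3) * u ^ 3 = (eta q + y0) * (u - x0) ^ 3"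
 proof -
 have "(2 * y0 * (1 - W q ^ 2) + (3 * x0 ^ 2 - 1) * Z q + (y0 ^ 2 - 2 * x0 ^ 3) * (Z q * W q) + 2 * y0 ^ 2 * (Z q * W q)
 + y0 * (3 * x0 ^ 2 - 1) * W q ^ 2 + y0 * (y0 ^ 2 - 2 * x0 ^ 3) * W q ^ 3) * u ^ 3
 = 2 * y0 * (u ^ 3 - (W q ^ 2 * u ^ 2) * u) + (3 * x0 ^ 2 - 1) * (u * (Z q * u ^ 2)) + (y0 ^ 2 - 2 * x0 ^ 3) * ((Z q * u ^ 2) * (W q * u))
 + 2 * y0 ^ 2 * ((Z q * u ^ 2) * (W q * u)) + y0 * (3 * x0 ^ 2 - 1) * ((W q ^ 2 * u ^ 2) * u) + y0 * (y0 ^ 2 - 2 * x0 ^ 3) * (W q ^ 3 * u ^ 3)"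
 by (simp add: algebra_simps power2_eq_square power3_eq_cube)
 then show ?thesis unfolding e2 W Z W2 W3 by simp
 qed
 have "((eta q + y0) * (1 - x0 * W q) ^ 3) * u ^ 3 = (eta q + y0) * (u - x0) ^ 3" unfolding lW[symmetric] by (simp add: power_mult_distrib)
 then have "(eta q + y0) * (1 - x0 * W q) ^ 3 = 2 * y0 * (1 - W q ^ 2) + (3 * x0 ^ 2 - 1) * Z q + (y0 ^ 2 - 2 * x0 ^ 3) * (Z q * W q) + 2 * y0 ^ 2 * (Z q * W q)
 + y0 * (3 * x0 ^ 2 - 1) * W q ^ 2 + y0 * (y0 ^ 2 - 2 * x0 ^ 3) * W q ^ 3"
 unfolding a2[symmetric] using uv(3) by (metis mult_cancel_right power_not_zero)
 then have "eta q + y0 = (2 * y0 * (1 - W q ^ 2) + (3 * x0 ^ 2 - 1) * Z q + (y0 ^ 2 - 2 * x0 ^ 3) * (Z q * W q) + 2 * y0 ^ 2 * (Z q * W q)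
 + y0 * (3 * x0 ^ 2 - 1) * W q ^ 2 + y0 * (y0 ^ 2 - 2 * x0 ^ 3) * W q ^ 3) / (1 - x0 * W q) ^ 3"
 using W0 by (simp add: nonzero_eq_divide_eq)
 with r1 show ?case by (simp add: eq_diff_eq)
 qed
 have v1: "has_val E (%q. 1 - x0 * W q) p (1 - x0 * 0)" by (intro has_val_diff[OF p(1)] has_val_mult[OF p(1)] has_val_const W)
 have "has_val E (%q. (x0 + (x0 ^ 2 - 1) * W q + 2 * y0 * Z q + (y0 ^ 2 - x0 ^ 3) * W q ^ 2) / (1 - x0 * W q) ^ 2) p
 ((x0 + (x0 ^ 2 - 1) * 0 + 2 * y0 * 0 + (y0 ^ 2 - x0 ^ 3) * 0 ^ 2) / (1 - x0 * 0) ^ 2)"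
 by (intro has_val_divide[OF p(1)] has_val_add[OF p(1)] has_val_power[OF p(1)] has_val_mult[OF p(1)] has_val_const W Z v1) simp
 moreover have "ev E (%q. (x0 + (x0 ^ 2 - 1) * W q + 2 * y0 * Z q + (y0 ^ 2 - x0 ^ 3) * W q ^ 2) / (1 - x0 * W q) ^ 2 = xi q)"
 using key by eventually_elim simp
 ultimately have xi: "has_val E xi p x0" using has_val_cong by fastforce
 have "has_val E (%q. (2 * y0 * (1 - W q ^ 2) + (3 * x0 ^ 2 - 1) * Z q + (y0 ^ 2 - 2 * x0 ^ 3) * (Z q * W q) + 2 * y0 ^ 2 * (Z q * W q)
 + y0 * (3 * x0 ^ 2 - 1) * W q ^ 2 + y0 * (y0 ^ 2 - 2 * x0 ^ 3) * W q ^ 3) / (1 - x0 * W q) ^ 3 - y0) p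
 ((2 * y0 * (1 - 0 ^ 2) + (3 * x0 ^ 2 - 1) * 0 + (y0 ^ 2 - 2 * x0 ^ 3) * (0 * 0) + 2 * y0 ^ 2 * (0 * 0)
 + y0 * (3 * x0 ^ 2 - 1) * 0 ^ 2 + y0 * (y0 ^ 2 - 2 * x0 ^ 3) * 0 ^ 3) / (1 - x0 * 0) ^ 3 - y0)"
 by (intro has_val_divide[OF p(1)] has_val_add[OF p(1)] has_val_diff[OF p(1)] has_val_power[OF p(1)] has_val_mult[OF p(1)] has_val_const W Z v1) simp
 moreover have "ev E (%q. (2 * y0 * (1 - W q ^ 2) + (3 * x0 ^ 2 - 1) * Z q + (y0 ^ 2 - 2 * x0 ^ 3) * (Z q * W q) + 2 * y0 ^ 2 * (Z q * W q)
 + y0 * (3 * x0 ^ 2 - 1) * W q ^ 2 + y0 * (y0 ^ 2 - 2 * x0 ^ 3) * W q ^ 3) / (1 - x0 * W q) ^ 3 - y0 = eta q)"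
 using key by eventually_elim simp
 ultimately have eta: "has_val E eta p y0" using has_val_cong by fastforce
 from p(1) show False
 proof (rule E_cases)
 assume o: "p = origin"
 have "has_val E (%q. eta q * (1 / eta q)) p (y0 * 0)"
 by (intro has_val_mult[OF p(1)] eta) (simp add: o origin_vals)
 moreover have "ev E (%q. eta q * (1 / eta q) = 1)" using eventually_eta by eventually_elim simp
 ultimately have "has_val E (%q. 1) p (y0 * 0)" by (rule has_val_cong)
 then show False using has_val_unique[OF p(1) has_val_const[of E 1 p]] by force
 next
 assume "p = aff (xi p) (eta p)" "eta p ^ 2 = xi p ^ 3 - xi p"
 then have "has_val E xi p (xi p)" "has_val E eta p (eta p)" using has_val_xi has_val_eta by metis+
 then have "xi p = x0" "eta p = y0" using has_val_unique[OF p(1)] xi eta by blast+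
 then show False using \<open>p = aff (xi p) (eta p)\<close> p(2) by simp
 qed
qed

lemma based_curve_affine: "based_curve B Bi E (aff x0 y0) chord_x chord_y"
proof unfold_locales
 show "aff x0 y0 : E" using P0 by (simp add: aff_in_E)
qed (fact rational_chord_x rational_chord_y chord_weierstrass chord_pole chord_involution | rule chord_regular, assumption+)+

end

lemma based_curve_exists:
 assumes "P0 : E" shows "EX px py. based_curve B Bi E P0 px py"
 using assms
proof (rule E_cases)
 assume "P0 = origin" then show ?thesis using based_curve_origin by blast
next
 assume "P0 = aff (xi P0) (eta P0)" "eta P0 ^ 2 = xi P0 ^ 3 - xi P0"
 then show ?thesis using based_curve_affine[of "eta P0" "xi P0"] by auto
qed

end

section \<open>The embedding by 4 P0 as an intersection of two quadrics\<close>

lemma vector_4 [simp]: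
 "(vector [a, b, c, d] :: ('a::zero) ^ 4) $ 1 = a" "(vector [a, b, c, d] :: ('a::zero) ^ 4) $ 2 = b"
 "(vector [a, b, c, d] :: ('a::zero) ^ 4) $ 3 = c" "(vector [a, b, c, d] :: ('a::zero) ^ 4) $ 4 = d"
 unfolding vector_def by auto

lemma proportional_hcoord:
 fixes v w :: "complex ^ 'n::finite"
 assumes "v ~= 0" "w ~= 0" "!!i j. v $ i * w $ j = v $ j * w $ i"
 shows "hcoord v = hcoord w"
proof -
 obtain k where k: "v $ k ~= 0" using assms(1) by (auto simp: vec_eq_iff)
 have w: "w = (w $ k / v $ k) *s v" using k assms(3)[of k] by (simp add: vec_eq_iff field_simps)
 then have "w $ k / v $ k ~= 0" using assms(2) by (metis vector_smult_lzero)
 then show ?thesis using w assms(1,2) hcoord_eq_iff by blast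
qed

context irreducible_curve
begin

lemma finsum_fun_class:
 assumes "finite I" "!!i. i : I ==> rational S (f i)"
 shows "(\<Oplus>\<^bsub>ffld S\<^esub>i\<in>I. fun_class S (f i)) = fun_class S (%q. \<Sum>i\<in>I. f i q)"
proof -
 interpret L: field "ffld S" by (rule field_function_field)
 show ?thesis using assms
 proof (induction I rule: finite_induct)
 case empty
 then show ?case by (simp add: function_field_zero)
 next
 case (insert x F)
 then have "(%i. fun_class S (f i)) : F \<rightarrow> carrier (ffld S)" by (auto simp: fun_class_in_carrier)
 then show ?case using insert
 by (simp add: L.finsum_insert fun_class_in_carrier function_field_add)
 qed
qed

end

context closed_irreducible_curve
begin

text \<open>Justifies the definite description in \<open>curve_morphism\<close>: for two
  multipliers, all products of a component of one value vector with a component of the other can be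
  evaluated in two ways, so the vectors are proportional.\<close>

lemma curve_morphism_eq:
 assumes p: "p : S" and F: "!!i. F i = fun_class S (f i)"
 and g: "rational S g" and val: "!!i. has_val S (%q. g q * f i q) p (w $ i)" and w: "w ~= 0"
 shows "curve_morphism S F p = hcoord w"
 unfolding curve_morphism_def
proof (rule the_equality)
 show "\<exists>g\<in>carrier (ffld S). EX w'. w' ~= 0 &
 (ALL i. has_value S (g \<otimes>\<^bsub>ffld S\<^esub> F i) p (w' $ i)) & hcoord w = hcoord w'"
 using g val w by (intro bexI[of _ "fun_class S g"] exI[of _ w])
 (auto simp: F function_field_mult has_value_iff fun_class_in_carrier)
next
 fix q assume "\<exists>g\<in>carrier (ffld S). EX w'. w' ~= 0 &
 (ALL i. has_value S (g \<otimes>\<^bsub>ffld S\<^esub> F i) p (w' $ i)) & q = hcoord w'"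
 then obtain G w' where G: "G : carrier (ffld S)" "w' ~= 0"
 "!!i. has_value S (G \<otimes>\<^bsub>ffld S\<^esub> F i) p (w' $ i)" "q = hcoord w'" by blast
 obtain g' where g': "G = fun_class S g'" using carrierE[OF G(1)] by metis
 have val': "has_val S (%q. g' q * f i q) p (w' $ i)" for i
 using G(3)[of i] by (simp add: g' F function_field_mult has_value_iff)
 have "w $ i * w' $ j = w $ j * w' $ i" for i j
 proof (rule has_val_unique[OF p])
 show "has_val S (%q. (g q * f i q) * (g' q * f j q)) p (w $ i * w' $ j)"
 by (rule has_val_mult[OF p val val'])
 have "has_val S (%q. (g q * f j q) * (g' q * f i q)) p (w $ j * w' $ i)"
 by (rule has_val_mult[OF p val val'])
 then show "has_val S (%q. (g q * f i q) * (g' q * f j q)) p (w $ j * w' $ i)"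
 by (simp add: mult_ac)
 qed
 then show "q = hcoord w" using proportional_hcoord[OF w G(2)] G(4) by simp
qed

end

definition root2 :: complex where "root2 = complex_of_real (sqrt 2)"

lemma root2_squares [simp]: "root2 * root2 = 2" "root2 * (root2 * z) = 2 * z" "root2 ^ 2 = 2"
proof -
 show 1: "root2 * root2 = 2" unfolding root2_def by (metis of_real_mult of_real_numeral real_sqrt_mult_self abs_numeral)
 then show "root2 * (root2 * z) = 2 * z" "root2 ^ 2 = 2" by (simp_all add: mult.assoc[symmetric] power2_eq_square)
qed

lemma root2_nonzero [simp]: "root2 ~= 0"
 by (simp add: root2_def)

definition qcone :: "(complex ^ 4) set" where
 "qcone = {s. (s $ 1) ^ 2 = (s $ 3) ^ 2 - (s $ 2) ^ 2 & (s $ 4) ^ 2 = (s $ 2) ^ 2 + (s $ 3) ^ 2}"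

text \<open>A basis of the span of 1, x, y, x^2 in which the quadrics through the curve become
  diagonal: the squares of the third and second component differ by 8 (x^3 - x) and add up to 2 (x^2
  + 1)^2. The vector \<open>sec_inf\<close> below consists of the coefficients of x^2.\<close>

definition sec :: "complex => complex => complex ^ 4" where
 "sec x y = vector [(2 * root2) * y, x ^ 2 - 2 * x - 1, x ^ 2 + 2 * x - 1, root2 * (x ^ 2 + 1)]"

definition sec_inf :: "complex ^ 4" where "sec_inf = vector [0, 1, 1, root2]"

lemma qcone_scale: "s : qcone ==> c *s s : qcone"
proof -
 assume "s : qcone"
 then have 1: "(s $ 1) ^ 2 = (s $ 3) ^ 2 - (s $ 2) ^ 2" "(s $ 4) ^ 2 = (s $ 2) ^ 2 + (s $ 3) ^ 2"
 by (auto simp: qcone_def)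
 show ?thesis unfolding qcone_def
 by (simp add: power_mult_distrib 1 algebra_simps)
qed

lemma sec_nonzero: "sec x y ~= 0"
proof
 assume 0: "sec x y = 0"
 have "root2 * (sec x y $ 4) - sec x y $ 2 - sec x y $ 3 = 4" by (simp add: sec_def algebra_simps)
 then show False unfolding 0 by simp
qed

lemma sec_inf_nonzero: "sec_inf ~= 0"
proof
 assume "sec_inf = 0"
 moreover have "sec_inf $ 2 = 1" by (simp add: sec_inf_def)
 ultimately show False by simp
qed

text \<open>Beyond the point \<open>sec_inf\<close>, the cone is exactly the image of the affine
  curve; (x, y) is recovered linearly up to scale.\<close>

lemma qcone_iff:
 assumes "s ~= 0"
 shows "s : qcone \<longleftrightarrow> hcoord s = hcoord sec_inf | (EX x y. y ^ 2 = x ^ 3 - x & hcoord s = hcoord (sec x y))"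
proof
 assume "s : qcone"
 then have 1: "(s $ 1) ^ 2 = (s $ 3) ^ 2 - (s $ 2) ^ 2" "(s $ 4) ^ 2 = (s $ 2) ^ 2 + (s $ 3) ^ 2"
 by (auto simp: qcone_def)
 \<comment> \<open>\<open>u\<close>, \<open>m\<close>, \<open>h\<close> are the multiples of 1, x
   and x^2 contained in \<open>s\<close>. The second quadric becomes h u = m^2, the first one gives
   the cubic, and u = 0 is the point over infinity.\<close>
 define u where "u = (root2 * s $ 4 - s $ 2 - s $ 3) / 4"
 define m where "m = (s $ 3 - s $ 2) / 4"
 define h where "h = (root2 * s $ 4 + s $ 2 + s $ 3) / 4"
 have s2: "s $ 2 = h - u - 2 * m" and s3: "s $ 3 = h - u + 2 * m" and s4: "root2 * s $ 4 = 2 * (h + u)"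
 by (simp_all add: u_def m_def h_def field_simps)
 have "root2 * (root2 * s $ 4) = root2 * (2 * (h + u))" by (simp only: s4)
 then have "2 * (s $ 4) = 2 * (root2 * (h + u))" by (simp add: algebra_simps)
 then have s4': "s $ 4 = root2 * (h + u)" by simp
 have hu: "h * u = m ^ 2"
 proof -
 have "(root2 * s $ 4) ^ 2 = 2 * (s $ 4) ^ 2" by (simp add: power_mult_distrib)
 then have "(2 * (h + u)) ^ 2 = 2 * ((h - u - 2 * m) ^ 2 + (h - u + 2 * m) ^ 2)" unfolding 1(2) s4 s2 s3 .
 then have "16 * (h * u) = 16 * m ^ 2" by (simp add: power2_eq_square algebra_simps)
 then show ?thesis by simp
 qed
 have s1: "(s $ 1) ^ 2 = 8 * (m * (h - u))" unfolding 1(1) s2 s3 by (simp add: power2_eq_square algebra_simps)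
 show "hcoord s = hcoord sec_inf | (EX x y. y ^ 2 = x ^ 3 - x & hcoord s = hcoord (sec x y))"
 proof (cases "u = 0")
 case True
 then have m: "m = 0" using hu by simp
 then have "s $ 1 = 0" using s1 by simp
 then have s: "s = h *s sec_inf" using True m s2 s3 s4' by (simp add: vec_eq_iff forall_4 sec_inf_def)
 then have "h ~= 0" using assms by auto
 then show ?thesis using hcoord_scale[of h sec_inf] s by simp
 next
 case False
 define x y where "x = m / u" and "y = s $ 1 / ((2 * root2) * u)"
 have mx: "m = u * x" using False by (simp add: x_def)
 then have hx: "h = u * x ^ 2" using hu False by (simp add: power2_eq_square)
 have "y ^ 2 = (s $ 1) ^ 2 / (8 * u ^ 2)" by (simp add: y_def power_divide power_mult_distrib)
 also have "\<dots> = x ^ 3 - x" unfolding s1 mx hx using False by (simp add: power2_eq_square power3_eq_cube field_simps)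
 finally have "y ^ 2 = x ^ 3 - x" .
 moreover have "s $ 1 = u * ((2 * root2) * y)" using False by (simp add: y_def)
 then have "s = u *s sec x y" using s2 s3 s4' mx hx
 by (simp add: vec_eq_iff forall_4 sec_def algebra_simps)
 then have "hcoord s = hcoord (sec x y)" using hcoord_scale[OF False] by metis
 ultimately show ?thesis by blast
 qed
next
 have inf: "sec_inf : qcone" by (simp add: sec_inf_def qcone_def)
 have aff: "sec x y : qcone" if "y ^ 2 = x ^ 3 - x" for x y
 unfolding qcone_def sec_def using that
 by (simp add: power_mult_distrib) (simp add: power2_eq_square power3_eq_cube algebra_simps)
 assume "hcoord s = hcoord sec_inf | (EX x y. y ^ 2 = x ^ 3 - x & hcoord s = hcoord (sec x y))"
 then obtain r where r: "r : qcone" "hcoord s = hcoord r" using inf aff by blast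
 have "s : hcoord s" by (metis mem_hcoord vec.scale_one)
 then obtain c where "s = c *s r" using r(2) by (auto simp: mem_hcoord)
 then show "s : qcone" using r(1) qcone_scale by simp
qed

context based_curve
begin

lemma combination_of_sec:
 "\<exists>r :: complex ^ 4. ALL q. comb c0 c1 c2 c3 q = (\<Sum>j\<in>UNIV. r $ j * sec (px q) (py q) $ j)"
proof
 let ?r = "vector [c2 * (2 * root2) / 8, (c3 - c0) / 4 - c1 / 4, (c3 - c0) / 4 + c1 / 4, root2 * (c0 + c3) / 4] :: complex ^ 4"
 show "ALL q. comb c0 c1 c2 c3 q = (\<Sum>j\<in>UNIV. ?r $ j * sec (px q) (py q) $ j)"
 by (simp add: sum_4 sec_def comb_def field_simps)
qed

lemma sec_combination: "EX c0 c1 c2 c3. ALL q. sec (px q) (py q) $ j = comb c0 c1 c2 c3 q"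
 using exhaust_4[of j]
proof (elim disjE)
 assume "j = 1" then show ?thesis by (intro exI[of _ 0] exI[of _ "(2 * root2)"]) (simp add: sec_def comb_def)
next
 assume "j = 2" then show ?thesis
 by (intro exI[of _ "-1"] exI[of _ "-2"] exI[of _ 0] exI[of _ 1]) (simp add: sec_def comb_def)
next
 assume "j = 3" then show ?thesis
 by (intro exI[of _ "-1"] exI[of _ 2] exI[of _ 0] exI[of _ 1]) (simp add: sec_def comb_def)
next
 assume "j = 4" then show ?thesis
 by (intro exI[of _ root2] exI[of _ 0] exI[of _ 0] exI[of _ root2]) (simp add: sec_def comb_def algebra_simps)
qed

lemma sec_independent:
 fixes r :: "complex ^ 4"
 assumes "ev E (%q. (\<Sum>j\<in>UNIV. r $ j * sec (px q) (py q) $ j) = 0)"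
 shows "r = 0"
proof -
 let ?A = "[:- r $ 2 - r $ 3 + root2 * r $ 4, 2 * r $ 3 - 2 * r $ 2, r $ 2 + r $ 3 + root2 * r $ 4:]"
 have "ev E (%q. poly ?A (px q) + py q * poly [:(2 * root2) * r $ 1:] (px q) = 0)"
 using assms by eventually_elim (simp add: sum_4 sec_def algebra_simps power2_eq_square)
 from px_form_unique[OF this] have *: "r $ 1 = 0" "- r $ 2 - r $ 3 + root2 * r $ 4 = 0" "r $ 3 = r $ 2" "r $ 2 + r $ 3 + root2 * r $ 4 = 0"
 by auto
 have "2 * (root2 * r $ 4) = (- r $ 2 - r $ 3 + root2 * r $ 4) + (r $ 2 + r $ 3 + root2 * r $ 4)" by simp
 then have r4: "r $ 4 = 0" unfolding *(2,4) by simp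
 with * have "r $ 2 = 0" by simp
 then show ?thesis using * r4 by (simp add: vec_eq_iff forall_4)
qed

text \<open>\<open>M\<close> expresses the given basis of L(4 P0) through the functions
  \<open>sec\<close>, \<open>N\<close> the functions \<open>sec\<close> through the basis; linear
  independence of the latter functions makes \<open>N\<close> a left inverse. At \<open>P0\<close>
  the morphism is computed after multiplying by 1/px^2.\<close>

lemma curve_image:
 fixes F :: "4 => (3 ppoint => complex) set"
 assumes F: "is_basis E (riemann_roch_space E (point_divisor 4 P0)) F"
 shows "\<exists>M N :: complex ^ 4 ^ 4. N ** M = mat 1 & M ** N = mat 1 &
 curve_morphism E F ` E = {p : proj_points. \<forall>v\<in>p. N *v v : qcone}"
proof -
 let ?s = "%q. sec (px q) (py q)"
 have "ALL i. EX r. F i = fun_class E (%q. \<Sum>j\<in>UNIV. r $ j * ?s q $ j)"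
 proof
 fix i
 have "F i : riemann_roch_space E (point_divisor 4 P0)" using F by (simp add: is_basis_def)
 then obtain c0 c1 c2 c3 where c: "F i = fun_class E (comb c0 c1 c2 c3)" unfolding riemann_roch_space_eq by blast
 obtain r :: "complex ^ 4" where "ALL q. comb c0 c1 c2 c3 q = (\<Sum>j\<in>UNIV. r $ j * ?s q $ j)"
 using combination_of_sec by blast
 then have "comb c0 c1 c2 c3 = (%q. \<Sum>j\<in>UNIV. r $ j * ?s q $ j)" by auto
 then show "EX r. F i = fun_class E (%q. \<Sum>j\<in>UNIV. r $ j * ?s q $ j)" using c by (intro exI[of _ r]) simp
 qed
 from choice[OF this] obtain r where r: "!!i. F i = fun_class E (%q. \<Sum>j\<in>UNIV. r i $ j * ?s q $ j)" by blast
 define M :: "complex ^ 4 ^ 4" where "M = (\<chi> i. r i)"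
 have Fi: "F i = fun_class E (%q. (M *v ?s q) $ i)" for i
 by (simp add: r M_def matrix_vector_mult_def)
 have rat_s: "rational E (%q. ?s q $ j)" for j
 proof -
 obtain c0 c1 c2 c3 where "ALL q. ?s q $ j = comb c0 c1 c2 c3 q" using sec_combination by blast
 then show ?thesis using rational_comb[of c0 c1 c2 c3] by (simp add: fun_eq_iff[symmetric])
 qed
 have rat_Ms: "rational E (%q. (M *v ?s q) $ i)" for i
 unfolding matrix_vector_mult_def by (simp, intro rational_sum finite rational_mult rational_const rat_s)
 have "ALL j. \<exists>c :: complex ^ 4. ev E (%q. ?s q $ j = (\<Sum>i\<in>UNIV. c $ i * (M *v ?s q) $ i))"
 proof
 fix j
 obtain c0 c1 c2 c3 where c: "ALL q. ?s q $ j = comb c0 c1 c2 c3 q" using sec_combination by blast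
 then have "fun_class E (%q. ?s q $ j) = fun_class E (comb c0 c1 c2 c3)" by simp
 then have "fun_class E (%q. ?s q $ j) : riemann_roch_space E (point_divisor 4 P0)"
 unfolding riemann_roch_space_eq by blast
 then obtain c :: "complex ^ 4" where c: "fun_class E (%q. ?s q $ j) =
 (\<Oplus>\<^bsub>ffld E\<^esub>i\<in>UNIV. const_class E (c $ i) \<otimes>\<^bsub>ffld E\<^esub> F i)"
 using F unfolding is_basis_def by blast
 have "(\<Oplus>\<^bsub>ffld E\<^esub>i\<in>UNIV. fun_class E (%q. c $ i * (M *v ?s q) $ i)) = fun_class E (%q. \<Sum>i\<in>UNIV. c $ i * (M *v ?s q) $ i)"
 by (rule finsum_fun_class) (auto intro: rational_mult rational_const rat_Ms)
 then show "\<exists>c :: complex ^ 4. ev E (%q. ?s q $ j = (\<Sum>i\<in>UNIV. c $ i * (M *v ?s q) $ i))"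
 using c by (auto simp: Fi const_class_def function_field_mult fun_class_eq_iff)
 qed
 from choice[OF this] obtain n where n: "!!j. ev E (%q. ?s q $ j = (\<Sum>i\<in>UNIV. n j $ i * (M *v ?s q) $ i))" by blast
 define N :: "complex ^ 4 ^ 4" where "N = (\<chi> j. n j)"
 have ev: "ev E (%q. ?s q $ j = ((N ** M) *v ?s q) $ j)" for j
 using n[of j] by eventually_elim (simp add: N_def matrix_vector_mul_assoc[symmetric], simp add: matrix_vector_mult_def)
 have "((mat 1 :: complex ^ 4 ^ 4) - N ** M) $ j = 0" for j
 proof (rule sec_independent)
 show "ev E (%q. (\<Sum>k\<in>UNIV. (mat 1 - N ** M) $ j $ k * ?s q $ k) = 0)"
 using ev[of j]
 proof eventually_elim
 case (elim q)
 have "(\<Sum>k\<in>UNIV. (mat 1 - N ** M) $ j $ k * ?s q $ k) = ((mat 1 - N ** M) *v ?s q) $ j"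
 by (simp add: matrix_vector_mult_def)
 also have "\<dots> = ?s q $ j - ((N ** M) *v ?s q) $ j"
 by (simp add: matrix_vector_mult_diff_rdistrib)
 finally show ?case using elim by simp
 qed
 qed
 then have "(mat 1 :: complex ^ 4 ^ 4) - N ** M = 0" by (simp add: vec_eq_iff)
 then have NM: "N ** M = mat 1" by simp
 then have MN: "M ** N = mat 1" by (simp add: matrix_left_right_inverse)
 have inj: "M *v w ~= 0" if "w ~= 0" for w
 using that NM by (metis matrix_vector_mul_assoc matrix_vector_mul_lid matrix_vector_mult_0_right)
 have val_lin: "has_val E (%q. g q * (M *v ?s q) $ i) p ((M *v w) $ i)"
 if p: "p : E" and v: "!!j. has_val E (%q. g q * ?s q $ j) p (w $ j)" for p g w i
 proof -
 have "has_val E (%q. \<Sum>j\<in>UNIV. M $ i $ j * (g q * ?s q $ j)) p (\<Sum>j\<in>UNIV. M $ i $ j * w $ j)"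
 by (intro has_val_sum[OF p] finite has_val_mult[OF p] has_val_const v)
 then show ?thesis by (simp add: matrix_vector_mult_def sum_distrib_left mult.left_commute)
 qed
 have mor_aff: "curve_morphism E F p = hcoord (M *v sec x y)"
 if p: "p : E" and x: "has_val E px p x" and y: "has_val E py p y" for p x y
 proof (rule curve_morphism_eq[OF p Fi rational_const[of E 1] val_lin[OF p]])
 fix j
 have "has_val E (%q. (2 * root2) * py q) p ((2 * root2) * y)"
 "has_val E (%q. px q ^ 2 - 2 * px q - 1) p (x ^ 2 - 2 * x - 1)"
 "has_val E (%q. px q ^ 2 + 2 * px q - 1) p (x ^ 2 + 2 * x - 1)"
 "has_val E (%q. root2 * (px q ^ 2 + 1)) p (root2 * (x ^ 2 + 1))"
 by (intro has_val_add[OF p] has_val_diff[OF p] has_val_mult[OF p] has_val_power[OF p] has_val_const x y)+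
 then show "has_val E (%q. 1 * ?s q $ j) p (sec x y $ j)"
 using exhaust_4[of j] by (auto simp: sec_def)
 qed (use inj sec_nonzero in blast)
 have mor_P0: "curve_morphism E F P0 = hcoord (M *v sec_inf)"
 proof (rule curve_morphism_eq[OF P0 Fi _ val_lin[OF P0]])
 show "rational E (%q. (1 / px q) ^ 2)"
 by (intro rational_power rational_divide rational_const rational_px)
 fix j
 have "has_val E (%q. (1 / px q) ^ 2 * ((2 * root2) * py q)) P0 0"
 using comb_P0[of 0 0 "(2 * root2)" 0] by (simp add: comb_def)
 moreover have "has_val E (%q. (1 / px q) ^ 2 * (px q ^ 2 - 2 * px q - 1)) P0 1"
 using comb_P0[of "-1" "-2" 0 1] by (simp add: comb_def algebra_simps)
 moreover have "has_val E (%q. (1 / px q) ^ 2 * (px q ^ 2 + 2 * px q - 1)) P0 1"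
 using comb_P0[of "-1" 2 0 1] by (simp add: comb_def algebra_simps)
 moreover have "has_val E (%q. (1 / px q) ^ 2 * (root2 * (px q ^ 2 + 1))) P0 (root2)"
 using comb_P0[of "root2" 0 0 "root2"] by (simp add: comb_def algebra_simps)
 ultimately show "has_val E (%q. (1 / px q) ^ 2 * ?s q $ j) P0 (sec_inf $ j)"
 using exhaust_4[of j] by (auto simp: sec_def sec_inf_def)
 qed (use inj sec_inf_nonzero in blast)
 have image: "curve_morphism E F ` E = {hcoord (M *v s) | s. s ~= 0 & s : qcone}"
 proof (intro equalityI subsetI)
 fix z assume "z : curve_morphism E F ` E"
 then obtain p where p: "p : E" "z = curve_morphism E F p" by blast
 show "z : {hcoord (M *v s) | s. s ~= 0 & s : qcone}"
 proof (cases "p = P0")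
 case True
 moreover have "sec_inf : qcone" using qcone_iff[OF sec_inf_nonzero] by blast
 ultimately show ?thesis using p mor_P0 sec_inf_nonzero by blast
 next
 case False
 obtain x where x: "has_val E px p x" using regular_px[OF p(1) False] ..
 obtain y where y: "has_val E py p y" "y ^ 2 = x ^ 3 - x" using regular_py[OF p(1) x] by blast
 have "sec x y : qcone" using qcone_iff[OF sec_nonzero] y(2) by blast
 then show ?thesis using p mor_aff[OF p(1) x y(1)] sec_nonzero by blast
 qed
 next
 have hM: "hcoord (M *v s) = hcoord (M *v t)" if "hcoord s = hcoord t" for s t
 using that by (metis proj_map_hcoord)
 fix z assume "z : {hcoord (M *v s) | s. s ~= 0 & s : qcone}"
 then obtain s where s: "s ~= 0" "s : qcone" "z = hcoord (M *v s)" by blast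
 from s(2) qcone_iff[OF s(1)] consider "hcoord s = hcoord sec_inf"
 | x y where "y ^ 2 = x ^ 3 - x" "hcoord s = hcoord (sec x y)" by blast
 then show "z : curve_morphism E F ` E"
 proof cases
 case 1
 then have "z = curve_morphism E F P0" using mor_P0 hM[OF 1] s(3) by simp
 then show ?thesis using P0 by blast
 next
 case 2
 obtain p where p: "p : E" "has_val E px p x" "has_val E py p y" using value_attained[OF 2(1)] by blast
 then have "z = curve_morphism E F p" using mor_aff hM[OF 2(2)] s(3) by simp
 then show ?thesis using p(1) by blast
 qed
 qed
 also have "\<dots> = {p : proj_points. \<forall>v\<in>p. N *v v : qcone}"
 proof (intro equalityI subsetI)
 fix z assume "z : {hcoord (M *v s) | s. s ~= 0 & s : qcone}"
 then obtain s where s: "s ~= 0" "s : qcone" "z = hcoord (M *v s)" by blast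
 have "N *v (c *s (M *v s)) = c *s s" for c
 by (simp add: vector_scalar_commute matrix_vector_mul_assoc NM)
 then show "z : {p : proj_points. \<forall>v\<in>p. N *v v : qcone}"
 using s inj by (auto simp: hcoord_in_proj_points mem_hcoord qcone_scale)
 next
 fix z assume z: "z : {p : proj_points. \<forall>v\<in>p. N *v v : qcone}"
 then have r: "rep z : z" "rep z ~= 0" "hcoord (rep z) = z" using rep_in hcoord_rep by auto
 have MNr: "M *v (N *v rep z) = rep z" by (simp add: matrix_vector_mul_assoc MN)
 then have "N *v rep z ~= 0" using r(2) by auto
 moreover have "N *v rep z : qcone" using z r(1) by blast
 ultimately show "z : {hcoord (M *v s) | s. s ~= 0 & s : qcone}"
 using MNr r(3) by (intro CollectI exI[of _ "N *v rep z"]) simp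
 qed
 finally show ?thesis using NM MN by blast
qed

end

section \<open>Normalization of a Weierstrass equation with j = 1728\<close>

text \<open>The hypothesis says c4^3 = 1728 D for the discriminant D, and c4^3 - c6^2 = 1728 D
  always holds; so c6 = 0. Completing the square and the cube therefore leaves no constant term, and
  rescaling by a fourth root of c4/48 makes the linear coefficient -1.\<close>

lemma weierstrass_1728:
 assumes disc: "weierstrass_disc a1 a2 a3 a4 a6 ~= 0" and j: "weierstrass_j a1 a2 a3 a4 a6 = 12 ^ 3"
 shows "EX B Bi. elliptic_curve B Bi (weierstrass_curve a1 a2 a3 a4 a6)"
proof -
 define b2 b4 b6 b8 where "b2 = a1 ^ 2 + 4 * a2" and "b4 = 2 * a4 + a1 * a3" and "b6 = a3 ^ 2 + 4 * a6"
 and "b8 = a1 ^ 2 * a6 + 4 * a2 * a6 - a1 * a3 * a4 + a2 * a3 ^ 2 - a4 ^ 2"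
 define c4 c6 where "c4 = b2 ^ 2 - 24 * b4" and "c6 = - (b2 ^ 3) + 36 * b2 * b4 - 216 * b6"
 define D where "D = weierstrass_disc a1 a2 a3 a4 a6"
 have D: "D = - (b2 ^ 2 * b8) - 8 * b4 ^ 3 - 27 * b6 ^ 2 + 9 * b2 * b4 * b6"
 by (simp add: D_def weierstrass_disc_def Let_def b2_def b4_def b6_def b8_def)
 have "c4 ^ 3 / D = 1728" using j by (simp add: weierstrass_j_def Let_def c4_def b2_def b4_def D_def)
 then have c4D: "c4 ^ 3 = 1728 * D" using disc by (simp add: D_def field_simps)
 have b8: "4 * b8 = b2 * b6 - b4 ^ 2"
 by (simp add: b2_def b4_def b6_def b8_def algebra_simps power2_eq_square)
 have "c4 ^ 3 - c6 ^ 2 = 1728 * (- 8 * b4 ^ 3 - 27 * b6 ^ 2 + 9 * b2 * b4 * b6) - 432 * (b2 ^ 2 * (b2 * b6 - b4 ^ 2))"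
 by (simp add: c4_def c6_def algebra_simps power2_eq_square power3_eq_cube)
 also have "\<dots> = 1728 * D" unfolding D b8[symmetric] by (simp add: algebra_simps)
 finally have c6: "c6 = 0" using c4D by simp
 have "c4 ~= 0" using c4D disc by (auto simp: D_def)
 define k where "k = csqrt (c4 / 48)"
 have k2: "k ^ 2 = c4 / 48" by (simp add: k_def)
 then have k0: "k ~= 0" using \<open>c4 ~= 0\<close> by auto
 define m where "m = csqrt k"
 have mk: "m ^ 2 = k" by (simp add: m_def)
 then have m0: "m ~= 0" using k0 by auto
 have b6: "216 * b6 = - (b2 ^ 3) + 36 * b2 * b4" using c6 by (simp add: c6_def)
 have b4: "24 * b4 = b2 ^ 2 - 48 * m ^ 4"
 proof -
 have "m ^ 4 = k ^ 2" by (simp add: mk[symmetric] power_mult[symmetric])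
 then have "48 * m ^ 4 = b2 ^ 2 - 24 * b4" using k2 by (simp add: c4_def mult.commute)
 then show ?thesis by simp
 qed
 text \<open>\<open>x = m\<^sup>2 \<xi> - b2 / 12\<close> and \<open>2 y + a1 x + a3 = 2 m\<^sup>3 \<eta>\<close>; here \<open>48 m\<^sup>4\<close> is the invariant \<open>c4\<close>.\<close>
 define B :: "complex ^ 3 ^ 3" where
 "B = vector [vector [1 / m ^ 2, 0, b2 / (12 * m ^ 2)], vector [a1 / (2 * m ^ 3), 1 / m ^ 3, a3 / (2 * m ^ 3)], vector [0, 0, 1]]"
 define Bi :: "complex ^ 3 ^ 3" where
 "Bi = vector [vector [m ^ 2, 0, - b2 / 12], vector [- a1 * m ^ 2 / 2, m ^ 3, a1 * b2 / 24 - a3 / 2], vector [0, 0, 1]]"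
 have Bv: "(B *v v) $ 1 = (v $ 1 + b2 / 12 * v $ 3) / m ^ 2" "(B *v v) $ 2 = (a1 / 2 * v $ 1 + v $ 2 + a3 / 2 * v $ 3) / m ^ 3"
 "(B *v v) $ 3 = v $ 3" for v
 using m0 by (simp_all add: B_def matrix_vector_mult_def sum_3 field_simps)
 have BBi: "B ** Bi = mat 1"
 using m0 by (simp add: B_def Bi_def matrix_matrix_mult_def sum_3 vec_eq_iff forall_3 mat_def field_simps power2_eq_square power3_eq_cube)
 have eq: "(y ^ 2 * z + a1 * x * y * z + a3 * y * z ^ 2 = x ^ 3 + a2 * x ^ 2 * z + a4 * x * z ^ 2 + a6 * z ^ 3) \<longleftrightarrow>
 (((a1 / 2 * x + y + a3 / 2 * z) / m ^ 3) ^ 2 * z = ((x + b2 / 12 * z) / m ^ 2) ^ 3 - (x + b2 / 12 * z) / m ^ 2 * z ^ 2)"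
 (is "?L \<longleftrightarrow> ?R") for x y z
 proof -
 have m6: "m ^ 6 ~= 0" using m0 by simp
 \<comment> \<open>The factor 864 clears the denominators and turns the constant term into the
   combination of b2 and b4 that equals 216 b6.\<close>
 have scaled: "l = r \<longleftrightarrow> 864 * (l - r) = 0" for l r :: complex by simp
 have "?R \<longleftrightarrow> m ^ 6 * (((a1 / 2 * x + y + a3 / 2 * z) / m ^ 3) ^ 2 * z) = m ^ 6 * (((x + b2 / 12 * z) / m ^ 2) ^ 3 - (x + b2 / 12 * z) / m ^ 2 * z ^ 2)"
 using m6 by simp
 also have "m ^ 6 * (((a1 / 2 * x + y + a3 / 2 * z) / m ^ 3) ^ 2 * z) = (a1 / 2 * x + y + a3 / 2 * z) ^ 2 * z"
 using m0 by (simp add: power_divide power_mult[symmetric])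
 also have "m ^ 6 * (((x + b2 / 12 * z) / m ^ 2) ^ 3 - (x + b2 / 12 * z) / m ^ 2 * z ^ 2) =
 (x + b2 / 12 * z) ^ 3 - m ^ 4 * ((x + b2 / 12 * z) * z ^ 2)"
 proof -
 have cancel: "(c * d) * (w / d * r) = c * (w * r)" if "d ~= 0" for c d w r :: complex
 using that by simp
 have "m ^ 4 * m ^ 2 = m ^ 6" by (simp add: power_add[symmetric])
 then have "m ^ 6 * ((x + b2 / 12 * z) / m ^ 2 * z ^ 2) = m ^ 4 * ((x + b2 / 12 * z) * z ^ 2)"
 using cancel[of "m ^ 2" "m ^ 4" "x + b2 / 12 * z" "z ^ 2"] m0 by (metis power_not_zero)
 moreover have "m ^ 6 * ((x + b2 / 12 * z) / m ^ 2) ^ 3 = (x + b2 / 12 * z) ^ 3"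
 using m0 by (simp add: power_divide power_mult[symmetric])
 ultimately show ?thesis by (simp add: right_diff_distrib)
 qed
 also have "m ^ 4 = (b2 ^ 2 - 24 * b4) / 48" using b4 by simp
 also have "(a1 / 2 * x + y + a3 / 2 * z) ^ 2 * z = (x + b2 / 12 * z) ^ 3 - (b2 ^ 2 - 24 * b4) / 48 * ((x + b2 / 12 * z) * z ^ 2) \<longleftrightarrow>
 864 * ((a1 / 2 * x + y + a3 / 2 * z) ^ 2 * z - ((x + b2 / 12 * z) ^ 3 - (b2 ^ 2 - 24 * b4) / 48 * ((x + b2 / 12 * z) * z ^ 2))) = 0"
 by (rule scaled)
 also have "864 * ((a1 / 2 * x + y + a3 / 2 * z) ^ 2 * z - ((x + b2 / 12 * z) ^ 3 - (b2 ^ 2 - 24 * b4) / 48 * ((x + b2 / 12 * z) * z ^ 2)))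
 = 864 * (a1 / 2 * x + y + a3 / 2 * z) ^ 2 * z - 864 * x ^ 3 - 216 * b2 * x ^ 2 * z - 432 * b4 * x * z ^ 2 - (- (b2 ^ 3) + 36 * b2 * b4) * z ^ 3"
 proof -
 obtain b g where bg: "b2 = 12 * b" "b4 = 6 * g" by (metis mult.commute nonzero_eq_divide_eq zero_neq_numeral)
 have e1: "(b2 ^ 2 - 24 * b4) / 48 = 3 * (b ^ 2 - g)" by (simp add: bg power_mult_distrib diff_divide_distrib)
 have e2: "b2 / 12 = b" by (simp add: bg)
 show ?thesis unfolding e1 e2 unfolding bg by (simp add: algebra_simps power2_eq_square power3_eq_cube)
 qed
 also have "\<dots> = 864 * (y ^ 2 * z + a1 * x * y * z + a3 * y * z ^ 2 - (x ^ 3 + a2 * x ^ 2 * z + a4 * x * z ^ 2 + a6 * z ^ 3))"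
 unfolding b6[symmetric] unfolding b2_def b4_def b6_def
 by (simp add: algebra_simps power2_eq_square power3_eq_cube)
 finally have "?R \<longleftrightarrow> 864 * (y ^ 2 * z + a1 * x * y * z + a3 * y * z ^ 2 - (x ^ 3 + a2 * x ^ 2 * z + a4 * x * z ^ 2 + a6 * z ^ 3)) = 0" .
 then show ?thesis unfolding scaled[symmetric] by (rule sym)
 qed
 have "elliptic_curve B Bi (weierstrass_curve a1 a2 a3 a4 a6)"
 proof
 show "B ** Bi = mat 1" by (rule BBi)
 then show "Bi ** B = mat 1" by (simp add: matrix_left_right_inverse)
 show "weierstrass_curve a1 a2 a3 a4 a6 =
 {p : proj_points. \<forall>v\<in>p. ((B *v v) $ 2) ^ 2 * (B *v v) $ 3 = ((B *v v) $ 1) ^ 3 - (B *v v) $ 1 * ((B *v v) $ 3) ^ 2}"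
 unfolding weierstrass_curve_def Bv Let_def eq ..
 qed
 then show ?thesis by blast
qed

theorem quartic_model:
 fixes F :: "4 => (3 ppoint => complex) set"
 assumes "weierstrass_disc a1 a2 a3 a4 a6 ~= 0" "weierstrass_j a1 a2 a3 a4 a6 = 12 ^ 3"
 and E: "E = weierstrass_curve a1 a2 a3 a4 a6" "P0 : E"
 and F: "is_basis E (riemann_roch_space E (point_divisor 4 P0)) F"
 shows "\<exists>M N :: complex ^ 4 ^ 4. N ** M = mat 1 & M ** N = mat 1 &
 curve_morphism E F ` E = {p : proj_points. \<forall>v\<in>p. N *v v : qcone}"
proof -
 obtain B Bi where "elliptic_curve B Bi E" using weierstrass_1728[OF assms(1,2)] E(1) by blast
 then obtain px py where "based_curve B Bi E P0 px py" using elliptic_curve.based_curve_exists E(2) by blast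
 then show ?thesis using based_curve.curve_image F by blast
qed

section \<open>The quartic curve\<close>

definition pa :: "complex poly" where "pa = [:1, 0, -1:]"
definition pb :: "complex poly" where "pb = [:1, 0, 1:]"

lemma poly_pa: "poly pa z = 1 - z ^ 2" and poly_pb: "poly pb z = 1 + z ^ 2"
 by (simp_all add: pa_def pb_def power2_eq_square)

text \<open>At a simple root of k the two sides would vanish to orders of different parity.\<close>

lemma square_free_obstruction:
 fixes p q k :: "complex poly"
 assumes eq: "p * p = k * (q * q)" and k: "poly k z = 0" "poly (pderiv k) z ~= 0"
 shows "p = 0" "q = 0"
proof -
 obtain k1 where k1: "k = [:- z, 1:] * k1" using k(1) poly_eq_0_iff_dvd dvdE by metis
 have "poly k1 z ~= 0" using k(2) unfolding k1 pderiv_mult by (auto simp: pderiv_pCons simp del: mult_pCons_left)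
 have k0: "k ~= 0" using k(2) by auto
 have lin: "Polynomial.order z [:- z, 1:] = 1" using order_power_n_n[of z 1] by simp
 have "Polynomial.order z k = 1"
 using k0 unfolding k1 by (subst order_mult) (auto simp: lin order_0I \<open>poly k1 z ~= 0\<close> simp del: mult_pCons_left)
 have q: "q = 0"
 proof (rule ccontr)
 assume "q ~= 0"
 then have "k * (q * q) ~= 0" using k0 by simp
 moreover then have "p ~= 0" using eq by auto
 ultimately have "Polynomial.order z p + Polynomial.order z p = 1 + (Polynomial.order z q + Polynomial.order z q)"
 using arg_cong[OF eq, of "Polynomial.order z"] \<open>q ~= 0\<close> by (simp add: order_mult \<open>Polynomial.order z k = 1\<close>)
 then show False by presburger
 qed
 then show "p = 0" "q = 0" using eq by auto
qed

lemma simple_roots_pa: "poly pa z = 0 ==> poly (pderiv pa) z ~= 0"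
 by (auto simp: poly_pa) (auto simp: pa_def pderiv_pCons)

lemma simple_roots_pb: "poly pb z = 0 ==> poly (pderiv pb) z ~= 0"
 by (auto simp: poly_pb) (auto simp: pb_def pderiv_pCons)

lemma simple_roots_pa_pb: "poly (pa * pb) z = 0 ==> poly (pderiv (pa * pb)) z ~= 0"
proof
 assume "poly (pa * pb) z = 0" "poly (pderiv (pa * pb)) z = 0"
 then have "(1 - z ^ 2) * (1 + z ^ 2) = 0" "- 4 * z ^ 3 = 0"
 by (simp add: poly_pa poly_pb)
 (use \<open>poly (pderiv (pa * pb)) z = 0\<close> in \<open>simp add: pa_def pb_def pderiv_pCons power3_eq_cube\<close>)
 then show False by auto
qed

lemma pa_root: "poly pa 1 = 0" "poly (pderiv pa) 1 ~= 0"
 using simple_roots_pa[of 1] by (simp_all add: poly_pa)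

lemma pb_root: "poly pb \<i> = 0" "poly (pderiv pb) \<i> ~= 0"
 using simple_roots_pb[of \<i>] by (simp_all add: poly_pb)

lemma pa_pb_root: "poly (pa * pb) 1 = 0" "poly (pderiv (pa * pb)) 1 ~= 0"
 using simple_roots_pa_pb[of 1] by (simp_all add: poly_pa)

lemma pa_pb_nonzero: "pa ~= 0" "pb ~= 0" by (simp_all add: pa_def pb_def)

definition qnorm :: "complex poly => complex poly => complex poly => complex poly => complex poly" where
 "qnorm A B C D = (let U = A * A + B * B * pa - pb * (C * C + D * D * pa); V = 2 * (A * B - pb * (C * D))
 in U * U - pa * (V * V))"

text \<open>Nonvanishing of the norm means that \<open>1, a, b, a b\<close> are independent over \<open>\<complex>(z)\<close>, where
 \<open>a\<^sup>2 = 1 - z\<^sup>2\<close> and \<open>b\<^sup>2 = 1 + z\<^sup>2\<close>.\<close>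

lemma qnorm_eq_0D:
 assumes "qnorm A B C D = 0" shows "A = 0" "B = 0" "C = 0" "D = 0"
proof -
 define U where "U = A * A + B * B * pa - pb * (C * C + D * D * pa)"
 define V where "V = 2 * (A * B - pb * (C * D))"
 have "U * U = pa * (V * V)" using assms by (simp add: qnorm_def Let_def U_def V_def)
 from square_free_obstruction[OF this pa_root] have "U = 0" "V = 0" .
 then have 1: "A * A + B * B * pa = pb * (C * C + D * D * pa)" and 2: "A * B = pb * (C * D)"
 by (simp_all add: U_def V_def)
 \<comment> \<open>The two quantities A^2 and B^2 a^2 have the same sum and product as b^2 C^2 and
   b^2 D^2 a^2, so they agree up to order. Either way some square is pb or pa pb times a square,
   against \<open>square_free_obstruction\<close>.\<close>
 have "(A * A - B * B * pa) * (A * A - B * B * pa) = (A * A + B * B * pa) * (A * A + B * B * pa) - 4 * pa * ((A * B) * (A * B))"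
 by (simp add: algebra_simps)
 also have "\<dots> = (pb * (C * C - D * D * pa)) * (pb * (C * C - D * D * pa))"
 unfolding 1 2 by (simp add: algebra_simps)
 finally have "(A * A - B * B * pa - pb * (C * C - D * D * pa)) * (A * A - B * B * pa + pb * (C * C - D * D * pa)) = 0"
 by (simp add: algebra_simps)
 then consider "A * A - B * B * pa = pb * (C * C - D * D * pa)" | "A * A - B * B * pa = - (pb * (C * C - D * D * pa))"
 by (auto simp: eq_neg_iff_add_eq_0)
 then have "A = 0 & B = 0 & C = 0 & D = 0"
 proof cases
 case 1
 have "2 * (A * A) = (A * A + B * B * pa) + (A * A - B * B * pa)" by simp
 also have "\<dots> = 2 * (pb * (C * C))" unfolding 1 \<open>A * A + B * B * pa = _\<close> by (simp add: algebra_simps)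
 finally have e1: "A * A = pb * (C * C)" by simp
 have "2 * (pa * (B * B)) = (A * A + B * B * pa) - (A * A - B * B * pa)" by (simp add: algebra_simps)
 also have "\<dots> = 2 * (pa * (pb * (D * D)))" unfolding 1 \<open>A * A + B * B * pa = _\<close> by (simp add: algebra_simps)
 finally have e2: "B * B = pb * (D * D)" using pa_pb_nonzero by simp
 from e1 e2
 show ?thesis using square_free_obstruction[OF _ pb_root] by blast
 next
 case 2
 have "2 * (A * A) = (A * A + B * B * pa) + (A * A - B * B * pa)" by simp
 also have "\<dots> = 2 * (pa * pb * (D * D))" unfolding 2 \<open>A * A + B * B * pa = _\<close> by (simp add: algebra_simps)
 finally have e1: "A * A = (pa * pb) * (D * D)" by simp
 have "2 * (pa * (B * B)) = (A * A + B * B * pa) - (A * A - B * B * pa)" by (simp add: algebra_simps)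
 also have "\<dots> = 2 * (pb * (C * C))" unfolding 2 \<open>A * A + B * B * pa = _\<close> by (simp add: algebra_simps)
 finally have "pa * (B * B) = pb * (C * C)" by simp
 then have "(pa * B) * (pa * B) = (pa * pb) * (C * C)" by (simp add: mult_ac)
 then have "pa * B = 0" "C = 0" using square_free_obstruction[OF _ pa_pb_root] by blast+
 moreover have "A = 0" "D = 0" using square_free_obstruction[OF e1 pa_pb_root] .
 ultimately show ?thesis using pa_pb_nonzero by simp
 qed
 then show "A = 0" "B = 0" "C = 0" "D = 0" by auto
qed

definition nf :: "(complex poly \<times> complex poly \<times> complex poly \<times> complex poly) => complex => complex => complex => complex" where
 "nf = (%(A, B, C, D) z a b. poly A z + a * poly B z + b * poly C z + a * b * poly D z)"

definition normal_form :: "(complex => complex => complex => complex) => bool" where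
 "normal_form g \<longleftrightarrow> (EX Q. ALL z a b. a ^ 2 = 1 - z ^ 2 --> b ^ 2 = 1 + z ^ 2 --> g z a b = nf Q z a b)"

text \<open>The product over all sign changes of a and b is the norm to the field of z; it is
  invariant, hence free of a and b.\<close>

lemma nf_norm:
 assumes "a ^ 2 = 1 - z ^ 2" "b ^ 2 = 1 + z ^ 2"
 shows "nf (A, B, C, D) z a b * (nf (A, B, C, D) z (- a) b * nf (A, B, C, D) z a (- b) * nf (A, B, C, D) z (- a) (- b)) =
 poly (qnorm A B C D) z"
proof -
 define p q r s where "p = poly A z" "q = poly B z" "r = poly C z" "s = poly D z"
 have "nf (A, B, C, D) z a b * (nf (A, B, C, D) z (- a) b * nf (A, B, C, D) z a (- b) * nf (A, B, C, D) z (- a) (- b)) =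
 ((p + a * q) ^ 2 - b ^ 2 * (r + a * s) ^ 2) * ((p - a * q) ^ 2 - b ^ 2 * (r - a * s) ^ 2)"
 by (simp add: nf_def p_q_r_s_def[symmetric] algebra_simps power2_eq_square)
 also have "\<dots> = ((p * p + q * q * a ^ 2 - b ^ 2 * (r * r + s * s * a ^ 2)) + a * (2 * (p * q - b ^ 2 * (r * s)))) *
 ((p * p + q * q * a ^ 2 - b ^ 2 * (r * r + s * s * a ^ 2)) - a * (2 * (p * q - b ^ 2 * (r * s))))"
 by (simp add: algebra_simps power2_eq_square)
 also have "\<dots> = (p * p + q * q * a ^ 2 - b ^ 2 * (r * r + s * s * a ^ 2)) * (p * p + q * q * a ^ 2 - b ^ 2 * (r * r + s * s * a ^ 2))
 - a ^ 2 * ((2 * (p * q - b ^ 2 * (r * s))) * (2 * (p * q - b ^ 2 * (r * s))))"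
 by (simp add: algebra_simps power2_eq_square)
 also have "\<dots> = poly (qnorm A B C D) z" unfolding assms
 by (simp add: qnorm_def Let_def p_q_r_s_def poly_pa poly_pb)
 finally show ?thesis .
qed

lemma normal_formI: "(!!z a b. a ^ 2 = 1 - z ^ 2 ==> b ^ 2 = 1 + z ^ 2 ==> g z a b = nf Q z a b) ==> normal_form g"
 unfolding normal_form_def by blast

lemma normal_form_linear: "normal_form (%z a b. c1 * a + c2 * z + c3 + c4 * b)"
 by (rule normal_formI[of _ "([:c3, c2:], [:c1:], [:c4:], 0)"]) (simp add: nf_def algebra_simps)

lemma normal_form_const: "normal_form (%z a b. c)"
 using normal_form_linear[of 0 0 c 0] by simp

lemma normal_form_add: assumes "normal_form f" "normal_form g" shows "normal_form (%z a b. f z a b + g z a b)"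
proof -
 obtain A B C D where 1: "!!z a b. a ^ 2 = 1 - z ^ 2 ==> b ^ 2 = 1 + z ^ 2 ==> f z a b = nf (A, B, C, D) z a b"
 using assms(1) unfolding normal_form_def by auto
 obtain A' B' C' D' where 2: "!!z a b. a ^ 2 = 1 - z ^ 2 ==> b ^ 2 = 1 + z ^ 2 ==> g z a b = nf (A', B', C', D') z a b"
 using assms(2) unfolding normal_form_def by auto
 show ?thesis
 by (rule normal_formI[of _ "(A + A', B + B', C + C', D + D')"]) (simp add: 1 2, simp add: nf_def algebra_simps)
qed

lemma normal_form_mult: assumes "normal_form f" "normal_form g" shows "normal_form (%z a b. f z a b * g z a b)"
proof -
 obtain A B C D where 1: "!!z a b. a ^ 2 = 1 - z ^ 2 ==> b ^ 2 = 1 + z ^ 2 ==> f z a b = nf (A, B, C, D) z a b"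
 using assms(1) unfolding normal_form_def by auto
 obtain A' B' C' D' where 2: "!!z a b. a ^ 2 = 1 - z ^ 2 ==> b ^ 2 = 1 + z ^ 2 ==> g z a b = nf (A', B', C', D') z a b"
 using assms(2) unfolding normal_form_def by auto
 show ?thesis
 proof (rule normal_formI[of _ "(A * A' + B * B' * pa + C * C' * pb + D * D' * pa * pb, A * B' + B * A' + (C * D' + D * C') * pb,
 A * C' + C * A' + (B * D' + D * B') * pa, A * D' + D * A' + B * C' + C * B')"])
 fix z a b :: complex assume ab: "a ^ 2 = 1 - z ^ 2" "b ^ 2 = 1 + z ^ 2"
 show "f z a b * g z a b = nf (A * A' + B * B' * pa + C * C' * pb + D * D' * pa * pb, A * B' + B * A' + (C * D' + D * C') * pb,
 A * C' + C * A' + (B * D' + D * B') * pa, A * D' + D * A' + B * C' + C * B') z a b"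
 proof -
 have "poly pa z = a * a" "poly pb z = b * b" using ab by (simp_all add: poly_pa poly_pb power2_eq_square)
 then show ?thesis unfolding 1[OF ab] 2[OF ab] by (simp add: nf_def algebra_simps)
 qed
 qed
qed

lemma normal_form_flip:
 assumes "normal_form f"
 shows "normal_form (%z a b. f z (- a) b)" "normal_form (%z a b. f z a (- b))"
proof -
 obtain A B C D where 1: "!!z a b. a ^ 2 = 1 - z ^ 2 ==> b ^ 2 = 1 + z ^ 2 ==> f z a b = nf (A, B, C, D) z a b"
 using assms(1) unfolding normal_form_def by auto
 show "normal_form (%z a b. f z (- a) b)"
 by (rule normal_formI[of _ "(A, - B, C, - D)"]) (simp add: 1, simp add: nf_def)
 show "normal_form (%z a b. f z a (- b))"
 by (rule normal_formI[of _ "(A, B, - C, - D)"]) (simp add: 1, simp add: nf_def)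
qed

text \<open>The curve in its original coordinates; \<open>N\<close> takes it to the cone
  \<open>qcone\<close>. In the chart s3 = 1 the curve is a^2 = 1 - z^2, b^2 = 1 + z^2, with z, a, b
  the functions \<open>zf\<close>, \<open>af\<close>, \<open>bf\<close>.\<close>

locale quartic_curve =
 fixes M N :: "complex ^ 4 ^ 4" and C :: "4 ppoint set"
 assumes N_M: "N ** M = mat 1" and M_N: "M ** N = mat 1"
 and C_def: "C = {p : proj_points. \<forall>v\<in>p. N *v v : qcone}"
begin

lemma N_M_vec [simp]: "N *v (M *v w) = w" and M_N_vec [simp]: "M *v (N *v w) = w"
 by (simp_all add: matrix_vector_mul_assoc N_M M_N)

lemma M_eq_0_iff [simp]: "M *v w = 0 \<longleftrightarrow> w = 0" and N_eq_0_iff [simp]: "N *v w = 0 \<longleftrightarrow> w = 0"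
 by (metis N_M_vec matrix_vector_mult_0_right, metis M_N_vec matrix_vector_mult_0_right)

definition pt :: "complex ^ 4 => 4 ppoint" where "pt s = hcoord (M *v s)"
definition co :: "4 ppoint => complex ^ 4" where "co p = N *v rep p"
definition aff :: "complex => complex => complex => 4 ppoint" where "aff z a b = pt (vector [a, z, 1, b])"
definition zf :: "4 ppoint => complex" where "zf p = co p $ 2 / co p $ 3"
definition af :: "4 ppoint => complex" where "af p = co p $ 1 / co p $ 3"
definition bf :: "4 ppoint => complex" where "bf p = co p $ 4 / co p $ 3"

lemma C_points: "C \<subseteq> proj_points" by (auto simp: C_def)

lemma pt_in_C: "s ~= 0 ==> pt s : C \<longleftrightarrow> s : qcone"
 unfolding C_def pt_def hcoord_eq_range
 using hcoord_in_proj_points[of "M *v s"] qcone_scale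
 by (auto simp: hcoord_eq_range vector_scalar_commute dest: spec[of _ 1])

lemma pt_scale: "c ~= 0 ==> pt (c *s s) = pt s"
 by (simp add: pt_def vector_scalar_commute hcoord_scale)

lemma co_pt:
 assumes "s ~= 0" obtains c where "c ~= 0" "co (pt s) = c *s s" "rep (pt s) = c *s (M *v s)"
proof -
 obtain c where c: "c ~= 0" "rep (pt s) = c *s (M *v s)" using rep_hcoord[of "M *v s"] assms unfolding pt_def by auto
 then have "co (pt s) = c *s s" by (simp add: co_def vector_scalar_commute)
 then show thesis using c that by blast
qed

lemma pt_co: "p : C ==> pt (co p) = p"
 using C_points hcoord_rep by (auto simp: pt_def co_def)

lemma co_nonzero: "p : C ==> co p ~= 0"
 using rep_in(2) C_points unfolding co_def by auto

lemma co_in_cone: "p : C ==> co p : qcone"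
 using rep_in(1) C_points unfolding co_def C_def by auto

lemma vector4_eq_0: "vector [x, y, z, w] = (0 :: complex ^ 4) \<longleftrightarrow> x = 0 & y = 0 & z = 0 & w = 0"
 by (simp add: vec_eq_iff forall_4)

lemma aff_in_C: "aff z a b : C \<longleftrightarrow> a ^ 2 = 1 - z ^ 2 & b ^ 2 = 1 + z ^ 2"
 unfolding aff_def by (subst pt_in_C) (auto simp: vector4_eq_0 qcone_def)

lemma co_aff:
 obtains c where "c ~= 0" "co (aff z a b) $ 1 = c * a" "co (aff z a b) $ 2 = c * z" "co (aff z a b) $ 3 = c"
 "co (aff z a b) $ 4 = c * b" "rep (aff z a b) = c *s (M *v vector [a, z, 1, b])"
proof -
 have "vector [a, z, 1, b] ~= (0 :: complex ^ 4)" by (simp add: vector4_eq_0)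
 then obtain c where "c ~= 0" "co (aff z a b) = c *s vector [a, z, 1, b]" "rep (aff z a b) = c *s (M *v vector [a, z, 1, b])"
 unfolding aff_def using co_pt by blast
 then show thesis using that[of c] by simp
qed

lemma zf_aff [simp]: "zf (aff z a b) = z" and af_aff [simp]: "af (aff z a b) = a" and bf_aff [simp]: "bf (aff z a b) = b"
proof -
 obtain c where c: "c ~= 0" "co (aff z a b) $ 1 = c * a" "co (aff z a b) $ 2 = c * z" "co (aff z a b) $ 3 = c"
 "co (aff z a b) $ 4 = c * b" by (rule co_aff)
 then show "zf (aff z a b) = z" "af (aff z a b) = a" "bf (aff z a b) = b" by (simp_all add: zf_def af_def bf_def)
qed

lemma co3_aff: "co (aff z a b) $ 3 ~= 0"
proof -
 obtain c where "c ~= 0" "co (aff z a b) $ 3 = c" by (rule co_aff)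
 then show ?thesis by simp
qed

lemma C_cases:
 assumes "p : C"
 obtains "p : {pt (vector [e, 1, 0, f]) | e f. e : {\<i>, - \<i>} & f : {1, - 1}}"
 | "p = aff (zf p) (af p) (bf p)" "af p ^ 2 = 1 - zf p ^ 2" "bf p ^ 2 = 1 + zf p ^ 2"
proof (cases "co p $ 3 = 0")
 case True
 have 1: "(co p $ 1) ^ 2 = - ((co p $ 2) ^ 2)" "(co p $ 4) ^ 2 = (co p $ 2) ^ 2"
 using co_in_cone[OF assms] True by (auto simp: qcone_def)
 have "co p $ 2 ~= 0"
 proof
 assume "co p $ 2 = 0"
 then have "co p = 0" using 1 True by (simp add: vec_eq_iff forall_4)
 then show False using co_nonzero[OF assms] by simp
 qed
 define e f where "e = co p $ 1 / co p $ 2" and "f = co p $ 4 / co p $ 2"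
 have "e ^ 2 = \<i> ^ 2" "f ^ 2 = 1 ^ 2" using 1 \<open>co p $ 2 ~= 0\<close> by (simp_all add: e_def f_def power_divide)
 then have ef: "e : {\<i>, - \<i>}" "f : {1, - 1}" unfolding power2_eq_iff by auto
 have "co p = co p $ 2 *s vector [e, 1, 0, f]" using \<open>co p $ 2 ~= 0\<close> True by (simp add: vec_eq_iff forall_4 e_def f_def)
 then have "pt (co p) = pt (vector [e, 1, 0, f])" using pt_scale[OF \<open>co p $ 2 ~= 0\<close>] by metis
 then have "p = pt (vector [e, 1, 0, f])" using pt_co[OF assms] by simp
 then show thesis using ef that(1) by blast
next
 case False
 then have "co p = co p $ 3 *s vector [af p, zf p, 1, bf p]" by (simp add: vec_eq_iff forall_4 af_def zf_def bf_def)
 then have "pt (co p) = aff (zf p) (af p) (bf p)" unfolding aff_def using pt_scale[OF False] by metis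
 then have p: "p = aff (zf p) (af p) (bf p)" using pt_co[OF assms] by simp
 then have "af p ^ 2 = 1 - zf p ^ 2 & bf p ^ 2 = 1 + zf p ^ 2" using aff_in_C assms by metis
 with p that(2) show thesis by blast
qed

lemma finite_square_roots: "finite {y :: complex. y ^ 2 = c}"
proof -
 have "{y. y ^ 2 = c} = {y. poly [:- c, 0, 1:] y = 0}" by (auto simp: power2_eq_square)
 then show ?thesis using poly_roots_finite[of "[:- c, 0, 1:]"] by simp
qed

lemma eventually_affine:
 assumes "Q ~= 0" "!!z a b. a ^ 2 = 1 - z ^ 2 ==> b ^ 2 = 1 + z ^ 2 ==> poly Q z ~= 0 ==> P (aff z a b)"
 shows "eventually P (almost C)"
proof -
 let ?I = "(%(e, f). pt (vector [e, 1, 0, f])) ` ({\<i>, - \<i>} \<times> {1, - 1})"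
 let ?T = "\<Union>z\<in>{z. poly Q z = 0}. (%(a, b). aff z a b) ` ({a. a ^ 2 = 1 - z ^ 2} \<times> {b. b ^ 2 = 1 + z ^ 2})"
 have "finite (?I \<union> ?T)" using finite_square_roots poly_roots_finite[OF assms(1)] by auto
 moreover have "{p\<in>C. \<not> P p} \<subseteq> ?I \<union> ?T"
 proof
 fix p assume "p : {p\<in>C. \<not> P p}"
 then have p: "p : C" "\<not> P p" by auto
 from p(1) show "p : ?I \<union> ?T"
 proof (rule C_cases)
 assume "p : {pt (vector [e, 1, 0, f]) | e f. e : {\<i>, - \<i>} & f : {1, - 1}}"
 then show ?thesis by blast
 next
 assume a: "p = aff (zf p) (af p) (bf p)" "af p ^ 2 = 1 - zf p ^ 2" "bf p ^ 2 = 1 + zf p ^ 2"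
 then have "poly Q (zf p) = 0" using assms(2) p(2) by metis
 then have "aff (zf p) (af p) (bf p) : ?T" using a(2,3) by blast
 then show ?thesis using a(1) by simp
 qed
 qed
 ultimately show ?thesis unfolding eventually_almost by (rule finite_subset[rotated])
qed

lemma almost_affine:
 assumes "eventually P (almost C)"
 obtains A where "finite A" "!!z a b. a ^ 2 = 1 - z ^ 2 ==> b ^ 2 = 1 + z ^ 2 ==> z \<notin> A ==> P (aff z a b)"
proof (rule that[of "zf ` {p\<in>C. \<not> P p}"])
 fix z a b :: complex
 assume ab: "a ^ 2 = 1 - z ^ 2" "b ^ 2 = 1 + z ^ 2" and z: "z \<notin> zf ` {p\<in>C. \<not> P p}"
 show "P (aff z a b)"
 proof (rule ccontr)
 assume "\<not> P (aff z a b)"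
 then have "zf (aff z a b) : zf ` {p\<in>C. \<not> P p}" using ab by (intro imageI) (simp add: aff_in_C)
 then show False using z by simp
 qed
qed (use assms in \<open>simp add: eventually_almost\<close>)

lemma form_normal_form:
 assumes "hpoly d P"
 shows "normal_form (%z a b. P (M *v vector [a, z, 1, b]))"
 using assms
proof (induction rule: hom_poly_induct)
 case (coord i)
 show ?case
 using normal_form_linear[of "M $ i $ 1" "M $ i $ 2" "M $ i $ 3" "M $ i $ 4"]
 by (simp add: matrix_vector_mult_def sum_4)
qed (auto intro: normal_form_const normal_form_add normal_form_mult)

lemma nf_nonzero:
 assumes "(A, B, C', D) ~= (0, 0, 0, 0)"
 shows "ev C (%p. nf (A, B, C', D) (zf p) (af p) (bf p) ~= 0)"
proof (rule eventually_affine)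
 show "qnorm A B C' D ~= 0" using qnorm_eq_0D[of A B C' D] assms by auto
 fix z a b assume ab: "a ^ 2 = 1 - z ^ 2" "b ^ 2 = 1 + z ^ 2" "poly (qnorm A B C' D) z ~= 0"
 then show "nf (A, B, C', D) (zf (aff z a b)) (af (aff z a b)) (bf (aff z a b)) ~= 0"
 using nf_norm[OF ab(1,2), of A B C' D] by auto
qed

lemma infinite_C: "infinite C"
proof
 assume "finite C"
 moreover have "zf ` C = UNIV"
 proof (intro equalityI subsetI)
 fix z :: complex
 have "aff z (csqrt (1 - z ^ 2)) (csqrt (1 + z ^ 2)) : C" by (simp add: aff_in_C)
 then show "z : zf ` C" using zf_aff by force
 qed simp
 ultimately show False using infinite_UNIV_char_0[where 'a = complex] finite_imageI[of C zf] by simp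
qed

lemma rep_aff_form:
 assumes "hpoly d P"
 shows "P (rep (aff z a b)) = (co (aff z a b) $ 3) ^ d * P (M *v vector [a, z, 1, b])"
proof -
 obtain c where "co (aff z a b) $ 3 = c" "rep (aff z a b) = c *s (M *v vector [a, z, 1, b])" by (rule co_aff)
 then show ?thesis using hom_poly_scale[OF assms] by simp
qed

sublocale irreducible_curve C
proof unfold_locales
 fix d and P :: "complex ^ 4 => complex" assume P: "hpoly d P"
 obtain A B C' D where Q: "!!z a b. a ^ 2 = 1 - z ^ 2 ==> b ^ 2 = 1 + z ^ 2 ==> P (M *v vector [a, z, 1, b]) = nf (A, B, C', D) z a b"
 using form_normal_form[OF P] unfolding normal_form_def by auto
 have rep: "ev C (%p. P (rep p) = 0 \<longleftrightarrow> nf (A, B, C', D) (zf p) (af p) (bf p) = 0)"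
 by (rule eventually_affine[of 1]) (auto simp: rep_aff_form[OF P] co3_aff Q)
 show "ev C (%p. P (rep p) ~= 0) | ev C (%p. P (rep p) = 0)"
 proof (cases "(A, B, C', D) = (0, 0, 0, 0)")
 case True
 have "ev C (%p. P (rep p) = 0)"
 using rep by eventually_elim (use True in \<open>simp add: nf_def\<close>)
 then show ?thesis ..
 next
 case False
 from nf_nonzero[OF False] rep have "ev C (%p. P (rep p) ~= 0)" by eventually_elim simp
 then show ?thesis ..
 qed
qed (use C_points infinite_C in auto)

lemma nf_unique:
 assumes "ev C (%p. nf (A, B, C', D) (zf p) (af p) (bf p) = 0)"
 shows "A = 0" "B = 0" "C' = 0" "D = 0"
proof -
 have "(A, B, C', D) = (0, 0, 0, 0)"
 proof (rule ccontr)
 assume "(A, B, C', D) ~= (0, 0, 0, 0)"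
 from nf_nonzero[OF this] assms have "ev C (%p. False)" by eventually_elim simp
 then show False using almost_neq_bot by simp
 qed
 then show "A = 0" "B = 0" "C' = 0" "D = 0" by auto
qed

lemma homogeneous_coordinate: "hpoly 1 (%v. (N *v v) $ i)"
 by (rule hom_poly_linear)

lemma eventually_curve: "ev C (%p. af p ^ 2 = 1 - zf p ^ 2 & bf p ^ 2 = 1 + zf p ^ 2)"
 by (rule eventually_affine[of 1]) auto

lemma eventually_co3: "ev C (%p. co p $ 3 ~= 0)"
 by (rule eventually_affine[of 1]) (simp_all add: co3_aff)

lemma eventually_poly_zf: "Q ~= 0 ==> ev C (%p. poly Q (zf p) ~= 0)"
 by (rule eventually_affine[of Q]) auto

text \<open>The denominator is multiplied by its three conjugates under the sign changes of a and
  b.\<close>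

lemma rational_normal_form:
 assumes "rational C f"
 shows "EX Q E. E ~= 0 & ev C (%p. f p * poly E (zf p) = nf Q (zf p) (af p) (bf p))"
proof -
 obtain d P R where 1: "hpoly d P" "hpoly d R"
 "ev C (%q. R (rep q) ~= 0 & f q = P (rep q) / R (rep q))" using rationalE[OF assms] .
 let ?P = "%z a b. P (M *v vector [a, z, 1, b])" and ?R = "%z a b. R (M *v vector [a, z, 1, b])"
 have nR: "normal_form ?R" and nP: "normal_form ?P" using form_normal_form 1 by blast+
 have "normal_form (%z a b. ?P z a b * (?R z (- a) b * ?R z a (- b) * ?R z (- a) (- b)))"
 using normal_form_mult[OF nP normal_form_mult[OF normal_form_mult[OF normal_form_flip(1)[OF nR] normal_form_flip(2)[OF nR]]
 normal_form_flip(1)[OF normal_form_flip(2)[OF nR]]]] .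
 then obtain Q where Q: "!!z a b. a ^ 2 = 1 - z ^ 2 ==> b ^ 2 = 1 + z ^ 2 ==>
 ?P z a b * (?R z (- a) b * ?R z a (- b) * ?R z (- a) (- b)) = nf Q z a b"
 unfolding normal_form_def by auto
 obtain A B C' D where R: "!!z a b. a ^ 2 = 1 - z ^ 2 ==> b ^ 2 = 1 + z ^ 2 ==> ?R z a b = nf (A, B, C', D) z a b"
 using nR unfolding normal_form_def by auto
 define E where "E = qnorm A B C' D"
 have norm: "?R z a b * (?R z (- a) b * ?R z a (- b) * ?R z (- a) (- b)) = poly E z"
 if "a ^ 2 = 1 - z ^ 2" "b ^ 2 = 1 + z ^ 2" for z a b
 using nf_norm[OF that, of A B C' D] that by (simp add: R E_def)
 have ev: "ev C (%p. R (rep p) ~= 0 --> nf (A, B, C', D) (zf p) (af p) (bf p) ~= 0 &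
 (P (rep p) / R (rep p)) * poly E (zf p) = nf Q (zf p) (af p) (bf p))"
 proof (rule eventually_affine[of 1])
 fix z a b :: complex assume ab: "a ^ 2 = 1 - z ^ 2" "b ^ 2 = 1 + z ^ 2"
 show "R (rep (aff z a b)) ~= 0 --> nf (A, B, C', D) (zf (aff z a b)) (af (aff z a b)) (bf (aff z a b)) ~= 0 &
 (P (rep (aff z a b)) / R (rep (aff z a b))) * poly E (zf (aff z a b)) = nf Q (zf (aff z a b)) (af (aff z a b)) (bf (aff z a b))"
 unfolding rep_aff_form[OF 1(1)] rep_aff_form[OF 1(2)] zf_aff af_aff bf_aff norm[OF ab, symmetric] Q[OF ab, symmetric] R[OF ab, symmetric]
 using co3_aff[of z a b] by simp
 qed simp
 have "ev C (%p. nf (A, B, C', D) (zf p) (af p) (bf p) ~= 0)"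
 using ev 1(3) by eventually_elim simp
 then have "(A, B, C', D) ~= (0, 0, 0, 0)"
 using almost_neq_bot by (auto simp: nf_def)
 then have "E ~= 0" unfolding E_def using qnorm_eq_0D by blast
 moreover have "ev C (%p. f p * poly E (zf p) = nf Q (zf p) (af p) (bf p))"
 using ev 1(3) by eventually_elim simp
 ultimately show ?thesis by blast
qed

text \<open>Used to isolate one of the four components of a normal form from its values at (a, b),
  (-a, b), (a, -b), (-a, -b), as a signed average.\<close>

lemma norm_sum4: "norm (w :: complex) <= K ==> norm x <= K ==> norm y <= K ==> norm z <= K ==>
 4 * v = w + x + y + z ==> norm v <= K"
proof -
 assume 1: "norm w <= K" "norm x <= K" "norm y <= K" "norm z <= K" "4 * v = w + x + y + z"
 have "norm (4 * v) <= norm w + norm x + norm y + norm z" unfolding 1(5)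
 by (intro norm_triangle_le add_mono order_refl)
 moreover have "norm (4 * v) = 4 * norm v" by (simp add: norm_mult)
 ultimately show ?thesis using 1 by linarith
qed

text \<open>The bound is inherited by each of A, a B, b C', a b D over the denominator. As a^2, b^2
  and (a b)^2 are squarefree of degrees 2, 2 and 4, \<open>rational_growth\<close> yields
  polynomials of the stated degrees.\<close>

lemma bounded_rational_normal_form:
 assumes f: "rational C f" and bound: "ev C (%p. norm (f p) <= K * (1 + norm (zf p)) ^ n)"
 shows "EX A B C' D. ev C (%p. f p = nf (A, B, C', D) (zf p) (af p) (bf p)) &
 pdeg A <= n & (B = 0 | pdeg B + 1 <= n) & (C' = 0 | pdeg C' + 1 <= n) &
 (D = 0 | pdeg D + 2 <= n)"
proof -
 obtain A B C' D E where E: "E ~= 0"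
 and eq: "ev C (%p. f p * poly E (zf p) = nf (A, B, C', D) (zf p) (af p) (bf p))"
 using rational_normal_form[OF f] by auto
 have "ev C (%p. norm (nf (A, B, C', D) (zf p) (af p) (bf p)) <= K * (1 + norm (zf p)) ^ n * norm (poly E (zf p)))"
 using eq bound
 proof eventually_elim
 case (elim p)
 have "norm (f p * poly E (zf p)) <= K * (1 + norm (zf p)) ^ n * norm (poly E (zf p))"
 unfolding norm_mult using elim(2) by (rule mult_right_mono) simp
 then show ?case using elim(1) by simp
 qed
 then obtain T where T: "finite T" "!!z a b. a ^ 2 = 1 - z ^ 2 ==> b ^ 2 = 1 + z ^ 2 ==> z \<notin> T ==>
 norm (nf (A, B, C', D) (zf (aff z a b)) (af (aff z a b)) (bf (aff z a b))) <= K * (1 + norm (zf (aff z a b))) ^ n * norm (poly E (zf (aff z a b)))"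
 using almost_affine by blast
 note T = T(1) T(2)[unfolded zf_aff af_aff bf_aff]
 define a b where "a z = csqrt (1 - z ^ 2)" and "b z = csqrt (1 + z ^ 2)" for z
 have ab: "a z ^ 2 = 1 - z ^ 2" "b z ^ 2 = 1 + z ^ 2" for z by (simp_all add: a_def b_def)
 let ?K = "%z. K * (1 + norm z) ^ n * norm (poly E z)"
 have parts: "norm (poly A z) <= ?K z & norm (a z * poly B z) <= ?K z & norm (b z * poly C' z) <= ?K z & norm (a z * b z * poly D z) <= ?K z"
 if z: "z \<notin> T" for z
 proof -
 have ab': "(- a z) ^ 2 = 1 - z ^ 2" "(- b z) ^ 2 = 1 + z ^ 2" using ab[of z] by simp_all
 have n: "norm (nf (A, B, C', D) z (a z) (b z)) <= ?K z" "norm (nf (A, B, C', D) z (- a z) (b z)) <= ?K z"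
 "norm (nf (A, B, C', D) z (a z) (- b z)) <= ?K z" "norm (nf (A, B, C', D) z (- a z) (- b z)) <= ?K z"
 using T(2) ab ab' z by blast+
 then have m: "norm (- nf (A, B, C', D) z (- a z) (b z)) <= ?K z"
 "norm (- nf (A, B, C', D) z (a z) (- b z)) <= ?K z" "norm (- nf (A, B, C', D) z (- a z) (- b z)) <= ?K z"
 by simp_all
 have "norm (poly A z) <= ?K z" by (rule norm_sum4[OF n]) (simp add: nf_def)
 moreover have "norm (a z * poly B z) <= ?K z" by (rule norm_sum4[OF n(1) m(1) n(3) m(3)]) (simp add: nf_def)
 moreover have "norm (b z * poly C' z) <= ?K z" by (rule norm_sum4[OF n(1) n(2) m(2) m(3)]) (simp add: nf_def)
 moreover have "norm (a z * b z * poly D z) <= ?K z" by (rule norm_sum4[OF n(1) m(1) m(2) n(4)]) (simp add: nf_def)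
 ultimately show ?thesis by blast
 qed
 have sq: "(?K z) ^ 2 = K ^ 2 * (1 + norm z) ^ (2 * n) * norm (poly E z) ^ 2" for z
 by (simp add: power_mult_distrib power_mult[symmetric] mult.commute)
 have growth: "EX r. p = E * r & (r = 0 | 2 * pdeg r + pdeg k <= 2 * n)"
 if k: "!!z. poly k z = 0 ==> poly (pderiv k) z ~= 0" and w: "!!z. w z ^ 2 = poly k z"
 and bd: "!!z. z \<notin> T ==> norm (w z * poly p z) <= ?K z" for p k w
 proof (rule rational_growth[OF T(1) _ E k])
 fix z assume "z \<notin> T"
 from power_mono[OF bd[OF this], of 2]
 have "norm (w z * poly p z) ^ 2 <= (?K z) ^ 2" by simp
 moreover have "norm (w z * poly p z) ^ 2 = norm (poly p z) ^ 2 * norm (poly k z)"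
 unfolding w[symmetric] by (simp add: norm_mult norm_power power_mult_distrib)
 ultimately show "norm (poly p z) ^ 2 * norm (poly k z) <= K ^ 2 * (1 + norm z) ^ (2 * n) * norm (poly E z) ^ 2"
 by (simp add: sq)
 qed
 obtain rA where rA: "A = E * rA" "rA = 0 | 2 * pdeg rA + pdeg (1 :: complex poly) <= 2 * n"
 using growth[of 1 "%_. 1" A] parts by auto
 obtain rB where rB: "B = E * rB" "rB = 0 | 2 * pdeg rB + pdeg pa <= 2 * n"
 using growth[of pa a B] simple_roots_pa parts by (auto simp: poly_pa ab)
 obtain rC where rC: "C' = E * rC" "rC = 0 | 2 * pdeg rC + pdeg pb <= 2 * n"
 using growth[of pb b C'] simple_roots_pb parts by (auto simp: poly_pb ab)
 obtain rD where rD: "D = E * rD" "rD = 0 | 2 * pdeg rD + pdeg (pa * pb) <= 2 * n"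
 using growth[of "pa * pb" "%z. a z * b z" D] simple_roots_pa_pb parts by (auto simp: poly_pa poly_pb ab power_mult_distrib)
 have degs: "pdeg pa = 2" "pdeg pb = 2" "pdeg (pa * pb) = 4"
 using pa_pb_nonzero by (simp_all add: degree_mult_eq) (simp_all add: pa_def pb_def)
 have "ev C (%p. f p = nf (rA, rB, rC, rD) (zf p) (af p) (bf p))"
 using eq eventually_poly_zf[OF E]
 proof eventually_elim
 case (elim p)
 have "f p * poly E (zf p) = nf (rA, rB, rC, rD) (zf p) (af p) (bf p) * poly E (zf p)"
 unfolding elim(1) by (simp add: nf_def rA(1) rB(1) rC(1) rD(1) algebra_simps)
 then show ?case using elim(2) by simp
 qed
 moreover have "pdeg rA <= n" using rA(2) by auto
 moreover have "rB = 0 | pdeg rB + 1 <= n" using rB(2) degs by auto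
 moreover have "rC = 0 | pdeg rC + 1 <= n" using rC(2) degs by auto
 moreover have "rD = 0 | pdeg rD + 2 <= n" using rD(2) degs by auto
 ultimately show ?thesis by blast
qed

text \<open>Linear normality of the quartic: functions growing like the hyperplane class s3 = 0 are
  linear forms over s3.\<close>

lemma bounded_rational_linear:
 assumes f: "rational C f" and bound: "ev C (%p. norm (f p) <= K * (1 + norm (zf p)))"
 shows "\<exists>r :: complex ^ 4. ev C (%p. f p = (\<Sum>j\<in>UNIV. r $ j * (co p $ j / co p $ 3)))"
proof -
 obtain A B C' D where 1: "ev C (%p. f p = nf (A, B, C', D) (zf p) (af p) (bf p))"
 "pdeg A <= 1" "B = 0 | pdeg B + 1 <= 1" "C' = 0 | pdeg C' + 1 <= 1" "D = 0"
 using bounded_rational_normal_form[OF f, of K 1] bound by auto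
 have "pdeg B = 0" "pdeg C' = 0" using 1(3,4) by auto
 then obtain cB cC where cB: "B = [:cB:]" and cC: "C' = [:cC:]" by (metis degree_eq_zeroE)
 have A: "A = [:Polynomial.coeff A 0, Polynomial.coeff A 1:]"
 using 1(2) by (intro poly_eqI) (auto simp: coeff_pCons coeff_eq_0 split: nat.split)
 have "ev C (%p. f p = (\<Sum>j\<in>UNIV. vector [cB, Polynomial.coeff A 1, Polynomial.coeff A 0, cC] $ j * (co p $ j / co p $ 3)))"
 using 1(1) eventually_co3
 proof eventually_elim
 case (elim p)
 show ?case unfolding elim(1) using elim(2)
 by (subst A) (simp add: nf_def cB cC 1(5) sum_4 zf_def af_def bf_def algebra_simps)
 qed
 then show ?thesis by blast
qed

lemma bounded_rational_const:
 assumes f: "rational C f" and bound: "ev C (%p. norm (f p) <= K)"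
 shows "EX c. ev C (%p. f p = c)"
proof -
 obtain A B C' D where 1: "ev C (%p. f p = nf (A, B, C', D) (zf p) (af p) (bf p))"
 "pdeg A = 0" "B = 0" "C' = 0" "D = 0"
 using bounded_rational_normal_form[OF f, of K 0] bound by auto
 then obtain c where "A = [:c:]" by (metis degree_eq_zeroE)
 with 1 have "ev C (%p. f p = c)" by (simp add: nf_def)
 then show ?thesis ..
qed

text \<open>The curve lies in no plane. Many identities of matrices below are checked on the curve,
  row by row, through this.\<close>

lemma linear_independent:
 fixes r :: "complex ^ 4"
 assumes "ev C (%p. (\<Sum>j\<in>UNIV. r $ j * co p $ j) = 0)"
 shows "r = 0"
proof -
 have "ev C (%p. nf ([:r $ 3, r $ 2:], [:r $ 1:], [:r $ 4:], 0) (zf p) (af p) (bf p) = 0)"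
 using assms eventually_co3
 proof eventually_elim
 case (elim p)
 have "nf ([:r $ 3, r $ 2:], [:r $ 1:], [:r $ 4:], 0) (zf p) (af p) (bf p) = (\<Sum>j\<in>UNIV. r $ j * co p $ j) / co p $ 3"
 using elim(2) by (simp add: nf_def sum_4 zf_def af_def bf_def field_simps)
 then show ?case using elim(1) by simp
 qed
 from nf_unique[OF this] show ?thesis by (simp add: vec_eq_iff forall_4)
qed

end

section \<open>Equations of lines, and compactness of the cone\<close>

lemma line_basis:
 fixes l :: "(complex ^ 4) set"
 assumes "l : proj_lines"
 obtains b1 b2 x y where "b1 ~= b2" "x ~= y" "vec.independent {b1, b2, x, y}" "l = vec.span {b1, b2}"
 "vec.span {b1, b2, x, y} = UNIV" "card {b1, b2, x, y} = 4"
proof -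
 have l: "vec.subspace l" "vec.dim l = 2" using assms by (auto simp: proj_lines_def)
 obtain B where B: "B \<subseteq> l" "vec.independent B" "l \<subseteq> vec.span B" "card B = 2"
 using vec.basis_exists[of l] l(2) by metis
 have lB: "l = vec.span B" using B l(1) by (simp add: vec.span_minimal subset_antisym)
 obtain b1 b2 where b: "B = {b1, b2}" "b1 ~= b2" using B(4) by (auto simp: card_2_iff)
 obtain T where T: "B \<subseteq> T" "vec.independent T" "UNIV \<subseteq> vec.span T"
 using vec.maximal_independent_subset_extend[of B UNIV] B(2) by auto
 have "card T = vec.dim (UNIV :: (complex ^ 4) set)"
 using T by (metis vec.basis_card_eq_dim subset_UNIV)
 then have cT: "card T = 4" unfolding vec_dim_card by simp
 then have "finite T" using card.infinite by fastforce
 then have "card (T - B) = 2" using cT B(4) T(1) by (simp add: card_Diff_subset finite_subset)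
 then obtain x y where xy: "T - B = {x, y}" "x ~= y" by (auto simp: card_2_iff)
 have "T = {b1, b2, x, y}" using xy(1) T(1) b(1) by blast
 then show thesis using that[OF b(2) xy(2)] T lB b(1) cT by auto
qed

text \<open>Shows that the choice of a matrix in \<open>line_subfield\<close> is not vacuous. The
  basis of the line is extended by x, y, and the matrix is dual to these two vectors.\<close>

lemma line_equations_exist:
 fixes l :: "(complex ^ 4) set"
 assumes "l : proj_lines"
 shows "\<exists>(A :: complex ^ 4 ^ 2) R. {v. A *v v = 0} = l & A ** R = mat 1"
proof -
 obtain b1 b2 x y where b: "b1 ~= b2" "x ~= y" "vec.independent {b1, b2, x, y}" "l = vec.span {b1, b2}"
 "vec.span {b1, b2, x, y} = UNIV" "card {b1, b2, x, y} = 4" by (rule line_basis[OF assms])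
 have dist: "x \<notin> {b1, b2}" "y \<notin> {b1, b2}" using b(1,2,6) by (auto simp: card_insert_if split: if_splits)
 obtain g where g: "Vector_Spaces.linear (*s) (*s) g"
 "\<forall>v\<in>{b1, b2, x, y}. g v = (if v = x then axis 1 1 else if v = y then axis 2 1 else 0 :: complex ^ 2)"
 using vec.linear_independent_extend[OF b(3), of "%v. if v = x then axis 1 1 else if v = y then axis 2 1 else 0"] by blast
 define A where "A = matrix g"
 have A: "A *v v = g v" for v unfolding A_def using matrix_works[OF g(1)] by simp
 have vals: "A *v b1 = 0" "A *v b2 = 0" "A *v x = axis 1 1" "A *v y = axis 2 1"
 using g(2) dist b(2) by (auto simp: A)
 have "{v. A *v v = 0} = l"
 proof (intro equalityI subsetI)
 fix v assume v: "v : {v. A *v v = 0}"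
 have "v : vec.span {x, y, b1, b2}" using b(5) by (simp add: insert_commute)
 then obtain c where "v - c *s x : vec.span {y, b1, b2}" unfolding vec.span_insert[of x] by blast
 then obtain d where d: "v - c *s x - d *s y : vec.span {b1, b2}" unfolding vec.span_insert[of y] by blast
 have ker: "A *v w = 0" if "w : vec.span {b1, b2}" for w
 using that by (rule vec.span_induct) (auto simp: vals vec.subspace_def vec.add vec.scale)
 have "A *v (v - c *s x - d *s y) = 0" using ker d by blast
 moreover have "(A *v (v - c *s x - d *s y)) $ 1 = - c" "(A *v (v - c *s x - d *s y)) $ 2 = - d"
 using v by (simp_all add: matrix_vector_mult_diff_distrib vector_scalar_commute vals axis_def)
 ultimately have "c = 0" "d = 0" by simp_all
 then show "v : l" using d b(4) by simp
 next
 fix v assume "v : l"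
 then have "v : vec.span {b1, b2}" using b(4) by simp
 then show "v : {v. A *v v = 0}"
 by (rule vec.span_induct) (auto simp: vals vec.subspace_def vec.add vec.scale)
 qed
 moreover have "A ** (\<chi> i j. if j = 1 then x $ i else y $ i) = mat 1" (is "A ** ?R = _")
 proof -
 have "(A ** ?R) $ i $ 1 = (A *v x) $ i" "(A ** ?R) $ i $ 2 = (A *v y) $ i" for i
 by (simp_all add: matrix_matrix_mult_def matrix_vector_mult_def)
 then show ?thesis by (simp add: vec_eq_iff forall_2 vals axis_def mat_def)
 qed
 ultimately show ?thesis by blast
qed

lemma line_equations_surj:
 fixes A :: "complex ^ 4 ^ 2"
 assumes l: "l : proj_lines" and A: "{v. A *v v = 0} = l"
 shows "\<exists>R :: complex ^ 2 ^ 4. A ** R = mat 1"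
proof -
 obtain A0 :: "complex ^ 4 ^ 2" and R where 0: "{v. A0 *v v = 0} = l" "A0 ** R = mat 1"
 using line_equations_exist[OF l] by blast
 have "w = 0" if "(A ** R) *v w = 0" for w
 proof -
 have "R *v w : l" using that A by (auto simp: matrix_vector_mul_assoc)
 then have "A0 *v (R *v w) = 0" using 0(1) by blast
 then show "w = 0" by (simp add: matrix_vector_mul_assoc 0(2))
 qed
 then obtain T where "T ** (A ** R) = mat 1" using matrix_left_invertible_ker[of "A ** R"] by blast
 then have "(A ** R) ** T = mat 1" by (simp add: matrix_left_right_inverse)
 then show ?thesis by (metis matrix_mul_assoc)
qed

lemma line_meets_plane:
 fixes l :: "(complex ^ 4) set"
 assumes l: "l : proj_lines"
 shows "\<exists>v\<in>l. v ~= 0 & (\<Sum>j\<in>UNIV. r $ j * v $ j) = 0"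
proof -
 obtain b1 b2 x y where b: "b1 ~= b2" "vec.independent {b1, b2, x, y}" "l = vec.span {b1, b2}"
 using line_basis[OF l] by metis
 have "vec.independent {b1, b2}" using b(2) by (rule vec.independent_mono) auto
 then have ind: "b1 \<notin> vec.span {b2}" "b2 \<notin> vec.span {b1}"
 using b(1) by (auto simp: vec.dependent_def insert_Diff_if split: if_splits)
 let ?f = "%v. \<Sum>j\<in>UNIV. r $ j * v $ j"
 have lin: "?f (c *s v - d *s w) = c * ?f v - d * ?f w" for c d and v w :: "complex ^ 4"
 by (simp add: sum_4 algebra_simps)
 show ?thesis
 proof (cases "?f b1 = 0")
 case True
 moreover have "b1 ~= 0" using ind(1) vec.span_zero by auto
 moreover have "b1 : l" using b(3) by (simp add: vec.span_base)
 ultimately show ?thesis by blast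
 next
 case False
 let ?v = "?f b1 *s b2 - ?f b2 *s b1"
 have "?v ~= 0"
 proof
 assume "?v = 0"
 then have "?f b1 *s b2 = ?f b2 *s b1" by simp
 then have "(1 / ?f b1) *s (?f b1 *s b2) = (1 / ?f b1) *s (?f b2 *s b1)" by simp
 then have "b2 = (?f b2 / ?f b1) *s b1" using False by (simp only: vec.scale_scale) simp
 then show False using ind(2) by (metis vec.span_base vec.span_scale singletonI)
 qed
 moreover have "?v : l" unfolding b(3) by (intro vec.span_diff vec.span_scale vec.span_base) auto
 moreover have "?f ?v = 0" unfolding lin by simp
 ultimately show ?thesis by blast
 qed
qed

text \<open>The norm of \<open>L *v s\<close> has a positive minimum on the compact set of unit
  vectors of the cone; homogeneity does the rest.\<close>

lemma qcone_bound:
 fixes L :: "complex ^ 4 ^ 'k::finite"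
 assumes "!!s. s : qcone ==> L *v s = 0 ==> s = 0"
 shows "EX K. \<forall>s\<in>qcone. norm s <= K * norm (L *v s)"
proof -
 have cont: "continuous_on UNIV (%s :: complex ^ 4. s $ i)" for i by (intro continuous_intros)
 have "closed qcone" unfolding qcone_def
 by (intro closed_Collect_conj closed_Collect_eq continuous_intros)
 then have "compact (sphere 0 1 \<inter> qcone)" by (intro compact_Int_closed) auto
 moreover have "vector [0, 1, 1, root2] : qcone" by (simp add: qcone_def)
 have normalize: "complex_of_real (1 / norm s) *s s : sphere 0 1 \<inter> qcone" if "s : qcone" "s ~= 0" for s
 proof -
 have "complex_of_real (1 / norm s) *s s = (1 / norm s) *\<^sub>R s"
 by (simp only: vec_eq_iff vector_scaleR_component vector_smult_component) (simp add: scaleR_conv_of_real)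
 then have "norm (complex_of_real (1 / norm s) *s s) = 1" using that(2) by simp
 then show ?thesis using qcone_scale[OF that(1)] by simp
 qed
 have "vector [0, 1, 1, root2] ~= (0 :: complex ^ 4)" by (simp add: vec_eq_iff forall_4)
 then have "sphere 0 1 \<inter> qcone ~= {}" using normalize \<open>vector [0, 1, 1, root2] : qcone\<close> by blast
 moreover have "continuous_on (sphere 0 1 \<inter> qcone) (%s. norm (L *v s))"
 unfolding matrix_vector_mult_def by (intro continuous_intros)
 ultimately obtain s0 where s0: "s0 : sphere 0 1 \<inter> qcone"
 "!!s. s : sphere 0 1 \<inter> qcone ==> norm (L *v s0) <= norm (L *v s)"
 using continuous_attains_inf by metis
 have pos: "norm (L *v s0) > 0" using assms s0(1) by force
 have "norm s <= (1 / norm (L *v s0)) * norm (L *v s)" if s: "s : qcone" for s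
 proof (cases "s = 0")
 case False
 have "norm (L *v s0) <= norm (L *v (complex_of_real (1 / norm s) *s s))" using s0(2) normalize[OF s False] by blast
 also have "L *v (complex_of_real (1 / norm s) *s s) = (1 / norm s) *\<^sub>R (L *v s)"
 unfolding vector_scalar_commute
 by (simp only: vec_eq_iff vector_scaleR_component vector_smult_component) (simp add: scaleR_conv_of_real)
 finally show ?thesis using pos False by (simp add: field_simps)
 qed simp
 then show ?thesis by blast
qed

lemma norm_vec2_le: "norm (v :: complex ^ 2) <= norm (v $ 1) + norm (v $ 2)"
 unfolding norm_vec_def by (simp add: L2_set_def sum_2 sqrt_sum_squares_le_sum)

context quartic_curve
begin

text \<open>If a form m had no zero on the curve, every coordinate divided by m would be bounded,
  hence constant; all coordinates would be multiples of the single form m.\<close>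

lemma plane_meets_cone:
 fixes m :: "complex ^ 4"
 shows "\<exists>s\<in>qcone. s ~= 0 & (\<Sum>j\<in>UNIV. m $ j * s $ j) = 0"
proof (rule ccontr)
 assume none: "\<not> ?thesis"
 define L :: "complex ^ 4 ^ 1" where "L = (\<chi> i. m)"
 have L: "(L *v s) $ 1 = (\<Sum>j\<in>UNIV. m $ j * s $ j)" for s by (simp add: L_def matrix_vector_mult_def)
 have L0: "s = 0" if "s : qcone" "L *v s = 0" for s using none that L[of s] by auto
 obtain K where K: "!!s. s : qcone ==> norm s <= K * norm (L *v s)"
 using qcone_bound[of L, OF L0] by blast
 have nL: "norm (L *v s) = norm (\<Sum>j\<in>UNIV. m $ j * s $ j)" for s
 unfolding L[symmetric] by (simp add: norm_vec_def L2_set_def)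
 let ?m = "%p. \<Sum>j\<in>UNIV. m $ j * co p $ j"
 have m_form: "hpoly 1 (%v. \<Sum>j\<in>UNIV. m $ j * (N *v v) $ j)"
 by (intro hom_poly_sum finite hom_poly_cmult homogeneous_coordinate)
 have m0: "ev C (%p. ?m p ~= 0)"
 proof (rule eventually_almostI)
 fix p assume "p : C"
 then show "?m p ~= 0" using none co_in_cone co_nonzero by blast
 qed
 have const: "EX c. ev C (%p. co p $ k / ?m p = c)" for k
 proof (rule bounded_rational_const)
 show "rational C (%p. co p $ k / ?m p)"
 unfolding co_def by (rule rational_hquot[OF homogeneous_coordinate m_form])
 show "ev C (%p. norm (co p $ k / ?m p) <= K)"
 using m0 eventually_almost_in[of C]
 proof eventually_elim
 case (elim p)
 have "norm (co p $ k) <= K * norm (?m p)"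
 using K[OF co_in_cone[OF elim(2)]] Finite_Cartesian_Product.norm_nth_le[of "co p" k] unfolding nL by linarith
 then show ?case using elim(1) by (simp add: norm_divide divide_le_eq)
 qed
 qed
 have ax: "EX c. axis k 1 = c *s m" for k
 proof -
 obtain c where c: "ev C (%p. co p $ k / ?m p = c)" using const by blast
 have "axis k 1 - c *s m = 0"
 proof (rule linear_independent)
 show "ev C (%p. (\<Sum>j\<in>UNIV. (axis k 1 - c *s m) $ j * co p $ j) = 0)"
 using c m0
 proof eventually_elim
 case (elim p)
 have "(\<Sum>j\<in>UNIV. (axis k 1 - c *s m) $ j * co p $ j) = co p $ k - c * ?m p"
 using exhaust_4[of k] by (auto simp: sum_4 axis_def algebra_simps)
 then show ?case using elim by (simp add: field_simps)
 qed
 qed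
 then show ?thesis by auto
 qed
 obtain c1 c2 where c: "axis 1 1 = c1 *s m" "axis 2 1 = c2 *s m" using ax by metis
 have "(axis 1 1 :: complex ^ 4) $ 1 * (axis 2 1 :: complex ^ 4) $ 2 = (axis 1 1 :: complex ^ 4) $ 2 * (axis 2 1 :: complex ^ 4) $ 1"
 unfolding c by simp
 then show False by (simp add: axis_def)
qed

end

section \<open>Projectivities preserving the cone\<close>

definition cone_auts :: "(complex ^ 4 ^ 4) set" where
 "cone_auts = {W. (EX Y. Y ** W = mat 1) & (\<forall>s\<in>qcone. W *v s : qcone)}"

lemma cone_auts_inj: "W : cone_auts ==> W *v s = 0 \<longleftrightarrow> s = 0"
 unfolding cone_auts_def using matrix_left_invertible_ker[of W] by auto

lemma cone_auts_mult: "W : cone_auts ==> Y : cone_auts ==> W ** Y : cone_auts"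
proof -
 assume W: "W : cone_auts" and Y: "Y : cone_auts"
 then have "ALL s. (W ** Y) *v s = 0 --> s = 0"
 by (metis cone_auts_inj matrix_vector_mul_assoc)
 then have "EX Z. Z ** (W ** Y) = mat 1" using matrix_left_invertible_ker by blast
 then show ?thesis using W Y unfolding cone_auts_def
 by (auto simp: matrix_vector_mul_assoc[symmetric])
qed

context quartic_curve
begin

text \<open>The quadrics through the curve form the pencil diag(a, a - b, -a - b, b), read off by
  comparing coefficients in the basis 1, a, b, a b. The matrix \<open>c\<close> need not be
  symmetric, so only sums of opposite entries are determined.\<close>

lemma quadric_vanish:
 assumes "ev C (%p. (\<Sum>i\<in>UNIV. \<Sum>j\<in>UNIV. c i j * co p $ i * co p $ j) = 0)"
 shows "c 1 2 + c 2 1 = 0" "c 1 3 + c 3 1 = 0" "c 1 4 + c 4 1 = 0" "c 2 3 + c 3 2 = 0" "c 2 4 + c 4 2 = 0" "c 3 4 + c 4 3 = 0"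
 "c 2 2 = c 1 1 - c 4 4" "c 3 3 = - c 1 1 - c 4 4"
proof -
 let ?A = "[:c 3 3 + c 1 1 + c 4 4, c 2 3 + c 3 2, c 2 2 - c 1 1 + c 4 4:]"
 let ?B = "[:c 1 3 + c 3 1, c 1 2 + c 2 1:]" and ?C = "[:c 3 4 + c 4 3, c 2 4 + c 4 2:]" and ?D = "[:c 1 4 + c 4 1:]"
 have "ev C (%p. nf (?A, ?B, ?C, ?D) (zf p) (af p) (bf p) = 0)"
 using assms eventually_co3 eventually_curve
 proof eventually_elim
 case (elim p)
 have co: "co p $ 1 = co p $ 3 * af p" "co p $ 2 = co p $ 3 * zf p" "co p $ 4 = co p $ 3 * bf p"
 using elim(2) by (simp_all add: af_def zf_def bf_def)
 have "(\<Sum>i\<in>UNIV. \<Sum>j\<in>UNIV. c i j * co p $ i * co p $ j) = (co p $ 3) ^ 2 *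
 (c 1 1 * af p ^ 2 + c 2 2 * zf p ^ 2 + c 3 3 + c 4 4 * bf p ^ 2 + (c 1 2 + c 2 1) * (af p * zf p) + (c 1 3 + c 3 1) * af p
 + (c 1 4 + c 4 1) * (af p * bf p) + (c 2 3 + c 3 2) * zf p + (c 2 4 + c 4 2) * (zf p * bf p) + (c 3 4 + c 4 3) * bf p)"
 unfolding sum_4 co by (simp add: algebra_simps power2_eq_square)
 then have "c 1 1 * af p ^ 2 + c 2 2 * zf p ^ 2 + c 3 3 + c 4 4 * bf p ^ 2 + (c 1 2 + c 2 1) * (af p * zf p) + (c 1 3 + c 3 1) * af p
 + (c 1 4 + c 4 1) * (af p * bf p) + (c 2 3 + c 3 2) * zf p + (c 2 4 + c 4 2) * (zf p * bf p) + (c 3 4 + c 4 3) * bf p = 0"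
 using elim(1,2) by simp
 note this[unfolded conjunct1[OF elim(3)] conjunct2[OF elim(3)]]
 then show ?case by (simp add: nf_def algebra_simps power2_eq_square)
 qed
 from nf_unique[OF this] show "c 1 2 + c 2 1 = 0" "c 1 3 + c 3 1 = 0" "c 1 4 + c 4 1 = 0" "c 2 3 + c 3 2 = 0" "c 2 4 + c 4 2 = 0" "c 3 4 + c 4 3 = 0"
 "c 2 2 = c 1 1 - c 4 4" "c 3 3 = - c 1 1 - c 4 4"
 by (simp_all add: algebra_simps eq_neg_iff_add_eq_0)
qed

definition nu :: "complex ^ 4 ^ 4 => 4 ppoint => 4 ppoint" where "nu W p = pt (W *v co p)"

lemma nu_in_C: "W : cone_auts ==> p : C ==> nu W p : C"
 unfolding nu_def using co_in_cone co_nonzero cone_auts_inj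
 by (subst pt_in_C) (auto simp: cone_auts_def)

lemma co_nu:
 assumes "W : cone_auts" "p : C"
 obtains c where "c ~= 0" "co (nu W p) = c *s (W *v co p)" "rep (nu W p) = c *s (M *v (W *v co p))"
proof -
 have "W *v co p ~= 0" using cone_auts_inj[OF assms(1)] co_nonzero[OF assms(2)] by simp
 then show thesis using co_pt that unfolding nu_def by metis
qed

lemma nu_mult:
 assumes "W : cone_auts" "Y : cone_auts" "p : C" shows "nu W (nu Y p) = nu (W ** Y) p"
proof -
 obtain c where c: "c ~= 0" "co (nu Y p) = c *s (Y *v co p)" using co_nu[OF assms(2,3)] by metis
 have "nu W (nu Y p) = pt (c *s (W *v (Y *v co p)))" unfolding nu_def[of W] c(2) by (simp add: vector_scalar_commute)
 also have "\<dots> = pt ((W ** Y) *v co p)" using c(1) by (simp add: pt_scale matrix_vector_mul_assoc)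
 finally show ?thesis by (simp add: nu_def)
qed

lemma nu_mat1: "p : C ==> nu (mat 1) p = p"
 by (simp add: nu_def pt_co)

lemma nu_inj: assumes W: "W : cone_auts" shows "inj_on (nu W) C"
proof (rule inj_onI)
 fix p q assume pq: "p : C" "q : C" "nu W p = nu W q"
 obtain Y where Y: "Y ** W = mat 1" using W unfolding cone_auts_def by blast
 obtain c where c: "c ~= 0" "co (nu W p) = c *s (W *v co p)" using co_nu[OF W pq(1)] by metis
 obtain d where d: "d ~= 0" "co (nu W q) = d *s (W *v co q)" using co_nu[OF W pq(2)] by metis
 have "Y *v (c *s (W *v co p)) = Y *v (d *s (W *v co q))" using c d pq(3) by simp
 then have "c *s co p = d *s co q" by (simp add: vector_scalar_commute matrix_vector_mul_assoc Y)
 then have "pt (c *s co p) = pt (d *s co q)" by simp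
 then show "p = q" using pt_co pq c(1) d(1) by (simp add: pt_scale)
qed

lemma eventually_nu:
 assumes W: "W : cone_auts" and P: "eventually P (almost C)"
 shows "ev C (%p. P (nu W p))"
proof -
 have "finite (nu W -` {q\<in>C. \<not> P q} \<inter> C)"
 using P nu_inj[OF W] by (intro finite_vimage_IntI) (auto simp: eventually_almost)
 moreover have "{p\<in>C. \<not> P (nu W p)} \<subseteq> nu W -` {q\<in>C. \<not> P q} \<inter> C" using nu_in_C[OF W] by auto
 ultimately show ?thesis unfolding eventually_almost by (rule finite_subset[rotated])
qed

lemma form_nu:
 assumes W: "W : cone_auts" and P: "hpoly d P" "hpoly d Q" and p: "p : C"
 shows "P (rep (nu W p)) / Q (rep (nu W p)) = P (M *v (W *v co p)) / Q (M *v (W *v co p))"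
proof -
 obtain c where "c ~= 0" "rep (nu W p) = c *s (M *v (W *v co p))" using co_nu[OF W p] by metis
 then show ?thesis by (simp add: hom_poly_scale[OF P(1)] hom_poly_scale[OF P(2)])
qed

lemma rational_nu:
 assumes W: "W : cone_auts" and f: "rational C f" shows "rational C (%p. f (nu W p))"
proof -
 obtain d P Q where 1: "hpoly d P" "hpoly d Q"
 "ev C (%q. Q (rep q) ~= 0 & f q = P (rep q) / Q (rep q))" using rationalE[OF f] .
 have "rational C (%p. P ((M ** W ** N) *v rep p) / Q ((M ** W ** N) *v rep p))"
 by (rule rational_hquot[OF hom_poly_compose[OF 1(1)] hom_poly_compose[OF 1(2)]])
 moreover have "ev C (%p. P ((M ** W ** N) *v rep p) / Q ((M ** W ** N) *v rep p) = f (nu W p))"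
 using eventually_nu[OF W 1(3)] eventually_almost_in[of C]
 proof eventually_elim
 case (elim p)
 then show ?case using form_nu[OF W 1(1,2) elim(2)]
 by (simp add: matrix_vector_mul_assoc[symmetric] co_def)
 qed
 ultimately show ?thesis by (rule rational_cong)
qed

end

section \<open>Galois automorphisms are induced by matrices\<close>

text \<open>\<open>A\<close> is the very matrix chosen in \<open>line_subfield\<close>;
  \<open>al\<close> is the same pair of equations in the coordinates of the cone.\<close>

locale quartic_line = quartic_curve M N C for M N C +
 fixes l :: "(complex ^ 4) set" and A :: "complex ^ 4 ^ 2"
 assumes line: "l : proj_lines" and disjoint: "points_of l \<inter> C = {}"
 and A_def: "A = (SOME A :: complex ^ 4 ^ 2. {v. A *v v = 0} = l)"
begin

lemma A_kernel: "{v. A *v v = 0} = l"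
 unfolding A_def using someI_ex[of "%A :: complex ^ 4 ^ 2. {v. A *v v = 0} = l"] line_equations_exist[OF line] by blast

definition al :: "complex ^ 4 ^ 2" where "al = A ** M"

lemma al_vec: "al *v s = A *v (M *v s)" by (simp add: al_def matrix_vector_mul_assoc)

lemma al_co: "al *v co p = A *v rep p" by (simp add: al_vec co_def)

lemma al_kernel: "al *v s = 0 \<longleftrightarrow> M *v s : l"
 using A_kernel by (auto simp: al_vec)

lemma cone_kernel: assumes "s : qcone" "al *v s = 0" shows "s = 0"
proof (rule ccontr)
 assume s: "s ~= 0"
 have "M *v s : l" using assms(2) al_kernel by blast
 then have "pt s \<subseteq> l" using line unfolding pt_def hcoord_def proj_lines_def by (intro vec.span_minimal) auto
 moreover have "pt s : C" using assms(1) s pt_in_C by blast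
 ultimately have "pt s : points_of l \<inter> C" using C_points by (auto simp: points_of_def)
 then show False using disjoint by blast
qed

lemma al_nonzero: "p : C ==> al *v co p ~= 0"
 using cone_kernel co_in_cone co_nonzero by blast

lemma al_surj: "EX R. al ** R = mat 1"
proof -
 obtain R where R: "A ** R = mat 1" using line_equations_surj[OF line A_kernel] by blast
 have "al ** (N ** R) = A ** ((M ** N) ** R)" by (simp add: al_def matrix_mul_assoc)
 then show ?thesis using R M_N by auto
qed

lemma al_rows_independent:
 assumes "!!j. c * al $ 1 $ j + d * al $ 2 $ j = 0" shows "c = 0" "d = 0"
proof -
 obtain R where R: "al ** R = mat 1" using al_surj by blast
 have "c * (al ** R) $ 1 $ k + d * (al ** R) $ 2 $ k = (\<Sum>j\<in>UNIV. (c * al $ 1 $ j + d * al $ 2 $ j) * R $ j $ k)" for k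
 by (simp add: matrix_matrix_mult_def sum_4 algebra_simps)
 then have "c * (mat 1 :: complex ^ 2 ^ 2) $ 1 $ k + d * (mat 1 :: complex ^ 2 ^ 2) $ 2 $ k = 0" for k
 unfolding R assms by simp
 from this[of 1] this[of 2] show "c = 0" "d = 0" by (simp_all add: mat_def)
qed

definition h1 :: "4 ppoint => complex" where "h1 p = (al *v co p) $ 1"
definition h2 :: "4 ppoint => complex" where "h2 p = (al *v co p) $ 2"

lemma homogeneous_al: "hpoly 1 (%v. (A *v v) $ i)"
 by (rule hom_poly_linear)

lemma eventually_h: assumes "(c, d) ~= (0, 0)" shows "ev C (%p. c * h1 p + d * h2 p ~= 0)"
proof -
 have form: "hpoly 1 (%v. c * (A *v v) $ 1 + d * (A *v v) $ 2)"
 by (intro hom_poly_add hom_poly_cmult homogeneous_al)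
 from form_dichotomy[OF form] show ?thesis
 proof
 assume "ev C (%p. c * (A *v rep p) $ 1 + d * (A *v rep p) $ 2 = 0)"
 then have "ev C (%p. (\<Sum>j\<in>UNIV. (c *s al $ 1 + d *s al $ 2) $ j * co p $ j) = 0)"
 proof eventually_elim
 case (elim p)
 have "(\<Sum>j\<in>UNIV. (c *s al $ 1 + d *s al $ 2) $ j * co p $ j) = c * (al *v co p) $ 1 + d * (al *v co p) $ 2"
 by (simp add: matrix_vector_mult_def sum_4 algebra_simps)
 then show ?case using elim by (simp add: al_co)
 qed
 from linear_independent[OF this] have "c * al $ 1 $ j + d * al $ 2 $ j = 0" for j
 by (metis vector_add_component vector_smult_component zero_index)
 from al_rows_independent[OF this] show ?thesis using assms by simp
 qed (simp add: h1_def h2_def al_co)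
qed

lemma eventually_h2: "ev C (%p. h2 p ~= 0)"
 using eventually_h[of 0 1] by simp

lemma rational_over_h2:
 assumes "hpoly 1 P" shows "rational C (%p. P (rep p) / h2 p)"
 unfolding h2_def al_co by (rule rational_hquot[OF assms homogeneous_al])

lemma rational_co_h2: "rational C (%p. co p $ j / h2 p)"
 unfolding co_def by (rule rational_over_h2[OF homogeneous_coordinate])

text \<open>Membership in the pulled back field, for representatives: a quotient of binary forms in
  the two equations of the line.\<close>

definition inK :: "(4 ppoint => complex) => bool" where
 "inK f \<longleftrightarrow> (EX d P Q v. hpoly d P & hpoly d Q & v ~= 0 & Q v ~= 0 &
 ev C (%p. f p = P (al *v co p) / Q (al *v co p)))"

text \<open>A function on the projective line is only known up to a finite set; its pullback is
  known up to a finite set because the fibres of the projection are finite. The value of the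
  pullback does not depend on the representative vector.\<close>

lemma fun_class_in_line_subfield: "fun_class C f : line_subfield C l \<longleftrightarrow> inK f"
proof
 let ?T = "proj_points :: 2 ppoint set"
 have pi: "proj_map A p : ?T & al *v co p : proj_map A p & proj_map A p = hcoord (al *v co p)" if "p : C" for p
 proof -
 have "proj_map A p = hcoord (al *v co p)"
 using that C_points hcoord_rep[of p] proj_map_hcoord[of A "rep p"] by (auto simp: al_co)
 then show ?thesis using al_nonzero[OF that] hcoord_in_proj_points mem_hcoord vec.scale_one by metis
 qed
 {
 assume "fun_class C f : line_subfield C l"
 then obtain g where g: "fun_class C f = fun_class C (g \<circ> proj_map A)" "fun_class ?T g : carrier (ffld ?T)"
 unfolding line_subfield_def pullback_field_def A_def by blast
 then obtain d P Q q where 1: "fun_class ?T g = fun_class ?T (hquot P Q)" "hpoly d P" "hpoly d Q"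
 "q : ?T" "Q (rep q) ~= 0" unfolding function_field_def by auto
 define Bad where "Bad = {t : ?T. g t ~= hquot P Q t}"
 have "finite Bad" using 1(1) unfolding fun_class_eq_iff eventually_almost Bad_def by simp
 moreover have "finite {p : C. proj_map A p = t}" if "t : Bad" for t
 proof -
 have t: "t : ?T" using that by (simp add: Bad_def)
 let ?w = "rep t"
 have w: "?w ~= 0" "hcoord ?w = t" using rep_in[OF t] hcoord_rep[OF t] by auto
 have "(?w $ 2, - ?w $ 1) ~= (0, 0)" using w(1) by (auto simp: vec_eq_iff forall_2)
 from eventually_h[OF this] have fin: "finite {p : C. \<not> ?w $ 2 * h1 p + - ?w $ 1 * h2 p ~= 0}"
 by (simp add: eventually_almost)
 have "{p : C. proj_map A p = t} \<subseteq> {p : C. \<not> ?w $ 2 * h1 p + - ?w $ 1 * h2 p ~= 0}"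
 proof
 fix p assume p: "p : {p : C. proj_map A p = t}"
 then have "al *v co p : hcoord ?w" using pi w by auto
 then obtain c where "al *v co p = c *s ?w" by (auto simp: mem_hcoord)
 then show "p : {p : C. \<not> ?w $ 2 * h1 p + - ?w $ 1 * h2 p ~= 0}" using p by (simp add: h1_def h2_def)
 qed
 then show ?thesis using fin by (rule finite_subset)
 qed
 ultimately have "finite (\<Union>t\<in>Bad. {p : C. proj_map A p = t})" by blast
 moreover have "{p : C. \<not> g (proj_map A p) = P (al *v co p) / Q (al *v co p)} \<subseteq> (\<Union>t\<in>Bad. {p : C. proj_map A p = t})"
 proof
 fix p assume p: "p : {p : C. \<not> g (proj_map A p) = P (al *v co p) / Q (al *v co p)}"
 then have "proj_map A p : Bad" unfolding Bad_def
 using hquot_eq[OF 1(2,3), of "proj_map A p" "al *v co p"] pi[of p] al_nonzero[of p] by auto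
 then show "p : (\<Union>t\<in>Bad. {p : C. proj_map A p = t})" using p by blast
 qed
 ultimately have "ev C (%p. g (proj_map A p) = P (al *v co p) / Q (al *v co p))"
 unfolding eventually_almost by (rule finite_subset[rotated])
 moreover have "ev C (%p. f p = g (proj_map A p))" using g(1) by (simp add: fun_class_eq_iff o_def)
 ultimately have "ev C (%p. f p = P (al *v co p) / Q (al *v co p))" by eventually_elim simp
 then show "inK f" unfolding inK_def using 1 rep_in(2)[OF 1(4)] by blast
 next
 assume "inK f"
 then obtain d P Q v where 1: "hpoly d P" "hpoly d Q" "v ~= 0" "Q v ~= 0"
 "ev C (%p. f p = P (al *v co p) / Q (al *v co p))" unfolding inK_def by blast
 have "\<exists>p\<in>?T. Q (rep p) ~= 0"
 proof (intro bexI)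
 show "hcoord v : ?T" using 1(3) by (rule hcoord_in_proj_points)
 show "Q (rep (hcoord v)) ~= 0"
 using hom_poly_rep_eq_0_iff[OF 1(2) hcoord_in_proj_points[OF 1(3)] _ 1(3)] 1(4) mem_hcoord vec.scale_one by metis
 qed
 then have "fun_class ?T (hquot P Q) : carrier (ffld ?T)" unfolding function_field_def using 1 by auto
 moreover have "ev C (%p. f p = (hquot P Q \<circ> proj_map A) p)"
 using 1(5) eventually_almost_in[of C]
 proof eventually_elim
 case (elim p)
 have "hquot P Q (proj_map A p) = P (al *v co p) / Q (al *v co p)"
 using hquot_eq[OF 1(1,2)] pi[OF elim(2)] al_nonzero[OF elim(2)] by blast
 then show ?case using elim(1) by simp
 qed
 then have "fun_class C f = fun_class C (hquot P Q \<circ> proj_map A)" by (simp add: fun_class_eq_iff)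
 ultimately show "fun_class C f : line_subfield C l"
 unfolding line_subfield_def pullback_field_def A_def by blast
 }
qed

lemma inK_rational: "inK f ==> rational C f"
proof -
 assume "inK f"
 then obtain d P Q v where 1: "hpoly d P" "hpoly d Q"
 "ev C (%p. f p = P (al *v co p) / Q (al *v co p))" unfolding inK_def by blast
 have "rational C (%p. P (A *v rep p) / Q (A *v rep p))"
 by (rule rational_hquot[OF hom_poly_compose[OF 1(1)] hom_poly_compose[OF 1(2)]])
 then show ?thesis by (rule rational_cong) (use 1(3) in eventually_elim, simp add: al_co)
qed

lemma line_subfield_subset: "line_subfield C l \<subseteq> carrier (ffld C)"
proof
 fix x assume x: "x : line_subfield C l"
 then obtain f where f: "x = fun_class C f" unfolding line_subfield_def pullback_field_def by blast
 then show "x : carrier (ffld C)"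
 using x fun_class_in_line_subfield inK_rational by (simp add: fun_class_in_carrier)
qed

lemma inK_const: "inK (%_. c)"
 unfolding inK_def
 by (intro exI[of _ 0] exI[of _ "%_. c"] exI[of _ "%_. 1"] exI[of _ "axis 1 1"]) (simp add: hom_poly_const axis_eq_0_iff)

lemma inK_u: "inK (%p. h1 p / h2 p)"
 unfolding inK_def h1_def h2_def
 by (rule exI[of _ 1], rule exI[of _ "%v. v $ 1"], rule exI[of _ "%v. v $ 2"], rule exI[of _ "axis 2 1"])
 (auto simp: axis_eq_0_iff intro: hom_poly_coord[unfolded One_nat_def])

text \<open>A homomorphism of the function field over the pulled back field, lifted to
  representatives; all laws hold almost everywhere only.\<close>

definition field_hom :: "((4 ppoint => complex) => 4 ppoint => complex) => bool" where
 "field_hom \<tau> \<longleftrightarrow> (ALL f. rational C f --> rational C (\<tau> f)) &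
 (ALL f g. rational C f --> rational C g --> ev C (%p. \<tau> (%p. f p + g p) p = \<tau> f p + \<tau> g p)) &
 (ALL f g. rational C f --> rational C g --> ev C (%p. \<tau> (%p. f p * g p) p = \<tau> f p * \<tau> g p)) &
 (ALL f g. rational C f --> ev C (%p. f p = g p) --> ev C (%p. \<tau> f p = \<tau> g p)) &
 (ALL f. rational C f --> ev C (%p. \<tau> f p = 0) --> ev C (%p. f p = 0)) &
 (ALL f. inK f --> ev C (%p. \<tau> f p = f p))"

lemma galois_aut_field_hom:
 assumes \<sigma>: "\<sigma> : galois_auts (ffld C) (line_subfield C l)"
 shows "\<exists>\<tau>. field_hom \<tau> & (ALL f. rational C f --> \<sigma> (fun_class C f) = fun_class C (\<tau> f))"
proof -
 let ?L = "ffld C"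
 have iso: "\<sigma> : ring_hom ?L ?L" "bij_betw \<sigma> (carrier ?L) (carrier ?L)" and fixK: "!!x. x : line_subfield C l ==> \<sigma> x = x"
 using \<sigma> by (auto simp: galois_auts_def ring_iso_def)
 have "ALL f. EX g. rational C f --> rational C g & \<sigma> (fun_class C f) = fun_class C g"
 proof
 fix f
 show "EX g. rational C f --> rational C g & \<sigma> (fun_class C f) = fun_class C g"
 proof (cases "rational C f")
 case True
 then have "\<sigma> (fun_class C f) : carrier ?L" using iso(1) fun_class_in_carrier ring_hom_closed by metis
 then show ?thesis by (metis carrierE)
 qed simp
 qed
 from choice[OF this] obtain \<tau> where \<tau>: "!!f. rational C f ==> rational C (\<tau> f)"
 "!!f. rational C f ==> \<sigma> (fun_class C f) = fun_class C (\<tau> f)" by blast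
 have add: "ev C (%p. \<tau> (%p. f p + g p) p = \<tau> f p + \<tau> g p)" if fg: "rational C f" "rational C g" for f g
 proof -
 have "\<sigma> (fun_class C f \<oplus>\<^bsub>?L\<^esub> fun_class C g) = \<sigma> (fun_class C f) \<oplus>\<^bsub>?L\<^esub> \<sigma> (fun_class C g)"
 by (rule ring_hom_add[OF iso(1)]) (simp_all add: fun_class_in_carrier fg)
 then show ?thesis using fg by (simp add: function_field_add \<tau>(2) rational_add fun_class_eq_iff)
 qed
 have mult: "ev C (%p. \<tau> (%p. f p * g p) p = \<tau> f p * \<tau> g p)" if fg: "rational C f" "rational C g" for f g
 proof -
 have "\<sigma> (fun_class C f \<otimes>\<^bsub>?L\<^esub> fun_class C g) = \<sigma> (fun_class C f) \<otimes>\<^bsub>?L\<^esub> \<sigma> (fun_class C g)"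
 by (rule ring_hom_mult[OF iso(1)]) (simp_all add: fun_class_in_carrier fg)
 then show ?thesis using fg by (simp add: function_field_mult \<tau>(2) rational_mult fun_class_eq_iff)
 qed
 have cong: "ev C (%p. \<tau> f p = \<tau> g p)" if "rational C f" "ev C (%p. f p = g p)" for f g
 proof -
 have "rational C g" using rational_cong that .
 moreover have "fun_class C f = fun_class C g" using that(2) by (simp add: fun_class_eq_iff)
 ultimately show ?thesis using \<tau>(2) that(1) by (metis fun_class_eq_iff)
 qed
 have inK: "ev C (%p. \<tau> f p = f p)" if "inK f" for f
 using fixK[of "fun_class C f"] \<tau>(2)[OF inK_rational[OF that]] that fun_class_in_line_subfield
 by (simp add: fun_class_eq_iff)
 have inj: "ev C (%p. f p = 0)" if "rational C f" "ev C (%p. \<tau> f p = 0)" for f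
 proof -
 have "\<sigma> (fun_class C f) = fun_class C (%_. 0)" using that \<tau>(2) by (simp add: fun_class_eq_iff)
 also have "\<dots> = \<sigma> (fun_class C (%_. 0))"
 using fixK[of "fun_class C (%_. 0)"] fun_class_in_line_subfield inK_const by simp
 finally have "fun_class C f = fun_class C (%_. 0)"
 using iso(2) that(1) rational_const unfolding bij_betw_def
 by (metis fun_class_in_carrier inj_onD)
 then show ?thesis by (simp add: fun_class_eq_iff)
 qed
 have "field_hom \<tau>" unfolding field_hom_def
 using \<tau>(1) add mult cong inj inK by (intro conjI allI impI)
 then show ?thesis using \<tau>(2) by blast
qed

context
 fixes \<tau> assumes \<tau>: "field_hom \<tau>"
begin

lemma hom_rational: "rational C f ==> rational C (\<tau> f)"
 and hom_add: "rational C f ==> rational C g ==> ev C (%p. \<tau> (%p. f p + g p) p = \<tau> f p + \<tau> g p)"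
 and hom_mult: "rational C f ==> rational C g ==> ev C (%p. \<tau> (%p. f p * g p) p = \<tau> f p * \<tau> g p)"
 and hom_cong: "rational C f ==> ev C (%p. f p = g p) ==> ev C (%p. \<tau> f p = \<tau> g p)"
 and hom_inj: "rational C f ==> ev C (%p. \<tau> f p = 0) ==> ev C (%p. f p = 0)"
 and hom_inK: "inK f ==> ev C (%p. \<tau> f p = f p)"
 using \<tau> unfolding field_hom_def by blast+

lemma hom_const: "ev C (%p. \<tau> (%_. c) p = c)"
 using hom_inK[OF inK_const] .

lemma hom_cmult:
 assumes "rational C f" shows "ev C (%p. \<tau> (%p. c * f p) p = c * \<tau> f p)"
 using hom_mult[OF rational_const[of C c] assms] hom_const[of c] by eventually_elim simp

lemma hom_linear:
 fixes r :: "complex ^ 4"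
 assumes "!!j. rational C (f j)"
 shows "ev C (%p. \<tau> (%p. \<Sum>j\<in>UNIV. r $ j * f j p) p = (\<Sum>j\<in>UNIV. r $ j * \<tau> (f j) p))"
proof -
 have r: "rational C (%p. r $ j * f j p)" for j by (intro rational_mult rational_const assms)
 have m: "ev C (%p. \<tau> (%p. r $ j * f j p) p = r $ j * \<tau> (f j) p)" for j by (rule hom_cmult[OF assms])
 have "ev C (%p. \<tau> (%p. r $ 1 * f 1 p + r $ 2 * f 2 p + r $ 3 * f 3 p + r $ 4 * f 4 p) p =
 r $ 1 * \<tau> (f 1) p + r $ 2 * \<tau> (f 2) p + r $ 3 * \<tau> (f 3) p + r $ 4 * \<tau> (f 4) p)"
 using hom_add[OF rational_add[OF rational_add[OF r r] r] r, of 1 2 3 4] hom_add[OF rational_add[OF r r] r, of 1 2 3]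
 hom_add[OF r r, of 1 2] m[of 1] m[of 2] m[of 3] m[of 4]
 by eventually_elim simp
 then show ?thesis by (simp add: sum_4)
qed

text \<open>If w^2 = 1 - z^2 or w^2 = 1 + z^2 then |w| is at most 1 + |z|.\<close>

lemma co_over_co3_bound: "ev C (%p. norm (co p $ j) <= norm (co p $ 3) * (1 + norm (zf p)))"
 using eventually_co3 eventually_curve
proof eventually_elim
 case (elim p)
 have root: "norm w <= 1 + norm (zf p)" if "w ^ 2 = 1 - zf p ^ 2 | w ^ 2 = 1 + zf p ^ 2" for w
 proof (rule power2_le_imp_le)
 have t: "norm (1 - zf p ^ 2) <= 1 + norm (zf p) ^ 2" "norm (1 + zf p ^ 2) <= 1 + norm (zf p) ^ 2"
 using norm_triangle_ineq4[of 1 "zf p ^ 2"] norm_triangle_ineq[of 1 "zf p ^ 2"] by (simp_all add: norm_power)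
 have "norm w ^ 2 = norm (w ^ 2)" by (simp add: norm_power)
 also have "\<dots> <= 1 + norm (zf p) ^ 2"
 using that by (elim disjE) (simp_all only: t)
 also have "\<dots> <= (1 + norm (zf p)) ^ 2" by (simp add: power2_sum)
 finally show "norm w ^ 2 <= (1 + norm (zf p)) ^ 2" .
 qed simp
 have "norm (co p $ j / co p $ 3) <= 1 + norm (zf p)"
 using exhaust_4[of j]
 proof (elim disjE)
 assume "j = 1" then show ?thesis using root[of "af p"] elim(2) by (simp add: af_def)
 next
 assume "j = 4" then show ?thesis using root[of "bf p"] elim(2) by (simp add: bf_def)
 qed (use elim(1) in \<open>simp_all add: zf_def\<close>)
 then show ?case using elim(1) by (simp add: norm_divide divide_le_eq mult.commute)
qed

text \<open>The images f_j of the coordinates over h2 satisfy the equations of the cone, and the two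
  forms take the values u = h1/h2 and 1 on them. So \<open>qcone_bound\<close> gives |f_j| <= K (|u|
  + 1): no new poles. After multiplication by h2/s3 the function grows at most linearly in z, and
  \<open>bounded_rational_linear\<close> turns it into a linear form.\<close>

lemma hom_matrix:
 "\<exists>W\<in>cone_auts. al ** W = al & (ALL j. ev C (%p. \<tau> (%p. co p $ j / h2 p) p = (W *v co p) $ j / h2 p))"
proof -
 define f where "f j = \<tau> (%p. co p $ j / h2 p)" for j
 have rf: "rational C (f j)" for j unfolding f_def by (rule hom_rational[OF rational_co_h2])
 have lin: "ev C (%p. \<tau> (%p. \<Sum>j\<in>UNIV. r $ j * (co p $ j / h2 p)) p = (\<Sum>j\<in>UNIV. r $ j * f j p))" for r :: "complex ^ 4"
 unfolding f_def by (rule hom_linear[OF rational_co_h2])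
 have rational_comb: "rational C (%p. \<Sum>j\<in>UNIV. r $ j * (co p $ j / h2 p))" for r :: "complex ^ 4"
 by (intro rational_sum finite rational_mult rational_const rational_co_h2)
 have h_eq: "h1 p = (\<Sum>j\<in>UNIV. al $ 1 $ j * co p $ j)" "h2 p = (\<Sum>j\<in>UNIV. al $ 2 $ j * co p $ j)" for p
 by (simp_all add: h1_def h2_def matrix_vector_mult_def)
 have f1: "ev C (%p. (\<Sum>j\<in>UNIV. al $ 1 $ j * f j p) = h1 p / h2 p)"
 proof -
 have "(%p. \<Sum>j\<in>UNIV. al $ 1 $ j * (co p $ j / h2 p)) = (%p. h1 p / h2 p)"
 by (simp add: h_eq(1) sum_divide_distrib)
 then show ?thesis using lin[of "al $ 1"] hom_inK[OF inK_u] by (auto elim: eventually_elim2)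
 qed
 have f2: "ev C (%p. (\<Sum>j\<in>UNIV. al $ 2 $ j * f j p) = 1)"
 proof -
 have "ev C (%p. (\<Sum>j\<in>UNIV. al $ 2 $ j * (co p $ j / h2 p)) = 1)"
 using eventually_h2
 proof eventually_elim
 case (elim p)
 have "(\<Sum>j\<in>UNIV. al $ 2 $ j * (co p $ j / h2 p)) = (\<Sum>j\<in>UNIV. al $ 2 $ j * co p $ j) / h2 p"
 by (simp add: sum_divide_distrib)
 also have "\<dots> = h2 p / h2 p" unfolding h_eq(2)[symmetric] ..
 finally have "(\<Sum>j\<in>UNIV. al $ 2 $ j * (co p $ j / h2 p)) = h2 p / h2 p" .
 then show ?case using elim by simp
 qed
 from hom_cong[OF rational_comb this]
 have "ev C (%p. \<tau> (%p. \<Sum>j\<in>UNIV. al $ 2 $ j * (co p $ j / h2 p)) p = \<tau> (%_. 1) p)" .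
 then show ?thesis using lin[of "al $ 2"] hom_const[of 1] by eventually_elim simp
 qed
 have sq: "ev C (%p. \<tau> (%p. (co p $ j / h2 p) * (co p $ j / h2 p)) p = f j p * f j p)" for j
 unfolding f_def by (rule hom_mult[OF rational_co_h2 rational_co_h2])
 have rsq: "rational C (%p. (co p $ j / h2 p) * (co p $ j / h2 p))" for j by (intro rational_mult rational_co_h2)
 have cone1: "ev C (%p. f 1 p * f 1 p + f 2 p * f 2 p = f 3 p * f 3 p)"
 proof -
 have "ev C (%p. (co p $ 1 / h2 p) * (co p $ 1 / h2 p) + (co p $ 2 / h2 p) * (co p $ 2 / h2 p) = (co p $ 3 / h2 p) * (co p $ 3 / h2 p))"
 using eventually_almost_in[of C] eventually_h2
 proof eventually_elim
 case (elim p)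
 then show ?case using co_in_cone[OF elim(1)]
 by (simp add: qcone_def power2_eq_square add_divide_distrib[symmetric])
 qed
 from hom_cong[OF rational_add[OF rsq rsq] this] hom_add[OF rsq rsq, of 1 2] sq[of 1] sq[of 2] sq[of 3]
 show ?thesis by eventually_elim simp
 qed
 have cone2: "ev C (%p. f 2 p * f 2 p + f 3 p * f 3 p = f 4 p * f 4 p)"
 proof -
 have "ev C (%p. (co p $ 2 / h2 p) * (co p $ 2 / h2 p) + (co p $ 3 / h2 p) * (co p $ 3 / h2 p) = (co p $ 4 / h2 p) * (co p $ 4 / h2 p))"
 using eventually_almost_in[of C] eventually_h2
 proof eventually_elim
 case (elim p)
 then show ?case using co_in_cone[OF elim(1)]
 by (simp add: qcone_def power2_eq_square add_divide_distrib[symmetric])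
 qed
 from hom_cong[OF rational_add[OF rsq rsq] this] hom_add[OF rsq rsq, of 2 3] sq[of 2] sq[of 3] sq[of 4]
 show ?thesis by eventually_elim simp
 qed
 obtain K where K: "!!s. s : qcone ==> norm s <= K * norm (al *v s)"
 using qcone_bound[of al, OF cone_kernel] by blast
 have fbound: "ev C (%p. norm (f j p) <= \<bar>K\<bar> * (norm (h1 p / h2 p) + 1))" for j
 using f1 f2 cone1 cone2
 proof eventually_elim
 case (elim p)
 define s where "s = (\<chi> j. f j p)"
 have "s : qcone" using elim(3,4) by (simp add: s_def qcone_def power2_eq_square algebra_simps)
 moreover have al: "(al *v s) $ 1 = h1 p / h2 p" "(al *v s) $ 2 = 1" using elim(1,2) by (simp_all add: s_def matrix_vector_mult_def)
 ultimately have "norm s <= K * norm (al *v s)" using K by blast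
 also have "\<dots> <= \<bar>K\<bar> * norm (al *v s)" by (intro mult_right_mono) auto
 also have "\<dots> <= \<bar>K\<bar> * (norm (h1 p / h2 p) + 1)"
 using norm_vec2_le[of "al *v s"] unfolding al by (intro mult_left_mono) auto
 finally show ?case using Finite_Cartesian_Product.norm_nth_le[of s j] by (simp add: s_def)
 qed
 have "ALL j. \<exists>r :: complex ^ 4. ev C (%p. f j p * (h2 p / co p $ 3) = (\<Sum>k\<in>UNIV. r $ k * (co p $ k / co p $ 3)))"
 proof
 fix j
 define K' where "K' = \<bar>K\<bar> * ((\<Sum>k\<in>UNIV. norm (al $ 1 $ k)) + (\<Sum>k\<in>UNIV. norm (al $ 2 $ k)))"
 show "\<exists>r :: complex ^ 4. ev C (%p. f j p * (h2 p / co p $ 3) = (\<Sum>k\<in>UNIV. r $ k * (co p $ k / co p $ 3)))"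
 proof (rule bounded_rational_linear)
 have "rational C (%p. h2 p / co p $ 3)" unfolding h2_def al_co unfolding co_def
 by (rule rational_hquot[OF homogeneous_al homogeneous_coordinate])
 then show "rational C (%p. f j p * (h2 p / co p $ 3))" by (intro rational_mult rf)
 show "ev C (%p. norm (f j p * (h2 p / co p $ 3)) <= K' * (1 + norm (zf p)))"
 using fbound[of j] eventually_h2 eventually_co3 co_over_co3_bound[of 1] co_over_co3_bound[of 2] co_over_co3_bound[of 3] co_over_co3_bound[of 4]
 proof eventually_elim
 case (elim p)
 define b where "b = norm (co p $ 3) * (1 + norm (zf p))"
 have cob: "norm (co p $ k) <= b" for k using elim(4-7) exhaust_4[of k] by (auto simp: b_def)
 have hb: "norm (\<Sum>k\<in>UNIV. al $ i $ k * co p $ k) <= (\<Sum>k\<in>UNIV. norm (al $ i $ k)) * b" for i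
 unfolding sum_distrib_right by (intro sum_norm_le) (simp add: norm_mult mult_left_mono cob)
 have "norm (f j p * (h2 p / co p $ 3)) <= \<bar>K\<bar> * (norm (h1 p / h2 p) + 1) * norm (h2 p / co p $ 3)"
 unfolding norm_mult using elim(1) by (rule mult_right_mono) simp
 also have "\<dots> = \<bar>K\<bar> * (norm (h1 p) + norm (h2 p)) / norm (co p $ 3)"
 proof -
 have "(norm (h1 p / h2 p) + 1) * norm (h2 p) = norm (h1 p) + norm (h2 p)"
 using elim(2) by (simp add: norm_divide distrib_right)
 then have "\<bar>K\<bar> * ((norm (h1 p / h2 p) + 1) * norm (h2 p)) / norm (co p $ 3) = \<bar>K\<bar> * (norm (h1 p) + norm (h2 p)) / norm (co p $ 3)"
 by simp
 then show ?thesis by (simp only: norm_divide[of "h2 p" "co p $ 3"] times_divide_eq_right mult.assoc)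
 qed
 also have "\<dots> <= \<bar>K\<bar> * ((\<Sum>k\<in>UNIV. norm (al $ 1 $ k)) * b + (\<Sum>k\<in>UNIV. norm (al $ 2 $ k)) * b) / norm (co p $ 3)"
 unfolding h_eq by (intro divide_right_mono mult_left_mono add_mono hb) auto
 also have "\<dots> = K' * (1 + norm (zf p))" using elim(3) by (simp add: K'_def b_def field_simps)
 finally show ?case .
 qed
 qed
 qed
 from choice[OF this] obtain r :: "4 => complex ^ 4" where
 r: "!!j. ev C (%p. f j p * (h2 p / co p $ 3) = (\<Sum>k\<in>UNIV. r j $ k * (co p $ k / co p $ 3)))" by blast
 define W :: "complex ^ 4 ^ 4" where "W = (\<chi> j. r j)"
 have fX: "ev C (%p. f j p = (W *v co p) $ j / h2 p)" for j
 using r[of j] eventually_h2 eventually_co3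
 proof eventually_elim
 case (elim p)
 have "(\<Sum>k\<in>UNIV. r j $ k * (co p $ k / co p $ 3)) = (W *v co p) $ j / co p $ 3"
 by (simp add: W_def matrix_vector_mult_def sum_divide_distrib)
 then show ?case using elim by (simp add: field_simps)
 qed
 have fXall: "ev C (%p. ALL j. f j p = (W *v co p) $ j / h2 p)"
 using fX by (simp add: eventually_all_finite)
 \<comment> \<open>A relation between the rows would be a relation between the f_j, hence by
   injectivity of \<tau> one between the coordinates on the curve.\<close>
 have inv: "EX Y. Y ** W = mat 1"
 proof -
 have "c = 0" if c: "(\<Sum>i\<in>UNIV. c $ i *s row i W) = 0" for c :: "complex ^ 4"
 proof -
 have "ev C (%p. (\<Sum>j\<in>UNIV. c $ j * f j p) = 0)"
 using fXall
 proof eventually_elim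
 case (elim p)
 have "(\<Sum>j\<in>UNIV. c $ j * f j p) = (\<Sum>j\<in>UNIV. c $ j * (W *v co p) $ j) / h2 p"
 using elim by (simp add: sum_divide_distrib)
 also have "(\<Sum>j\<in>UNIV. c $ j * (W *v co p) $ j) = (\<Sum>k\<in>UNIV. (\<Sum>i\<in>UNIV. c $ i *s row i W) $ k * co p $ k)"
 by (simp add: matrix_vector_mult_def sum_4 row_def algebra_simps)
 finally show ?case unfolding c by simp
 qed
 then have "ev C (%p. \<tau> (%p. \<Sum>j\<in>UNIV. c $ j * (co p $ j / h2 p)) p = 0)"
 using lin[of c] by eventually_elim simp
 from hom_inj[OF rational_comb this]
 have "ev C (%p. (\<Sum>j\<in>UNIV. c $ j * (co p $ j / h2 p)) = 0)" .
 then have "ev C (%p. (\<Sum>j\<in>UNIV. c $ j * co p $ j) = 0)"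
 using eventually_h2 by eventually_elim (simp add: sum_divide_distrib[symmetric])
 then show "c = 0" by (rule linear_independent)
 qed
 then have "ALL c. (\<Sum>i\<in>UNIV. c i *s row i W) = 0 --> (ALL i. c i = 0)"
 by (metis (no_types, lifting) sum.cong vec_lambda_beta zero_index)
 then obtain Y where "W ** Y = mat 1" using matrix_right_invertible_independent_rows[of W] by blast
 then show ?thesis using matrix_left_right_inverse[of W Y] by blast
 qed
 have Xcone: "ev C (%p. W *v co p : qcone)"
 using cone1 cone2 fXall eventually_h2
 proof eventually_elim
 case (elim p)
 then have "W *v co p = h2 p *s (\<chi> j. f j p)" by (simp add: vec_eq_iff)
 moreover have "(\<chi> j. f j p) : qcone" using elim(1,2) by (simp add: qcone_def power2_eq_square algebra_simps)
 ultimately show ?case using qcone_scale by simp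
 qed
 \<comment> \<open>So far almost all points of the curve go into the cone. The pulled back quadrics
   thus vanish on the curve, belong to the pencil by \<open>quadric_vanish\<close>, and vanish on
   the whole cone.\<close>
 have preserve: "W *v s : qcone" if s: "s : qcone" for s
 proof -
 define c d where "c i j = W $ 1 $ i * W $ 1 $ j + W $ 2 $ i * W $ 2 $ j - W $ 3 $ i * W $ 3 $ j"
 and "d i j = W $ 4 $ i * W $ 4 $ j - W $ 2 $ i * W $ 2 $ j - W $ 3 $ i * W $ 3 $ j" for i j
 have c: "(\<Sum>i\<in>UNIV. \<Sum>j\<in>UNIV. c i j * v $ i * v $ j) = ((W *v v) $ 1) ^ 2 + ((W *v v) $ 2) ^ 2 - ((W *v v) $ 3) ^ 2" for v
 by (simp add: c_def matrix_vector_mult_def sum_4 power2_eq_square algebra_simps)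
 have d: "(\<Sum>i\<in>UNIV. \<Sum>j\<in>UNIV. d i j * v $ i * v $ j) = ((W *v v) $ 4) ^ 2 - ((W *v v) $ 2) ^ 2 - ((W *v v) $ 3) ^ 2" for v
 by (simp add: d_def matrix_vector_mult_def sum_4 power2_eq_square algebra_simps)
 have sym: "c i j = c j i" "d i j = d j i" for i j by (simp_all add: c_def d_def)
 have "ev C (%p. (\<Sum>i\<in>UNIV. \<Sum>j\<in>UNIV. c i j * co p $ i * co p $ j) = 0)"
 using Xcone by eventually_elim (simp add: c qcone_def)
 note qc = quadric_vanish[OF this, unfolded sym(1)[of 2 1] sym(1)[of 3 1] sym(1)[of 4 1] sym(1)[of 3 2] sym(1)[of 4 2] sym(1)[of 4 3]]
 have "ev C (%p. (\<Sum>i\<in>UNIV. \<Sum>j\<in>UNIV. d i j * co p $ i * co p $ j) = 0)"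
 using Xcone by eventually_elim (simp add: d qcone_def)
 note qd = quadric_vanish[OF this, unfolded sym(2)[of 2 1] sym(2)[of 3 1] sym(2)[of 4 1] sym(2)[of 3 2] sym(2)[of 4 2] sym(2)[of 4 3]]
 have s': "s $ 1 * s $ 1 = s $ 3 * s $ 3 - s $ 2 * s $ 2" "s $ 4 * s $ 4 = s $ 2 * s $ 2 + s $ 3 * s $ 3"
 using s by (simp_all add: qcone_def power2_eq_square)
 have off: "c 1 2 = 0" "c 1 3 = 0" "c 1 4 = 0" "c 2 3 = 0" "c 2 4 = 0" "c 3 4 = 0"
 "d 1 2 = 0" "d 1 3 = 0" "d 1 4 = 0" "d 2 3 = 0" "d 2 4 = 0" "d 3 4 = 0" using qc(1-6) qd(1-6) by simp_all
 have vanish: "(\<Sum>i\<in>UNIV. \<Sum>j\<in>UNIV. e i j * s $ i * s $ j) = 0"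
 if "e 1 2 = 0" "e 1 3 = 0" "e 1 4 = 0" "e 2 3 = 0" "e 2 4 = 0" "e 3 4 = 0" "e 2 2 = e 1 1 - e 4 4" "e 3 3 = - e 1 1 - e 4 4"
 and sy: "!!i j. e i j = e j i" for e
 proof -
 have "(\<Sum>i\<in>UNIV. \<Sum>j\<in>UNIV. e i j * s $ i * s $ j) = e 1 1 * (s $ 1 * s $ 1) + e 2 2 * (s $ 2 * s $ 2) + e 3 3 * (s $ 3 * s $ 3) + e 4 4 * (s $ 4 * s $ 4)"
 unfolding sum_4 sy[of 2 1] sy[of 3 1] sy[of 4 1] sy[of 3 2] sy[of 4 2] sy[of 4 3] that(1-6) by simp
 also have "\<dots> = 0" unfolding s' that(7,8) by (simp add: algebra_simps)
 finally show ?thesis .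
 qed
 have "((W *v s) $ 1) ^ 2 + ((W *v s) $ 2) ^ 2 - ((W *v s) $ 3) ^ 2 = 0"
 unfolding c[symmetric] by (rule vanish) (fact off qc sym)+
 moreover have "((W *v s) $ 4) ^ 2 - ((W *v s) $ 2) ^ 2 - ((W *v s) $ 3) ^ 2 = 0"
 unfolding d[symmetric] by (rule vanish) (fact off qd sym)+
 ultimately show ?thesis by (simp add: qcone_def algebra_simps)
 qed
 have alX: "al ** W = al"
 proof -
 have "(al ** W - al) $ i = 0" for i
 proof (rule linear_independent)
 have eq: "(\<Sum>j\<in>UNIV. (al ** W - al) $ i $ j * co p $ j) = (\<Sum>j\<in>UNIV. al $ i $ j * (W *v co p) $ j) - (\<Sum>j\<in>UNIV. al $ i $ j * co p $ j)" for p
 by (simp add: matrix_matrix_mult_def matrix_vector_mult_def sum_4 algebra_simps)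
 show "ev C (%p. (\<Sum>j\<in>UNIV. (al ** W - al) $ i $ j * co p $ j) = 0)"
 using fXall f1 f2 eventually_h2
 proof eventually_elim
 case (elim p)
 have "(\<Sum>j\<in>UNIV. al $ k $ j * (W *v co p) $ j) = h2 p * (\<Sum>j\<in>UNIV. al $ k $ j * f j p)" for k
 using elim(1,4) by (simp add: sum_distrib_left mult.left_commute)
 then show ?case unfolding eq using exhaust_2[of i] elim(2,3,4) by (auto simp: h_eq[symmetric])
 qed
 qed
 then show ?thesis by (simp add: vec_eq_iff)
 qed
 have "W : cone_auts" using inv preserve by (auto simp: cone_auts_def)
 then show ?thesis using alX fX unfolding f_def by blast
qed

end

text \<open>The matrix describes the automorphism on the coordinates over h2. Induction on forms
  extends this to all P / h2^d, and every rational function is a quotient of two of these.\<close>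

lemma galois_aut_matrix:
 assumes \<sigma>: "\<sigma> : galois_auts (ffld C) (line_subfield C l)"
 shows "\<exists>W\<in>cone_auts. al ** W = al & (ALL f. rational C f --> \<sigma> (fun_class C f) = fun_class C (%p. f (nu W p)))"
proof -
 obtain \<tau> where \<tau>: "field_hom \<tau>" "!!f. rational C f ==> \<sigma> (fun_class C f) = fun_class C (\<tau> f)"
 using galois_aut_field_hom[OF \<sigma>] by blast
 obtain W where W: "W : cone_auts" "al ** W = al"
 "!!j. ev C (%p. \<tau> (%p. co p $ j / h2 p) p = (W *v co p) $ j / h2 p)"
 using hom_matrix[OF \<tau>(1)] by blast
 have hd: "hpoly d (%v. (A *v v) $ 2 ^ d)" for d
 using hom_poly_power[OF homogeneous_al[of 2], of d] by simp
 have ratP: "rational C (%p. P (rep p) / h2 p ^ d)" if "hpoly d P" for d P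
 unfolding h2_def al_co by (rule rational_hquot[OF that hd])
 have form: "ev C (%p. \<tau> (%p. P (rep p) / h2 p ^ d) p = P (M *v (W *v co p)) / h2 p ^ d)"
 if "hpoly d P" for d P
 using that
 proof (induction rule: hom_poly_induct)
 case (const c)
 then show ?case using hom_const[OF \<tau>(1), of c] by simp
 next
 case (coord i)
 have "rep p $ i / h2 p ^ 1 = (\<Sum>j\<in>UNIV. M $ i $ j * (co p $ j / h2 p))" for p
 proof -
 have "rep p $ i = (M *v co p) $ i" by (simp add: co_def)
 then show ?thesis by (simp add: matrix_vector_mult_def sum_divide_distrib)
 qed
 moreover have "(M *v (W *v co p)) $ i / h2 p ^ 1 = (\<Sum>j\<in>UNIV. M $ i $ j * ((W *v co p) $ j / h2 p))" for p
 by (simp only: matrix_vector_mult_def[of M]) (simp add: sum_divide_distrib)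
 moreover have "ev C (%p. ALL j. \<tau> (%p. co p $ j / h2 p) p = (W *v co p) $ j / h2 p)"
 using W(3) by (simp add: eventually_all_finite)
 then have "ev C (%p. \<tau> (%p. \<Sum>j\<in>UNIV. M $ i $ j * (co p $ j / h2 p)) p = (\<Sum>j\<in>UNIV. M $ i $ j * ((W *v co p) $ j / h2 p)))"
 using hom_linear[OF \<tau>(1) rational_co_h2, of "M $ i"] by eventually_elim simp
 ultimately show ?case by simp
 next
 case (add d P Q)
 show ?case
 using add(3,4) hom_add[OF \<tau>(1) ratP[OF add(1)] ratP[OF add(2)]]
 by eventually_elim (simp add: add_divide_distrib)
 next
 case (mult d e P Q)
 show ?case
 using mult(3,4) hom_mult[OF \<tau>(1) ratP[OF mult(1)] ratP[OF mult(2)]]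
 by eventually_elim (simp add: power_add)
 qed
 have "\<sigma> (fun_class C f) = fun_class C (%p. f (nu W p))" if f: "rational C f" for f
 proof -
 obtain d P Q where 1: "hpoly d P" "hpoly d Q"
 "ev C (%q. Q (rep q) ~= 0 & f q = P (rep q) / Q (rep q))" using rationalE[OF f] .
 have "ev C (%p. f p * (Q (rep p) / h2 p ^ d) = P (rep p) / h2 p ^ d)"
 using 1(3) by eventually_elim simp
 from hom_cong[OF \<tau>(1) rational_mult[OF f ratP[OF 1(2)]] this] hom_mult[OF \<tau>(1) f ratP[OF 1(2)]]
 form[OF 1(1)] form[OF 1(2)] eventually_nu[OF W(1) 1(3)] eventually_h2 eventually_almost_in[of C]
 have "ev C (%p. \<tau> f p = f (nu W p))"
 proof eventually_elim
 case (elim p)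
 obtain c where c: "c ~= 0" "rep (nu W p) = c *s (M *v (W *v co p))" using co_nu[OF W(1) elim(7)] by metis
 have "Q (M *v (W *v co p)) ~= 0" using elim(5) c hom_poly_scale[OF 1(2)] by auto
 then show ?case using elim form_nu[OF W(1) 1(1,2) elim(7)] by (simp add: field_simps)
 qed
 then show ?thesis by (simp add: \<tau>(2)[OF f] fun_class_eq_iff)
 qed
 then show ?thesis using W(1,2) by blast
qed

end

section \<open>Which projectivities of the cone fix the equations of a line\<close>

text \<open>A monomial map acts linearly on the vectors of squares of points of the cone. These fill
  the plane spanned by the two test vectors, which must be preserved; what remains is the dihedral
  group of order 8 with the blocks {1,4} and {2,3}.\<close>

lemma permutation_cases:
 fixes j1 j2 j3 j4 :: 4 and n1 n2 n3 n4 :: complex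
 assumes dist: "distinct [j1, j2, j3, j4]" and n: "n1 ~= 0" "n2 ~= 0" "n3 ~= 0" "n4 ~= 0"
 and e: "!!w :: complex ^ 4. w = vector [-1, 1, 0, 1] | w = vector [1, 0, 1, 1] ==>
 n1 * w $ j1 + n2 * w $ j2 = n3 * w $ j3 & n4 * w $ j4 = n2 * w $ j2 + n3 * w $ j3"
 shows "(j1, j2, j3, j4) : {(1,2,3,4), (1,3,2,4), (4,2,3,1), (4,3,2,1), (2,1,4,3), (3,4,1,2), (2,4,1,3), (3,1,4,2)}"
proof -
 have e1: "n1 * vector [-1, 1, 0, 1] $ j1 + n2 * vector [-1, 1, 0, 1] $ j2 = n3 * vector [-1, 1, 0, 1] $ j3"
 "n4 * vector [-1, 1, 0, 1] $ j4 = n2 * vector [-1, 1, 0, 1] $ j2 + n3 * vector [-1, 1, 0, 1] $ j3"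
 "n1 * vector [1, 0, 1, 1] $ j1 + n2 * vector [1, 0, 1, 1] $ j2 = n3 * vector [1, 0, 1, 1] $ j3"
 "n4 * vector [1, 0, 1, 1] $ j4 = n2 * vector [1, 0, 1, 1] $ j2 + n3 * vector [1, 0, 1, 1] $ j3"
 using e by blast+
 show ?thesis
 using exhaust_4[of j1] exhaust_4[of j2] exhaust_4[of j3] exhaust_4[of j4] dist e1 n
 by (elim disjE) (simp_all, (auto simp: eq_neg_iff_add_eq_0)?)
qed

context quartic_curve
begin

lemma cone_aut_pencil:
 assumes W: "W : cone_auts"
 defines "c a b i j \<equiv> a * W $ 1 $ i * W $ 1 $ j + (a - b) * W $ 2 $ i * W $ 2 $ j + (- a - b) * W $ 3 $ i * W $ 3 $ j + b * W $ 4 $ i * W $ 4 $ j"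
 shows "i ~= j ==> c a b i j = 0" "c a b 2 2 = c a b 1 1 - c a b 4 4" "c a b 3 3 = - c a b 1 1 - c a b 4 4"
proof -
 have sum: "(\<Sum>i\<in>UNIV. \<Sum>j\<in>UNIV. c a b i j * v $ i * v $ j) =
 a * ((W *v v) $ 1) ^ 2 + (a - b) * ((W *v v) $ 2) ^ 2 + (- a - b) * ((W *v v) $ 3) ^ 2 + b * ((W *v v) $ 4) ^ 2" for v
 by (simp add: c_def matrix_vector_mult_def sum_4 power2_eq_square algebra_simps)
 have "ev C (%p. (\<Sum>i\<in>UNIV. \<Sum>j\<in>UNIV. c a b i j * co p $ i * co p $ j) = 0)"
 proof (rule eventually_almostI)
 fix p assume "p : C"
 then have "W *v co p : qcone" using W co_in_cone by (simp add: cone_auts_def)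
 then have q: "((W *v co p) $ 1) ^ 2 = ((W *v co p) $ 3) ^ 2 - ((W *v co p) $ 2) ^ 2"
 "((W *v co p) $ 4) ^ 2 = ((W *v co p) $ 2) ^ 2 + ((W *v co p) $ 3) ^ 2" by (simp_all add: qcone_def)
 show "(\<Sum>i\<in>UNIV. \<Sum>j\<in>UNIV. c a b i j * co p $ i * co p $ j) = 0"
 unfolding sum q by (simp add: algebra_simps)
 qed
 note v = quadric_vanish[OF this]
 have sym: "c a b i j = c a b j i" for i j by (simp add: c_def)
 show "c a b 2 2 = c a b 1 1 - c a b 4 4" "c a b 3 3 = - c a b 1 1 - c a b 4 4" by (fact v)+
 have "c a b 1 2 = 0" "c a b 1 3 = 0" "c a b 1 4 = 0" "c a b 2 3 = 0" "c a b 2 4 = 0" "c a b 3 4 = 0"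
 using v(1-6) by (simp_all add: sym[of 2 1] sym[of 3 1] sym[of 4 1] sym[of 3 2] sym[of 4 2] sym[of 4 3])
 then show "i ~= j ==> c a b i j = 0"
 using exhaust_4[of i] exhaust_4[of j] by (auto simp: sym[of 2 1] sym[of 3 1] sym[of 4 1] sym[of 3 2] sym[of 4 2] sym[of 4 3])
qed

text \<open>A cone automorphism permutes the kernels of the four singular quadrics in the pencil, which
 are the coordinate axes.\<close>

lemma cone_aut_axis:
 assumes W: "W : cone_auts"
 shows "EX j. W $ k $ j ~= 0 & (ALL i. i ~= k --> W $ i $ j = 0)"
proof -
 obtain Y where "Y ** W = mat 1" using W by (auto simp: cone_auts_def)
 then have Y: "W ** Y = mat 1" by (simp add: matrix_left_right_inverse)
 define v where "v = Y *v axis k 1"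
 have Wv: "W *v v = axis k 1" by (simp add: v_def matrix_vector_mul_assoc Y)
 \<comment> \<open>A member of the pencil is diag(a, a - b, -a - b, b); the one chosen here is
   singular exactly at the k-th coordinate point. The vector \<open>v\<close> is the preimage of
   that point under \<open>W\<close>.\<close>
 define D :: "complex => complex => complex ^ 4" where "D a b = vector [a, a - b, - a - b, b]" for a b
 obtain a b where D: "D a b $ k = 0" "!!i. i ~= k ==> D a b $ i ~= 0"
 proof -
 have "EX a b. D a b $ k = 0 & (ALL i. i ~= k --> D a b $ i ~= 0)"
 using exhaust_4[of k]
 proof (elim disjE)
 assume "k = 1" then show ?thesis by (intro exI[of _ 0] exI[of _ 1]) (simp add: D_def forall_4)
 next
 assume "k = 2" then show ?thesis by (intro exI[of _ 1] exI[of _ 1]) (simp add: D_def forall_4)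
 next
 assume "k = 3" then show ?thesis
 by (rule_tac exI[of _ 1], rule_tac exI[of _ "-1"]) (simp add: D_def forall_4)
 next
 assume "k = 4" then show ?thesis
 by (rule_tac exI[of _ 1], rule_tac exI[of _ 0]) (simp add: D_def forall_4)
 qed
 then show thesis using that by blast
 qed
 define c where "c i j = (\<Sum>m\<in>UNIV. D a b $ m * W $ m $ i * W $ m $ j)" for i j
 have c_eq: "c i j = a * W $ 1 $ i * W $ 1 $ j + (a - b) * W $ 2 $ i * W $ 2 $ j + (- a - b) * W $ 3 $ i * W $ 3 $ j + b * W $ 4 $ i * W $ 4 $ j" for i j
 by (simp add: c_def D_def sum_4)
 have off: "c i j = 0" if "i ~= j" for i j unfolding c_eq by (rule cone_aut_pencil(1)[OF W that])
 have diag: "c 2 2 = c 1 1 - c 4 4" "c 3 3 = - c 1 1 - c 4 4" unfolding c_eq by (rule cone_aut_pencil[OF W])+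
 \<comment> \<open>The pulled back quadric \<open>c\<close> is diagonal and has \<open>v\<close> in
   its kernel.\<close>
 have cv: "c i i * v $ i = 0" for i
 proof -
 have "c i i * v $ i = (\<Sum>j\<in>UNIV. c i j * v $ j)"
 using exhaust_4[of i] off by (auto simp: sum_4)
 also have "\<dots> = (\<Sum>m\<in>UNIV. D a b $ m * W $ m $ i * (W *v v) $ m)"
 by (simp add: c_def matrix_vector_mult_def sum_4 algebra_simps)
 also have "\<dots> = 0" unfolding Wv using D(1) exhaust_4[of k] by (auto simp: sum_4 axis_def)
 finally show ?thesis .
 qed
 have "c 1 1 ~= 0 | c 4 4 ~= 0"
 proof (rule ccontr)
 assume "\<not> ?thesis"
 then have "c i i = 0" for i using diag exhaust_4[of i] by auto
 then have c0: "c i j = 0" for i j using off by (cases "i = j") auto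
 obtain i where ik: "i ~= k" by (metis (full_types) zero_neq_one)
 define t where "t = Y *v axis i 1"
 have Wt: "W *v t = axis i 1" by (simp add: t_def matrix_vector_mul_assoc Y)
 have "0 = (\<Sum>p\<in>UNIV. \<Sum>q\<in>UNIV. c p q * t $ p * t $ q)" by (simp add: c0)
 also have "\<dots> = (\<Sum>m\<in>UNIV. D a b $ m * ((W *v t) $ m) * ((W *v t) $ m))"
 by (simp add: c_def matrix_vector_mult_def sum_4 algebra_simps)
 also have "\<dots> = D a b $ i" unfolding Wt using exhaust_4[of i] by (auto simp: sum_4 axis_def)
 finally show False using D(2)[OF ik] by simp
 qed
 \<comment> \<open>A nonzero member of the pencil has at most one zero on its diagonal, so its
   kernel lies on one coordinate axis.\<close>
 then have two: "v $ i = 0 | v $ j = 0" if "i ~= j" for i j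
 using cv[of i] cv[of j] that diag exhaust_4[of i] exhaust_4[of j] by auto
 have "v ~= 0" using Wv by (auto simp: axis_eq_0_iff)
 then obtain j where j: "v $ j ~= 0" by (auto simp: vec_eq_iff)
 have v: "v $ i = 0" if "i ~= j" for i using two[OF that] j by auto
 have "(W *v v) $ i = W $ i $ j * v $ j" for i
 using v exhaust_4[of j] by (auto simp: matrix_vector_mult_def sum_4)
 then have "W $ i $ j * v $ j = axis k 1 $ i" for i using Wv by metis
 then have W_col: "W $ i $ j = axis k 1 $ i / v $ j" for i using j by (simp add: eq_divide_eq)
 show ?thesis using j by (intro exI[of _ j]) (simp add: W_col axis_def)
qed

lemma cone_aut_monomial:
 assumes W: "W : cone_auts"
 shows "EX m j. (ALL k. m k ~= 0) & inj j & (ALL s k. (W *v s) $ k = m k * s $ j k)"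
proof -
 obtain j where j: "!!k. W $ k $ j k ~= 0" "!!k i. i ~= k ==> W $ i $ j k = 0"
 using cone_aut_axis[OF W] by metis
 have inj: "inj j" by (rule injI) (metis j)
 have surj: "EX k. i = j k" for i
 using finite_UNIV_inj_surj[OF finite inj] by (metis surjD)
 have "(W *v s) $ k = W $ k $ j k * s $ j k" for s k
 proof -
 have "W $ k $ i = 0" if "i ~= j k" for i using surj[of i] j(2) that by metis
 then have "(\<Sum>i\<in>UNIV. W $ k $ i * s $ i) = (\<Sum>i\<in>UNIV. if i = j k then W $ k $ j k * s $ j k else 0)"
 by (intro sum.cong) auto
 then show ?thesis by (simp add: matrix_vector_mult_def)
 qed
 then show ?thesis using j(1) inj by (intro exI[of _ "%k. W $ k $ j k"] exI[of _ j]) auto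
qed

end

definition dot :: "complex ^ 4 => complex ^ 4 => complex" where "dot v s = (\<Sum>j\<in>UNIV. v $ j * s $ j)"

text \<open>Describes the line s_q + e s_r = 0, s_p = 0, which passes through the i-th coordinate
  point. The pairs {i, p} and {q, r} are the blocks {1,4} and {2,3}.\<close>

definition Z4_data :: "4 => 4 => 4 => 4 => complex => bool" where
 "Z4_data i p q r e \<longleftrightarrow> (i, p, q, r) : {(1,4,2,3), (2,3,1,4)} & (e = 1 | e = - 1) \<or>
 (i, p, q, r) : {(4,1,2,3), (3,2,1,4)} & (e = \<i> | e = - \<i>)"

definition reflection :: "4 => complex ^ 4 ^ 4" where
 "reflection i = (\<chi> k j. if k = j then if k = i then - 1 else 1 else 0)"

lemma complex_square_eq_1: "x ^ 2 = (1 :: complex) \<longleftrightarrow> x = 1 | x = - 1"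
 by (simp add: power2_eq_1_iff)

lemma complex_square_eq_minus_1: "x ^ 2 = (- 1 :: complex) \<longleftrightarrow> x = \<i> | x = - \<i>"
proof
 assume "x ^ 2 = - 1"
 then have "(x - \<i>) * (x + \<i>) = 0" by (simp add: algebra_simps power2_eq_square)
 then show "x = \<i> | x = - \<i>" by (auto simp: eq_neg_iff_add_eq_0)
qed auto

context quartic_line
begin

text \<open>The image of the k-th coordinate point under the projection; it is 0 exactly when that
  vertex lies on the line.\<close>

definition cl :: "4 => complex ^ 2" where "cl k = (\<chi> i. al $ i $ k)"

lemma al_cl: "al *v s = s $ 1 *s cl 1 + s $ 2 *s cl 2 + s $ 3 *s cl 3 + s $ 4 *s cl 4"
 by (simp add: vec_eq_iff matrix_vector_mult_def cl_def sum_4 mult.commute)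

lemma columns_not_proportional:
 assumes "!!k. EX a. cl k = a *s u" shows False
proof -
 obtain a where a: "!!k. cl k = a k *s u" using assms by metis
 have ex: "EX b. w = b *s u" for w
 proof -
 obtain R where R: "al ** R = mat 1" using al_surj by blast
 have "w = al *v (R *v w)" by (simp add: matrix_vector_mul_assoc R)
 then have "w = ((R *v w) $ 1 * a 1 + (R *v w) $ 2 * a 2 + (R *v w) $ 3 * a 3 + (R *v w) $ 4 * a 4) *s u"
 unfolding al_cl a by (simp add: vec.scale_left_distrib)
 then show ?thesis by blast
 qed
 obtain b c where "axis 1 1 = b *s u" "axis 2 1 = c *s u" using ex by metis
 from arg_cong[OF this(1), of "%v. v $ 1"] arg_cong[OF this(2), of "%v. v $ 1"]
 arg_cong[OF this(1), of "%v. v $ 2"] arg_cong[OF this(2), of "%v. v $ 2"]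
 show False by (auto simp: axis_def)
qed

text \<open>Such a relation would exhibit a point of the curve on the line.\<close>

lemma no_cone_relation:
 assumes "vector [a, b, c, d] : qcone" "(a, b, c, d) ~= (0, 0, 0, 0)"
 "a *s cl 1 + b *s cl 2 + c *s cl 3 + d *s cl 4 = 0"
 shows False
 using cone_kernel[OF assms(1)] assms(2,3) by (simp add: al_cl vector4_eq_0)

text \<open>In terms of columns the condition is cl (j k) = m k cl k. A column at a fixed point of j
  is 0 or has m k = 1. The identity permutation gives sign changes, with a zero column for each
  minus sign; the transpositions give the Z4-lines or two zero columns; the 4-cycles make all
  columns proportional; the double transpositions force a point of the curve onto the line.\<close>

lemma stabilizer_cases:
 assumes W: "W : cone_auts" and alW: "al ** W = al"
 shows "W = mat 1 | (EX i. W = reflection i & cl i = 0) | (EX i j. i ~= j & cl i = 0 & cl j = 0) \<or>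
 (EX i p q r e. Z4_data i p q r e & cl i = 0 & cl r = e *s cl q)"
proof -
 obtain m j where mj: "!!k. m k ~= 0" "inj j" "!!s k. (W *v s) $ k = m k * s $ j k"
 using cone_aut_monomial[OF W] by blast
 have col: "cl (j k) = m k *s cl k" for k
 proof -
 have "W *v axis (j k) 1 = m k *s axis k 1"
 using injD[OF mj(2)] by (auto simp: vec_eq_iff mj(3) axis_def)
 then have "al *v (W *v axis (j k) 1) = m k *s (al *v axis k 1)" by (simp add: vector_scalar_commute)
 moreover have "al *v (W *v axis (j k) 1) = al *v axis (j k) 1" by (simp add: matrix_vector_mul_assoc alW)
 moreover have "al *v axis k 1 = cl k" for k
 by (simp add: vec_eq_iff cl_def matrix_vector_mult_def axis_def if_distrib cong: if_cong)
 ultimately show ?thesis by simp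
 qed
 \<comment> \<open>Any solution w of the two linear relations is the vector of squares of a point of
   the cone.\<close>
 have cone: "(m 1) ^ 2 * w $ j 1 + (m 2) ^ 2 * w $ j 2 = (m 3) ^ 2 * w $ j 3 & (m 4) ^ 2 * w $ j 4 = (m 2) ^ 2 * w $ j 2 + (m 3) ^ 2 * w $ j 3"
 if w: "w $ 1 + w $ 2 = w $ 3" "w $ 4 = w $ 2 + w $ 3" for w :: "complex ^ 4"
 proof -
 define s :: "complex ^ 4" where "s = (\<chi> k. csqrt (w $ k))"
 have s: "(s $ k) ^ 2 = w $ k" for k by (simp add: s_def)
 have "s : qcone" by (simp add: qcone_def s w(2) w(1)[symmetric])
 then have "W *v s : qcone" using W by (simp add: cone_auts_def)
 then show ?thesis by (simp add: qcone_def mj(3) power_mult_distrib s)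
 qed
 have "(j 1, j 2, j 3, j 4) : {(1,2,3,4), (1,3,2,4), (4,2,3,1), (4,3,2,1), (2,1,4,3), (3,4,1,2), (2,4,1,3), (3,1,4,2)}"
 proof (rule permutation_cases)
 show "distinct [j 1, j 2, j 3, j 4]" using mj(2) by (simp add: inj_eq)
 show "(m 1)\<^sup>2 ~= 0" "(m 2)\<^sup>2 ~= 0" "(m 3)\<^sup>2 ~= 0" "(m 4)\<^sup>2 ~= 0" using mj(1) by auto
 fix w :: "complex ^ 4"
 assume "w = vector [- 1, 1, 0, 1] | w = vector [1, 0, 1, 1]"
 then show "(m 1)\<^sup>2 * w $ j 1 + (m 2)\<^sup>2 * w $ j 2 = (m 3)\<^sup>2 * w $ j 3 & (m 4)\<^sup>2 * w $ j 4 = (m 2)\<^sup>2 * w $ j 2 + (m 3)\<^sup>2 * w $ j 3"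
 by (intro cone) auto
 qed
 note perms = this
 note c1 = conjunct1[OF cone[of "vector [- 1, 1, 0, 1]", simplified]] conjunct2[OF cone[of "vector [- 1, 1, 0, 1]", simplified]]
 conjunct1[OF cone[of "vector [1, 0, 1, 1]", simplified]] conjunct2[OF cone[of "vector [1, 0, 1, 1]", simplified]]
 have col4: "cl (j 1) = m 1 *s cl 1" "cl (j 2) = m 2 *s cl 2" "cl (j 3) = m 3 *s cl 3" "cl (j 4) = m 4 *s cl 4"
 by (rule col)+
 have fixed: "m = 1" if "cl k = m *s cl k" "cl k ~= 0" for k m
 proof -
 have "(1 - m) *s cl k = 0" using that(1) by (simp add: vec.scale_left_diff_distrib)
 then show ?thesis using that(2) by (simp only: vec.scale_eq_0_iff) simp
 qed
 have all: False if "!!k. k : {1,2,3,4} ==> EX a. cl k = a *s u" for u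
 using columns_not_proportional[of u] that exhaust_4 by blast
 from perms show ?thesis
 unfolding insert_iff empty_iff simp_thms
 proof (elim disjE)
 assume "(j 1, j 2, j 3, j 4) = (1, 2, 3, 4)"
 then have j: "j 1 = 1" "j 2 = 2" "j 3 = 3" "j 4 = 4" by auto
 note n = c1[unfolded j, simplified] and c = col4[unfolded j]
 obtain k where "cl k ~= 0" using all[of 0] by (metis vec.scale_zero_right)
 then have "m k = 1" using fixed col[of k] j exhaust_4[of k] by metis
 moreover have eq: "(m 2)^2 = (m 1)^2" "(m 3)^2 = (m 1)^2" "(m 4)^2 = (m 1)^2" using n by auto
 ultimately have "(m 1)^2 = 1" using exhaust_4[of k] by auto
 then have pm: "m k = 1 | m k = - 1" for k using eq exhaust_4[of k] complex_square_eq_1 by metis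
 have W_diag: "W $ i $ k = (if i = k then m i else 0)" for i k
 proof -
 have "W $ i $ k = (W *v axis k 1) $ i"
 by (simp add: matrix_vector_mult_def axis_def if_distrib cong: if_cong)
 then show ?thesis using exhaust_4[of i] j by (auto simp: mj(3) axis_def)
 qed
 have neg: "cl k = 0" if "m k = - 1" for k using fixed[of k "m k"] col[of k] that j exhaust_4[of k] by force
 show ?thesis
 proof (cases "EX i k. i ~= k & m i = - 1 & m k = - 1")
 case False
 show ?thesis
 proof (cases "EX i. m i = - 1")
 case True
 then obtain i where i: "m i = - 1" by blast
 then have "m k = 1" if "k ~= i" for k using False that pm by blast
 then have "W = reflection i" using i by (auto simp: vec_eq_iff W_diag reflection_def)
 then show ?thesis using neg i by blast
 next
 case False
 then have "W = mat 1" using pm by (auto simp: vec_eq_iff W_diag mat_def)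
 then show ?thesis by blast
 qed
 qed (use neg in blast)
 next
 assume "(j 1, j 2, j 3, j 4) = (1, 3, 2, 4)"
 then have j: "j 1 = 1" "j 2 = 3" "j 3 = 2" "j 4 = 4" by auto
 note n = c1[unfolded j, simplified] and c = col4[unfolded j]
 have n': "(m 2)^2 = - ((m 1)^2)" "(m 3)^2 = - ((m 1)^2)" "(m 4)^2 = - ((m 1)^2)" using n by (auto simp: eq_neg_iff_add_eq_0 add.commute)
 show ?thesis
 proof (cases "cl 1 = 0")
 case True
 show ?thesis
 proof (cases "cl 4 = 0")
 case False
 then have "m 4 = 1" using fixed c by blast
 then have "(m 2)^2 = 1" using n' by simp
 then have "Z4_data 1 4 2 3 (m 2)" by (simp add: Z4_data_def complex_square_eq_1)
 then show ?thesis using True c(2) by blast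
 next
 case c4: True
 have "(1::4) ~= 4" by simp
 then show ?thesis using True c4 by blast
 qed
 next
 case False
 then have m1: "m 1 = 1" using fixed c by blast
 then have "m 4 ~= 1" using n' by auto
 then have "cl 4 = 0" using fixed c by blast
 moreover have "Z4_data 4 1 2 3 (m 2)" using n' m1 by (simp add: Z4_data_def complex_square_eq_minus_1)
 ultimately show ?thesis using c(2) by blast
 qed
 next
 assume "(j 1, j 2, j 3, j 4) = (4, 2, 3, 1)"
 then have j: "j 1 = 4" "j 2 = 2" "j 3 = 3" "j 4 = 1" by auto
 note n = c1[unfolded j, simplified] and c = col4[unfolded j]
 have n': "(m 1)^2 = - ((m 2)^2)" "(m 3)^2 = - ((m 2)^2)" using n by (auto simp: eq_neg_iff_add_eq_0 add.commute)
 show ?thesis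
 proof (cases "cl 2 = 0")
 case True
 show ?thesis
 proof (cases "cl 3 = 0")
 case False
 then have "m 3 = 1" using fixed c by blast
 then have "(m 1)^2 = 1" using n' by simp
 then have "Z4_data 2 3 1 4 (m 1)" by (simp add: Z4_data_def complex_square_eq_1)
 then show ?thesis using True c(1) by blast
 next
 case c3: True
 have "(2::4) ~= 3" by simp
 then show ?thesis using True c3 by blast
 qed
 next
 case False
 then have m2: "m 2 = 1" using fixed c by blast
 then have "m 3 ~= 1" using n' by auto
 then have "cl 3 = 0" using fixed c by blast
 moreover have "Z4_data 3 2 1 4 (m 1)" using n' m2 by (simp add: Z4_data_def complex_square_eq_minus_1)
 ultimately show ?thesis using c(1) by blast
 qed
 next
 assume "(j 1, j 2, j 3, j 4) = (2, 4, 1, 3)"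
 then have "j 1 = 2" "j 2 = 4" "j 3 = 1" "j 4 = 3" by auto
 note c = col4[unfolded this]
 have "cl 2 = m 1 *s cl 1" "cl 4 = (m 2 * m 1) *s cl 1" "cl 3 = (m 4 * (m 2 * m 1)) *s cl 1" "cl 1 = 1 *s cl 1"
 by (fact c(1), metis c(1,2) vec.scale_scale, metis c(1,2,4) vec.scale_scale, simp)
 then have False using all[of "cl 1"] by blast
 then show ?thesis ..
 next
 assume "(j 1, j 2, j 3, j 4) = (3, 1, 4, 2)"
 then have "j 1 = 3" "j 2 = 1" "j 3 = 4" "j 4 = 2" by auto
 note c = col4[unfolded this]
 have "cl 3 = m 1 *s cl 1" "cl 4 = (m 3 * m 1) *s cl 1" "cl 2 = (m 4 * (m 3 * m 1)) *s cl 1" "cl 1 = 1 *s cl 1"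
 by (fact c(1), metis c(1,3) vec.scale_scale, metis c(1,3,4) vec.scale_scale, simp)
 then have False using all[of "cl 1"] by blast
 then show ?thesis ..
 next
 assume "(j 1, j 2, j 3, j 4) = (4, 3, 2, 1)"
 then have j: "j 1 = 4" "j 2 = 3" "j 3 = 2" "j 4 = 1" by auto
 note n = c1[unfolded j, simplified] and c = col4[unfolded j]
 have m11: "m 1 * m 4 = 1"
 proof (rule fixed)
 show "cl 1 = (m 1 * m 4) *s cl 1" by (metis c vec.scale_scale mult.commute)
 show "cl 1 ~= 0"
 proof
 assume "cl 1 = 0"
 then have "cl 1 = 0 *s cl 2" "cl 4 = 0 *s cl 2" "cl 2 = 1 *s cl 2" "cl 3 = m 2 *s cl 2"
 by (simp, metis c vec.scale_zero_left vec.scale_zero_right, simp, metis c)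
 then show False using all[of "cl 2"] by blast
 qed
 qed
 then have n11: "(m 1)^2 * (m 4)^2 = 1" by (simp add: power_mult_distrib[symmetric])
 \<comment> \<open>The columns satisfy cl 4 = m 1 cl 1 and cl 3 = m 2 cl 2. Any combination of these
   two relations is a relation of columns, and this weight puts its coefficient vector on the cone.
   The other double transpositions are handled alike.\<close>
 define a where "a = csqrt (1 + (m 2)^2)"
 have a: "a ^ 2 = 1 + (m 2)^2" by (simp add: a_def)
 have n': "(m 1)^2 = - ((m 2)^2)" "(m 4)^2 = (m 2)^2" using n by (auto simp: eq_neg_iff_add_eq_0 add.commute)
 have False
 proof (rule no_cone_relation[of "- m 1 * a" "- m 2" 1 a])
 show "vector [- m 1 * a, - m 2, 1, a] : qcone"
 using n11 by (simp add: qcone_def power_mult_distrib a n' algebra_simps)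
 qed (simp_all add: c(1,2) mult.commute)
 then show ?thesis ..
 next
 assume "(j 1, j 2, j 3, j 4) = (2, 1, 4, 3)"
 then have j: "j 1 = 2" "j 2 = 1" "j 3 = 4" "j 4 = 3" by auto
 note n = c1[unfolded j, simplified] and c = col4[unfolded j]
 have m11: "m 1 * m 2 = 1"
 proof (rule fixed)
 show "cl 1 = (m 1 * m 2) *s cl 1" by (metis c vec.scale_scale mult.commute)
 show "cl 1 ~= 0"
 proof
 assume "cl 1 = 0"
 then have "cl 1 = 0 *s cl 3" "cl 2 = 0 *s cl 3" "cl 3 = 1 *s cl 3" "cl 4 = m 3 *s cl 3"
 by (simp, metis c vec.scale_zero_left vec.scale_zero_right, simp, metis c)
 then show False using all[of "cl 3"] by blast
 qed
 qed
 then have n11: "(m 1)^2 * (m 2)^2 = 1" by (simp add: power_mult_distrib[symmetric])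
 define a where "a = csqrt (1 - ((m 2)^2))"
 have a: "a ^ 2 = 1 - ((m 2)^2)" by (simp add: a_def)
 have n1: "(m 1)^2 - (m 2)^2 = (m 3)^2" "(m 3)^2 - (m 2)^2 = 0"
 using cone[of "vector [- 1, 1, 0, 1]"] by (simp_all add: j)
 have n': "(m 3)^2 = (m 2)^2" using n1(2) by simp
 have n': "(m 3)^2 = (m 2)^2" "(m 1)^2 = 2 * (m 2)^2" using n1(1) unfolding n' by (simp_all add: diff_eq_eq)
 have False
 proof (rule no_cone_relation[of "- m 1 * a" a "- m 3" 1])
 show "vector [- m 1 * a, a, - m 3, 1] : qcone"
 using n11 by (simp add: qcone_def power_mult_distrib a n' algebra_simps)
 qed (simp_all add: c(1,3) mult.commute)
 then show ?thesis ..
 next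
 assume "(j 1, j 2, j 3, j 4) = (3, 4, 1, 2)"
 then have j: "j 1 = 3" "j 2 = 4" "j 3 = 1" "j 4 = 2" by auto
 note n = c1[unfolded j, simplified] and c = col4[unfolded j]
 have m11: "m 1 * m 3 = 1"
 proof (rule fixed)
 show "cl 1 = (m 1 * m 3) *s cl 1" by (metis c vec.scale_scale mult.commute)
 show "cl 1 ~= 0"
 proof
 assume "cl 1 = 0"
 then have "cl 1 = 0 *s cl 2" "cl 3 = 0 *s cl 2" "cl 2 = 1 *s cl 2" "cl 4 = m 2 *s cl 2"
 by (simp, metis c vec.scale_zero_left vec.scale_zero_right, simp, metis c)
 then show False using all[of "cl 2"] by blast
 qed
 qed
 then have n11: "(m 1)^2 * (m 3)^2 = 1" by (simp add: power_mult_distrib[symmetric])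
 define a where "a = csqrt (1 - ((m 2)^2))"
 have a: "a ^ 2 = 1 - ((m 2)^2)" by (simp add: a_def)
 have n1: "(m 2)^2 = - ((m 3)^2)" "(m 1)^2 + (m 2)^2 = (m 3)^2"
 using cone[of "vector [- 1, 1, 0, 1]"] cone[of "vector [1, 0, 1, 1]"] by (simp_all add: j)
 have n': "(m 3)^2 = - ((m 2)^2)" using n1(1) by simp
 have n': "(m 3)^2 = - ((m 2)^2)" "(m 1)^2 = - 2 * (m 2)^2" using n1(2) unfolding n' by (simp_all add: eq_diff_eq[symmetric])
 have False
 proof (rule no_cone_relation[of "- m 1 * a" "- m 2" a 1])
 show "vector [- m 1 * a, - m 2, a, 1] : qcone"
 using n11 by (simp add: qcone_def power_mult_distrib a n' algebra_simps)
 qed (simp_all add: c(1,2) mult.commute)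
 then show ?thesis ..
 qed
qed

end

section \<open>Necessary conditions for a Galois line\<close>

lemma dehomogenize:
 fixes P :: "complex ^ 2 => complex"
 assumes "hpoly d P"
 shows "EX p. ALL v. v $ 2 ~= 0 --> P v = (v $ 2) ^ d * poly p (v $ 1 / v $ 2)"
 using assms
proof (induction rule: hom_poly_induct)
 case (const c)
 then show ?case by (intro exI[of _ "[:c:]"]) simp
next
 case (coord i)
 show ?case
 proof (cases "i = 1")
 case True
 then show ?thesis by (intro exI[of _ "[:0, 1:]"]) simp
 next
 case False
 then have "i = 2" using exhaust_2[of i] by simp
 then show ?thesis by (intro exI[of _ "1"]) simp
 qed
next
 case (add d P Q)
 then obtain p q where "!!v. v $ 2 ~= 0 ==> P v = (v $ 2) ^ d * poly p (v $ 1 / v $ 2)"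
 "!!v. v $ 2 ~= 0 ==> Q v = (v $ 2) ^ d * poly q (v $ 1 / v $ 2)" by metis
 then show ?case by (intro exI[of _ "p + q"]) (simp add: algebra_simps)
next
 case (mult d e P Q)
 then obtain p q where "!!v. v $ 2 ~= 0 ==> P v = (v $ 2) ^ d * poly p (v $ 1 / v $ 2)"
 "!!v. v $ 2 ~= 0 ==> Q v = (v $ 2) ^ e * poly q (v $ 1 / v $ 2)" by metis
 then show ?case by (intro exI[of _ "p * q"]) (simp add: power_add)
qed

lemma reflection_vec: "(reflection i *v s) $ k = (if k = i then - s $ k else s $ k)"
proof -
 have "(\<Sum>j\<in>UNIV. (if k = j then if k = i then - 1 else 1 else 0) * s $ j) =
 (\<Sum>j\<in>UNIV. if k = j then (if k = i then - s $ k else s $ k) else 0)"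
 by (rule sum.cong) auto
 then show ?thesis by (simp add: reflection_def matrix_vector_mult_def)
qed

lemma dot_scale: "dot r (c *s s) = c * dot r s"
 by (simp add: dot_def sum_distrib_left mult.left_commute)

lemma dot_axis: "dot (axis k 1) s = s $ k"
 using exhaust_4[of k] by (auto simp: dot_def sum_4 axis_def)

lemma norm_dot_le: "norm (dot r s) <= (\<Sum>j\<in>UNIV. norm (r $ j)) * norm s"
proof -
 have "norm (dot r s) <= (\<Sum>j\<in>UNIV. norm (r $ j * s $ j))" unfolding dot_def by (rule norm_sum)
 also have "\<dots> <= (\<Sum>j\<in>UNIV. norm (r $ j) * norm s)"
 unfolding norm_mult by (intro sum_mono mult_left_mono Finite_Cartesian_Product.norm_nth_le) auto
 finally show ?thesis by (simp add: sum_distrib_right)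
qed

context quartic_line
begin

definition uf :: "4 ppoint => complex" where "uf p = h1 p / h2 p"

lemma eventually_poly_uf:
 assumes "q ~= 0" shows "ev C (%p. poly q (uf p) ~= 0)"
proof -
 have "ev C (%p. uf p ~= z)" for z
 using eventually_h[of 1 "- z", simplified] eventually_h2
 proof eventually_elim
 case (elim p)
 then show ?case by (simp add: uf_def divide_eq_eq)
 qed
 then have "ev C (%p. \<forall>z\<in>{z. poly q z = 0}. uf p ~= z)"
 by (intro eventually_ball_finite poly_roots_finite[OF assms] ballI)
 then show ?thesis by eventually_elim blast
qed

text \<open>The value z is taken by u = h1/h2 where the plane h1 = z h2 meets the curve; there h2 is
  nonzero since the line misses the curve.\<close>

lemma uf_surj_almost:
 assumes "eventually G (almost C)"
 shows "finite {z. \<not> (\<exists>p\<in>C. G p & h2 p ~= 0 & uf p = z)}"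
proof -
 have "finite {p : C. \<not> G p}" using assms by (simp add: eventually_almost)
 moreover have "{z. \<not> (\<exists>p\<in>C. G p & h2 p ~= 0 & uf p = z)} \<subseteq> uf ` {p : C. \<not> G p}"
 proof
 fix z assume z: "z : {z. \<not> (\<exists>p\<in>C. G p & h2 p ~= 0 & uf p = z)}"
 obtain s where s: "s : qcone" "s ~= 0" "(\<Sum>j\<in>UNIV. (al $ 1 - z *s al $ 2) $ j * s $ j) = 0"
 using plane_meets_cone by blast
 define p where "p = pt s"
 have p: "p : C" unfolding p_def using s by (simp add: pt_in_C)
 obtain c where c: "co p = c *s s" using co_pt[OF s(2)] unfolding p_def by metis
 have "(\<Sum>j\<in>UNIV. (al $ 1 - z *s al $ 2) $ j * s $ j) = (al *v s) $ 1 - z * (al *v s) $ 2"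
 by (simp add: matrix_vector_mult_def sum_4 algebra_simps)
 then have h: "h1 p = z * h2 p" using s(3) by (simp add: h1_def h2_def c vector_scalar_commute)
 have "h2 p ~= 0"
 proof
 assume "h2 p = 0"
 then have "al *v co p = 0" using h by (simp add: vec_eq_iff forall_2 h1_def h2_def)
 then show False using al_nonzero[OF p] by simp
 qed
 moreover then have "uf p = z" using h by (simp add: uf_def)
 ultimately show "z : uf ` {p : C. \<not> G p}" using z p by blast
 qed
 ultimately show ?thesis by (rule finite_surj)
qed

text \<open>A linear form over h2 that lies in the pulled back field is a rational function of u
  growing at most linearly, hence c0 + c1 u. So the form is a combination of h1 and h2 and vanishes
  on the line.\<close>

lemma inK_linear_form:
 assumes K: "inK (%p. dot r (co p) / h2 p)" and ker: "al *v s = 0"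
 shows "dot r s = 0"
proof -
 obtain d P Q v where PQ: "hpoly d P" "hpoly d Q"
 "ev C (%p. dot r (co p) / h2 p = P (al *v co p) / Q (al *v co p))"
 using K unfolding inK_def by blast
 obtain p0 where p0: "!!v. v $ 2 ~= 0 ==> P v = (v $ 2) ^ d * poly p0 (v $ 1 / v $ 2)" using dehomogenize[OF PQ(1)] by blast
 obtain q0 where q0: "!!v. v $ 2 ~= 0 ==> Q v = (v $ 2) ^ d * poly q0 (v $ 1 / v $ 2)" using dehomogenize[OF PQ(2)] by blast
 have ev: "ev C (%p. dot r (co p) / h2 p = poly p0 (uf p) / poly q0 (uf p))"
 using PQ(3) eventually_h2
 proof eventually_elim
 case (elim p)
 have "(al *v co p) $ 2 ~= 0" using elim(2) by (simp add: h2_def)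
 from p0[OF this] q0[OF this] elim show ?case by (simp add: uf_def h1_def h2_def)
 qed
 have "EX c0 c1. ev C (%p. dot r (co p) / h2 p = c0 + c1 * uf p)"
 proof (cases "q0 = 0")
 case True
 then show ?thesis using ev by (intro exI[of _ 0]) simp
 next
 case False
 obtain K where K: "!!s. s : qcone ==> norm s <= K * norm (al *v s)"
 using qcone_bound[of al] cone_kernel by blast
 define B where "B = (\<Sum>j\<in>UNIV. norm (r $ j)) * \<bar>K\<bar>"
 have B: "B \<ge> 0" by (simp add: B_def sum_nonneg)
 have bound: "norm (dot r (co p) / h2 p) <= B * (1 + norm (uf p))" if p: "p : C" "h2 p ~= 0" for p
 proof -
 have "norm (dot r (co p)) <= (\<Sum>j\<in>UNIV. norm (r $ j)) * norm (co p)" by (rule norm_dot_le)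
 also have "\<dots> <= (\<Sum>j\<in>UNIV. norm (r $ j)) * (K * norm (al *v co p))"
 using K[OF co_in_cone[OF p(1)]] by (intro mult_left_mono sum_nonneg) auto
 also have "\<dots> <= (\<Sum>j\<in>UNIV. norm (r $ j)) * (\<bar>K\<bar> * (norm (h1 p) + norm (h2 p)))"
 unfolding h1_def h2_def by (intro mult_left_mono mult_mono norm_vec2_le sum_nonneg) auto
 finally have "norm (dot r (co p)) <= B * (norm (h1 p) + norm (h2 p))" by (simp add: B_def mult.assoc)
 then show ?thesis using p(2) by (simp add: uf_def norm_divide field_simps)
 qed
 define A where "A = {z. \<not> (\<exists>p\<in>C. dot r (co p) / h2 p = poly p0 (uf p) / poly q0 (uf p) & h2 p ~= 0 & uf p = z)}
 \<union> {z. poly q0 z = 0}"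
 have "EX t. p0 = q0 * t & (t = 0 | 2 * pdeg t + pdeg (1 :: complex poly) <= 2)"
 proof (rule rational_growth[of A])
 show "finite A" unfolding A_def using uf_surj_almost[OF ev] poly_roots_finite[OF False] by simp
 fix z assume z: "z \<notin> A"
 then obtain p where p: "p : C" "dot r (co p) / h2 p = poly p0 z / poly q0 z" "h2 p ~= 0" "uf p = z" "poly q0 z ~= 0"
 unfolding A_def by auto
 have "norm (poly p0 z) <= B * (1 + norm z) * norm (poly q0 z)"
 using bound[OF p(1,3)] p(5) unfolding p(2,4) by (simp add: norm_divide field_simps)
 then have "norm (poly p0 z) ^ 2 <= (B * (1 + norm z) * norm (poly q0 z)) ^ 2" by (intro power_mono) auto
 then show "norm (poly p0 z) ^ 2 * norm (poly 1 z) <= B ^ 2 * (1 + norm z) ^ 2 * norm (poly q0 z) ^ 2"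
 by (simp add: power_mult_distrib)
 qed (use False in auto)
 then obtain t where t0: "p0 = q0 * t" "t = 0 | 2 * pdeg t <= 2" by auto
 then have t: "p0 = q0 * t" "pdeg t <= 1" by auto
 then have t_eq: "t = [:Polynomial.coeff t 0, Polynomial.coeff t 1:]"
 by (intro poly_eqI) (auto simp: coeff_pCons coeff_eq_0 split: nat.split)
 have "ev C (%p. dot r (co p) / h2 p = Polynomial.coeff t 0 + Polynomial.coeff t 1 * uf p)"
 using ev eventually_poly_uf[OF False]
 proof eventually_elim
 case (elim p)
 then have "dot r (co p) / h2 p = poly t (uf p)" by (simp add: t(1))
 then show ?case by (subst (asm) t_eq) (simp add: mult.commute)
 qed
 then show ?thesis by blast
 qed
 then obtain c0 c1 where c: "ev C (%p. dot r (co p) / h2 p = c0 + c1 * uf p)" by blast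
 have "r - c1 *s al $ 1 - c0 *s al $ 2 = 0"
 proof (rule linear_independent)
 show "ev C (%p. (\<Sum>j\<in>UNIV. (r - c1 *s al $ 1 - c0 *s al $ 2) $ j * co p $ j) = 0)"
 using c eventually_h2
 proof eventually_elim
 case (elim p)
 then have "dot r (co p) = c0 * h2 p + c1 * h1 p" by (simp add: uf_def field_simps)
 then show ?case by (simp add: dot_def h1_def h2_def matrix_vector_mult_def sum_4 algebra_simps)
 qed
 qed
 then have r: "r = c1 *s al $ 1 + c0 *s al $ 2" by (simp add: algebra_simps)
 have "dot r s = c1 * (al *v s) $ 1 + c0 * (al *v s) $ 2"
 by (simp add: r dot_def matrix_vector_mult_def sum_4 algebra_simps)
 then show ?thesis by (simp add: ker)
qed

lemma dot_ratio_nu: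
 assumes W: "W : cone_auts" "al ** W = al" and p: "p : C"
 shows "dot r (co (nu W p)) / h2 (nu W p) = dot r (W *v co p) / h2 p" "uf (nu W p) = uf p"
proof -
 obtain c where c: "c ~= 0" "co (nu W p) = c *s (W *v co p)" using co_nu[OF W(1) p] by metis
 have "al *v (W *v s) = al *v s" for s by (simp add: matrix_vector_mul_assoc W(2))
 then show "dot r (co (nu W p)) / h2 (nu W p) = dot r (W *v co p) / h2 p" "uf (nu W p) = uf p"
 using c(1) by (simp_all add: uf_def h1_def h2_def c(2) vector_scalar_commute dot_scale)
qed

text \<open>Otherwise only the identity and the sign change of one coordinate can occur in the
  group. All other coordinates over h2 are then invariant, lie in the base field, and vanish on the
  line by \<open>inK_linear_form\<close>; three independent equations leave no room for a
  line.\<close>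

theorem galois_extension_cases:
 assumes G: "galois_extension (ffld C) (line_subfield C l)"
 shows "(EX i j. i ~= j & cl i = 0 & cl j = 0) | (EX i p q r e. Z4_data i p q r e & cl i = 0 & cl r = e *s cl q)"
proof (rule ccontr)
 assume none: "\<not> ?thesis"
 have fixed_in_K: "x : line_subfield C l"
 if "x : carrier (ffld C)" "!!\<sigma>. \<sigma> : galois_auts (ffld C) (line_subfield C l) ==> \<sigma> x = x" for x
 using G that unfolding galois_extension_def by blast
 have W_cases: "W = mat 1 | (EX i. W = reflection i & cl i = 0)" if "W : cone_auts" "al ** W = al" for W
 using stabilizer_cases[OF that] none by blast
 obtain i0 where i0: "!!i. cl i = 0 ==> i = i0" using none by metis
 have "dot (axis k 1) s = 0" if k: "k ~= i0" and s: "al *v s = 0" for k s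
 proof (rule inK_linear_form[OF _ s])
 have rat: "rational C (%p. dot (axis k 1) (co p) / h2 p)" unfolding dot_axis by (rule rational_co_h2)
 have "\<sigma> (fun_class C (%p. dot (axis k 1) (co p) / h2 p)) = fun_class C (%p. dot (axis k 1) (co p) / h2 p)"
 if \<sigma>: "\<sigma> : galois_auts (ffld C) (line_subfield C l)" for \<sigma>
 proof -
 obtain W where W: "W : cone_auts" "al ** W = al"
 "\<sigma> (fun_class C (%p. dot (axis k 1) (co p) / h2 p)) = fun_class C (%p. dot (axis k 1) (co (nu W p)) / h2 (nu W p))"
 using galois_aut_matrix[OF \<sigma>] rat by blast
 have "(W *v s) $ k = s $ k" for s
 using W_cases[OF W(1,2)] i0 k by (auto simp: reflection_vec)
 then show ?thesis unfolding W(3) fun_class_eq_iff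
 by (intro eventually_almostI) (simp add: dot_ratio_nu(1)[OF W(1,2)], simp add: dot_axis)
 qed
 moreover have "fun_class C (%p. dot (axis k 1) (co p) / h2 p) : carrier (ffld C)"
 using rat by (simp only: fun_class_in_carrier)
 ultimately have "fun_class C (%p. dot (axis k 1) (co p) / h2 p) : line_subfield C l"
 using fixed_in_K by blast
 then show "inK (%p. dot (axis k 1) (co p) / h2 p)" by (simp add: fun_class_in_line_subfield)
 qed
 then have ker: "s $ k = 0" if "k ~= i0" "al *v s = 0" for k s using that by (simp add: dot_axis)
 \<comment> \<open>The line contains a nonzero vector whose coordinate \<open>i0\<close> is zero as
   well, so all coordinates of it vanish.\<close>
 obtain v where v: "v : l" "v ~= 0" "(\<Sum>j\<in>UNIV. N $ i0 $ j * v $ j) = 0" using line_meets_plane[OF line] by blast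
 have "al *v (N *v v) = 0" using v(1) by (simp add: al_kernel)
 moreover have "(N *v v) $ i0 = 0" using v(3) by (simp add: matrix_vector_mult_def)
 ultimately have "(N *v v) $ k = 0" for k using ker by (cases "k = i0") auto
 then have "N *v v = 0" by (simp add: vec_eq_iff)
 then show False using v(2) by simp
qed

text \<open>The automorphism of the function field induced by a cone automorphism; the choice of a
 representative is irrelevant.\<close>

definition fun_aut :: "complex ^ 4 ^ 4 => (4 ppoint => complex) set => (4 ppoint => complex) set" where
 "fun_aut W = (\<lambda>x\<in>carrier (ffld C). fun_class C (%p. (SOME f. rational C f & x = fun_class C f) (nu W p)))"

lemma fun_aut_fun_class:
 assumes W: "W : cone_auts" and f: "rational C f"
 shows "fun_aut W (fun_class C f) = fun_class C (%p. f (nu W p))"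
proof -
 define g where "g = (SOME g. rational C g & fun_class C f = fun_class C g)"
 have g: "rational C g & fun_class C f = fun_class C g"
 unfolding g_def by (rule someI[of _ f]) (simp add: f)
 then have "ev C (%p. f p = g p)" by (simp add: fun_class_eq_iff)
 then have "ev C (%p. g p = f p)" by eventually_elim simp
 from eventually_nu[OF W this] show ?thesis
 using f by (simp add: fun_aut_def fun_class_in_carrier fun_class_eq_iff g_def)
qed

lemma fun_aut_closed: "W : cone_auts ==> x : carrier (ffld C) ==> fun_aut W x : carrier (ffld C)"
 by (elim carrierE) (simp add: fun_aut_fun_class fun_class_in_carrier rational_nu)

text \<open>Functions are pulled back, so the order of the matrices is reversed.\<close>

lemma fun_aut_mult:
 assumes W: "W : cone_auts" "Y : cone_auts" and x: "x : carrier (ffld C)"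
 shows "fun_aut W (fun_aut Y x) = fun_aut (Y ** W) x"
proof -
 obtain f where f: "rational C f" "x = fun_class C f" using x by (rule carrierE)
 show ?thesis unfolding f(2)
 by (simp add: fun_aut_fun_class W f(1) rational_nu cone_auts_mult fun_class_eq_iff)
 (rule eventually_almostI, simp add: nu_mult W)
qed

lemma fun_aut_mat1: "x : carrier (ffld C) ==> fun_aut (mat 1) x = x"
proof -
 assume "x : carrier (ffld C)"
 then obtain f where f: "rational C f" "x = fun_class C f" by (rule carrierE)
 have "mat 1 : cone_auts" by (auto simp: cone_auts_def intro: exI[of _ "mat 1"])
 then show ?thesis unfolding f(2)
 by (simp add: fun_aut_fun_class f(1) fun_class_eq_iff) (rule eventually_almostI, simp add: nu_mat1)
qed

lemma fun_aut_galois: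
 assumes W: "W : cone_auts" "al ** W = al" and Y: "Y : cone_auts" "Y ** W = mat 1"
 shows "fun_aut W : galois_auts (ffld C) (line_subfield C l)"
proof -
 let ?L = "ffld C"
 have WY: "W ** Y = mat 1" using Y(2) by (simp add: matrix_left_right_inverse)
 have "fun_aut W : ring_hom ?L ?L"
 proof (rule ring_hom_memI)
 fix x y assume "x : carrier ?L" "y : carrier ?L"
 then obtain f g where fg: "rational C f" "x = fun_class C f" "rational C g" "y = fun_class C g" by (metis carrierE)
 show "fun_aut W (x \<otimes>\<^bsub>?L\<^esub> y) = fun_aut W x \<otimes>\<^bsub>?L\<^esub> fun_aut W y"
 "fun_aut W (x \<oplus>\<^bsub>?L\<^esub> y) = fun_aut W x \<oplus>\<^bsub>?L\<^esub> fun_aut W y"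
 using fg by (simp_all add: function_field_mult function_field_add fun_aut_fun_class W rational_mult rational_add)
 next
 show "fun_aut W \<one>\<^bsub>?L\<^esub> = \<one>\<^bsub>?L\<^esub>" unfolding function_field_one
 using fun_aut_fun_class[OF W(1) rational_const] by simp
 qed (use fun_aut_closed W in blast)
 moreover have "bij_betw (fun_aut W) (carrier ?L) (carrier ?L)"
 by (rule bij_betw_byWitness[of _ "fun_aut Y"])
 (auto simp: fun_aut_mult W Y WY fun_aut_mat1 fun_aut_closed)
 moreover have "fun_aut W : extensional (carrier ?L)" by (simp add: fun_aut_def)
 moreover have "fun_aut W x = x" if x: "x : line_subfield C l" for x
 proof -
 obtain f where f: "rational C f" "x = fun_class C f" using x line_subfield_subset by (meson carrierE subsetD)
 then have "inK f" using x fun_class_in_line_subfield by blast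
 then obtain d P Q v where PQ: "hpoly d P" "hpoly d Q"
 "ev C (%p. f p = P (al *v co p) / Q (al *v co p))" unfolding inK_def by blast
 have "ev C (%p. f (nu W p) = f p)"
 using PQ(3) eventually_nu[OF W(1) PQ(3)] eventually_almost_in[of C]
 proof eventually_elim
 case (elim p)
 obtain c where c: "c ~= 0" "co (nu W p) = c *s (W *v co p)" using co_nu[OF W(1) elim(3)] by metis
 have "al *v co (nu W p) = c *s (al *v co p)" by (simp add: c(2) vector_scalar_commute matrix_vector_mul_assoc W(2))
 then show ?case using elim(1,2) c(1) by (simp add: hom_poly_scale[OF PQ(1)] hom_poly_scale[OF PQ(2)])
 qed
 then show ?thesis unfolding f(2) fun_aut_fun_class[OF W(1) f(1)] fun_class_eq_iff .
 qed
 ultimately show ?thesis unfolding galois_auts_def ring_iso_def by blast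
qed

text \<open>The coordinates over h2 determine the matrix itself and not only its class up to
  scalars, because h2 is fixed.\<close>

lemma fun_aut_inj:
 assumes W: "W : cone_auts" "al ** W = al" and Y: "Y : cone_auts" "al ** Y = al" and eq: "fun_aut W = fun_aut Y"
 shows "W = Y"
proof -
 have "W $ k - Y $ k = 0" for k
 proof (rule linear_independent)
 have rat: "rational C (%p. dot (axis k 1) (co p) / h2 p)" unfolding dot_axis by (rule rational_co_h2)
 have "ev C (%p. dot (axis k 1) (co (nu W p)) / h2 (nu W p) = dot (axis k 1) (co (nu Y p)) / h2 (nu Y p))"
 using fun_cong[OF eq, of "fun_class C (%p. dot (axis k 1) (co p) / h2 p)"]
 unfolding fun_aut_fun_class[OF W(1) rat] fun_aut_fun_class[OF Y(1) rat] fun_class_eq_iff .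
 then show "ev C (%p. (\<Sum>j\<in>UNIV. (W $ k - Y $ k) $ j * co p $ j) = 0)"
 using eventually_h2 eventually_almost_in[of C]
 proof eventually_elim
 case (elim p)
 then have "(W *v co p) $ k = (Y *v co p) $ k"
 using dot_ratio_nu(1)[OF W elim(3), of "axis k 1"] dot_ratio_nu(1)[OF Y elim(3), of "axis k 1"] by (simp add: dot_axis)
 then show ?case by (simp add: matrix_vector_mult_def sum_4 algebra_simps)
 qed
 qed
 then show ?thesis by (simp add: vec_eq_iff)
qed

end

section \<open>Lines whose group acts diagonally are Galois\<close>

lemma dot_diff_left: "dot (r - t) s = dot r s - dot t s"
 by (simp add: dot_def sum_subtractf algebra_simps)

lemma dot_add_left: "dot (r + t) s = dot r s + dot t s"
 by (simp add: dot_def sum.distrib algebra_simps)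

definition pmult :: "complex \<times> complex => complex \<times> complex => complex \<times> complex" where
 "pmult x y = (fst x * fst y, snd x * snd y)"

lemma pmult_simps: "fst (pmult x y) = fst x * fst y" "snd (pmult x y) = snd x * snd y"
 by (simp_all add: pmult_def)

text \<open>The line is cut out by the forms \<open>f1\<close>, \<open>f2\<close>, and its group acts diagonally on the
 remaining coordinates \<open>t1\<close>, \<open>t2\<close>, through the pairs of characters in \<open>Ch\<close>.\<close>

locale diagonal_line = quartic_line M N C l A for M N C l A +
 fixes t1 t2 f1 f2 :: "complex ^ 4" and a b c a' b' :: complex
 and Ch :: "(complex \<times> complex) set" and W :: "complex \<times> complex => complex ^ 4 ^ 4"
 assumes kernel: "!!s. al *v s = 0 \<longleftrightarrow> dot f1 s = 0 & dot f2 s = 0"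
 and basis: "!!s. dot t1 s = 0 ==> dot t2 s = 0 ==> dot f1 s = 0 ==> dot f2 s = 0 ==> s = 0"
 and rel1: "!!s. s : qcone ==> dot t1 s ^ 2 = a * dot f1 s ^ 2 + b * dot f2 s ^ 2 + c * dot f1 s * dot t2 s"
 and rel2: "!!s. s : qcone ==> dot t2 s ^ 2 = a' * dot f1 s ^ 2 + b' * dot f2 s ^ 2"
 and W_cone: "!!x. x : Ch ==> W x : cone_auts"
 and W_vec: "!!x s. x : Ch ==> dot t1 (W x *v s) = fst x * dot t1 s" "!!x s. x : Ch ==> dot t2 (W x *v s) = snd x * dot t2 s"
 "!!x s. x : Ch ==> dot f1 (W x *v s) = dot f1 s" "!!x s. x : Ch ==> dot f2 (W x *v s) = dot f2 s"
 and finite_Ch: "finite Ch" and Ch_one: "(1, 1) : Ch"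
 and Ch_mult: "!!x y. x : Ch ==> y : Ch ==> pmult x y : Ch"
 and Ch_inverse: "!!x. x : Ch ==> \<exists>y\<in>Ch. pmult x y = (1, 1)"
 and Ch_sums: "(\<Sum>x\<in>Ch. fst x) = 0" "(\<Sum>x\<in>Ch. snd x) = 0" "(\<Sum>x\<in>Ch. fst x * snd x) = 0"
 and complete: "!!Y. Y : cone_auts ==> al ** Y = al ==>
 \<exists>x\<in>Ch. ALL s. dot t1 (Y *v s) = fst x * dot t1 s & dot t2 (Y *v s) = snd x * dot t2 s"
begin

text \<open>A form vanishing on the line factors through the surjection \<open>al\<close>.\<close>

lemma kernel_form:
 assumes "!!s. al *v s = 0 ==> dot r s = 0"
 shows "EX g0 g1. ALL s. dot r s = g1 * (al *v s) $ 1 + g0 * (al *v s) $ 2"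
proof -
 obtain R where R: "al ** R = mat 1" using al_surj by blast
 have "dot r s = dot r (R *v (al *v s))" for s
 proof -
 have "al *v (s - R *v (al *v s)) = 0"
 by (simp add: matrix_vector_mult_diff_distrib matrix_vector_mul_assoc matrix_mul_assoc R)
 from assms[OF this] have "dot r (s - R *v (al *v s)) = 0" .
 then show ?thesis by (simp add: dot_def sum_subtractf algebra_simps)
 qed
 moreover have "dot r (R *v w) = dot r (R *v axis 1 1) * w $ 1 + dot r (R *v axis 2 1) * w $ 2" for w
 by (simp add: dot_def matrix_vector_mult_def sum_4 sum_2 axis_def algebra_simps)
 ultimately show ?thesis by metis
qed

lemma coordinates_ext:
 assumes "dot t1 s = dot t1 s'" "dot t2 s = dot t2 s'" "dot f1 s = dot f1 s'" "dot f2 s = dot f2 s'"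
 shows "s = s'"
proof -
 have d: "dot r (s - s') = dot r s - dot r s'" for r by (simp add: dot_def sum_subtractf algebra_simps)
 have "s - s' = 0" by (rule basis) (simp_all add: d assms)
 then show ?thesis by simp
qed

lemma al_ext:
 assumes "dot f1 s = dot f1 s'" "dot f2 s = dot f2 s'"
 shows "al *v s = al *v s'"
proof -
 have d: "dot r (s - s') = dot r s - dot r s'" for r by (simp add: dot_def sum_subtractf algebra_simps)
 have "al *v (s - s') = 0" unfolding kernel by (simp add: d assms)
 then show ?thesis by (simp add: matrix_vector_mult_diff_distrib)
qed

lemma al_W: "x : Ch ==> al ** W x = al"
proof -
 assume x: "x : Ch"
 have "(al ** W x) *v s = al *v s" for s
 unfolding matrix_vector_mul_assoc[symmetric] using W_vec(3,4)[OF x] by (rule al_ext)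
 then show ?thesis by (simp add: matrix_eq)
qed

lemma W_mult: "x : Ch ==> y : Ch ==> W x ** W y = W (pmult x y)"
 unfolding matrix_eq
 by (intro allI coordinates_ext)
 (simp_all add: matrix_vector_mul_assoc[symmetric] W_vec Ch_mult pmult_simps)

lemma W_one: "W (1, 1) = mat 1"
 unfolding matrix_eq by (intro allI coordinates_ext) (simp_all add: W_vec Ch_one)

definition y1 :: "4 ppoint => complex" where "y1 p = dot t1 (co p) / h2 p"
definition y2 :: "4 ppoint => complex" where "y2 p = dot t2 (co p) / h2 p"

lemma y_nu: assumes "x : Ch" "p : C"
 shows "y1 (nu (W x) p) = fst x * y1 p" "y2 (nu (W x) p) = snd x * y2 p" "uf (nu (W x) p) = uf p"
 using dot_ratio_nu[OF W_cone[OF assms(1)] al_W[OF assms(1)] assms(2)]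
 by (simp_all add: y1_def y2_def W_vec assms)

text \<open>Polynomials in u with the basis 1, y1, y2, y1 y2. The relations \<open>rel1\<close> and
  \<open>rel2\<close> make these functions a ring, and the group multiplies the four basis elements
  by characters.\<close>

definition reduced :: "(4 ppoint => complex) => bool" where
 "reduced f \<longleftrightarrow> (EX P Q S T. ev C (%p. f p = poly P (uf p) + y1 p * poly Q (uf p) + y2 p * poly S (uf p) + y1 p * y2 p * poly T (uf p)))"

lemma reducedI:
 "ev C (%p. f p = poly P (uf p) + y1 p * poly Q (uf p) + y2 p * poly S (uf p) + y1 p * y2 p * poly T (uf p)) ==> reduced f"
 unfolding reduced_def by blast

lemma reduced_const: "reduced (%_. k)"
 by (rule reducedI[of _ "[:k:]" 0 0 0]) simp

lemma reduced_add:
 assumes "reduced f" "reduced g" shows "reduced (%p. f p + g p)"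
proof -
 obtain P Q S T where f: "ev C (%p. f p = poly P (uf p) + y1 p * poly Q (uf p) + y2 p * poly S (uf p) + y1 p * y2 p * poly T (uf p))"
 using assms(1) unfolding reduced_def by blast
 obtain P' Q' S' T' where g: "ev C (%p. g p = poly P' (uf p) + y1 p * poly Q' (uf p) + y2 p * poly S' (uf p) + y1 p * y2 p * poly T' (uf p))"
 using assms(2) unfolding reduced_def by blast
 have "ev C (%p. f p + g p = poly (P + P') (uf p) + y1 p * poly (Q + Q') (uf p) + y2 p * poly (S + S') (uf p) + y1 p * y2 p * poly (T + T') (uf p))"
 using f g by eventually_elim (simp add: algebra_simps)
 then show ?thesis by (rule reducedI)
qed

lemma relations:
 obtains q1 l1 q2 where "ev C (%p. y1 p * y1 p = poly q1 (uf p) + poly l1 (uf p) * y2 p & y2 p * y2 p = poly q2 (uf p))"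
proof -
 obtain d0 d1 where d: "!!s. dot f1 s = d1 * (al *v s) $ 1 + d0 * (al *v s) $ 2"
 using kernel_form[of f1] kernel by blast
 obtain e0 e1 where e: "!!s. dot f2 s = e1 * (al *v s) $ 1 + e0 * (al *v s) $ 2"
 using kernel_form[of f2] kernel by blast
 let ?D = "[:d0, d1:]" and ?E = "[:e0, e1:]"
 have "ev C (%p. y1 p * y1 p = poly (Polynomial.smult a (?D * ?D) + Polynomial.smult b (?E * ?E)) (uf p) + poly (Polynomial.smult c ?D) (uf p) * y2 p &
 y2 p * y2 p = poly (Polynomial.smult a' (?D * ?D) + Polynomial.smult b' (?E * ?E)) (uf p))"
 using eventually_h2 eventually_almost_in[of C]
 proof eventually_elim
 case (elim p)
 have D: "dot f1 (co p) = h2 p * poly ?D (uf p)" and E: "dot f2 (co p) = h2 p * poly ?E (uf p)"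
 using elim(1) by (simp_all add: d e uf_def h1_def[symmetric] h2_def[symmetric] field_simps)
 note r = rel1[OF co_in_cone[OF elim(2)]] rel2[OF co_in_cone[OF elim(2)]]
 have "y1 p * y1 p = dot t1 (co p) ^ 2 / h2 p ^ 2" "y2 p * y2 p = dot t2 (co p) ^ 2 / h2 p ^ 2"
 by (simp_all add: y1_def y2_def power2_eq_square)
 then show ?case unfolding r D E using elim(1)
 by (simp add: y2_def add_divide_distrib power_mult_distrib) (simp add: power2_eq_square algebra_simps add_divide_distrib)
 qed
 then show thesis by (rule that)
qed

lemma reduced_mult:
 assumes "reduced f" "reduced g" shows "reduced (%p. f p * g p)"
proof -
 obtain P Q S T where f: "ev C (%p. f p = poly P (uf p) + y1 p * poly Q (uf p) + y2 p * poly S (uf p) + y1 p * y2 p * poly T (uf p))"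
 using assms(1) unfolding reduced_def by blast
 obtain P' Q' S' T' where g: "ev C (%p. g p = poly P' (uf p) + y1 p * poly Q' (uf p) + y2 p * poly S' (uf p) + y1 p * y2 p * poly T' (uf p))"
 using assms(2) unfolding reduced_def by blast
 obtain q1 l1 q2 where rel: "ev C (%p. y1 p * y1 p = poly q1 (uf p) + poly l1 (uf p) * y2 p & y2 p * y2 p = poly q2 (uf p))"
 by (rule relations)
 have "ev C (%p. f p * g p =
 poly (P * P' + Q * Q' * q1 + S * S' * q2 + (Q * T' + T * Q') * l1 * q2 + T * T' * q1 * q2) (uf p) +
 y1 p * poly (P * Q' + Q * P' + (S * T' + T * S') * q2) (uf p) +
 y2 p * poly (P * S' + S * P' + Q * Q' * l1 + (Q * T' + T * Q') * q1 + T * T' * l1 * q2) (uf p) +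
 y1 p * y2 p * poly (P * T' + T * P' + Q * S' + S * Q') (uf p))"
 using f g rel
 proof eventually_elim
 case (elim p)
 define u v where "u = y1 p" and "v = y2 p"
 have uu: "u * u = poly q1 (uf p) + poly l1 (uf p) * v" and vv: "v * v = poly q2 (uf p)"
 using elim(3) by (simp_all add: u_def v_def)
 have expand: "(p0 + u * q + v * s + u * v * t) * (p' + u * q' + v * s' + u * v * t') =
 p0 * p' + u * (p0 * q' + q * p') + v * (p0 * s' + s * p') + u * v * (p0 * t' + t * p' + q * s' + s * q') +
 (u * u) * (q * q') + (v * v) * (s * s') + (u * u) * v * (q * t' + t * q') + u * (v * v) * (s * t' + t * s') + (u * u) * (v * v) * (t * t')"
 for p0 q s t p' q' s' t' :: complex by (simp add: algebra_simps)
 have e2: "(k1 + k2 * v) * v = k1 * v + k2 * (v * v)" for k1 k2 by (simp add: algebra_simps)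
 show ?case unfolding elim(1,2) u_def[symmetric] v_def[symmetric] expand uu e2 vv
 by (simp add: algebra_simps)
 qed
 then show ?thesis by (rule reducedI)
qed

lemma coordinate_matrix:
 obtains Y :: "complex ^ 4 ^ 4" where "!!w. dot t1 (Y *v w) = w $ 1" "!!w. dot t2 (Y *v w) = w $ 2"
 "!!w. dot f1 (Y *v w) = w $ 3" "!!w. dot f2 (Y *v w) = w $ 4"
proof -
 define B :: "complex ^ 4 ^ 4" where "B = vector [t1, t2, f1, f2]"
 have B: "(B *v s) $ 1 = dot t1 s" "(B *v s) $ 2 = dot t2 s" "(B *v s) $ 3 = dot f1 s" "(B *v s) $ 4 = dot f2 s" for s
 by (simp_all add: B_def matrix_vector_mult_def dot_def)
 have "s = 0" if "B *v s = 0" for s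
 using basis[of s] that B[of s] by simp
 then obtain Y where "Y ** B = mat 1" using matrix_left_invertible_ker[of B] by blast
 then have Y: "B ** Y = mat 1" by (simp add: matrix_left_right_inverse)
 show thesis by (rule that[of Y]) (simp_all add: B[symmetric] matrix_vector_mul_assoc Y)
qed

lemma reduced_linear: "reduced (%p. dot r (co p) / h2 p)"
proof -
 obtain Y :: "complex ^ 4 ^ 4" where Y: "!!w. dot t1 (Y *v w) = w $ 1" "!!w. dot t2 (Y *v w) = w $ 2"
 "!!w. dot f1 (Y *v w) = w $ 3" "!!w. dot f2 (Y *v w) = w $ 4" using coordinate_matrix by metis
 define g where "g k = dot r (Y *v axis k 1)" for k
 have "dot r (Y *v w) = g 1 * w $ 1 + g 2 * w $ 2 + g 3 * w $ 3 + g 4 * w $ 4" for w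
 by (simp add: g_def dot_def matrix_vector_mult_def sum_4 axis_def algebra_simps)
 moreover have "s = Y *v vector [dot t1 s, dot t2 s, dot f1 s, dot f2 s]" for s
 by (rule coordinates_ext) (simp_all add: Y)
 ultimately have r: "dot r s = g 1 * dot t1 s + g 2 * dot t2 s + (g 3 * dot f1 s + g 4 * dot f2 s)" for s
 by (metis (no_types, lifting) vector_4 add.assoc)
 obtain d0 d1 where d: "!!s. dot f1 s = d1 * (al *v s) $ 1 + d0 * (al *v s) $ 2"
 using kernel_form[of f1] kernel by blast
 obtain e0 e1 where e: "!!s. dot f2 s = e1 * (al *v s) $ 1 + e0 * (al *v s) $ 2"
 using kernel_form[of f2] kernel by blast
 have "ev C (%p. dot r (co p) / h2 p = poly (Polynomial.smult (g 3) [:d0, d1:] + Polynomial.smult (g 4) [:e0, e1:]) (uf p) +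
 y1 p * poly [:g 1:] (uf p) + y2 p * poly [:g 2:] (uf p) + y1 p * y2 p * poly 0 (uf p))"
 using eventually_h2
 proof eventually_elim
 case (elim p)
 then show ?case unfolding r d e y1_def y2_def uf_def h1_def[symmetric] h2_def[symmetric]
 by (simp add: field_simps)
 qed
 then show ?thesis by (rule reducedI)
qed

lemma reduced_form:
 assumes "hpoly d P" shows "reduced (%p. P (rep p) / h2 p ^ d)"
 using assms
proof (induction rule: hom_poly_induct)
 case (const k)
 then show ?case using reduced_const[of k] by simp
next
 case (coord i)
 have eq: "rep p $ i / h2 p ^ 1 = dot (M $ i) (co p) / h2 p" for p
 proof -
 have "rep p $ i = (M *v co p) $ i" by (simp add: co_def)
 then show ?thesis by (simp add: matrix_vector_mult_def dot_def)
 qed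
 show ?case unfolding eq by (rule reduced_linear)
next
 case (add d P Q)
 then show ?case using reduced_add[OF add(3,4)] by (simp add: add_divide_distrib)
next
 case (mult d e P Q)
 then show ?case using reduced_mult[OF mult(3,4)] by (simp add: power_add)
qed

lemma reduced_nu:
 assumes f: "reduced f" and x: "x : Ch" shows "reduced (%p. f (nu (W x) p))"
proof -
 obtain P Q S T where f: "ev C (%p. f p = poly P (uf p) + y1 p * poly Q (uf p) + y2 p * poly S (uf p) + y1 p * y2 p * poly T (uf p))"
 using f unfolding reduced_def by blast
 have "ev C (%p. f (nu (W x) p) = poly P (uf p) + y1 p * poly (Polynomial.smult (fst x) Q) (uf p) + y2 p * poly (Polynomial.smult (snd x) S) (uf p)
 + y1 p * y2 p * poly (Polynomial.smult (fst x * snd x) T) (uf p))"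
 using eventually_nu[OF W_cone[OF x] f] eventually_almost_in[of C]
 by eventually_elim (simp add: y_nu[OF x])
 then show ?thesis by (rule reducedI)
qed

lemma reduced_prod:
 assumes "finite I" "!!i. i : I ==> reduced (f i)" shows "reduced (%p. \<Prod>i\<in>I. f i p)"
 using assms by (induction rule: finite_induct) (auto intro: reduced_const reduced_mult)

text \<open>Averaging over the group: by \<open>Ch_sums\<close> the characters of y1, y2 and y1 y2
  sum to 0, so only the polynomial in u survives.\<close>

lemma reduced_invariant:
 assumes f: "reduced f" and inv: "!!x. x : Ch ==> ev C (%p. f (nu (W x) p) = f p)"
 shows "EX P. ev C (%p. f p = poly P (uf p))"
proof -
 obtain P Q S T where f: "ev C (%p. f p = poly P (uf p) + y1 p * poly Q (uf p) + y2 p * poly S (uf p) + y1 p * y2 p * poly T (uf p))"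
 using f unfolding reduced_def by blast
 have "ev C (%p. \<forall>x\<in>Ch. f p = poly P (uf p) + fst x * (y1 p * poly Q (uf p)) + snd x * (y2 p * poly S (uf p)) + (fst x * snd x) * (y1 p * y2 p * poly T (uf p)))"
 proof (intro eventually_ball_finite finite_Ch ballI)
 fix x assume x: "x : Ch"
 show "ev C (%p. f p = poly P (uf p) + fst x * (y1 p * poly Q (uf p)) + snd x * (y2 p * poly S (uf p)) + (fst x * snd x) * (y1 p * y2 p * poly T (uf p)))"
 using inv[OF x] eventually_nu[OF W_cone[OF x] f] eventually_almost_in[of C]
 proof eventually_elim
 case (elim p)
 have "f p = f (nu (W x) p)" using elim(1) by simp
 then show ?case unfolding elim(2) y_nu[OF x elim(3)] by (simp add: mult_ac)
 qed
 qed
 then have "ev C (%p. f p = poly P (uf p))"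
 proof eventually_elim
 case (elim p)
 have "of_nat (card Ch) * f p = (\<Sum>x\<in>Ch. f p)" by simp
 also have "\<dots> = (\<Sum>x\<in>Ch. poly P (uf p) + fst x * (y1 p * poly Q (uf p)) + snd x * (y2 p * poly S (uf p)) + (fst x * snd x) * (y1 p * y2 p * poly T (uf p)))"
 using elim by (intro sum.cong refl) blast
 also have "\<dots> = of_nat (card Ch) * poly P (uf p)"
 by (simp add: sum.distrib sum_distrib_right[symmetric] Ch_sums)
 finally show ?case using finite_Ch Ch_one by auto
 qed
 then show ?thesis by blast
qed

text \<open>Both polynomials are homogenized to the common degree \<open>n\<close> in h1 and
  h2.\<close>

lemma inK_quotient:
 assumes Q: "Q ~= 0" and f: "ev C (%p. f p = poly P (uf p) / poly Q (uf p))"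
 shows "inK f"
proof -
 define n where "n = max (pdeg P) (pdeg Q)"
 define hm :: "complex poly => complex ^ 2 => complex" where
 "hm R v = (\<Sum>i\<le>n. Polynomial.coeff R i * ((v $ 1) ^ i * (v $ 2) ^ (n - i)))" for R v
 have hom: "hpoly n (hm R)" for R
 unfolding hm_def
 proof (intro hom_poly_sum finite_atMost hom_poly_cmult)
 fix i assume "i : {..n}"
 then show "hpoly n (%v :: complex ^ 2. (v $ 1) ^ i * (v $ 2) ^ (n - i))"
 using hom_poly_mult[OF hom_poly_power[OF hom_poly_coord[of 1], of i]
 hom_poly_power[OF hom_poly_coord[of 2], of "n - i"]] by simp
 qed
 have hm: "hm R (al *v co p) = h2 p ^ n * poly R (uf p)" if "pdeg R <= n" "h2 p ~= 0" for R p
 proof -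
 have "poly R (uf p) = (\<Sum>i\<le>n. Polynomial.coeff R i * uf p ^ i)"
 unfolding poly_altdef using that(1) by (intro sum.mono_neutral_left) (auto simp: coeff_eq_0)
 then have "h2 p ^ n * poly R (uf p) = (\<Sum>i\<le>n. Polynomial.coeff R i * (h2 p ^ n * uf p ^ i))"
 by (simp add: sum_distrib_left mult_ac)
 also have "\<dots> = hm R (al *v co p)" unfolding hm_def
 proof (rule sum.cong)
 fix i assume "i : {..n}"
 then have "h2 p ^ n = h2 p ^ i * h2 p ^ (n - i)" by (simp add: power_add[symmetric])
 then show "Polynomial.coeff R i * (h2 p ^ n * uf p ^ i) = Polynomial.coeff R i * ((al *v co p) $ 1 ^ i * (al *v co p) $ 2 ^ (n - i))"
 using that(2) by (simp add: uf_def h1_def[symmetric] h2_def[symmetric] power_divide)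
 qed simp
 finally show ?thesis ..
 qed
 have deg: "pdeg P <= n" "pdeg Q <= n" by (simp_all add: n_def)
 have ev: "ev C (%p. hm Q (al *v co p) ~= 0 & al *v co p ~= 0 & f p = hm P (al *v co p) / hm Q (al *v co p))"
 using f eventually_poly_uf[OF Q] eventually_h2 eventually_almost_in[of C]
 proof eventually_elim
 case (elim p)
 then show ?case using hm[OF deg(1) elim(3)] hm[OF deg(2) elim(3)] al_nonzero[OF elim(4)] by simp
 qed
 from eventually_happens[OF ev] almost_neq_bot obtain p where "hm Q (al *v co p) ~= 0" "al *v co p ~= 0" by blast
 moreover have "ev C (%p. f p = hm P (al *v co p) / hm Q (al *v co p))"
 using ev by eventually_elim simp
 ultimately show ?thesis unfolding inK_def using hom by blast
qed

text \<open>The product of all conjugates of the denominator is invariant, hence a polynomial in u;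
  the numerator is multiplied by all conjugates except the denominator itself.\<close>

lemma norm_denominator:
 assumes f: "rational C f"
 obtains g Q where "reduced g" "Q ~= 0" "ev C (%p. f p * poly Q (uf p) = g p)"
proof -
 obtain d P Q where PQ: "hpoly d P" "hpoly d Q"
 "ev C (%q. Q (rep q) ~= 0 & f q = P (rep q) / Q (rep q))" using rationalE[OF f] .
 define q where "q p = Q (rep p) / h2 p ^ d" for p
 define n where "n p = (\<Prod>x\<in>Ch. q (nu (W x) p))" for p
 have q: "reduced q" unfolding q_def by (rule reduced_form[OF PQ(2)])
 have rn: "reduced n" unfolding n_def by (intro reduced_prod finite_Ch reduced_nu q)
 have "ev C (%p. n (nu (W y) p) = n p)" if y: "y : Ch" for y
 proof (rule eventually_almostI)
 fix p assume p: "p : C"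
 obtain y' where y': "y' : Ch" "pmult y y' = (1, 1)" using Ch_inverse[OF y] by blast
 have "n (nu (W y) p) = (\<Prod>x\<in>Ch. q (nu (W (pmult x y)) p))"
 unfolding n_def by (intro prod.cong refl) (simp add: nu_mult W_cone y p W_mult)
 also have "\<dots> = n p" unfolding n_def
 proof (rule prod.reindex_bij_betw)
 show "bij_betw (%x. pmult x y) Ch Ch"
 proof (rule bij_betw_byWitness[of _ "%x. pmult x y'"])
 show "\<forall>x\<in>Ch. pmult (pmult x y) y' = x" "\<forall>x\<in>Ch. pmult (pmult x y') y = x"
 using y'(2) by (auto simp: pmult_def mult.assoc mult.left_commute mult.commute)
 qed (use y y'(1) Ch_mult in blast)+
 qed
 finally show "n (nu (W y) p) = n p" .
 qed
 from reduced_invariant[OF rn this] obtain S where S: "ev C (%p. n p = poly S (uf p))" by blast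
 have q0: "ev C (%p. q p ~= 0)" using PQ(3) eventually_h2 by eventually_elim (simp add: q_def)
 then have "ev C (%p. \<forall>x\<in>Ch. q (nu (W x) p) ~= 0)"
 by (intro eventually_ball_finite finite_Ch ballI eventually_nu W_cone)
 then have "ev C (%p. poly S (uf p) ~= 0)"
 using S
 proof eventually_elim
 case (elim p)
 have "n p ~= 0" unfolding n_def using elim(1) finite_Ch by simp
 then show ?case using elim(2) by simp
 qed
 from eventually_happens[OF this] almost_neq_bot have S0: "S ~= 0" by auto
 define g where "g p = P (rep p) / h2 p ^ d * (\<Prod>x\<in>Ch - {(1, 1)}. q (nu (W x) p))" for p
 have g: "reduced g" unfolding g_def
 by (intro reduced_mult reduced_form[OF PQ(1)] reduced_prod finite_Diff finite_Ch reduced_nu q) auto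
 have "ev C (%p. f p * poly S (uf p) = g p)"
 using S PQ(3) eventually_almost_in[of C]
 proof eventually_elim
 case (elim p)
 have "poly S (uf p) = q (nu (W (1, 1)) p) * (\<Prod>x\<in>Ch - {(1, 1)}. q (nu (W x) p))"
 unfolding elim(1)[symmetric] n_def by (rule prod.remove[OF finite_Ch Ch_one])
 then show ?case using elim(2) by (simp add: W_one nu_mat1[OF elim(3)] g_def q_def)
 qed
 then show thesis using that g S0 by blast
qed

lemma invariant_inK:
 assumes f: "rational C f" and inv: "!!x. x : Ch ==> ev C (%p. f (nu (W x) p) = f p)"
 shows "inK f"
proof -
 obtain g Q where g: "reduced g" "Q ~= 0" "ev C (%p. f p * poly Q (uf p) = g p)"
 using norm_denominator[OF f] .
 have "ev C (%p. g (nu (W x) p) = g p)" if x: "x : Ch" for x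
 using g(3) eventually_nu[OF W_cone[OF x] g(3)] inv[OF x] eventually_almost_in[of C]
 proof eventually_elim
 case (elim p)
 then show ?case using y_nu(3)[OF x elim(4)] by simp
 qed
 from reduced_invariant[OF g(1) this] obtain P where "ev C (%p. g p = poly P (uf p))" by blast
 then have "ev C (%p. f p = poly P (uf p) / poly Q (uf p))"
 using g(3) eventually_poly_uf[OF g(2)] by eventually_elim (simp add: field_simps)
 then show ?thesis by (rule inK_quotient[OF g(2)])
qed

lemma rational_decomposition:
 assumes f: "rational C f"
 shows "EX k1 k2 k3 k4. inK k1 & inK k2 & inK k3 & inK k4 &
 ev C (%p. f p = k1 p + k2 p * y1 p + k3 p * y2 p + k4 p * (y1 p * y2 p))"
proof -
 obtain g Q where g: "reduced g" "Q ~= 0" "ev C (%p. f p * poly Q (uf p) = g p)"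
 using norm_denominator[OF f] .
 obtain P1 P2 P3 P4 where P: "ev C (%p. g p = poly P1 (uf p) + y1 p * poly P2 (uf p) + y2 p * poly P3 (uf p) + y1 p * y2 p * poly P4 (uf p))"
 using g(1) unfolding reduced_def by blast
 have "inK (%p. poly R (uf p) / poly Q (uf p))" for R by (rule inK_quotient[OF g(2), of _ R]) simp
 moreover have "ev C (%p. f p = poly P1 (uf p) / poly Q (uf p) + poly P2 (uf p) / poly Q (uf p) * y1 p +
 poly P3 (uf p) / poly Q (uf p) * y2 p + poly P4 (uf p) / poly Q (uf p) * (y1 p * y2 p))"
 using g(3) P eventually_poly_uf[OF g(2)] by eventually_elim (simp add: field_simps)
 ultimately show ?thesis by blast
qed

text \<open>An automorphism comes from a matrix fixing f1, f2 and, by \<open>complete\<close>,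
  acting on t1, t2 through a pair of characters in \<open>Ch\<close>; these four forms are
  coordinates, so it is one of the \<open>W x\<close>.\<close>

lemma galois_auts_eq: "galois_auts (ffld C) (line_subfield C l) = (%x. fun_aut (W x)) ` Ch"
proof (intro equalityI subsetI)
 fix \<sigma> assume \<sigma>: "\<sigma> : galois_auts (ffld C) (line_subfield C l)"
 obtain Y where Y: "Y : cone_auts" "al ** Y = al"
 "!!f. rational C f ==> \<sigma> (fun_class C f) = fun_class C (%p. f (nu Y p))" using galois_aut_matrix[OF \<sigma>] by blast
 obtain x where x: "x : Ch" "!!s. dot t1 (Y *v s) = fst x * dot t1 s" "!!s. dot t2 (Y *v s) = snd x * dot t2 s"
 using complete[OF Y(1,2)] by blast
 have "dot f1 (Y *v s) = dot f1 s" "dot f2 (Y *v s) = dot f2 s" for s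
 proof -
 have "al *v (Y *v s - s) = 0" by (simp add: matrix_vector_mult_diff_distrib matrix_vector_mul_assoc Y(2))
 then have "dot f1 (Y *v s - s) = 0" "dot f2 (Y *v s - s) = 0" unfolding kernel by auto
 then show "dot f1 (Y *v s) = dot f1 s" "dot f2 (Y *v s) = dot f2 s" by (simp_all add: dot_def sum_subtractf algebra_simps)
 qed
 then have "Y = W x" unfolding matrix_eq using x(2,3) by (intro allI coordinates_ext) (simp_all add: W_vec[OF x(1)])
 moreover have "\<sigma> = fun_aut Y"
 proof
 fix z show "\<sigma> z = fun_aut Y z"
 proof (cases "z : carrier (ffld C)")
 case True
 then obtain f where "rational C f" "z = fun_class C f" by (rule carrierE)
 then show ?thesis by (simp add: Y(3) fun_aut_fun_class Y(1))
 next
 case False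
 then show ?thesis using \<sigma> by (simp add: galois_auts_def fun_aut_def extensional_def)
 qed
 qed
 ultimately show "\<sigma> : (%x. fun_aut (W x)) ` Ch" using x(1) by blast
next
 fix \<sigma> assume "\<sigma> : (%x. fun_aut (W x)) ` Ch"
 then obtain x where x: "x : Ch" "\<sigma> = fun_aut (W x)" by blast
 obtain y where y: "y : Ch" "pmult x y = (1, 1)" using Ch_inverse[OF x(1)] by blast
 have "pmult y x = (1, 1)" using y(2) by (simp add: pmult_def mult.commute)
 then have "W y ** W x = mat 1" by (simp add: W_mult x(1) y(1) W_one)
 then show "\<sigma> : galois_auts (ffld C) (line_subfield C l)"
 unfolding x(2) by (intro fun_aut_galois[OF W_cone al_W W_cone]) (use x y in auto)
qed

lemma fixed_eq:
 "{x : carrier (ffld C). \<forall>\<sigma> \<in> galois_auts (ffld C) (line_subfield C l). \<sigma> x = x} = line_subfield C l"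
proof (intro equalityI subsetI)
 fix x assume x: "x : {x : carrier (ffld C). \<forall>\<sigma> \<in> galois_auts (ffld C) (line_subfield C l). \<sigma> x = x}"
 then obtain f where f: "rational C f" "x = fun_class C f" by (auto elim: carrierE)
 have "ev C (%p. f (nu (W y) p) = f p)" if "y : Ch" for y
 proof -
 have "fun_aut (W y) x = x" using x that unfolding galois_auts_eq by blast
 then show ?thesis unfolding f(2) fun_aut_fun_class[OF W_cone[OF that] f(1)] fun_class_eq_iff .
 qed
 then show "x : line_subfield C l" unfolding f(2) fun_class_in_line_subfield by (intro invariant_inK f(1))
next
 fix x assume "x : line_subfield C l"
 then show "x : {x : carrier (ffld C). \<forall>\<sigma> \<in> galois_auts (ffld C) (line_subfield C l). \<sigma> x = x}"
 using line_subfield_subset unfolding galois_auts_def by blast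
qed

lemma invariant_in_line_subfield:
 assumes "rational C f" "!!x. x : Ch ==> ev C (%p. f (nu (W x) p) = f p)"
 shows "fun_class C f : line_subfield C l"
 unfolding fun_class_in_line_subfield using assms by (rule invariant_inK)

lemma line_subfieldE:
 assumes "x : line_subfield C l"
 obtains f where "rational C f" "x = fun_class C f" "!!x. x : Ch ==> ev C (%p. f (nu (W x) p) = f p)"
proof -
 obtain f where f: "rational C f" "x = fun_class C f" using assms line_subfield_subset by (meson carrierE subsetD)
 have "ev C (%p. f (nu (W y) p) = f p)" if "y : Ch" for y
 proof -
 have "fun_aut (W y) x = x" using assms that fixed_eq galois_auts_eq by blast
 then show ?thesis unfolding f(2) fun_aut_fun_class[OF W_cone[OF that] f(1)] fun_class_eq_iff .
 qed
 then show thesis using f that by blast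
qed

lemma subfield_line_subfield: "subfield (line_subfield C l) (ffld C)"
proof -
 let ?L = "ffld C" and ?K = "line_subfield C l"
 interpret L: field ?L by (rule field_function_field)
 show ?thesis
 proof (rule L.subfieldI')
 show "subring ?K ?L"
 proof (rule L.subringI)
 show "?K \<subseteq> carrier ?L" by (rule line_subfield_subset)
 show "\<one>\<^bsub>?L\<^esub> : ?K" unfolding function_field_one by (rule invariant_in_line_subfield) (auto intro: rational_const)
 show "\<ominus>\<^bsub>?L\<^esub> x : ?K" if x: "x : ?K" for x
 proof -
 obtain f where f: "rational C f" "x = fun_class C f" "!!x. x : Ch ==> ev C (%p. f (nu (W x) p) = f p)"
 using line_subfieldE[OF x] by metis
 have "fun_class C (%p. - f p) : ?K"
 proof (rule invariant_in_line_subfield)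
 fix x assume "x : Ch"
 from f(3)[OF this] show "ev C (%p. - f (nu (W x) p) = - f p)" by eventually_elim simp
 qed (intro rational_uminus f)
 moreover have "fun_class C (%p. - f p) = \<ominus>\<^bsub>?L\<^esub> x"
 proof (rule L.minus_equality[symmetric])
 show "fun_class C (%p. - f p) \<oplus>\<^bsub>?L\<^esub> x = \<zero>\<^bsub>?L\<^esub>"
 by (simp add: f(2) function_field_add function_field_zero)
 qed (simp_all add: f fun_class_in_carrier rational_uminus)
 ultimately show ?thesis by simp
 qed
 fix x y assume xy: "x : ?K" "y : ?K"
 obtain f where f: "rational C f" "x = fun_class C f" "!!x. x : Ch ==> ev C (%p. f (nu (W x) p) = f p)"
 using line_subfieldE[OF xy(1)] by metis
 obtain g where g: "rational C g" "y = fun_class C g" "!!x. x : Ch ==> ev C (%p. g (nu (W x) p) = g p)"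
 using line_subfieldE[OF xy(2)] by metis
 show "x \<otimes>\<^bsub>?L\<^esub> y : ?K" unfolding f(2) g(2) function_field_mult
 proof (rule invariant_in_line_subfield)
 fix z assume z: "z : Ch"
 show "ev C (%p. f (nu (W z) p) * g (nu (W z) p) = f p * g p)"
 using f(3)[OF z] g(3)[OF z] by eventually_elim simp
 qed (intro rational_mult f g)
 show "x \<oplus>\<^bsub>?L\<^esub> y : ?K" unfolding f(2) g(2) function_field_add
 proof (rule invariant_in_line_subfield)
 fix z assume z: "z : Ch"
 show "ev C (%p. f (nu (W z) p) + g (nu (W z) p) = f p + g p)"
 using f(3)[OF z] g(3)[OF z] by eventually_elim simp
 qed (intro rational_add f g)
 qed
 fix x assume x: "x : ?K - {\<zero>\<^bsub>?L\<^esub>}"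
 obtain f where f: "rational C f" "x = fun_class C f" "!!x. x : Ch ==> ev C (%p. f (nu (W x) p) = f p)"
 using line_subfieldE[of x] x by blast
 have f0: "ev C (%p. f p ~= 0)"
 using rational_dichotomy[OF f(1)] x by (auto simp: f(2) function_field_zero fun_class_eq_iff)
 have ri: "rational C (%p. inverse (f p))" by (rule rational_inverse[OF f(1)])
 have "inv\<^bsub>?L\<^esub> x = fun_class C (%p. inverse (f p))"
 proof (rule L.comm_inv_char)
 show "x \<otimes>\<^bsub>?L\<^esub> fun_class C (%p. inverse (f p)) = \<one>\<^bsub>?L\<^esub>"
 unfolding f(2) function_field_mult function_field_one fun_class_eq_iff using f0 by eventually_elim simp
 qed (simp_all add: f fun_class_in_carrier ri)
 moreover have "fun_class C (%p. inverse (f p)) : ?K"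
 proof (rule invariant_in_line_subfield[OF ri])
 fix x assume "x : Ch"
 from f(3)[OF this] show "ev C (%p. inverse (f (nu (W x) p)) = inverse (f p))" by eventually_elim simp
 qed
 ultimately show "inv\<^bsub>?L\<^esub> x : ?K" by simp
 qed
qed

lemma rational_y: "rational C y1" "rational C y2"
proof -
 have "rational C (%p. dot r (co p) / h2 p)" for r
 proof -
 have "hpoly 1 (%v. dot r (N *v v))"
 unfolding dot_def by (intro hom_poly_sum finite hom_poly_cmult homogeneous_coordinate)
 from rational_over_h2[OF this] show ?thesis by (simp add: co_def)
 qed
 then show "rational C y1" "rational C y2" unfolding y1_def y2_def by blast+
qed

text \<open>The four elements 1, y1, y2, y1 y2 span the function field over the subfield, so the
  extension is finite.\<close>

lemma algebraic_line_subfield: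
 assumes x: "x : carrier (ffld C)"
 shows "ring.algebraic (ffld C) (line_subfield C l) x"
proof -
 let ?L = "ffld C" and ?K = "line_subfield C l"
 interpret L: field ?L by (rule field_function_field)
 define Us where "Us = [fun_class C (%_. 1), fun_class C y1, fun_class C y2, fun_class C (%p. y1 p * y2 p)]"
 have Us: "set Us \<subseteq> carrier ?L"
 by (simp add: Us_def fun_class_in_carrier rational_y rational_mult rational_const)
 have Span_Cons: "L.Span ?K (u # us) = L.line_extension ?K u (L.Span ?K us)" for u us by simp
 have "x : L.Span ?K Us" if x: "x : carrier ?L" for x
 proof -
 obtain f where f: "rational C f" "x = fun_class C f" using x by (rule carrierE)
 obtain k1 k2 k3 k4 where k: "inK k1" "inK k2" "inK k3" "inK k4"
 "ev C (%p. f p = k1 p + k2 p * y1 p + k3 p * y2 p + k4 p * (y1 p * y2 p))"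
 using rational_decomposition[OF f(1)] by blast
 have "fun_class C (%p. k4 p * (y1 p * y2 p) + 0) : L.Span ?K [fun_class C (%p. y1 p * y2 p)]"
 unfolding function_field_add[symmetric] function_field_mult[symmetric, of C k4]
 using k(4) by (auto simp: L.line_extension_mem_iff fun_class_in_line_subfield function_field_zero)
 then have "fun_class C (%p. k3 p * y2 p + (k4 p * (y1 p * y2 p) + 0)) : L.Span ?K [fun_class C y2, fun_class C (%p. y1 p * y2 p)]"
 unfolding function_field_add[symmetric, of C "%p. k3 p * y2 p"] function_field_mult[symmetric, of C k3]
 using k(3) unfolding Span_Cons[of "fun_class C y2"] L.line_extension_mem_iff by (metis fun_class_in_line_subfield)
 then have "fun_class C (%p. k2 p * y1 p + (k3 p * y2 p + (k4 p * (y1 p * y2 p) + 0))) : L.Span ?K [fun_class C y1, fun_class C y2, fun_class C (%p. y1 p * y2 p)]"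
 unfolding function_field_add[symmetric, of C "%p. k2 p * y1 p"] function_field_mult[symmetric, of C k2]
 using k(2) unfolding Span_Cons[of "fun_class C y1"] L.line_extension_mem_iff by (metis fun_class_in_line_subfield)
 then have "fun_class C (%p. k1 p * 1 + (k2 p * y1 p + (k3 p * y2 p + (k4 p * (y1 p * y2 p) + 0)))) : L.Span ?K Us"
 unfolding Us_def function_field_add[symmetric, of C "%p. k1 p * 1"] function_field_mult[symmetric, of C k1]
 using k(1) unfolding Span_Cons[of "fun_class C (%_. 1)"] L.line_extension_mem_iff by (metis fun_class_in_line_subfield)
 moreover have "fun_class C (%p. k1 p * 1 + (k2 p * y1 p + (k3 p * y2 p + (k4 p * (y1 p * y2 p) + 0)))) = x"
 unfolding f(2) fun_class_eq_iff using k(5) by eventually_elim simp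
 ultimately show ?thesis by simp
 qed
 then have "L.Span ?K Us = carrier ?L"
 using L.Span_in_carrier[OF line_subfield_subset Us] by blast
 then have "L.finite_dimension ?K (carrier ?L)"
 using L.Span_finite_dimension[OF subfield_line_subfield Us] by simp
 then show ?thesis
 using L.finite_dimension_imp_algebraic[OF subfield_line_subfield L.carrier_is_subring _ x] by (simp add: over_def)
qed

theorem galois_extension: "galois_extension (ffld C) (line_subfield C l)"
 unfolding galois_extension_def using subfield_line_subfield algebraic_line_subfield fixed_eq by blast

theorem galois_line: "galois_line C l"
 unfolding galois_line_def using line disjoint galois_extension by blast

theorem galois_group_iso:
 assumes H: "group H" and \<theta>: "bij_betw \<theta> (carrier H) Ch"
 and hom: "!!i j. i : carrier H ==> j : carrier H ==> \<theta> (i \<otimes>\<^bsub>H\<^esub> j) = pmult (\<theta> i) (\<theta> j)"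
 shows "galois_group (ffld C) (line_subfield C l) \<cong> H" "H \<cong> galois_group (ffld C) (line_subfield C l)"
proof -
 let ?G = "galois_group (ffld C) (line_subfield C l)"
 define \<phi> where "\<phi> i = fun_aut (W (\<theta> i))" for i
 have \<theta>_Ch: "\<theta> i : Ch" if "i : carrier H" for i using \<theta> that by (auto simp: bij_betw_def)
 have carrier: "carrier ?G = (%x. fun_aut (W x)) ` Ch" by (simp add: galois_group_def galois_auts_eq)
 have inj: "inj_on (%x. fun_aut (W x)) Ch"
 proof (rule inj_onI)
 fix x y assume xy: "x : Ch" "y : Ch" "fun_aut (W x) = fun_aut (W y)"
 have W_eq: "W x = W y" by (rule fun_aut_inj) (use xy W_cone al_W in auto)
 have eq: "fst x * dot t1 s = fst y * dot t1 s" "snd x * dot t2 s = snd y * dot t2 s" for s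
 by (metis W_vec(1)[OF xy(1)] W_vec(1)[OF xy(2)] W_eq, metis W_vec(2)[OF xy(1)] W_vec(2)[OF xy(2)] W_eq)
 obtain Y :: "complex ^ 4 ^ 4" where Y: "!!w. dot t1 (Y *v w) = w $ 1" "!!w. dot t2 (Y *v w) = w $ 2"
 using coordinate_matrix by metis
 have "dot t1 (Y *v axis 1 1) ~= 0" "dot t2 (Y *v axis 2 1) ~= 0" unfolding Y by (simp_all add: axis_def)
 then have "fst x = fst y" "snd x = snd y"
 using eq(1)[of "Y *v axis 1 1"] eq(2)[of "Y *v axis 2 1"] by simp_all
 then show "x = y" by (simp add: prod_eq_iff)
 qed
 have "bij_betw \<phi> (carrier H) (carrier ?G)"
 unfolding carrier \<phi>_def using bij_betw_trans[OF \<theta> inj_on_imp_bij_betw[OF inj]] by (simp add: o_def)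
 moreover have "\<phi> : hom H ?G"
 proof (rule homI)
 show "\<phi> i : carrier ?G" if "i : carrier H" for i unfolding carrier \<phi>_def using \<theta>_Ch[OF that] by blast
 fix i j assume ij: "i : carrier H" "j : carrier H"
 have bij: "fun_aut (W x) : Bij (carrier (ffld C))" if "x : Ch" for x
 using that galois_auts_eq unfolding galois_auts_def Bij_def ring_iso_def by blast
 \<comment> \<open>\<open>fun_aut\<close> reverses products; commutativity of the characters still
   gives a homomorphism.\<close>
 have "pmult (\<theta> j) (\<theta> i) = pmult (\<theta> i) (\<theta> j)" by (simp add: pmult_def mult.commute)
 then have "W (\<theta> j) ** W (\<theta> i) = W (\<theta> (i \<otimes>\<^bsub>H\<^esub> j))" using ij \<theta>_Ch by (simp add: W_mult hom)
 then have "compose (carrier (ffld C)) (\<phi> i) (\<phi> j) = \<phi> (i \<otimes>\<^bsub>H\<^esub> j)"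
 using ij \<theta>_Ch W_cone by (auto simp: compose_def \<phi>_def fun_aut_mult fun_eq_iff restrict_def fun_aut_def[of "W (\<theta> (i \<otimes>\<^bsub>H\<^esub> j))"])
 then show "\<phi> (i \<otimes>\<^bsub>H\<^esub> j) = \<phi> i \<otimes>\<^bsub>?G\<^esub> \<phi> j"
 using bij \<theta>_Ch ij by (simp add: galois_group_def BijGroup_def \<phi>_def)
 qed
 ultimately show "H \<cong> ?G" unfolding is_iso_def iso_def by blast
 then show "?G \<cong> H" by (rule group.iso_sym[OF H])
qed

end

section \<open>The two families of lines and their groups\<close>

text \<open>The edge joining the vertices i and j is cut out by the two complementary coordinates k
  and m.\<close>

definition V4_data :: "4 => 4 => 4 => 4 => bool" where
 "V4_data i j k m \<longleftrightarrow> (i, j, k, m) : {(1,2,3,4), (1,3,2,4), (1,4,2,3), (2,3,1,4), (2,4,1,3), (3,4,1,2)}"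

lemma V4_data_exhaust: "V4_data i j k m ==> x = i | x = j | x = k | x = m"
 using exhaust_4[of x] by (auto simp: V4_data_def)

lemma V4_data_distinct: "V4_data i j k m ==> i ~= j & i ~= k & i ~= m & j ~= k & j ~= m & k ~= m"
 by (auto simp: V4_data_def)

lemma V4_data_ex: "i ~= j ==> EX k m. V4_data i j k m | V4_data j i k m"
 using exhaust_4[of i] exhaust_4[of j] by (elim disjE) (simp_all add: V4_data_def)

lemma Z4_data_exhaust: "Z4_data i p q r e ==> x = i | x = p | x = q | x = r"
 using exhaust_4[of x] by (auto simp: Z4_data_def)

lemma Z4_data_distinct: "Z4_data i p q r e ==> i ~= p & i ~= q & i ~= r & p ~= q & p ~= r & q ~= r & e ~= 0"
 by (auto simp: Z4_data_def)

lemma qcone_components: "s : qcone \<longleftrightarrow> s $ 1 ^ 2 = s $ 3 ^ 2 - s $ 2 ^ 2 & s $ 4 ^ 2 = s $ 2 ^ 2 + s $ 3 ^ 2"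
 by (simp add: qcone_def)

lemma V4_relations:
 assumes "V4_data i j k m"
 shows "EX a b a' b'. \<forall>s\<in>qcone. s $ i ^ 2 = a * s $ k ^ 2 + b * s $ m ^ 2 & s $ j ^ 2 = a' * s $ k ^ 2 + b' * s $ m ^ 2"
proof -
 have w: "EX a b a' b'. \<forall>s\<in>qcone. s $ i ^ 2 = a * s $ k ^ 2 + b * s $ m ^ 2 & s $ j ^ 2 = a' * s $ k ^ 2 + b' * s $ m ^ 2"
 if "!!s. s : qcone ==> s $ i ^ 2 = a * s $ k ^ 2 + b * s $ m ^ 2 & s $ j ^ 2 = a' * s $ k ^ 2 + b' * s $ m ^ 2" for a b a' b'
 using that by blast
 from assms show ?thesis unfolding V4_data_def insert_iff empty_iff simp_thms
 proof (elim disjE)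
 assume "(i, j, k, m) = (1, 2, 3, 4)" then show ?thesis by (intro w[of 2 "- 1" "- 1" 1]) (auto simp: qcone_components)
 next
 assume "(i, j, k, m) = (1, 3, 2, 4)" then show ?thesis by (intro w[of "- 2" 1 "- 1" 1]) (auto simp: qcone_components)
 next
 assume "(i, j, k, m) = (1, 4, 2, 3)" then show ?thesis by (intro w[of "- 1" 1 1 1]) (auto simp: qcone_components)
 next
 assume "(i, j, k, m) = (2, 3, 1, 4)" then show ?thesis
 by (intro w[of "- 1 / 2" "1 / 2" "1 / 2" "1 / 2"]) (auto simp: qcone_components field_simps, metis distrib_left)
 next
 assume "(i, j, k, m) = (2, 4, 1, 3)" then show ?thesis by (intro w[of "- 1" 1 "- 1" 2]) (auto simp: qcone_components)
 next
 assume "(i, j, k, m) = (3, 4, 1, 2)" then show ?thesis by (intro w[of 1 1 1 2]) (auto simp: qcone_components)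
 qed
qed

text \<open>On the cone s_i^2 is a multiple of s_q^2 - e^2 s_r^2, which factors, and s_q^2 + e^2
  s_r^2 is a multiple of s_p^2.\<close>

lemma Z4_relations:
 assumes "Z4_data i p q r e"
 shows "EX c m. \<forall>s\<in>qcone. s $ i ^ 2 = c * (s $ q + e * s $ r) * (s $ q - e * s $ r) &
 (s $ q - e * s $ r) ^ 2 = - 1 * (s $ q + e * s $ r) ^ 2 + m * s $ p ^ 2"
proof -
 have e4: "(x + e * y) * (x - e * y) = x ^ 2 - e ^ 2 * y ^ 2" "(x - e * y) ^ 2 + (x + e * y) ^ 2 = 2 * (x ^ 2 + e ^ 2 * y ^ 2)" for x y
 by (simp_all add: algebra_simps power2_eq_square)
 have w: ?thesis if "!!s. s : qcone ==> s $ i ^ 2 = c * (s $ q ^ 2 - e ^ 2 * s $ r ^ 2) &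
 2 * (s $ q ^ 2 + e ^ 2 * s $ r ^ 2) = m * s $ p ^ 2" for c m
 using that unfolding e4(1)[symmetric] e4(2)[symmetric]
 by (intro exI[of _ c] exI[of _ m]) (auto simp: mult.assoc eq_diff_eq)
 from assms consider "(i, p, q, r) = (1,4,2,3)" "e ^ 2 = 1" | "(i, p, q, r) = (2,3,1,4)" "e ^ 2 = 1"
 | "(i, p, q, r) = (4,1,2,3)" "e ^ 2 = - 1" | "(i, p, q, r) = (3,2,1,4)" "e ^ 2 = - 1"
 by (auto simp: Z4_data_def)
 then show ?thesis
 proof cases
 case 1 then show ?thesis by (intro w[of "- 1" 2]) (auto simp: qcone_components)
 next
 case 2 then show ?thesis by (intro w[of "- 1 / 2" 4]) (auto simp: qcone_components field_simps, metis distrib_left)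
 next
 case 3 then show ?thesis by (intro w[of 1 "- 2"]) (auto simp: qcone_components)
 next
 case 4 then show ?thesis by (intro w[of "1 / 2" "- 4"]) (auto simp: qcone_components field_simps, metis distrib_left)
 qed
qed

lemma cone_autsI:
 assumes "Y ** W = mat 1" "!!s. s : qcone ==> W *v s : qcone"
 shows "W : cone_auts"
 using assms by (auto simp: cone_auts_def)

definition sign_matrix :: "4 => 4 => complex \<times> complex => complex ^ 4 ^ 4" where
 "sign_matrix i j x = matrix (%s. \<chi> k. if k = i then fst x * s $ i else if k = j then snd x * s $ j else s $ k)"

lemma sign_matrix: "(sign_matrix i j x *v s) $ k = (if k = i then fst x * s $ i else if k = j then snd x * s $ j else s $ k)"
proof -
 have "Vector_Spaces.linear (*s) (*s) (%s :: complex ^ 4. \<chi> k. if k = i then fst x * s $ i else if k = j then snd x * s $ j else s $ k)"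
 by (simp add: Vector_Spaces.linear_iff vec.vector_space_axioms vec_eq_iff algebra_simps)
 from matrix_works[OF this] show ?thesis by (simp add: sign_matrix_def)
qed

lemma sign_matrix_cone:
 assumes "i ~= j" and x: "fst x = 1 | fst x = - 1" "snd x = 1 | snd x = - 1"
 shows "sign_matrix i j x : cone_auts"
proof (rule cone_autsI)
 have x2: "fst x * fst x = 1" "snd x * snd x = 1" using x by auto
 show "sign_matrix i j x ** sign_matrix i j x = mat 1"
 unfolding matrix_eq
 by (simp add: matrix_vector_mul_assoc[symmetric] vec_eq_iff sign_matrix x2 mult.assoc[symmetric])
 fix s assume "s : qcone"
 moreover have "((sign_matrix i j x *v s) $ k) ^ 2 = (s $ k) ^ 2" for k
 unfolding sign_matrix by (auto simp: power_mult_distrib power2_eq_square[of "fst x"] power2_eq_square[of "snd x"] x2)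
 ultimately show "sign_matrix i j x *v s : qcone" by (simp add: qcone_components)
qed

text \<open>The second character is \<open>1\<close> or \<open>-1\<close>; in the latter case the coordinates \<open>q\<close> and \<open>r\<close> are
 exchanged up to the factor \<open>e\<close>.\<close>

definition cycle_matrix :: "4 => 4 => 4 => complex => complex \<times> complex => complex ^ 4 ^ 4" where
 "cycle_matrix i q r e x = matrix (%s. \<chi> k. if k = i then fst x * s $ i
 else if k = q then (if snd x = 1 then s $ q else e * s $ r)
 else if k = r then (if snd x = 1 then s $ r else s $ q / e) else s $ k)"

lemma cycle_matrix: "(cycle_matrix i q r e x *v s) $ k = (if k = i then fst x * s $ i
 else if k = q then (if snd x = 1 then s $ q else e * s $ r)
 else if k = r then (if snd x = 1 then s $ r else s $ q / e) else s $ k)"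
proof -
 have "Vector_Spaces.linear (*s) (*s) (%s :: complex ^ 4. \<chi> k. if k = i then fst x * s $ i
 else if k = q then (if snd x = 1 then s $ q else e * s $ r)
 else if k = r then (if snd x = 1 then s $ r else s $ q / e) else s $ k)"
 by (simp add: Vector_Spaces.linear_iff vec.vector_space_axioms vec_eq_iff algebra_simps add_divide_distrib)
 from matrix_works[OF this] show ?thesis by (simp add: cycle_matrix_def)
qed

text \<open>The cyclic group generated by (\<i>, -1): if s_q - e s_r changes sign, s_i is multiplied
  by a primitive fourth root of unity.\<close>

definition Z4_characters :: "(complex \<times> complex) set" where
 "Z4_characters = {(1, 1), (\<i>, - 1), (- 1, 1), (- \<i>, - 1)}"

definition V4_characters :: "(complex \<times> complex) set" where
 "V4_characters = {(1, 1), (1, - 1), (- 1, 1), (- 1, - 1)}"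

lemma cycle_matrix_cone:
 assumes D: "Z4_data i p q r e" and x: "x : Z4_characters"
 shows "cycle_matrix i q r e x : cone_auts"
proof (rule cone_autsI)
 note d = Z4_data_distinct[OF D]
 define y where "y = (1 / fst x, snd x)"
 have x0: "fst x ~= 0" using x by (auto simp: Z4_characters_def)
 show "cycle_matrix i q r e y ** cycle_matrix i q r e x = mat 1"
 unfolding matrix_eq using d x0
 by (auto simp: matrix_vector_mul_assoc[symmetric] vec_eq_iff cycle_matrix y_def)
 fix s assume s: "s : qcone"
 have f: "fst x ^ 2 = (if snd x = 1 then 1 else - 1)" using x by (auto simp: Z4_characters_def)
 from D consider "(i, p, q, r) = (1,4,2,3)" "e ^ 2 = 1" | "(i, p, q, r) = (2,3,1,4)" "e ^ 2 = 1"
 | "(i, p, q, r) = (4,1,2,3)" "e ^ 2 = - 1" | "(i, p, q, r) = (3,2,1,4)" "e ^ 2 = - 1"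
 by (auto simp: Z4_data_def)
 then show "cycle_matrix i q r e x *v s : qcone"
 by cases (use s in \<open>auto simp: qcone_components cycle_matrix power_mult_distrib power_divide f\<close>)
qed

text \<open>Doubling kills every element of the four group, but not the generator 1 of Z4.\<close>

lemma group_iso_contradiction: "\<not> integer_mod_group 4 \<cong> integer_mod_group 2 \<times>\<times> integer_mod_group 2"
proof
 assume "integer_mod_group 4 \<cong> integer_mod_group 2 \<times>\<times> integer_mod_group 2"
 then obtain h where h: "h : hom (integer_mod_group 4) (integer_mod_group 2 \<times>\<times> integer_mod_group 2)"
 "inj_on h (carrier (integer_mod_group 4))"
 unfolding is_iso_def iso_def bij_betw_def by blast
 have car: "carrier (integer_mod_group 4) = {0..<4}" "carrier (integer_mod_group 2) = {0..<2}"
 by (simp_all add: carrier_integer_mod_group)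
 have double: "h ((x + x) mod 4) = (0, 0)" if "x : {0..<4}" for x
 proof -
 have "h (x \<otimes>\<^bsub>integer_mod_group 4\<^esub> x) = h x \<otimes>\<^bsub>integer_mod_group 2 \<times>\<times> integer_mod_group 2\<^esub> h x"
 using that car by (intro hom_mult[OF h(1)]) auto
 moreover have "h x : {0..<2} \<times> {0..<2}"
 using that car hom_in_carrier[OF h(1), of x] by simp
 ultimately show ?thesis by (auto simp: mult_integer_mod_group split: prod.splits)
 qed
 have "h 2 = h 0" using double[of 1] double[of 0] by simp
 from inj_onD[OF h(2) this] show False using car by simp
qed

context quartic_curve
begin

text \<open>The product of u - v and u + v vanishes on the curve, which is irreducible and lies in
  no plane.\<close>

lemma forms_square:
 assumes "!!s. s : qcone ==> dot u s ^ 2 = dot v s ^ 2"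
 shows "u = v | u = - v"
proof -
 have "hpoly 1 (%x. dot (u - v) (N *v x))"
 unfolding dot_def by (intro hom_poly_sum finite hom_poly_cmult homogeneous_coordinate)
 from form_dichotomy[OF this] show ?thesis
 proof
 assume "ev C (%p. dot (u - v) (N *v rep p) = 0)"
 then have "ev C (%p. (\<Sum>j\<in>UNIV. (u - v) $ j * co p $ j) = 0)" by (simp add: dot_def co_def)
 from linear_independent[OF this] show ?thesis by simp
 next
 assume "ev C (%p. dot (u - v) (N *v rep p) ~= 0)"
 then have "ev C (%p. (\<Sum>j\<in>UNIV. (u + v) $ j * co p $ j) = 0)"
 using eventually_almost_in[of C]
 proof eventually_elim
 case (elim p)
 have "dot (u - v) (co p) * dot (u + v) (co p) = dot u (co p) ^ 2 - dot v (co p) ^ 2"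
 by (simp add: dot_diff_left dot_add_left algebra_simps power2_eq_square)
 then have "dot (u + v) (co p) = 0" using elim(1) assms[OF co_in_cone[OF elim(2)]] by (simp add: co_def)
 then show ?case by (simp add: dot_def)
 qed
 from linear_independent[OF this] show ?thesis by (simp add: eq_neg_iff_add_eq_0)
 qed
qed

lemma forms_square_matrix:
 assumes "!!s. s : qcone ==> dot u (Y *v s) ^ 2 = k ^ 2 * dot u s ^ 2"
 shows "(ALL s. dot u (Y *v s) = k * dot u s) | (ALL s. dot u (Y *v s) = - k * dot u s)"
proof -
 have Y: "dot u (Y *v s) = dot (transpose Y *v u) s" for s
 by (simp add: dot_def matrix_vector_mult_def transpose_def sum_4 algebra_simps)
 have k: "dot (k *s u) s = k * dot u s" for s k by (simp add: dot_def sum_distrib_left mult.assoc)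
 have "transpose Y *v u = k *s u | transpose Y *v u = - (k *s u)"
 by (rule forms_square) (use assms in \<open>simp add: Y k power_mult_distrib\<close>)
 moreover have "- (k *s u) = (- k) *s u" by (simp add: vec_eq_iff)
 ultimately show ?thesis unfolding Y using k by metis
qed

end

context quartic_line
begin

lemma V4_case:
 assumes D: "V4_data i j k m" and ker: "!!s. al *v s = 0 \<longleftrightarrow> s $ k = 0 & s $ m = 0"
 shows "galois_line C l" "galois_group (ffld C) (line_subfield C l) \<cong> integer_mod_group 2 \<times>\<times> integer_mod_group 2"
 "integer_mod_group 2 \<times>\<times> integer_mod_group 2 \<cong> galois_group (ffld C) (line_subfield C l)"
proof -
 note d = V4_data_distinct[OF D]
 obtain a b a' b' where rel: "!!s. s : qcone ==> s $ i ^ 2 = a * s $ k ^ 2 + b * s $ m ^ 2"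
 "!!s. s : qcone ==> s $ j ^ 2 = a' * s $ k ^ 2 + b' * s $ m ^ 2" using V4_relations[OF D] by blast
 have pm: "x : V4_characters \<longleftrightarrow> (fst x = 1 | fst x = - 1) & (snd x = 1 | snd x = - 1)" for x
 by (cases x) (auto simp: V4_characters_def)
 interpret diagonal_line M N C l A "axis i 1" "axis j 1" "axis k 1" "axis m 1" a b 0 a' b' V4_characters "sign_matrix i j"
 proof unfold_locales
 fix Y assume Y: "Y : cone_auts" "al ** Y = al"
 have fix_km: "(Y *v s) $ k = s $ k & (Y *v s) $ m = s $ m" for s
 proof -
 have "al *v (Y *v s - s) = 0" by (simp add: matrix_vector_mult_diff_distrib matrix_vector_mul_assoc Y(2))
 then show ?thesis unfolding ker by simp
 qed
 have Ys: "Y *v s : qcone" if "s : qcone" for s using Y(1) that by (simp add: cone_auts_def)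
 have "(ALL s. dot (axis i 1) (Y *v s) = 1 * dot (axis i 1) s) | (ALL s. dot (axis i 1) (Y *v s) = - 1 * dot (axis i 1) s)"
 by (rule forms_square_matrix) (simp add: dot_axis rel Ys fix_km)
 moreover have "(ALL s. dot (axis j 1) (Y *v s) = 1 * dot (axis j 1) s) | (ALL s. dot (axis j 1) (Y *v s) = - 1 * dot (axis j 1) s)"
 by (rule forms_square_matrix) (simp add: dot_axis rel Ys fix_km)
 ultimately show "\<exists>x\<in>V4_characters. ALL s. dot (axis i 1) (Y *v s) = fst x * dot (axis i 1) s & dot (axis j 1) (Y *v s) = snd x * dot (axis j 1) s"
 unfolding V4_characters_def bex_simps by auto
 next
 fix s assume "dot (axis i 1) s = 0" "dot (axis j 1) s = 0" "dot (axis k 1) s = 0" "dot (axis m 1) s = 0"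
 then have "s $ x = 0" for x using V4_data_exhaust[OF D, of x] by (auto simp: dot_axis)
 then show "s = 0" by (simp add: vec_eq_iff)
 next
 show "\<exists>y\<in>V4_characters. pmult x y = (1, 1)" if "x : V4_characters" for x
 using that by (intro bexI[of _ x]) (auto simp: V4_characters_def pmult_def)
 qed (use d in \<open>auto simp: dot_axis ker rel sign_matrix pm intro: sign_matrix_cone\<close>,
 auto simp: V4_characters_def pmult_def)
 show "galois_line C l" by (rule galois_line)
 define \<theta> where "\<theta> x = (if fst x = (0::int) then 1 else - 1 :: complex, if snd x = (0::int) then 1 else - 1 :: complex)" for x
 have car: "carrier (integer_mod_group 2 \<times>\<times> integer_mod_group 2) = {(0, 0), (0, 1), (1, 0), (1, 1)}"
 by (auto simp: carrier_integer_mod_group)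
 have H: "group (integer_mod_group 2 \<times>\<times> integer_mod_group 2)" by (intro DirProd_group group_integer_mod_group)
 have bij: "bij_betw \<theta> (carrier (integer_mod_group 2 \<times>\<times> integer_mod_group 2)) V4_characters"
 unfolding car bij_betw_def by (auto simp: \<theta>_def V4_characters_def)
 have hom: "\<theta> (x \<otimes>\<^bsub>integer_mod_group 2 \<times>\<times> integer_mod_group 2\<^esub> y) = pmult (\<theta> x) (\<theta> y)"
 if "x : carrier (integer_mod_group 2 \<times>\<times> integer_mod_group 2)" "y : carrier (integer_mod_group 2 \<times>\<times> integer_mod_group 2)" for x y
 using that unfolding car insert_iff empty_iff simp_thms
 by (elim disjE) (simp_all add: \<theta>_def pmult_def mult_integer_mod_group)
 show "galois_group (ffld C) (line_subfield C l) \<cong> integer_mod_group 2 \<times>\<times> integer_mod_group 2" "integer_mod_group 2 \<times>\<times> integer_mod_group 2 \<cong> galois_group (ffld C) (line_subfield C l)"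
 by (rule galois_group_iso[OF H bij]; rule hom; assumption)+
qed

text \<open>A matrix fixing f = s_q + e s_r and s_p fixes the square of t = s_q - e s_r, so t goes
  to t or -t. As s_i^2 is a multiple of f t, its square is multiplied by the same sign, and s_i by
  one of the two roots of that sign.\<close>

lemma Z4_case:
 assumes D: "Z4_data i p q r e" and ker: "!!s. al *v s = 0 \<longleftrightarrow> s $ q + e * s $ r = 0 & s $ p = 0"
 shows "galois_line C l" "galois_group (ffld C) (line_subfield C l) \<cong> integer_mod_group 4"
 "integer_mod_group 4 \<cong> galois_group (ffld C) (line_subfield C l)"
proof -
 note d = Z4_data_distinct[OF D]
 let ?f = "axis q 1 + e *s axis r 1" and ?t = "axis q 1 - e *s axis r 1"
 have dots: "dot ?f s = s $ q + e * s $ r" "dot ?t s = s $ q - e * s $ r" for s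
 proof -
 have "dot (e *s axis r 1) s = e * dot (axis r 1) s" by (simp add: dot_def sum_distrib_left mult.assoc)
 then show "dot ?f s = s $ q + e * s $ r" "dot ?t s = s $ q - e * s $ r"
 by (simp_all add: dot_add_left dot_diff_left dot_axis)
 qed
 obtain c m where rel: "!!s. s : qcone ==> s $ i ^ 2 = c * (s $ q + e * s $ r) * (s $ q - e * s $ r)"
 "!!s. s : qcone ==> (s $ q - e * s $ r) ^ 2 = - 1 * (s $ q + e * s $ r) ^ 2 + m * s $ p ^ 2"
 using Z4_relations[OF D] by blast
 interpret diagonal_line M N C l A "axis i 1" ?t ?f "axis p 1" 0 0 c "- 1" m Z4_characters "cycle_matrix i q r e"
 proof unfold_locales
 fix Y assume Y: "Y : cone_auts" "al ** Y = al"
 have fix_f: "(Y *v s) $ q + e * (Y *v s) $ r = s $ q + e * s $ r & (Y *v s) $ p = s $ p" for s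
 proof -
 have "al *v (Y *v s - s) = 0" by (simp add: matrix_vector_mult_diff_distrib matrix_vector_mul_assoc Y(2))
 then show ?thesis unfolding ker by (simp add: algebra_simps)
 qed
 have Ys: "Y *v s : qcone" if "s : qcone" for s using Y(1) that by (simp add: cone_auts_def)
 have t: "(ALL s. dot ?t (Y *v s) = 1 * dot ?t s) | (ALL s. dot ?t (Y *v s) = - 1 * dot ?t s)"
 by (rule forms_square_matrix) (simp add: dots rel Ys fix_f)
 have i1: "(ALL s. dot (axis i 1) (Y *v s) = k * dot (axis i 1) s) | (ALL s. dot (axis i 1) (Y *v s) = - k * dot (axis i 1) s)"
 if tk: "!!s. dot ?t (Y *v s) = k ^ 2 * dot ?t s" for k
 proof (rule forms_square_matrix)
 fix s assume s: "s : qcone"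
 show "dot (axis i 1) (Y *v s) ^ 2 = k ^ 2 * dot (axis i 1) s ^ 2"
 unfolding dot_axis rel(1)[OF s] rel(1)[OF Ys[OF s]] conjunct1[OF fix_f] tk[unfolded dots] by simp
 qed
 from t show "\<exists>x\<in>Z4_characters. ALL s. dot (axis i 1) (Y *v s) = fst x * dot (axis i 1) s & dot ?t (Y *v s) = snd x * dot ?t s"
 proof
 assume "ALL s. dot ?t (Y *v s) = 1 * dot ?t s"
 with i1[of 1] show ?thesis unfolding Z4_characters_def bex_simps by auto
 next
 assume "ALL s. dot ?t (Y *v s) = - 1 * dot ?t s"
 with i1[of \<i>] show ?thesis unfolding Z4_characters_def bex_simps by auto
 qed
 next
 fix s assume s: "dot (axis i 1) s = 0" "dot ?t s = 0" "dot ?f s = 0" "dot (axis p 1) s = 0"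
 then have "s $ i = 0" "s $ p = 0" "s $ q = 0" "s $ r = 0" using d unfolding dots dot_axis by auto
 then have "s $ x = 0" for x using Z4_data_exhaust[OF D, of x] by auto
 then show "s = 0" by (simp add: vec_eq_iff)
 next
 show "cycle_matrix i q r e x : cone_auts" if "x : Z4_characters" for x by (rule cycle_matrix_cone[OF D that])
 show "\<exists>y\<in>Z4_characters. pmult x y = (1, 1)" if "x : Z4_characters" for x
 using that by (auto simp: Z4_characters_def pmult_def)
 show "dot ?t (cycle_matrix i q r e x *v s) = snd x * dot ?t s" if "x : Z4_characters" for x s
 using that d unfolding dots by (auto simp: cycle_matrix Z4_characters_def)
 show "dot ?f (cycle_matrix i q r e x *v s) = dot ?f s" if "x : Z4_characters" for x s
 using that d unfolding dots by (auto simp: cycle_matrix Z4_characters_def)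
 qed (use d in \<open>auto simp: dot_axis dots ker rel cycle_matrix\<close>, auto simp: Z4_characters_def pmult_def)
 show "galois_line C l" by (rule galois_line)
 define \<theta> where "\<theta> x = (if x = (0::int) then (1, 1) else if x = 1 then (\<i>, - 1) else if x = 2 then (- 1, 1) else (- \<i>, - 1 :: complex))" for x
 have car: "carrier (integer_mod_group 4) = {0, 1, 2, 3}" by (auto simp: carrier_integer_mod_group)
 have H: "group (integer_mod_group 4)" by simp
 have bij: "bij_betw \<theta> (carrier (integer_mod_group 4)) Z4_characters"
 unfolding car bij_betw_def by (auto simp: \<theta>_def Z4_characters_def complex_eq_iff)
 have hom: "\<theta> (x \<otimes>\<^bsub>integer_mod_group 4\<^esub> y) = pmult (\<theta> x) (\<theta> y)"
 if "x : carrier (integer_mod_group 4)" "y : carrier (integer_mod_group 4)" for x y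
 using that unfolding car by (auto simp: \<theta>_def pmult_def mult_integer_mod_group)
 show "galois_group (ffld C) (line_subfield C l) \<cong> integer_mod_group 4" "integer_mod_group 4 \<cong> galois_group (ffld C) (line_subfield C l)"
 by (rule galois_group_iso[OF H bij]; rule hom; assumption)+
qed

text \<open>All columns are combinations of u and v; a nontrivial relation between u and v would
  make them multiples of one vector, against the rank of \<open>al\<close>.\<close>

lemma kernel_two_vectors:
 assumes al: "!!s. al *v s = f s *s u + g s *s v"
 shows "al *v s = 0 \<longleftrightarrow> f s = 0 & g s = 0"
proof
 assume s: "al *v s = 0"
 have cl: "cl k = f (axis k 1) *s u + g (axis k 1) *s v" for k
 unfolding al[symmetric] by (simp add: vec_eq_iff cl_def matrix_vector_mult_def axis_def if_distrib cong: if_cong)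
 have no_relation: False
 if xy: "x ~= 0" "x *s u' + y *s v' = 0" and comb: "!!k. EX a b. cl k = a *s u' + b *s v'" for x y u' v'
 proof (rule columns_not_proportional[of v'])
 fix k
 have "u' = (1 / x) *s (x *s u')" using xy(1) by (simp add: vec.scale_scale)
 also have "x *s u' = - (y *s v')" using xy(2) by (simp add: eq_neg_iff_add_eq_0)
 finally have "u' = (- y / x) *s v'" by (simp add: vec_eq_iff)
 moreover obtain a b where "cl k = a *s u' + b *s v'" using comb by blast
 ultimately have "cl k = (a * (- y / x) + b) *s v'" by (simp add: vec.scale_left_distrib vec.scale_scale)
 then show "EX a. cl k = a *s v'" by blast
 qed
 have "f s = 0" using no_relation[of "f s" u "g s" v] s cl al by metis
 moreover have "g s = 0" using no_relation[of "g s" v "f s" u] s cl al by (metis add.commute)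
 ultimately show "f s = 0 & g s = 0" ..
qed (simp add: al)

lemma kernel_V4:
 assumes D: "V4_data i j k m" and c: "cl i = 0" "cl j = 0"
 shows "al *v s = 0 \<longleftrightarrow> s $ k = 0 & s $ m = 0"
 by (rule kernel_two_vectors[of "%s. s $ k" "cl k" "%s. s $ m" "cl m"])
 (use D c in \<open>auto simp: V4_data_def al_cl add_ac\<close>)

lemma kernel_Z4:
 assumes D: "Z4_data i p q r e" and c: "cl i = 0" "cl r = e *s cl q"
 shows "al *v s = 0 \<longleftrightarrow> s $ q + e * s $ r = 0 & s $ p = 0"
proof (rule kernel_two_vectors[of "%s. s $ q + e * s $ r" "cl q" "%s. s $ p" "cl p"])
 fix s
 have "al *v s = s $ i *s cl i + s $ p *s cl p + s $ q *s cl q + s $ r *s cl r"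
 using D unfolding Z4_data_def al_cl by (auto simp: add_ac)
 then show "al *v s = (s $ q + e * s $ r) *s cl q + s $ p *s cl p"
 by (simp add: c vec.scale_left_distrib vec.scale_scale mult.commute add_ac)
qed

end

section \<open>The tetrahedron and the eight Z4-lines in coordinates\<close>

definition sg :: "nat => complex" where "sg m = (if m = 1 then 1 else - 1)"

text \<open>In the coordinates of the cone, vertex \<open>n\<close>, the direction of the Z4-line \<open>m\<close> through it, and
 the equations of that line.\<close>

definition vx :: "nat => 4" where "vx n = (if n = 0 then 1 else if n = 1 then 2 else if n = 2 then 3 else 4)"

definition vertex :: "nat => complex ^ 4" where "vertex n = axis (vx n) 1"

definition trace_vec :: "nat => nat => complex ^ 4" where
 "trace_vec n m = (if n = 0 then vector [0, - sg m, 1, 0] else if n = 1 then vector [sg m, 0, 0, 1]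
 else if n = 2 then vector [- sg m * \<i>, 0, 0, 1] else vector [0, sg m * \<i>, 1, 0])"

definition Z4_mem :: "nat => nat => complex ^ 4 => bool" where
 "Z4_mem n m t \<longleftrightarrow> (if n = 0 then t $ 2 + sg m * t $ 3 = 0 & t $ 4 = 0
 else if n = 1 then t $ 1 + - sg m * t $ 4 = 0 & t $ 3 = 0
 else if n = 2 then t $ 1 + (sg m * \<i>) * t $ 4 = 0 & t $ 2 = 0 else t $ 2 + (- sg m * \<i>) * t $ 3 = 0 & t $ 1 = 0)"

lemma less_4_cases: "n < 4 ==> n = 0 | n = 1 | n = 2 | n = (3::nat)"
 by auto

lemma sg_nonzero [simp]: "sg m ~= 0" by (simp add: sg_def)

lemma vertex_nonzero: "vertex n ~= 0" by (simp add: vertex_def axis_eq_0_iff)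

lemma trace_vec_nonzero: "trace_vec n m ~= 0"
 by (auto simp: trace_vec_def vec_eq_iff forall_4)

lemma Z4_mem_vertex:
 assumes "n < 4" "i < 4" shows "Z4_mem n m (vertex i) \<longleftrightarrow> i = n"
 using less_4_cases[OF assms(1)] less_4_cases[OF assms(2)] by (elim disjE) (simp_all add: Z4_mem_def vertex_def vx_def axis_def)

lemma Z4_mem_trace_vec:
 assumes "n < 4" "m : {1, 2}" "m' : {1, 2}" shows "Z4_mem n m (trace_vec n m') \<longleftrightarrow> m = m'"
 using less_4_cases[OF assms(1)] assms(2,3) by (elim disjE insertE emptyE) (simp_all add: Z4_mem_def trace_vec_def sg_def)

text \<open>A point of the line is a combination of the vertex and of the second point
  \<open>trace_vec\<close>. A point on an edge has two zero coordinates, and then one of the two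
  coefficients is 0.\<close>

lemma Z4_mem_decompose:
 assumes "n < 4" "Z4_mem n m t"
 shows "EX k. t = t $ vx n *s vertex n + t $ k *s trace_vec n m &
 (ALL i j. i ~= j --> t $ i = 0 --> t $ j = 0 --> t $ vx n = 0 | t $ k = 0)"
proof -
 have sg2: "sg m = 1 | sg m = - 1" by (simp add: sg_def)
 have two: "ALL i j. i ~= j --> t $ i = 0 --> t $ j = 0 --> t $ v = 0 | t $ k = 0"
 if "t $ k' ~= 0 | t $ k = 0" "!!i. i = v | i = k | i = k' | i = p" for v k k' p
 using that by metis
 have neg: "x + y = 0 ==> x = - y" for x y :: complex by (simp add: eq_neg_iff_add_eq_0)
 show ?thesis using less_4_cases[OF assms(1)]
 proof (elim disjE)
 assume n: "n = 0"
 then have t: "t $ 2 = - (sg m * t $ 3)" "t $ 4 = 0" using assms(2) neg by (auto simp: Z4_mem_def)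
 show ?thesis
 proof (intro exI[of _ 3] conjI)
 show "t = t $ vx n *s vertex n + t $ 3 *s trace_vec n m"
 by (simp add: vec_eq_iff forall_4 n vertex_def vx_def trace_vec_def axis_def t)
 show "ALL i j. i ~= j --> t $ i = 0 --> t $ j = 0 --> t $ vx n = 0 | t $ 3 = 0"
 by (rule two[of 2 3 "vx n" 4]) (use t exhaust_4 in \<open>auto simp: vx_def n\<close>)
 qed
 next
 assume n: "n = 1"
 then have t: "t $ 1 = sg m * t $ 4" "t $ 3 = 0" using assms(2) by (auto simp: Z4_mem_def)
 show ?thesis
 proof (intro exI[of _ 4] conjI)
 show "t = t $ vx n *s vertex n + t $ 4 *s trace_vec n m"
 by (simp add: vec_eq_iff forall_4 n vertex_def vx_def trace_vec_def axis_def t)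
 show "ALL i j. i ~= j --> t $ i = 0 --> t $ j = 0 --> t $ vx n = 0 | t $ 4 = 0"
 by (rule two[of 1 4 "vx n" 3]) (use t exhaust_4 in \<open>auto simp: vx_def n\<close>)
 qed
 next
 assume n: "n = 2"
 then have t: "t $ 1 = - (sg m * \<i> * t $ 4)" "t $ 2 = 0" using assms(2) neg by (auto simp: Z4_mem_def)
 show ?thesis
 proof (intro exI[of _ 4] conjI)
 show "t = t $ vx n *s vertex n + t $ 4 *s trace_vec n m"
 by (simp add: vec_eq_iff forall_4 n vertex_def vx_def trace_vec_def axis_def t)
 show "ALL i j. i ~= j --> t $ i = 0 --> t $ j = 0 --> t $ vx n = 0 | t $ 4 = 0"
 by (rule two[of 1 4 "vx n" 2]) (use t exhaust_4 in \<open>auto simp: vx_def n\<close>)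
 qed
 next
 assume n: "n = 3"
 then have t: "t $ 2 = sg m * \<i> * t $ 3" "t $ 1 = 0" using assms(2) by (auto simp: Z4_mem_def)
 show ?thesis
 proof (intro exI[of _ 3] conjI)
 show "t = t $ vx n *s vertex n + t $ 3 *s trace_vec n m"
 by (simp add: vec_eq_iff forall_4 n vertex_def vx_def trace_vec_def axis_def t)
 show "ALL i j. i ~= j --> t $ i = 0 --> t $ j = 0 --> t $ vx n = 0 | t $ 3 = 0"
 by (rule two[of 2 3 "vx n" 1]) (use t exhaust_4 in \<open>auto simp: vx_def n\<close>)
 qed
 qed
qed

text \<open>The equations of the two lines either kill all coordinates directly or leave one
  coordinate multiplied by a nonzero number of the form (+-1) + (+-1) \<i>.\<close>

lemma Z4_mem_disjoint:
 assumes "n < 4" "n' < 4" "n ~= n'" "Z4_mem n m t" "Z4_mem n' m' t"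
 shows "t = 0"
proof -
 have ne: "sg m * \<i> + sg m' ~= 0" "sg m + sg m' * \<i> ~= 0" for m m'
 by (auto simp: sg_def complex_eq_iff)
 have zero: "sg m * \<i> * y + sg m' * y = 0 \<longleftrightarrow> y = 0" "sg m * y + sg m' * \<i> * y = 0 \<longleftrightarrow> y = 0" for m m' y
 unfolding distrib_right[symmetric] using ne by auto
 from less_4_cases[OF assms(1)] less_4_cases[OF assms(2)] show ?thesis
 by (elim disjE) (use assms(3-5) zero in
 \<open>auto simp: Z4_mem_def vec_eq_iff forall_4\<close>)
qed

lemma Z4_mem_scale: "Z4_mem n m t ==> Z4_mem n m (c *s t)"
proof -
 have lin: "c * x + k * (c * y) = c * (x + k * y)" for x y k :: complex by (simp add: algebra_simps)
 show "Z4_mem n m t ==> Z4_mem n m (c *s t)" by (auto simp: Z4_mem_def lin simp del: mult_minus_left split: if_splits)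
qed

text \<open>Passes from the eight cases of \<open>Z4_data\<close> to the numbering by a vertex
  \<open>n\<close> and a sign index \<open>m\<close>, which fixes the names of the points R in part
  (c). The sign in \<open>e\<close> is that of \<open>sg m\<close> for n = 0 and n = 2, and the
  opposite one for n = 1 and n = 3.\<close>

lemma Z4_data_mem:
 "(EX i p q r e. Z4_data i p q r e & S = {x. h x $ q + e * h x $ r = 0 & h x $ p = 0}) \<longleftrightarrow>
 (\<exists>n<4. \<exists>m\<in>{1, 2}. S = {x. Z4_mem n m (h x)})"
proof
 assume "EX i p q r e. Z4_data i p q r e & S = {x. h x $ q + e * h x $ r = 0 & h x $ p = 0}"
 then obtain i p q r e where D: "Z4_data i p q r e" and S: "S = {x. h x $ q + e * h x $ r = 0 & h x $ p = 0}" by blast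
 have "\<exists>n<4. \<exists>m\<in>{1, 2}. ALL t. Z4_mem n m t \<longleftrightarrow> t $ q + e * t $ r = 0 & t $ p = 0"
 using D unfolding Z4_data_def insert_iff empty_iff simp_thms
 proof (elim disjE conjE)
 assume "(i, p, q, r) = (1, 4, 2, 3)" "e = 1"
 then show ?thesis by (intro exI[of _ 0] conjI bexI[of _ 1]) (auto simp: Z4_mem_def sg_def)
 next
 assume "(i, p, q, r) = (1, 4, 2, 3)" "e = - 1"
 then show ?thesis by (intro exI[of _ 0] conjI bexI[of _ 2]) (auto simp: Z4_mem_def sg_def)
 next
 assume "(i, p, q, r) = (2, 3, 1, 4)" "e = 1"
 then show ?thesis by (intro exI[of _ 1] conjI bexI[of _ 2]) (auto simp: Z4_mem_def sg_def)
 next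
 assume "(i, p, q, r) = (2, 3, 1, 4)" "e = - 1"
 then show ?thesis by (intro exI[of _ 1] conjI bexI[of _ 1]) (auto simp: Z4_mem_def sg_def)
 next
 assume "(i, p, q, r) = (4, 1, 2, 3)" "e = \<i>"
 then show ?thesis by (intro exI[of _ 3] conjI bexI[of _ 2]) (auto simp: Z4_mem_def sg_def)
 next
 assume "(i, p, q, r) = (4, 1, 2, 3)" "e = - \<i>"
 then show ?thesis by (intro exI[of _ 3] conjI bexI[of _ 1]) (auto simp: Z4_mem_def sg_def)
 next
 assume "(i, p, q, r) = (3, 2, 1, 4)" "e = \<i>"
 then show ?thesis by (intro exI[of _ 2] conjI bexI[of _ 1]) (auto simp: Z4_mem_def sg_def)
 next
 assume "(i, p, q, r) = (3, 2, 1, 4)" "e = - \<i>"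
 then show ?thesis by (intro exI[of _ 2] conjI bexI[of _ 2]) (auto simp: Z4_mem_def sg_def)
 qed
 then obtain n m where nm: "n < 4" "m : {1, 2}" "!!t. Z4_mem n m t \<longleftrightarrow> t $ q + e * t $ r = 0 & t $ p = 0" by metis
 have "S = {x. Z4_mem n m (h x)}" unfolding S nm(3) ..
 then show "\<exists>n<4. \<exists>m\<in>{1, 2}. S = {x. Z4_mem n m (h x)}" using nm(1,2) by blast
next
 assume "\<exists>n<4. \<exists>m\<in>{1, 2}. S = {x. Z4_mem n m (h x)}"
 then obtain n m where n: "n < 4" "m : {1, 2}" and S: "S = {x. Z4_mem n m (h x)}" by blast
 have s: "sg m = 1 | sg m = - 1" by (simp add: sg_def)
 from less_4_cases[OF n(1)]
 show "EX i p q r e. Z4_data i p q r e & S = {x. h x $ q + e * h x $ r = 0 & h x $ p = 0}"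
 proof (elim disjE)
 assume "n = 0"
 then have "Z4_data 1 4 2 3 (sg m) & S = {x. h x $ 2 + sg m * h x $ 3 = 0 & h x $ 4 = 0}"
 using s by (auto simp: S Z4_mem_def Z4_data_def)
 then show ?thesis by blast
 next
 assume "n = 1"
 then have "Z4_data 2 3 1 4 (- sg m) & S = {x. h x $ 1 + - sg m * h x $ 4 = 0 & h x $ 3 = 0}"
 using s by (auto simp: S Z4_mem_def Z4_data_def)
 then show ?thesis by blast
 next
 assume "n = 2"
 then have "Z4_data 3 2 1 4 (sg m * \<i>) & S = {x. h x $ 1 + (sg m * \<i>) * h x $ 4 = 0 & h x $ 2 = 0}"
 using s by (auto simp: S Z4_mem_def Z4_data_def)
 then show ?thesis by blast
 next
 assume "n = 3"
 then have "Z4_data 4 1 2 3 (- sg m * \<i>) & S = {x. h x $ 2 + (- sg m * \<i>) * h x $ 3 = 0 & h x $ 1 = 0}"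
 using s by (auto simp: S Z4_mem_def Z4_data_def)
 then show ?thesis by blast
 qed
qed

context quartic_curve
begin

lemma span_pair: "vec.span {M *v u, M *v v} = {x. EX a b. N *v x = a *s u + b *s v}"
proof -
 have "x : vec.span {M *v u, M *v v} \<longleftrightarrow> (EX a b. N *v x = a *s u + b *s v)" for x
 proof -
 have "x : vec.span {M *v u, M *v v} \<longleftrightarrow> (EX a b. x - a *s (M *v u) = b *s (M *v v))"
 by (auto simp: vec.span_insert[of "M *v u"] vec.span_singleton)
 also have "\<dots> \<longleftrightarrow> (EX a b. x = M *v (a *s u + b *s v))"
 by (simp add: matrix_vector_right_distrib vector_scalar_commute algebra_simps)
 also have "\<dots> \<longleftrightarrow> (EX a b. N *v x = a *s u + b *s v)"
 by (metis N_M_vec M_N_vec)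
 finally show ?thesis .
 qed
 then show ?thesis by blast
qed

lemma line_through_pt: "line_through (pt u) (pt v) = {x. EX a b. N *v x = a *s u + b *s v}"
 unfolding span_pair[symmetric] line_through_def pt_def hcoord_def
proof (rule subset_antisym)
 show "vec.span (vec.span {M *v u} \<union> vec.span {M *v v}) \<subseteq> vec.span {M *v u, M *v v}"
 by (intro vec.span_minimal Un_least vec.span_mono vec.subspace_span) auto
 show "vec.span {M *v u, M *v v} \<subseteq> vec.span (vec.span {M *v u} \<union> vec.span {M *v v})"
 by (intro vec.span_mono) (auto intro: vec.span_base)
qed

lemma span_pair_line:
 assumes "!!a b. a *s u + b *s v = 0 ==> a = 0 & b = 0"
 shows "{x. EX a b. N *v x = a *s u + b *s v} : proj_lines"
proof -
 have v0: "v ~= 0" using assms[of 0 1] by auto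
 have u: "M *v u \<notin> vec.span {M *v v}"
 proof
 assume "M *v u : vec.span {M *v v}"
 then obtain c where "M *v u = c *s (M *v v)" by (auto simp: vec.span_singleton)
 then have "N *v (M *v u) = N *v (c *s (M *v v))" by simp
 then have "1 *s u + (- c) *s v = 0" by (simp add: vector_scalar_commute)
 then show False using assms[of 1 "- c"] by simp
 qed
 then have ne: "M *v u ~= M *v v" using vec.span_base[of "M *v v" "{M *v v}"] by auto
 have "vec.independent {M *v v}" using v0 by simp
 with u have "vec.independent {M *v u, M *v v}" by (rule vec.independent_insertI)
 then have "vec.dim (vec.span {M *v u, M *v v}) = 2"
 using ne by (subst vec.dim_span_eq_card_independent) auto
 then show ?thesis unfolding span_pair[symmetric] proj_lines_def by (simp add: vec.subspace_span)
qed

definition V4_set :: "4 => 4 => (complex ^ 4) set" where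
 "V4_set k m = {x. (N *v x) $ k = 0 & (N *v x) $ m = 0}"

definition Z4_set :: "nat => nat => (complex ^ 4) set" where
 "Z4_set n m = {x. Z4_mem n m (N *v x)}"

lemma V4_set_span:
 assumes D: "V4_data i j k m"
 shows "V4_set k m = {x. EX a b. N *v x = a *s axis i 1 + b *s axis j 1}"
proof -
 have "t $ k = 0 & t $ m = 0 \<longleftrightarrow> (EX a b. t = a *s axis i 1 + b *s axis j 1)" for t :: "complex ^ 4"
 proof
 assume t: "t $ k = 0 & t $ m = 0"
 have "t = t $ i *s axis i 1 + t $ j *s axis j 1"
 using t V4_data_exhaust[OF D] V4_data_distinct[OF D] by (auto simp: vec_eq_iff axis_def)
 then show "EX a b. t = a *s axis i 1 + b *s axis j 1" by blast
 next
 assume "EX a b. t = a *s axis i 1 + b *s axis j 1"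
 then show "t $ k = 0 & t $ m = 0" using V4_data_distinct[OF D] by (auto simp: axis_def)
 qed
 then show ?thesis unfolding V4_set_def by blast
qed

lemma V4_set_line:
 assumes D: "V4_data i j k m" shows "V4_set k m : proj_lines"
 unfolding V4_set_span[OF D]
proof (rule span_pair_line)
 fix a b assume "a *s axis i 1 + b *s axis j 1 = (0 :: complex ^ 4)"
 then have "(a *s axis i 1 + b *s axis j 1) $ i = (0 :: complex)" "(a *s axis i 1 + b *s axis j 1) $ j = (0 :: complex)" by simp_all
 then show "a = 0 & b = 0" using V4_data_distinct[OF D] by (simp add: axis_def)
qed

lemma Z4_data_line:
 assumes D: "Z4_data i p q r e" shows "{x. (N *v x) $ q + e * (N *v x) $ r = 0 & (N *v x) $ p = 0} : proj_lines"
proof -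
 note d = Z4_data_distinct[OF D]
 let ?u = "axis i 1 :: complex ^ 4" and ?v = "(\<chi> k. if k = r then 1 else if k = q then - e else 0) :: complex ^ 4"
 have "t $ q + e * t $ r = 0 & t $ p = 0 \<longleftrightarrow> (EX a b. t = a *s ?u + b *s ?v)" for t
 proof
 assume t: "t $ q + e * t $ r = 0 & t $ p = 0"
 then have q: "t $ q = - e * t $ r" by (simp add: eq_neg_iff_add_eq_0)
 have "t $ x = (t $ i *s ?u + t $ r *s ?v) $ x" for x
 using Z4_data_exhaust[OF D, of x] d conjunct2[OF t] by (elim disjE) (auto simp: axis_def q)
 then have "t = t $ i *s ?u + t $ r *s ?v" unfolding vec_eq_iff by blast
 then show "EX a b. t = a *s ?u + b *s ?v" by blast
 next
 assume "EX a b. t = a *s ?u + b *s ?v"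
 then show "t $ q + e * t $ r = 0 & t $ p = 0" using d by (auto simp: axis_def)
 qed
 then have eq: "{x. (N *v x) $ q + e * (N *v x) $ r = 0 & (N *v x) $ p = 0} = {x. EX a b. N *v x = a *s ?u + b *s ?v}" by blast
 show ?thesis unfolding eq
 proof (rule span_pair_line)
 fix a b assume "a *s ?u + b *s ?v = 0"
 then have "(a *s ?u + b *s ?v) $ i = 0" "(a *s ?u + b *s ?v) $ r = 0" by simp_all
 then show "a = 0 & b = 0" using d by (auto simp: axis_def)
 qed
qed

lemma disjointI:
 assumes "!!s. s : qcone ==> \<Phi> s ==> s = 0"
 shows "points_of {x. \<Phi> (N *v x)} \<inter> C = {}"
proof -
 have False if p: "p : C" "p \<subseteq> {x. \<Phi> (N *v x)}" for p
 proof -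
 have "rep p : p" using rep_in(1) C_points p(1) by blast
 then have "\<Phi> (co p)" using p(2) by (auto simp: co_def)
 then show False using assms[OF co_in_cone[OF p(1)]] co_nonzero[OF p(1)] by blast
 qed
 then show ?thesis by (auto simp: points_of_def)
qed

lemma V4_set_galois:
 assumes D: "V4_data i j k m"
 shows "galois_line C (V4_set k m)" "V4_line C (V4_set k m)" "\<not> Z4_line C (V4_set k m)"
proof -
 define A where "A = (SOME A :: complex ^ 4 ^ 2. {v. A *v v = 0} = V4_set k m)"
 interpret quartic_line M N C "V4_set k m" A
 proof unfold_locales
 show "points_of (V4_set k m) \<inter> C = {}" unfolding V4_set_def
 proof (rule disjointI)
 fix s assume s: "s : qcone" "s $ k = 0 & s $ m = 0"
 obtain a b a' b' where "\<forall>s\<in>qcone. s $ i ^ 2 = a * s $ k ^ 2 + b * s $ m ^ 2 & s $ j ^ 2 = a' * s $ k ^ 2 + b' * s $ m ^ 2"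
 using V4_relations[OF D] by blast
 then have "s $ i = 0" "s $ j = 0" using s by auto
 then have "s $ x = 0" for x using s(2) V4_data_exhaust[OF D, of x] by auto
 then show "s = 0" by (simp add: vec_eq_iff)
 qed
 qed (use V4_set_line[OF D] A_def in auto)
 have ker: "al *v s = 0 \<longleftrightarrow> s $ k = 0 & s $ m = 0" for s
 unfolding al_kernel V4_set_def by simp
 note props = V4_case[OF D ker]
 then show "galois_line C (V4_set k m)" "V4_line C (V4_set k m)" unfolding V4_line_def by blast+
 show "\<not> Z4_line C (V4_set k m)"
 proof
 assume "Z4_line C (V4_set k m)"
 then have "galois_group (ffld C) (line_subfield C (V4_set k m)) \<cong> integer_mod_group 4"
 by (simp add: Z4_line_def)
 from iso_trans[OF props(3) this] have "integer_mod_group 2 \<times>\<times> integer_mod_group 2 \<cong> integer_mod_group 4" .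
 from group.iso_sym[OF DirProd_group[OF group_integer_mod_group group_integer_mod_group] this]
 have "integer_mod_group 4 \<cong> integer_mod_group 2 \<times>\<times> integer_mod_group 2" .
 then show False using group_iso_contradiction by blast
 qed
qed

lemma Z4_data_galois:
 assumes D: "Z4_data i p q r e"
 defines "l \<equiv> {x. (N *v x) $ q + e * (N *v x) $ r = 0 & (N *v x) $ p = 0}"
 shows "galois_line C l" "Z4_line C l" "\<not> V4_line C l"
proof -
 define A where "A = (SOME A :: complex ^ 4 ^ 2. {v. A *v v = 0} = l)"
 interpret quartic_line M N C l A
 proof unfold_locales
 show "points_of l \<inter> C = {}" unfolding l_def
 proof (rule disjointI)
 fix s assume s: "s : qcone" "s $ q + e * s $ r = 0 & s $ p = 0"
 obtain c m where "\<forall>s\<in>qcone. s $ i ^ 2 = c * (s $ q + e * s $ r) * (s $ q - e * s $ r) &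
 (s $ q - e * s $ r) ^ 2 = - 1 * (s $ q + e * s $ r) ^ 2 + m * s $ p ^ 2" using Z4_relations[OF D] by blast
 then have "s $ i = 0" "s $ q - e * s $ r = 0" using s by auto
 moreover then have "s $ q = 0" "s $ r = 0" using s(2) Z4_data_distinct[OF D] by auto
 ultimately have "s $ x = 0" for x using s(2) Z4_data_exhaust[OF D, of x] by auto
 then show "s = 0" by (simp add: vec_eq_iff)
 qed
 qed (use Z4_data_line[OF D] A_def l_def in auto)
 have ker: "al *v s = 0 \<longleftrightarrow> s $ q + e * s $ r = 0 & s $ p = 0" for s
 unfolding al_kernel l_def by simp
 note props = Z4_case[OF D ker]
 then show "galois_line C l" "Z4_line C l" unfolding Z4_line_def by blast+
 show "\<not> V4_line C l"
 unfolding V4_line_def using props(3) iso_trans group_iso_contradiction by blast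
qed

text \<open>The column conditions of \<open>galois_extension_cases\<close>, translated into the
  kernel of \<open>al\<close>, which is the line itself.\<close>

lemma galois_line_cases:
 assumes "galois_line C l"
 shows "(EX i j k m. V4_data i j k m & l = V4_set k m) \<or>
 (EX i p q r e. Z4_data i p q r e & l = {x. (N *v x) $ q + e * (N *v x) $ r = 0 & (N *v x) $ p = 0})"
proof -
 define A where "A = (SOME A :: complex ^ 4 ^ 2. {v. A *v v = 0} = l)"
 interpret quartic_line M N C l A
 by unfold_locales (use assms A_def in \<open>auto simp: galois_line_def\<close>)
 have l: "x : l \<longleftrightarrow> al *v (N *v x) = 0" for x by (simp add: al_kernel)
 have "galois_extension (ffld C) (line_subfield C l)" using assms by (simp add: galois_line_def)
 from galois_extension_cases[OF this] show ?thesis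
 proof
 assume "EX i j. i ~= j & cl i = 0 & cl j = 0"
 then obtain i j k m where D: "V4_data i j k m" and c: "cl i = 0" "cl j = 0" using V4_data_ex by metis
 have "l = V4_set k m" unfolding V4_set_def using l kernel_V4[OF D c] by blast
 then show ?thesis using D by blast
 next
 assume "EX i p q r e. Z4_data i p q r e & cl i = 0 & cl r = e *s cl q"
 then obtain i p q r e where D: "Z4_data i p q r e" and c: "cl i = 0" "cl r = e *s cl q" by blast
 have "l = {x. (N *v x) $ q + e * (N *v x) $ r = 0 & (N *v x) $ p = 0}" using l kernel_Z4[OF D c] by blast
 then show ?thesis using D by blast
 qed
qed

lemma V4_line_iff: "V4_line C l \<longleftrightarrow> (EX i j k m. V4_data i j k m & l = V4_set k m)"
proof
 assume l: "V4_line C l"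
 then have "galois_line C l" by (simp add: V4_line_def)
 from galois_line_cases[OF this] show "EX i j k m. V4_data i j k m & l = V4_set k m"
 proof
 assume "EX i p q r e. Z4_data i p q r e & l = {x. (N *v x) $ q + e * (N *v x) $ r = 0 & (N *v x) $ p = 0}"
 then show ?thesis using l Z4_data_galois(3) by blast
 qed
next
 assume "EX i j k m. V4_data i j k m & l = V4_set k m"
 then obtain i j k m where D: "V4_data i j k m" "l = V4_set k m" by blast
 show "V4_line C l" unfolding D(2) by (rule V4_set_galois(2)[OF D(1)])
qed

lemma Z4_line_iff: "Z4_line C l \<longleftrightarrow> (\<exists>n<4. \<exists>m\<in>{1, 2}. l = Z4_set n m)"
proof -
 have "Z4_line C l \<longleftrightarrow> (EX i p q r e. Z4_data i p q r e & l = {x. (N *v x) $ q + e * (N *v x) $ r = 0 & (N *v x) $ p = 0})"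
proof
 assume l: "Z4_line C l"
 then have "galois_line C l" by (simp add: Z4_line_def)
 from galois_line_cases[OF this]
 show "EX i p q r e. Z4_data i p q r e & l = {x. (N *v x) $ q + e * (N *v x) $ r = 0 & (N *v x) $ p = 0}"
 proof
 assume "EX i j k m. V4_data i j k m & l = V4_set k m"
 then show ?thesis using l V4_set_galois(3) by blast
 qed
next
 assume "EX i p q r e. Z4_data i p q r e & l = {x. (N *v x) $ q + e * (N *v x) $ r = 0 & (N *v x) $ p = 0}"
 then obtain i p q r e where D: "Z4_data i p q r e" "l = {x. (N *v x) $ q + e * (N *v x) $ r = 0 & (N *v x) $ p = 0}" by blast
 show "Z4_line C l" unfolding D(2) by (rule Z4_data_galois(2)[OF D(1)])
qed
 then show ?thesis unfolding Z4_data_mem[of l "%x. N *v x"] Z4_set_def .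
qed

lemma galois_line_V4_or_Z4:
 assumes "galois_line C l" shows "V4_line C l | Z4_line C l"
 using galois_line_cases[OF assms]
proof
 assume "EX i j k m. V4_data i j k m & l = V4_set k m"
 then show ?thesis unfolding V4_line_iff[symmetric] by (rule disjI1)
next
 assume "EX i p q r e. Z4_data i p q r e & l = {x. (N *v x) $ q + e * (N *v x) $ r = 0 & (N *v x) $ p = 0}"
 then obtain i p q r e where D: "Z4_data i p q r e" "l = {x. (N *v x) $ q + e * (N *v x) $ r = 0 & (N *v x) $ p = 0}" by blast
 have "Z4_line C l" unfolding D(2) by (rule Z4_data_galois(2)[OF D(1)])
 then show ?thesis by (rule disjI2)
qed

end

lemma V4_data_ex_kernel: "k ~= m ==> EX i j. V4_data i j k m | V4_data i j m k"
 using exhaust_4[of k] exhaust_4[of m] by (elim disjE) (simp_all add: V4_data_def)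

context quartic_curve
begin

lemma pt_in_proj_points: "t ~= 0 ==> pt t : proj_points"
 by (simp add: pt_def hcoord_in_proj_points)

lemma proj_point_pt: assumes "p : proj_points" obtains t where "t ~= 0" "p = pt t"
proof (rule that[of "N *v rep p"])
 show "N *v rep p ~= 0" using rep_in(2)[OF assms] by simp
 show "p = pt (N *v rep p)" using hcoord_rep[OF assms] by (simp add: pt_def)
qed

lemma points_of_pt:
 assumes "!!c s. \<Phi> s ==> \<Phi> (c *s s)" and t: "t ~= 0"
 shows "pt t : points_of {x. \<Phi> (N *v x)} \<longleftrightarrow> \<Phi> t"
proof
 assume "pt t : points_of {x. \<Phi> (N *v x)}"
 moreover have "1 *s (M *v t) : pt t" unfolding pt_def mem_hcoord by blast
 ultimately have "1 *s (M *v t) : {x. \<Phi> (N *v x)}" unfolding points_of_def by blast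
 then show "\<Phi> t" by simp
next
 assume "\<Phi> t"
 then show "pt t : points_of {x. \<Phi> (N *v x)}"
 using assms pt_in_proj_points[OF t] by (auto simp: points_of_def pt_def hcoord_eq_range vector_scalar_commute)
qed

lemma points_V4_set: "t ~= 0 ==> pt t : points_of (V4_set k m) \<longleftrightarrow> t $ k = 0 & t $ m = 0"
 unfolding V4_set_def by (rule points_of_pt) auto

lemma points_Z4_set: "t ~= 0 ==> pt t : points_of (Z4_set n m) \<longleftrightarrow> Z4_mem n m t"
 unfolding Z4_set_def by (rule points_of_pt) (auto intro: Z4_mem_scale)

lemma pt_eqD:
 assumes "pt s = pt t" "s ~= 0" "t ~= 0" shows "s $ i * t $ j = s $ j * t $ i"
proof -
 obtain c where "M *v t = c *s (M *v s)" using assms hcoord_eq_iff[of "M *v s" "M *v t"] by (auto simp: pt_def)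
 then have "N *v (M *v t) = N *v (c *s (M *v s))" by simp
 then have "t = c *s s" by (simp add: vector_scalar_commute)
 then show ?thesis by simp
qed

text \<open>The edges are the loci where two of the coordinates vanish.\<close>

lemma points_V4_lines:
 assumes "t ~= 0"
 shows "pt t : (\<Union>m\<in>{m. V4_line C m}. points_of m) \<longleftrightarrow> (EX k m. k ~= m & t $ k = 0 & t $ m = 0)"
proof
 assume "pt t : (\<Union>m\<in>{m. V4_line C m}. points_of m)"
 then obtain l where l: "V4_line C l" "pt t : points_of l" by blast
 obtain i j k m where D: "V4_data i j k m" "l = V4_set k m" using l(1) V4_line_iff by metis
 then show "EX k m. k ~= m & t $ k = 0 & t $ m = 0"
 using l(2) V4_data_distinct[OF D(1)] points_V4_set[OF assms] by blast
next
 assume "EX k m. k ~= m & t $ k = 0 & t $ m = 0"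
 then obtain k m i j where D: "V4_data i j k m" "t $ k = 0" "t $ m = 0" using V4_data_ex_kernel by metis
 then show "pt t : (\<Union>m\<in>{m. V4_line C m}. points_of m)"
 using V4_set_galois(2)[OF D(1)] points_V4_set[OF assms, of k m] by blast
qed

lemma Z4_set_inj:
 assumes n: "n < 4" "n' < 4" and m: "m : {1, 2}" "m' : {1, 2}" and eq: "Z4_set n m = Z4_set n' m'"
 shows "n = n' & m = m'"
proof -
 have "Z4_mem n m (vertex n) \<longleftrightarrow> Z4_mem n' m' (vertex n)"
 using eq points_Z4_set[OF vertex_nonzero] by metis
 then have nn: "n = n'" using Z4_mem_vertex n by blast
 have "Z4_mem n m (trace_vec n m) \<longleftrightarrow> Z4_mem n' m' (trace_vec n m)"
 using eq points_Z4_set[OF trace_vec_nonzero] by metis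
 then show ?thesis using Z4_mem_trace_vec n(1) m nn by metis
qed

lemma vertex_components:
 "vertex 0 = axis 1 1" "vertex 1 = axis 2 1" "vertex 2 = axis 3 1" "vertex 3 = axis 4 1"
 by (simp_all add: vertex_def vx_def)

text \<open>By \<open>Z4_mem_decompose\<close>, a point of a Z4-line with two zero coordinates is a
  multiple of one of the two spanning vectors; conversely each of these has two zero
  coordinates.\<close>

lemma Z4_trace:
 assumes n: "n < 4" and m: "m : {1, 2}"
 shows "points_of (Z4_set n m) \<inter> (\<Union>m\<in>{m. V4_line C m}. points_of m) = {pt (vertex n), pt (trace_vec n m)}"
proof (intro equalityI subsetI)
 fix p assume p: "p : points_of (Z4_set n m) \<inter> (\<Union>m\<in>{m. V4_line C m}. points_of m)"
 then have "p : proj_points" by (simp add: points_of_def)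
 then obtain t where t: "t ~= 0" "p = pt t" by (rule proj_point_pt)
 have mem: "Z4_mem n m t" using p points_Z4_set[OF t(1)] t(2) by blast
 obtain k1 k2 where k: "k1 ~= k2" "t $ k1 = 0" "t $ k2 = 0" using p points_V4_lines[OF t(1)] t(2) by blast
 obtain k where dec: "t = t $ vx n *s vertex n + t $ k *s trace_vec n m" "t $ vx n = 0 | t $ k = 0"
 using Z4_mem_decompose[OF n mem] k by metis
 from dec(2) show "p : {pt (vertex n), pt (trace_vec n m)}"
 proof
 assume z: "t $ vx n = 0"
 then obtain c where c: "t = c *s trace_vec n m" using dec(1) by (metis add_0 vec.scale_zero_left)
 then have "c ~= 0" using t(1) by auto
 then show ?thesis unfolding t(2) c by (simp add: pt_scale)
 next
 assume z: "t $ k = 0"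
 then obtain c where c: "t = c *s vertex n" using dec(1) by (metis add.right_neutral vec.scale_zero_left)
 then have "c ~= 0" using t(1) by auto
 then show ?thesis unfolding t(2) c by (simp add: pt_scale)
 qed
next
 fix p assume p: "p : {pt (vertex n), pt (trace_vec n m)}"
 have "EX k m. k ~= m & vertex n $ k = 0 & vertex n $ m = 0"
 using less_4_cases[OF n]
 proof (elim disjE)
 assume "n = 0" then show ?thesis by (intro exI[of _ 2] exI[of _ 3]) (simp add: vertex_components axis_def)
 next
 assume "n = 1" then show ?thesis by (intro exI[of _ 1] exI[of _ 3]) (simp add: vertex_components[simplified] axis_def)
 next
 assume "n = 2" then show ?thesis by (intro exI[of _ 1] exI[of _ 2]) (simp add: vertex_components axis_def)
 next
 assume "n = 3" then show ?thesis by (intro exI[of _ 1] exI[of _ 2]) (simp add: vertex_components axis_def)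
 qed
 moreover have "EX k k'. k ~= k' & trace_vec n m $ k = 0 & trace_vec n m $ k' = 0"
 proof (cases "n = 0 | n = 3")
 case True
 then show ?thesis by (intro exI[of _ 1] exI[of _ 4]) (auto simp: trace_vec_def)
 next
 case False
 then have "n = 1 | n = 2" using n by auto
 then show ?thesis by (intro exI[of _ 2] exI[of _ 3]) (auto simp: trace_vec_def)
 qed
 ultimately show "p : points_of (Z4_set n m) \<inter> (\<Union>m\<in>{m. V4_line C m}. points_of m)"
 using p points_Z4_set[OF vertex_nonzero] points_Z4_set[OF trace_vec_nonzero]
 points_V4_lines[OF vertex_nonzero] points_V4_lines[OF trace_vec_nonzero]
 Z4_mem_vertex[OF n n] Z4_mem_trace_vec[OF n m m]
 by (elim insertE emptyE) (simp_all only: Int_iff simp_thms)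
qed

lemma Z4_lines_through_vertex:
 assumes "i < 4"
 shows "{l. Z4_line C l & pt (vertex i) : points_of l} = {Z4_set i 1, Z4_set i 2}"
proof -
 have "Z4_line C l & pt (vertex i) : points_of l \<longleftrightarrow> l = Z4_set i 1 | l = Z4_set i 2" for l
 proof
 assume "Z4_line C l & pt (vertex i) : points_of l"
 then obtain n m where l: "n < 4" "m : {1, 2}" "l = Z4_set n m" "pt (vertex i) : points_of l"
 unfolding Z4_line_iff by blast
 then have "i = n" using points_Z4_set[OF vertex_nonzero] Z4_mem_vertex[OF l(1) assms] by blast
 then show "l = Z4_set i 1 | l = Z4_set i 2" using l(2,3) by blast
 next
 assume "l = Z4_set i 1 | l = Z4_set i 2"
 then show "Z4_line C l & pt (vertex i) : points_of l"
 unfolding Z4_line_iff using points_Z4_set[OF vertex_nonzero] Z4_mem_vertex[OF assms assms] assms by blast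
 qed
 then show ?thesis by blast
qed

lemma V4_lines_eq: "{l. V4_line C l} = {V4_set 3 4, V4_set 2 4, V4_set 2 3, V4_set 1 4, V4_set 1 3, V4_set 1 2}"
 unfolding V4_line_iff V4_data_def by auto

lemma V4_set_eq_iff: "V4_set k m = V4_set k' m' \<longleftrightarrow> {k, m} = {k', m'}"
proof
 assume eq: "V4_set k m = V4_set k' m'"
 have "x : {k, m} \<longleftrightarrow> x : {k', m'}" for x
 proof -
 have "M *v axis x 1 : V4_set k m \<longleftrightarrow> x \<notin> {k, m}" for k m by (auto simp: V4_set_def axis_def)
 then show ?thesis using eq by metis
 qed
 then show "{k, m} = {k', m'}" by blast
qed (auto simp: V4_set_def doubleton_eq_iff)

lemma V4_edges:
 "line_through (pt (vertex 0)) (pt (vertex 1)) = V4_set 3 4" "line_through (pt (vertex 0)) (pt (vertex 2)) = V4_set 2 4"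
 "line_through (pt (vertex 0)) (pt (vertex 3)) = V4_set 2 3" "line_through (pt (vertex 1)) (pt (vertex 2)) = V4_set 1 4"
 "line_through (pt (vertex 1)) (pt (vertex 3)) = V4_set 1 3" "line_through (pt (vertex 2)) (pt (vertex 3)) = V4_set 1 2"
 unfolding vertex_components line_through_pt
 by (rule V4_set_span[symmetric], simp add: V4_data_def)+

lemma vertices_span: "vec.span (\<Union>i<4. pt (vertex i)) = UNIV"
proof -
 let ?S = "vec.span (\<Union>i<4. pt (vertex i))"
 have v: "M *v vertex n : ?S" if "n < 4" for n
 proof (rule vec.span_base)
 have "1 *s (M *v vertex n) : pt (vertex n)" unfolding pt_def mem_hcoord by blast
 then show "M *v vertex n : (\<Union>i<4. pt (vertex i))" using that by auto
 qed
 have "x : ?S" for x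
 proof -
 have "N *v x = (N *v x) $ 1 *s vertex 0 + (N *v x) $ 2 *s vertex 1 + (N *v x) $ 3 *s vertex 2 + (N *v x) $ 4 *s vertex 3"
 unfolding vertex_components by (simp add: vec_eq_iff forall_4 axis_def)
 from arg_cong[OF this, of "%s. M *v s"]
 have x: "x = (N *v x) $ 1 *s (M *v vertex 0) + (N *v x) $ 2 *s (M *v vertex 1) + (N *v x) $ 3 *s (M *v vertex 2) + (N *v x) $ 4 *s (M *v vertex 3)"
 by (simp only: matrix_vector_right_distrib vector_scalar_commute M_N_vec)
 show ?thesis by (subst x) (intro vec.span_add vec.span_scale v; simp)
 qed
 then show ?thesis by blast
qed

text \<open>Its columns are the prescribed coordinates of the four vertices, the first one scaled by
  twice the square root of 2 so that the points R on the edge from Q0 to Q3 get theirs as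
  well.\<close>

definition T0 :: "complex ^ 4 ^ 4" where
 "T0 = vector [vector [0, 4, 4, 4], vector [0, - 1, - 1, 1], vector [0, 2, - 2, 0], vector [2 * of_real (sqrt 2), 0, 0, 0]]"

lemma T0: "T0 *v s = vector [4 * (s $ 2 + s $ 3 + s $ 4), s $ 4 - s $ 2 - s $ 3, 2 * (s $ 2 - s $ 3), 2 * of_real (sqrt 2) * s $ 1]"
 by (simp add: vec_eq_iff forall_4 T0_def matrix_vector_mult_def sum_4 algebra_simps)

lemma T0_invertible: "invertible (T0 ** N)"
proof -
 have "x = 0" if "(T0 ** N) *v x = 0" for x
 proof -
 define s where "s = N *v x"
 have "T0 *v s = 0" using that by (simp add: s_def matrix_vector_mul_assoc)
 then have e0: "4 * (s $ 2 + s $ 3 + s $ 4) = 0 & s $ 4 - s $ 2 - s $ 3 = 0 & 2 * (s $ 2 - s $ 3) = 0 & 2 * of_real (sqrt 2) * s $ 1 = 0"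
 unfolding T0 vector4_eq_0 .
 have c: "(2 :: complex) ~= 0" "(4 :: complex) ~= 0" "2 * complex_of_real (sqrt 2) ~= 0" by simp_all
 from e0 have e: "s $ 2 + s $ 3 + s $ 4 = 0" "s $ 4 - s $ 2 - s $ 3 = 0" "s $ 2 - s $ 3 = 0" "s $ 1 = 0"
 by (meson c mult_eq_0_iff)+
 have "2 * s $ 4 = (s $ 2 + s $ 3 + s $ 4) + (s $ 4 - s $ 2 - s $ 3)" by simp
 then have s4: "s $ 4 = 0" using e(1,2) by simp
 have "2 * s $ 2 = (s $ 2 + s $ 3 + s $ 4) + (s $ 2 - s $ 3) - s $ 4" by simp
 then have s2: "s $ 2 = 0" using e(1,3) s4 by simp
 then have "s = 0" using e(3,4) s4 by (simp add: vec_eq_iff forall_4)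
 then show "x = 0" by (simp add: s_def)
 qed
 then obtain Y where "Y ** (T0 ** N) = mat 1" using matrix_left_invertible_ker[of "T0 ** N"] by blast
 then show ?thesis unfolding invertible_def using matrix_left_right_inverse[of Y "T0 ** N"] by blast
qed

lemma T0_pt:
 assumes "c ~= 0" "T0 *v t = c *s w" shows "proj_map (T0 ** N) (pt t) = hcoord w"
proof -
 have "(T0 ** N) *v (M *v t) = T0 *v t" by (simp add: matrix_vector_mul_assoc[symmetric])
 then show ?thesis unfolding pt_def proj_map_hcoord using assms by (simp add: hcoord_scale)
qed

theorem tetrahedron:
 shows "\<exists>(Q :: nat => 4 ppoint) (R :: nat => nat => 4 ppoint).
 (\<forall>i<4. Q i : proj_points) & vec.span (\<Union>i<4. Q i) = UNIV &
 \<comment> \<open>(a)\<close>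
 {l. V4_line C l} =
 {line_through (Q 0) (Q 1), line_through (Q 0) (Q 2), line_through (Q 0) (Q 3),
 line_through (Q 1) (Q 2), line_through (Q 1) (Q 3), line_through (Q 2) (Q 3)} &
 card {l. V4_line C l} = 6 &
 (ALL l. galois_line C l & \<not> V4_line C l --> Z4_line C l) &
 \<comment> \<open>(b)\<close>
 (ALL l. Z4_line C l --> (\<exists>!i. i < 4 & Q i : points_of l)) &
 (\<forall>i<4. card {l. Z4_line C l & Q i : points_of l} = 2) &
 card {l. Z4_line C l} = 8 &
 (ALL l m. Z4_line C l & Z4_line C m & \<not> (\<exists>i<4. Q i : points_of l & Q i : points_of m) -->
 points_of l \<inter> points_of m = {}) &
 \<comment> \<open>(c)\<close>
 (ALL l. Z4_line C l --> card (points_of l \<inter> (\<Union>m\<in>{m. V4_line C m}. points_of m)) = 2) &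
 (\<forall>i<4. EX l1 l2. l1 ~= l2 & {l. Z4_line C l & Q i : points_of l} = {l1, l2} &
 R i 1 ~= Q i & R i 2 ~= Q i &
 points_of l1 \<inter> (\<Union>m\<in>{m. V4_line C m}. points_of m) = {Q i, R i 1} &
 points_of l2 \<inter> (\<Union>m\<in>{m. V4_line C m}. points_of m) = {Q i, R i 2}) &
 distinct [R 0 1, R 0 2, R 3 1, R 3 2] &
 {R 0 1, R 0 2, R 3 1, R 3 2} \<subseteq> points_of (line_through (Q 1) (Q 2)) - {Q 1, Q 2} &
 distinct [R 1 1, R 1 2, R 2 1, R 2 2] &
 {R 1 1, R 1 2, R 2 1, R 2 2} \<subseteq> points_of (line_through (Q 0) (Q 3)) - {Q 0, Q 3} &
 \<comment> \<open>(d)\<close>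
 (\<exists>T :: complex ^ 4 ^ 4. invertible T &
 proj_map T (Q 0) = hcoord (vector [0, 0, 0, 1]) &
 proj_map T (Q 1) = hcoord (vector [4, -1, 2, 0]) &
 proj_map T (Q 2) = hcoord (vector [4, -1, -2, 0]) &
 proj_map T (Q 3) = hcoord (vector [4, 1, 0, 0]) &
 proj_map T (R 0 1) = hcoord (vector [0, 0, 1, 0]) &
 proj_map T (R 0 2) = hcoord (vector [4, -1, 0, 0]) &
 proj_map T (R 3 1) = hcoord (vector [4, -1, 2 * \<i>, 0]) &
 proj_map T (R 3 2) = hcoord (vector [4, -1, - 2 * \<i>, 0]) &
 proj_map T (R 2 1) = hcoord (vector [4, 1, 0, - 2 * of_real (sqrt 2) * \<i>]) &
 proj_map T (R 2 2) = hcoord (vector [4, 1, 0, 2 * of_real (sqrt 2) * \<i>]) &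
 proj_map T (R 1 1) = hcoord (vector [4, 1, 0, 2 * of_real (sqrt 2)]) &
 proj_map T (R 1 2) = hcoord (vector [4, 1, 0, - 2 * of_real (sqrt 2)]))"
proof -
 define Q where "Q = (%n. pt (vertex n))"
 define R where "R = (%n m. pt (trace_vec n m))"
 let ?U = "\<Union>m\<in>{m. V4_line C m}. points_of m"
 have Z4: "Z4_line C (Z4_set n m)" if "n < 4" "m : {1, 2}" for n m using that Z4_line_iff by blast
 have on: "Q i : points_of (Z4_set n m) \<longleftrightarrow> i = n" if "n < 4" "i < 4" for i n m
 unfolding Q_def points_Z4_set[OF vertex_nonzero] by (rule Z4_mem_vertex[OF that])
 have R_on: "R n m' : points_of (Z4_set n m) \<longleftrightarrow> m = m'" if "n < 4" "m : {1, 2}" "m' : {1, 2}" for n m m'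
 unfolding R_def points_Z4_set[OF trace_vec_nonzero] by (rule Z4_mem_trace_vec[OF that])
 have RQ: "R n m ~= Q n" if n: "n < 4" and m: "m : {1, 2}" for n m
 proof -
 \<comment> \<open>The index of the other Z4-line through the vertex: it contains the vertex but not
   this point R, so the two points differ.\<close>
 define m' :: nat where "m' = (if m = 1 then 2 else 1)"
 have m': "m' : {1, 2}" "m' ~= m" by (simp_all add: m'_def)
 have "Q n : points_of (Z4_set n m')" using on[OF n n] by simp
 moreover have "R n m \<notin> points_of (Z4_set n m')" using R_on[OF n m'(1) m] m'(2) by simp
 ultimately show ?thesis by auto
 qed
 have lines12: "Z4_set i 1 ~= Z4_set i 2" if "i < 4" for i using Z4_set_inj[OF that that, of 1 2] by auto
 have R3: "trace_vec 0 m $ 3 = 1" "trace_vec 3 m $ 3 = 1" "trace_vec 1 m $ 4 = 1" "trace_vec 2 m $ 4 = 1"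
 "trace_vec 0 m $ 2 = - sg m" "trace_vec 3 m $ 2 = sg m * \<i>" "trace_vec 1 m $ 1 = sg m" "trace_vec 2 m $ 1 = - sg m * \<i>"
 "trace_vec 0 m $ 1 = 0" "trace_vec 3 m $ 1 = 0" "trace_vec 0 m $ 4 = 0" "trace_vec 3 m $ 4 = 0"
 "trace_vec 1 m $ 2 = 0" "trace_vec 2 m $ 2 = 0" "trace_vec 1 m $ 3 = 0" "trace_vec 2 m $ 3 = 0" for m
 by (simp_all add: trace_vec_def)
 note R_eqD = pt_eqD[OF _ trace_vec_nonzero trace_vec_nonzero] and RQ_eqD = pt_eqD[OF _ trace_vec_nonzero vertex_nonzero]
 have g1: "\<forall>i<4. Q i : proj_points" unfolding Q_def by (simp add: pt_in_proj_points vertex_nonzero)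
 have g2: "vec.span (\<Union>i<4. Q i) = UNIV" unfolding Q_def by (rule vertices_span)
 have g3: "{l. V4_line C l} =
 {line_through (Q 0) (Q 1), line_through (Q 0) (Q 2), line_through (Q 0) (Q 3),
 line_through (Q 1) (Q 2), line_through (Q 1) (Q 3), line_through (Q 2) (Q 3)}"
 unfolding Q_def V4_edges by (rule V4_lines_eq)
 have g4: "card {l. V4_line C l} = 6" unfolding V4_lines_eq by (simp add: V4_set_eq_iff doubleton_eq_iff)
 have g5: "ALL l. galois_line C l & \<not> V4_line C l --> Z4_line C l" using galois_line_V4_or_Z4 by blast
 have g6: "ALL l. Z4_line C l --> (\<exists>!i. i < 4 & Q i : points_of l)"
 proof (intro allI impI)
 fix l assume "Z4_line C l"
 then obtain n m where l: "n < 4" "m : {1, 2}" "l = Z4_set n m" unfolding Z4_line_iff by blast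
 show "\<exists>!i. i < 4 & Q i : points_of l" unfolding l(3) using on[OF l(1)] l(1) by blast
 qed
 have g7: "\<forall>i<4. card {l. Z4_line C l & Q i : points_of l} = 2"
 using lines12 by (simp add: Q_def Z4_lines_through_vertex)
 have "{l. Z4_line C l} = (%(n, m). Z4_set n m) ` ({..<4} \<times> {1, 2})" unfolding Z4_line_iff by auto
 moreover have "inj_on (%(n, m). Z4_set n m) ({..<4} \<times> {1, 2})"
 proof (rule inj_onI)
 fix x y assume "x : {..<4} \<times> {1, 2}" "y : {..<4} \<times> {1, 2}" "(%(n, m). Z4_set n m) x = (%(n, m). Z4_set n m) y"
 then show "x = y" using Z4_set_inj[of "fst x" "fst y" "snd x" "snd y"]
 by (simp add: mem_Times_iff case_prod_beta prod_eq_iff)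
 qed
 ultimately have g8: "card {l. Z4_line C l} = 8" by (simp add: card_image card_cartesian_product)
 have g9: "ALL l m. Z4_line C l & Z4_line C m & \<not> (\<exists>i<4. Q i : points_of l & Q i : points_of m) -->
 points_of l \<inter> points_of m = {}"
 proof (intro allI impI)
 fix l l' assume a: "Z4_line C l & Z4_line C l' & \<not> (\<exists>i<4. Q i : points_of l & Q i : points_of l')"
 then obtain n m where l: "n < 4" "m : {1, 2}" "l = Z4_set n m" unfolding Z4_line_iff by blast
 from a obtain n' m' where l': "n' < 4" "m' : {1, 2}" "l' = Z4_set n' m'" unfolding Z4_line_iff by blast
 have "n ~= n'" using a l l' on by metis
 have False if p: "p : points_of l" "p : points_of l'" for p
 proof -
 have "p : proj_points" using p(1) by (simp add: points_of_def)
 then obtain t where t: "t ~= 0" "p = pt t" by (rule proj_point_pt)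
 have "Z4_mem n m t" "Z4_mem n' m' t" using p points_Z4_set[OF t(1)] unfolding t(2) l(3) l'(3) by blast+
 then show False using Z4_mem_disjoint[OF l(1) l'(1) \<open>n ~= n'\<close>] t(1) by blast
 qed
 then show "points_of l \<inter> points_of l' = {}" by blast
 qed
 have g10: "ALL l. Z4_line C l --> card (points_of l \<inter> ?U) = 2"
 proof (intro allI impI)
 fix l assume "Z4_line C l"
 then obtain n m where l: "n < 4" "m : {1, 2}" "l = Z4_set n m" unfolding Z4_line_iff by blast
 show "card (points_of l \<inter> ?U) = 2"
 unfolding l(3) Z4_trace[OF l(1,2)] using RQ[OF l(1,2)] by (simp add: Q_def R_def)
 qed
 have g11: "\<forall>i<4. EX l1 l2. l1 ~= l2 & {l. Z4_line C l & Q i : points_of l} = {l1, l2} &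
 R i 1 ~= Q i & R i 2 ~= Q i & points_of l1 \<inter> ?U = {Q i, R i 1} & points_of l2 \<inter> ?U = {Q i, R i 2}"
 proof (intro allI impI)
 fix i :: nat assume i: "i < 4"
 show "EX l1 l2. l1 ~= l2 & {l. Z4_line C l & Q i : points_of l} = {l1, l2} &
 R i 1 ~= Q i & R i 2 ~= Q i & points_of l1 \<inter> ?U = {Q i, R i 1} & points_of l2 \<inter> ?U = {Q i, R i 2}"
 proof (rule exI[of _ "Z4_set i 1"], rule exI[of _ "Z4_set i 2"], intro conjI)
 show "Z4_set i 1 ~= Z4_set i 2" by (rule lines12[OF i])
 show "{l. Z4_line C l & Q i : points_of l} = {Z4_set i 1, Z4_set i 2}"
 unfolding Q_def by (rule Z4_lines_through_vertex[OF i])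
 show "R i 1 ~= Q i" "R i 2 ~= Q i" by (rule RQ[OF i], simp)+
 show "points_of (Z4_set i 1) \<inter> ?U = {Q i, R i 1}" "points_of (Z4_set i 2) \<inter> ?U = {Q i, R i 2}"
 unfolding Q_def R_def by (rule Z4_trace[OF i], simp)+
 qed
 qed
 have ne: "pt (trace_vec n m) ~= pt (trace_vec n' m')"
 if "trace_vec n m $ i * trace_vec n' m' $ j ~= trace_vec n m $ j * trace_vec n' m' $ i" for n m n' m' i j
 using R_eqD that by blast
 have neQ: "pt (trace_vec n m) ~= pt (vertex n')"
 if "trace_vec n m $ i * vertex n' $ j ~= trace_vec n m $ j * vertex n' $ i" for n m n' i j
 using RQ_eqD that by blast
 have sg12: "sg 1 = 1" "sg (Suc 0) = 1" "sg 2 = - 1" by (simp_all add: sg_def)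
 have ii: "\<i> ~= - 1" "1 ~= \<i>" "- 1 ~= \<i>" "1 ~= - \<i>" "- \<i> ~= 1" "\<i> ~= - \<i>" "- \<i> ~= \<i>" by (simp_all add: complex_eq_iff)
 have "R 0 1 ~= R 0 2" "R 0 1 ~= R 3 1" "R 0 1 ~= R 3 2" "R 0 2 ~= R 3 1" "R 0 2 ~= R 3 2" "R 3 1 ~= R 3 2"
 unfolding R_def by (rule ne[of _ _ 2 _ _ 3], use ii in \<open>simp add: R3 sg12 del: One_nat_def\<close>)+
 then have g12: "distinct [R 0 1, R 0 2, R 3 1, R 3 2]" by simp
 have "R 1 1 ~= R 1 2" "R 1 1 ~= R 2 1" "R 1 1 ~= R 2 2" "R 1 2 ~= R 2 1" "R 1 2 ~= R 2 2" "R 2 1 ~= R 2 2"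
 unfolding R_def by (rule ne[of _ _ 1 _ _ 4], use ii in \<open>simp add: R3 sg12 del: One_nat_def\<close>)+
 then have g13: "distinct [R 1 1, R 1 2, R 2 1, R 2 2]" by simp
 have v: "vertex 1 $ 2 = 1" "vertex 1 $ 3 = 0" "vertex 2 $ 2 = 0" "vertex 2 $ 3 = 1"
 "vertex 0 $ 1 = 1" "vertex 0 $ 4 = 0" "vertex 3 $ 1 = 0" "vertex 3 $ 4 = 1"
 unfolding vertex_components by (simp_all add: axis_def)
 have "R n m : points_of (V4_set 1 4) & R n m ~= Q 1 & R n m ~= Q 2" if "n = 0 | n = 3" for n m
 unfolding R_def Q_def points_V4_set[OF trace_vec_nonzero] using that
 by (intro conjI neQ[of _ _ 2 _ 3]) (auto simp: R3 v simp del: One_nat_def)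
 then have g14: "{R 0 1, R 0 2, R 3 1, R 3 2} \<subseteq> points_of (line_through (Q 1) (Q 2)) - {Q 1, Q 2}"
 unfolding Q_def V4_edges(4) by simp
 have "R n m : points_of (V4_set 2 3) & R n m ~= Q 0 & R n m ~= Q 3" if "n = 1 | n = 2" for n m
 unfolding R_def Q_def points_V4_set[OF trace_vec_nonzero] using that
 by (intro conjI neQ[of _ _ 1 _ 4]) (auto simp: R3 v simp del: One_nat_def)
 then have g15: "{R 1 1, R 1 2, R 2 1, R 2 2} \<subseteq> points_of (line_through (Q 0) (Q 3)) - {Q 0, Q 3}"
 unfolding Q_def V4_edges(3) by simp
 have g16: "invertible (T0 ** N)" by (rule T0_invertible)
 have img: "c ~= 0 ==> T0 *v t = c *s w ==> proj_map (T0 ** N) (pt t) = hcoord w" for c t w by (rule T0_pt)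
 have g17: "proj_map (T0 ** N) (Q 0) = hcoord (vector [0, 0, 0, 1])"
 unfolding Q_def vertex_components by (rule img[of "2 * of_real (sqrt 2)"]) (simp_all add: T0 vec_eq_iff forall_4 axis_def)
 have g18: "proj_map (T0 ** N) (Q 1) = hcoord (vector [4, - 1, 2, 0])"
 unfolding Q_def vertex_components by (rule img[of 1]) (simp_all add: T0 vec_eq_iff forall_4 axis_def)
 have g19: "proj_map (T0 ** N) (Q 2) = hcoord (vector [4, - 1, - 2, 0])"
 unfolding Q_def vertex_components by (rule img[of 1]) (simp_all add: T0 vec_eq_iff forall_4 axis_def)
 have g20: "proj_map (T0 ** N) (Q 3) = hcoord (vector [4, 1, 0, 0])"
 unfolding Q_def vertex_components by (rule img[of 1]) (simp_all add: T0 vec_eq_iff forall_4 axis_def)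
 have g21: "proj_map (T0 ** N) (R 0 1) = hcoord (vector [0, 0, 1, 0])"
 unfolding R_def by (rule img[of "- 4"]) (simp_all add: T0 vec_eq_iff forall_4 trace_vec_def sg_def)
 have g22: "proj_map (T0 ** N) (R 0 2) = hcoord (vector [4, - 1, 0, 0])"
 unfolding R_def by (rule img[of 2]) (simp_all add: T0 vec_eq_iff forall_4 trace_vec_def sg_def)
 \<comment> \<open>The factor 1 + \<i> arises from \<i> - 1 = \<i> (1 + \<i>); its conjugate serves
   for the other sign.\<close>
 have g23: "proj_map (T0 ** N) (R 3 1) = hcoord (vector [4, - 1, 2 * \<i>, 0])"
 unfolding R_def by (rule img[of "1 + \<i>"]) (simp_all add: T0 vec_eq_iff forall_4 trace_vec_def sg_def complex_eq_iff)
 have g24: "proj_map (T0 ** N) (R 3 2) = hcoord (vector [4, - 1, - 2 * \<i>, 0])"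
 unfolding R_def by (rule img[of "1 - \<i>"]) (simp_all add: T0 vec_eq_iff forall_4 trace_vec_def sg_def complex_eq_iff)
 have g25: "proj_map (T0 ** N) (R 2 1) = hcoord (vector [4, 1, 0, - 2 * of_real (sqrt 2) * \<i>])"
 unfolding R_def by (rule img[of 1]) (simp_all add: T0 vec_eq_iff forall_4 trace_vec_def sg_def)
 have g26: "proj_map (T0 ** N) (R 2 2) = hcoord (vector [4, 1, 0, 2 * of_real (sqrt 2) * \<i>])"
 unfolding R_def by (rule img[of 1]) (simp_all add: T0 vec_eq_iff forall_4 trace_vec_def sg_def)
 have g27: "proj_map (T0 ** N) (R 1 1) = hcoord (vector [4, 1, 0, 2 * of_real (sqrt 2)])"
 unfolding R_def by (rule img[of 1]) (simp_all add: T0 vec_eq_iff forall_4 trace_vec_def sg_def)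
 have g28: "proj_map (T0 ** N) (R 1 2) = hcoord (vector [4, 1, 0, - 2 * of_real (sqrt 2)])"
 unfolding R_def by (rule img[of 1]) (simp_all add: T0 vec_eq_iff forall_4 trace_vec_def sg_def)
 show ?thesis
 by (rule exI[of _ Q], rule exI[of _ R], intro conjI exI[of _ "T0 ** N"]) (fact g1 g2 g3 g4 g5 g6 g7 g8 g9 g10 g11 g12 g13 g14 g15 g16 g17 g18 g19 g20 g21 g22 g23 g24 g25 g26 g27 g28)+
qed

end

theorem theorem1:
  fixes a1 a2 a3 a4 a6 :: complex
    and E :: "3 ppoint set"
    and P0 :: "3 ppoint"
    and F :: "4 \<Rightarrow> (3 ppoint \<Rightarrow> complex) set"
    and C :: "4 ppoint set"
  assumes "weierstrass_disc a1 a2 a3 a4 a6 \<noteq> 0"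
    and "weierstrass_j a1 a2 a3 a4 a6 = 12 ^ 3"
    and "E = weierstrass_curve a1 a2 a3 a4 a6"
    and "P0 \<in> E"
    and "is_basis E (riemann_roch_space E (point_divisor 4 P0)) F"
    and "C = curve_morphism E F ` E"
  shows "\<exists>(Q :: nat \<Rightarrow> 4 ppoint) (R :: nat \<Rightarrow> nat \<Rightarrow> 4 ppoint).
    (\<forall>i<4. Q i \<in> proj_points) \<and> vec.span (\<Union>i<4. Q i) = UNIV \<and>
    \<comment> \<open>(a)\<close>
    {l. V4_line C l} =
      {line_through (Q 0) (Q 1), line_through (Q 0) (Q 2), line_through (Q 0) (Q 3),
       line_through (Q 1) (Q 2), line_through (Q 1) (Q 3), line_through (Q 2) (Q 3)} \<and>
    card {l. V4_line C l} = 6 \<and>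
    (\<forall>l. galois_line C l \<and> \<not> V4_line C l \<longrightarrow> Z4_line C l) \<and>
    \<comment> \<open>(b)\<close>
    (\<forall>l. Z4_line C l \<longrightarrow> (\<exists>!i. i < 4 \<and> Q i \<in> points_of l)) \<and>
    (\<forall>i<4. card {l. Z4_line C l \<and> Q i \<in> points_of l} = 2) \<and>
    card {l. Z4_line C l} = 8 \<and>
    (\<forall>l m. Z4_line C l \<and> Z4_line C m \<and> \<not> (\<exists>i<4. Q i \<in> points_of l \<and> Q i \<in> points_of m) \<longrightarrow>
       points_of l \<inter> points_of m = {}) \<and>
    \<comment> \<open>(c)\<close>
    (\<forall>l. Z4_line C l \<longrightarrow> card (points_of l \<inter> (\<Union>m\<in>{m. V4_line C m}. points_of m)) = 2) \<and>
    (\<forall>i<4. \<exists>l1 l2. l1 \<noteq> l2 \<and> {l. Z4_line C l \<and> Q i \<in> points_of l} = {l1, l2} \<and>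
       R i 1 \<noteq> Q i \<and> R i 2 \<noteq> Q i \<and>
       points_of l1 \<inter> (\<Union>m\<in>{m. V4_line C m}. points_of m) = {Q i, R i 1} \<and>
       points_of l2 \<inter> (\<Union>m\<in>{m. V4_line C m}. points_of m) = {Q i, R i 2}) \<and>
    distinct [R 0 1, R 0 2, R 3 1, R 3 2] \<and>
    {R 0 1, R 0 2, R 3 1, R 3 2} \<subseteq> points_of (line_through (Q 1) (Q 2)) - {Q 1, Q 2} \<and>
    distinct [R 1 1, R 1 2, R 2 1, R 2 2] \<and>
    {R 1 1, R 1 2, R 2 1, R 2 2} \<subseteq> points_of (line_through (Q 0) (Q 3)) - {Q 0, Q 3} \<and>
    \<comment> \<open>(d)\<close>
    (\<exists>T :: complex ^ 4 ^ 4. invertible T \<and>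
       proj_map T (Q 0) = hcoord (vector [0, 0, 0, 1]) \<and>
       proj_map T (Q 1) = hcoord (vector [4, -1, 2, 0]) \<and>
       proj_map T (Q 2) = hcoord (vector [4, -1, -2, 0]) \<and>
       proj_map T (Q 3) = hcoord (vector [4, 1, 0, 0]) \<and>
       proj_map T (R 0 1) = hcoord (vector [0, 0, 1, 0]) \<and>
       proj_map T (R 0 2) = hcoord (vector [4, -1, 0, 0]) \<and>
       proj_map T (R 3 1) = hcoord (vector [4, -1, 2 * \<i>, 0]) \<and>
       proj_map T (R 3 2) = hcoord (vector [4, -1, - 2 * \<i>, 0]) \<and>
       proj_map T (R 2 1) = hcoord (vector [4, 1, 0, - 2 * of_real (sqrt 2) * \<i>]) \<and>
       proj_map T (R 2 2) = hcoord (vector [4, 1, 0, 2 * of_real (sqrt 2) * \<i>]) \<and>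
       proj_map T (R 1 1) = hcoord (vector [4, 1, 0, 2 * of_real (sqrt 2)]) \<and>
       proj_map T (R 1 2) = hcoord (vector [4, 1, 0, - 2 * of_real (sqrt 2)]))"
proof -
  obtain M N :: "complex ^ 4 ^ 4" where MN: "N ** M = mat 1 & M ** N = mat 1 &
    curve_morphism E F ` E = {p \<in> proj_points. \<forall>v\<in>p. N *v v \<in> qcone}"
    using quartic_model[OF assms(1-5)] by (elim exE) (rule that)
  have "C = {p \<in> proj_points. \<forall>v\<in>p. N *v v \<in> qcone}"
    unfolding assms(6) using MN by (elim conjE)
  then interpret quartic_curve M N C using MN by unfold_locales simp_all
  show ?thesis by (rule tetrahedron)
qed

end
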